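(* Let $X$ be a second-countable locally compact Hausdorff space and let $T\colon\mathbb N^k\curvearrowright X$ be an action by local homeomorphisms. Then the map $\pi\colon X\times\mathbb T^k\to\operatorname{Prim}(C^*(G_T))$, $\pi(x,z)=\ker(\pi_{(x,z)})$, is continuous.
   Context: Conventions: $\mathbb N$ contains $0$; for $z\in\mathbb T^k$, $n\in\mathbb Z^k$, $z^n=\prod_i z_i^{n_i}$. An action $T\colon\mathbb N^k\curvearrowright X$ by local homeomorphisms is a monoid homomorphism $n\mapsto T^n$ from $\mathbb N^k$ to the monoid of local homeomorphisms $X\to X$. Its Deaconu--Renault groupoid is $G_T=\{(x,p-q,y): x,y\in X,\ p,q\in\mathbb N^k,\ T^p(x)=T^q(y)\}$ with $r(x,m,y)=x$, $s(x,m,y)=y$, $(x,m,y)(y,n,w)=(x,m+n,w)$, $(x,m,y)^{-1}=(y,-m,x)$, unit space identified with $X$ via $x\leftrightarrow(x,0,x)$, and topology with basis the sets $\{(x,p-q,y):x\in U,\ y\in V,\ T^p(x)=T^q(y)\}$ for $U,V\subseteq X$ open and $p,q\in\mathbb N^k$; it is a locally compact Hausdorff étale groupoid. The canonical cocycle is $c(x,m,y)=m$. Write $(G_T)_x=s^{-1}(x)$ and $[x]=\{r(\gamma):\gamma\in(G_T)_x\}$. $C^*(G_T)$ is the full groupoid $C^*$-algebra. For $(x,z)\in X\times\mathbb T^k$, $\pi_{(x,z)}$ is the irreducible representation of $C^*(G_T)$ on $\ell^2([x])$ with $\pi_{(x,z)}(f)e_y=\sum_{\gamma\in(G_T)_y}z^{c(\gamma)}f(\gamma)e_{r(\gamma)}$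 for $f\in C_c(G_T)$, $y\in[x]$. The map $\pi$ is known to be surjective onto $\operatorname{Prim}(C^*(G_T))$, which carries the hull-kernel topology. *)

theory Defs
  imports "HOL-Analysis.Analysis"
begin

section \<open>Hilbert spaces and bounded operators\<close>

text \<open>
  Every complex Hilbert space is unitarily equivalent to some \<open>\<ell>\<^sup>2(S)\<close>, so all Hilbert
  spaces below are taken of this form. Vectors are functions vanishing off \<open>S\<close>; operators are
  functions of which only the values on \<open>\<ell>\<^sup>2(S)\<close> matter.
\<close>

definition ell2 :: "'i set \<Rightarrow> ('i \<Rightarrow> complex) set" where
  "ell2 S = {\<xi>. (\<forall>i. i \<notin> S \<longrightarrow> \<xi> i = 0) \<and> (\<lambda>i. (cmod (\<xi> i))\<^sup>2) summable_on S}"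

definition ell2_inner :: "'i set \<Rightarrow> ('i \<Rightarrow> complex) \<Rightarrow> ('i \<Rightarrow> complex) \<Rightarrow> complex" where
  "ell2_inner S \<xi> \<eta> = (\<Sum>\<^sub>\<infinity>i\<in>S. \<xi> i * cnj (\<eta> i))"

definition ell2_norm :: "'i set \<Rightarrow> ('i \<Rightarrow> complex) \<Rightarrow> real" where
  "ell2_norm S \<xi> = sqrt (\<Sum>\<^sub>\<infinity>i\<in>S. (cmod (\<xi> i))\<^sup>2)"

definition basis_vec :: "'i \<Rightarrow> 'i \<Rightarrow> complex" where
  "basis_vec y = (\<lambda>w. if w = y then 1 else 0)"

definition bounded_operator :: "'i set \<Rightarrow> (('i \<Rightarrow> complex) \<Rightarrow> 'i \<Rightarrow> complex) \<Rightarrow> bool" where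
  "bounded_operator S L \<longleftrightarrow>
     (\<forall>\<xi>\<in>ell2 S. L \<xi> \<in> ell2 S) \<and>
     (\<forall>\<xi>\<in>ell2 S. \<forall>\<eta>\<in>ell2 S. L (\<lambda>i. \<xi> i + \<eta> i) = (\<lambda>i. L \<xi> i + L \<eta> i)) \<and>
     (\<forall>c. \<forall>\<xi>\<in>ell2 S. L (\<lambda>i. c * \<xi> i) = (\<lambda>i. c * L \<xi> i)) \<and>
     (\<exists>M. \<forall>\<xi>\<in>ell2 S. ell2_norm S (L \<xi>) \<le> M * ell2_norm S \<xi>)"

definition op_norm :: "'i set \<Rightarrow> (('i \<Rightarrow> complex) \<Rightarrow> 'i \<Rightarrow> complex) \<Rightarrow> real" where
  "op_norm S L = Sup {ell2_norm S (L \<xi>) | \<xi>. \<xi> \<in> ell2 S \<and> ell2_norm S \<xi> \<le> 1}"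

definition closed_subspace :: "'i set \<Rightarrow> ('i \<Rightarrow> complex) set \<Rightarrow> bool" where
  "closed_subspace S W \<longleftrightarrow>
     W \<subseteq> ell2 S \<and> (\<lambda>_. 0) \<in> W \<and>
     (\<forall>\<xi>\<in>W. \<forall>\<eta>\<in>W. (\<lambda>i. \<xi> i + \<eta> i) \<in> W) \<and>
     (\<forall>c. \<forall>\<xi>\<in>W. (\<lambda>i. c * \<xi> i) \<in> W) \<and>
     (\<forall>u. \<forall>\<xi>\<in>ell2 S. (\<forall>n::nat. u n \<in> W) \<longrightarrow>
        (\<lambda>n. ell2_norm S (\<lambda>i. u n i - \<xi> i)) \<longlonglongrightarrow> 0 \<longrightarrow> \<xi> \<in> W)"


section \<open>Complex *-algebras and their representations\<close>

record 'a star_algebra =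
  elems :: "'a set"
  add :: "'a \<Rightarrow> 'a \<Rightarrow> 'a"
  smul :: "complex \<Rightarrow> 'a \<Rightarrow> 'a"
  mul :: "'a \<Rightarrow> 'a \<Rightarrow> 'a"
  star :: "'a \<Rightarrow> 'a"

definition star_rep ::
    "'a star_algebra \<Rightarrow> 'i set \<Rightarrow> ('a \<Rightarrow> ('i \<Rightarrow> complex) \<Rightarrow> 'i \<Rightarrow> complex) \<Rightarrow> bool" where
  "star_rep A S \<rho> \<longleftrightarrow>
     (\<forall>a\<in>elems A. bounded_operator S (\<rho> a)) \<and>
     (\<forall>a\<in>elems A. \<forall>b\<in>elems A. \<forall>\<xi>\<in>ell2 S. \<rho> (add A a b) \<xi> = (\<lambda>i. \<rho> a \<xi> i + \<rho> b \<xi> i)) \<and>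
     (\<forall>c. \<forall>a\<in>elems A. \<forall>\<xi>\<in>ell2 S. \<rho> (smul A c a) \<xi> = (\<lambda>i. c * \<rho> a \<xi> i)) \<and>
     (\<forall>a\<in>elems A. \<forall>b\<in>elems A. \<forall>\<xi>\<in>ell2 S. \<rho> (mul A a b) \<xi> = \<rho> a (\<rho> b \<xi>)) \<and>
     (\<forall>a\<in>elems A. \<forall>\<xi>\<in>ell2 S. \<forall>\<eta>\<in>ell2 S.
        ell2_inner S (\<rho> (star A a) \<xi>) \<eta> = ell2_inner S \<xi> (\<rho> a \<eta>))"

definition rep_ker ::
    "'a star_algebra \<Rightarrow> 'i set \<Rightarrow> ('a \<Rightarrow> ('i \<Rightarrow> complex) \<Rightarrow> 'i \<Rightarrow> complex) \<Rightarrow> 'a set" where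
  "rep_ker A S \<rho> = {a \<in> elems A. \<forall>\<xi>\<in>ell2 S. \<rho> a \<xi> = (\<lambda>_. 0)}"

definition irreducible_rep ::
    "'a star_algebra \<Rightarrow> 'i set \<Rightarrow> ('a \<Rightarrow> ('i \<Rightarrow> complex) \<Rightarrow> 'i \<Rightarrow> complex) \<Rightarrow> bool" where
  "irreducible_rep A S \<rho> \<longleftrightarrow>
     star_rep A S \<rho> \<and> rep_ker A S \<rho> \<noteq> elems A \<and>
     (\<forall>W. closed_subspace S W \<and> (\<forall>a\<in>elems A. \<forall>\<xi>\<in>W. \<rho> a \<xi> \<in> W) \<longrightarrow>
        W = {\<lambda>_. 0} \<or> W = ell2 S)"


section \<open>Primitive ideals and the hull-kernel topology\<close>

text \<open>
  An irreducible representation of a C*-algebra \<open>A\<close> is cyclic, so its Hilbert space has dimension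
  at most the cardinality of \<open>A\<close>; hence index sets \<open>S\<close> inside the element type realise all
  irreducible representations up to unitary equivalence. The norm of \<open>A\<close> is not needed
  here, since *-homomorphisms between C*-algebras are automatically continuous.
\<close>

definition prim :: "'a star_algebra \<Rightarrow> 'a set set" where
  "prim A = {rep_ker A S \<rho> | (S :: 'a set) \<rho>. irreducible_rep A S \<rho>}"

definition hull_of :: "'a star_algebra \<Rightarrow> 'a set \<Rightarrow> 'a set set" where
  "hull_of A I = {P \<in> prim A. I \<subseteq> P}"

definition kernel_of :: "'a star_algebra \<Rightarrow> 'a set set \<Rightarrow> 'a set" where
  "kernel_of A F = elems A \<inter> \<Inter>F"

text \<open>
  The closed sets are the hulls of kernels. Over a C*-algebra the complements of
  these already form a topology on \<open>prim A\<close>, so generating adds no further open sets.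
\<close>

definition hull_kernel_topology :: "'a star_algebra \<Rightarrow> 'a set topology" where
  "hull_kernel_topology A =
     topology_generated_by {prim A - hull_of A (kernel_of A F) | F. F \<subseteq> prim A}"


section \<open>The enveloping C*-algebra of a *-algebra\<close>

text \<open>
  The supremum runs over all *-representations on Hilbert spaces. Since every representation is
  a direct sum of cyclic ones and a zero one, index sets \<open>S\<close> inside the element type suffice, as
  above. The supremum is a real one, so the definition is meaningful for *-algebras in which it is
  finite for every element, such as \<open>C\<^sub>c(G)\<close> for an etale groupoid \<open>G\<close>.
\<close>

definition universal_seminorm :: "'a star_algebra \<Rightarrow> 'a \<Rightarrow> real" where
  "universal_seminorm A a = Sup {op_norm S (\<rho> a) | (S :: 'a set) \<rho>. star_rep A S \<rho>}"

definition universal_dist :: "'a star_algebra \<Rightarrow> 'a \<Rightarrow> 'a \<Rightarrow> real" where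
  "universal_dist A a b = universal_seminorm A (add A a (smul A (-1) b))"

definition cauchy_seqs :: "'a star_algebra \<Rightarrow> (nat \<Rightarrow> 'a) set" where
  "cauchy_seqs A =
     {u. (\<forall>n. u n \<in> elems A) \<and>
         (\<forall>e>0. \<exists>N. \<forall>m\<ge>N. \<forall>n\<ge>N. universal_dist A (u m) (u n) < e)}"

definition null_rel :: "'a star_algebra \<Rightarrow> ((nat \<Rightarrow> 'a) \<times> (nat \<Rightarrow> 'a)) set" where
  "null_rel A =
     {(u, v). u \<in> cauchy_seqs A \<and> v \<in> cauchy_seqs A \<and>
              (\<lambda>n. universal_dist A (u n) (v n)) \<longlonglongrightarrow> 0}"

definition enveloping_cstar :: "'a star_algebra \<Rightarrow> (nat \<Rightarrow> 'a) set star_algebra" where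
  "enveloping_cstar A =
     \<lparr> elems = cauchy_seqs A // null_rel A,
       add = (\<lambda>P Q. \<Union>u\<in>P. \<Union>v\<in>Q. null_rel A `` {\<lambda>n. add A (u n) (v n)}),
       smul = (\<lambda>c P. \<Union>u\<in>P. null_rel A `` {\<lambda>n. smul A c (u n)}),
       mul = (\<lambda>P Q. \<Union>u\<in>P. \<Union>v\<in>Q. null_rel A `` {\<lambda>n. mul A (u n) (v n)}),
       star = (\<lambda>P. \<Union>u\<in>P. null_rel A `` {\<lambda>n. star A (u n)}) \<rparr>"

definition enveloping_embed :: "'a star_algebra \<Rightarrow> 'a \<Rightarrow> (nat \<Rightarrow> 'a) set" where
  "enveloping_embed A a = null_rel A `` {\<lambda>_. a}"


section \<open>The full C*-algebra of an etale groupoid\<close>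

text \<open>
  A groupoid with arrows \<open>topspace (gtop G)\<close> and unit space identified with a subset of \<open>'x\<close>;
  \<open>comp G \<alpha> \<beta>\<close> is meaningful when \<open>src G \<alpha> = rng G \<beta>\<close>.
\<close>

record ('g, 'x) top_groupoid =
  gtop :: "'g topology"
  rng :: "'g \<Rightarrow> 'x"
  src :: "'g \<Rightarrow> 'x"
  comp :: "'g \<Rightarrow> 'g \<Rightarrow> 'g"
  ginv :: "'g \<Rightarrow> 'g"

abbreviation arrows :: "('g, 'x) top_groupoid \<Rightarrow> 'g set" where
  "arrows G \<equiv> topspace (gtop G)"

definition orbit :: "('g, 'x) top_groupoid \<Rightarrow> 'x \<Rightarrow> 'x set" where
  "orbit G x = {rng G \<gamma> | \<gamma>. \<gamma> \<in> arrows G \<and> src G \<gamma> = x}"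

text \<open>
  The functions in \<open>C\<^sub>c(G)\<close> are extended by \<open>0\<close> off the set of arrows.
\<close>

definition Cc :: "('g, 'x) top_groupoid \<Rightarrow> ('g \<Rightarrow> complex) set" where
  "Cc G = {f. continuous_map (gtop G) euclidean f \<and>
              (\<forall>\<gamma>. \<gamma> \<notin> arrows G \<longrightarrow> f \<gamma> = 0) \<and>
              compactin (gtop G) (gtop G closure_of {\<gamma> \<in> arrows G. f \<gamma> \<noteq> 0})}"

text \<open>
  The convolution sum has only finitely many nonzero terms when \<open>G\<close> is etale.
\<close>

definition convolution ::
    "('g, 'x) top_groupoid \<Rightarrow> ('g \<Rightarrow> complex) \<Rightarrow> ('g \<Rightarrow> complex) \<Rightarrow> 'g \<Rightarrow> complex" where
  "convolution G f g \<gamma> =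
     (\<Sum>\<^sub>\<infinity>(\<alpha>, \<beta>)\<in>{(\<alpha>, \<beta>). \<alpha> \<in> arrows G \<and> \<beta> \<in> arrows G \<and> src G \<alpha> = rng G \<beta> \<and> comp G \<alpha> \<beta> = \<gamma>}.
        f \<alpha> * g \<beta>)"

definition Cc_algebra :: "('g, 'x) top_groupoid \<Rightarrow> ('g \<Rightarrow> complex) star_algebra" where
  "Cc_algebra G =
     \<lparr> elems = Cc G,
       add = (\<lambda>f g \<gamma>. f \<gamma> + g \<gamma>),
       smul = (\<lambda>c f \<gamma>. c * f \<gamma>),
       mul = convolution G,
       star = (\<lambda>f \<gamma>. cnj (f (ginv G \<gamma>))) \<rparr>"

definition groupoid_cstar :: "('g, 'x) top_groupoid \<Rightarrow> (nat \<Rightarrow> 'g \<Rightarrow> complex) set star_algebra" where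
  "groupoid_cstar G = enveloping_cstar (Cc_algebra G)"


section \<open>Deaconu--Renault groupoids\<close>

definition local_homeo :: "'x topology \<Rightarrow> ('x \<Rightarrow> 'x) \<Rightarrow> bool" where
  "local_homeo X f \<longleftrightarrow>
     f ` topspace X \<subseteq> topspace X \<and>
     (\<forall>x\<in>topspace X. \<exists>U. openin X U \<and> x \<in> U \<and> openin X (f ` U) \<and>
        homeomorphic_map (subtopology X U) (subtopology X (f ` U)) f)"

definition local_homeo_action :: "'x topology \<Rightarrow> (nat ^ 'k \<Rightarrow> 'x \<Rightarrow> 'x) \<Rightarrow> bool" where
  "local_homeo_action X T \<longleftrightarrow>
     (\<forall>n. local_homeo X (T n)) \<and>
     (\<forall>x\<in>topspace X. T 0 x = x) \<and>
     (\<forall>m n. \<forall>x\<in>topspace X. T (m + n) x = T m (T n x))"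

definition int_diff :: "nat ^ 'k \<Rightarrow> nat ^ 'k \<Rightarrow> int ^ 'k" where
  "int_diff p q = (\<chi> i. int (p $ i) - int (q $ i))"

definition DR_basic ::
    "(nat ^ 'k \<Rightarrow> 'x \<Rightarrow> 'x) \<Rightarrow> 'x set \<Rightarrow> nat ^ 'k \<Rightarrow> nat ^ 'k \<Rightarrow> 'x set \<Rightarrow> ('x \<times> (int ^ 'k) \<times> 'x) set" where
  "DR_basic T U p q V = {(x, int_diff p q, y) | x y. x \<in> U \<and> y \<in> V \<and> T p x = T q y}"

text \<open>
  The generating sets form a basis, and their union \<open>arrows (DR_groupoid X T)\<close> is the set of all
  \<open>(x, p - q, y)\<close> with \<open>x\<close>, \<open>y\<close> in \<open>X\<close> and \<open>T p x = T q y\<close>.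
\<close>

definition DR_groupoid ::
    "'x topology \<Rightarrow> (nat ^ 'k \<Rightarrow> 'x \<Rightarrow> 'x) \<Rightarrow> ('x \<times> (int ^ 'k) \<times> 'x, 'x) top_groupoid" where
  "DR_groupoid X T =
     \<lparr> gtop = topology_generated_by {DR_basic T U p q V | U p q V. openin X U \<and> openin X V},
       rng = (\<lambda>(x, m, y). x),
       src = (\<lambda>(x, m, y). y),
       comp = (\<lambda>(x, m, y) (y', n, w). (x, m + n, w)),
       ginv = (\<lambda>(x, m, y). (y, - m, x)) \<rparr>"

definition DR_cocycle :: "'x \<times> (int ^ 'k) \<times> 'x \<Rightarrow> int ^ 'k" where
  "DR_cocycle = (\<lambda>(x, m, y). m)"

definition torus :: "(complex ^ 'k) set" where
  "torus = {z. \<forall>i. cmod (z $ i) = 1}"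

definition torus_power :: "complex ^ 'k \<Rightarrow> int ^ 'k \<Rightarrow> complex" where
  "torus_power z n = (\<Prod>i\<in>UNIV. (z $ i) powi (n $ i))"

text \<open>
  The formula on \<open>C\<^sub>c(G)\<close> determines the representation on all of \<open>C*(G)\<close>, since \<open>C\<^sub>c(G)\<close> is dense,
  *-representations are contractive, and the vectors \<open>e\<^sub>y\<close> span a dense subspace. So the choice
  operator only chooses irrelevant values outside the elements of \<open>C*(G)\<close> and of \<open>\<ell>\<^sup>2([x])\<close>.
  The sum has only finitely many nonzero terms.
\<close>

definition DR_rep ::
    "'x topology \<Rightarrow> (nat ^ 'k \<Rightarrow> 'x \<Rightarrow> 'x) \<Rightarrow> 'x \<Rightarrow> complex ^ 'k \<Rightarrow>
     (nat \<Rightarrow> 'x \<times> (int ^ 'k) \<times> 'x \<Rightarrow> complex) set \<Rightarrow> ('x \<Rightarrow> complex) \<Rightarrow> 'x \<Rightarrow> complex" where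
  "DR_rep X T x z =
     (let G = DR_groupoid X T in
      SOME \<rho>. star_rep (groupoid_cstar G) (orbit G x) \<rho> \<and>
        (\<forall>f\<in>Cc G. \<forall>y\<in>orbit G x.
           \<rho> (enveloping_embed (Cc_algebra G) f) (basis_vec y) =
           (\<lambda>w. \<Sum>\<^sub>\<infinity>\<gamma>\<in>{\<gamma> \<in> arrows G. src G \<gamma> = y}.
              torus_power z (DR_cocycle \<gamma>) * f \<gamma> * basis_vec (rng G \<gamma>) w)))"

definition DR_prim ::
    "'x topology \<Rightarrow> (nat ^ 'k \<Rightarrow> 'x \<Rightarrow> 'x) \<Rightarrow> 'x \<times> (complex ^ 'k) \<Rightarrow>
     (nat \<Rightarrow> 'x \<times> (int ^ 'k) \<times> 'x \<Rightarrow> complex) set set" where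
  "DR_prim X T = (\<lambda>(x, z).
     rep_ker (groupoid_cstar (DR_groupoid X T)) (orbit (DR_groupoid X T) x) (DR_rep X T x z))"

end

theory Submission
  imports Defs
begin

text \<open>
  The preimage of the complement of a hull is the union, over the elements \<open>a\<close> of the
  corresponding kernel, of the sets of all \<open>(x, z)\<close> with \<open>\<pi>\<^sub>x\<^sub>,\<^sub>z(a) \<noteq> 0\<close>. So the claim is that
  these sets are open for every \<open>a\<close> in the C*-algebra (\<open>not_in_DR_prim_nearby\<close>), and that the
  kernels are indeed primitive (\<open>DR_prim_in_prim\<close>).

  Let \<open>\<pi>\<^sub>x\<^sub>0\<^sub>,\<^sub>z\<^sub>0(a) \<noteq> 0\<close>. Some basis vector is not annihilated, and functions in \<open>C\<^sub>c(G)\<close> move basis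
  vectors of an orbit to one another, so \<open>\<pi>\<^sub>x\<^sub>0\<^sub>,\<^sub>z\<^sub>0(a) e\<^sub>x\<^sub>0 \<noteq> 0\<close> without loss of generality. Let
  \<open>F(x, z) = \<parallel>\<pi>\<^sub>x\<^sub>,\<^sub>z(a) e\<^sub>x\<parallel>\<^sup>2\<close>. If \<open>u \<in> C\<^sub>c(G)\<close> is close to \<open>a\<close> and \<open>b = u\<^sup>*u\<close>, then \<open>F(x, z)\<close> is
  close, uniformly in \<open>x\<close> and \<open>z\<close>, to the trigonometric polynomial \<open>\<Sum>\<^sub>n z\<^sup>n b(x, n, x)\<close>
  (\<open>rep_norm_approx\<close>). This gives continuity in \<open>z\<close>. The isotropy of \<open>x\<close> is not continuous
  in \<open>x\<close>, however, and neither is \<open>F\<close> in general: for \<open>x\<close> near \<open>x\<^sub>0\<close> the coefficient \<open>b(x, n, x)\<close> is close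
  to \<open>b(x\<^sub>0, n, x\<^sub>0)\<close> if \<open>n\<close> lies in the set \<open>H\<^sub>x\<close> of those isotropy elements of \<open>x\<^sub>0\<close> whose germs
  fix \<open>x\<close>, and close to \<open>0\<close> otherwise (\<open>Cc_near_iso\<close>). Thus \<open>F(x, z)\<close> is approximately the value
  at \<open>w = 1\<close> of the polynomial \<open>w \<mapsto> F(x\<^sub>0, zw)\<close> with its coefficients restricted to \<open>H\<^sub>x\<close>.

  If \<open>H\<^sub>x\<close> were a subgroup of \<open>\<int>\<^sup>k\<close>, this restriction would be the average over the translations
  by the annihilator of \<open>H\<^sub>x\<close>, hence positive. For \<open>z\<close> near \<open>z\<^sub>0\<close> the function \<open>w \<mapsto> F(x\<^sub>0, zw)\<close> is
  bounded below by a constant \<open>c > 0\<close> near \<open>w = 1\<close>, hence everywhere by \<open>c \<bar>q\<bar>\<^sup>2 - \<epsilon>\<close>, where \<open>q\<close> is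
  a trigonometric polynomial with nonnegative coefficients \<open>\<beta>\<close> concentrated at \<open>w = 1\<close>
  (\<open>concentrating_polynomial\<close>), and restricting to \<open>H\<^sub>x\<close> yields at least
  \<open>c \<Sum>\<beta>\<^sup>2 - \<epsilon> > 0\<close>. In general \<open>H\<^sub>x\<close> is closed under differences only inside a box, which can be
  chosen as large as desired by shrinking the neighbourhood of \<open>x\<^sub>0\<close>. That is enough, because
  \<open>\<int>\<^sup>k\<close> is amenable and the average can be replaced by one over a finite Folner set
  (\<open>local_subgroup_positivity\<close>).

  Three facts on representations precede this argument. The universal seminorm of \<open>C\<^sub>c(G)\<close> is finite,
  since \<open>C\<^sub>c(G)\<close> is spanned by functions \<open>e\<close> supported on open bisections, for which \<open>e\<^sup>*e\<close> lives
  on the unit space (\<open>elementary_rep_bound\<close>). Contractive representations extend to the completion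
  (\<open>ext_rep_star_rep\<close>). Finally every representation of the completion is contractive
  (\<open>rep_contractive\<close>), so that \<open>C\<^sub>c(G)\<close> approximates \<open>a\<close> uniformly in all representations at once.
\<close>

section \<open>Hilbert spaces of square-summable functions\<close>

lemma L2_le_iff:
  assumes "B \<ge> 0"
  shows "L2_set f F \<le> B \<longleftrightarrow> (\<Sum>i\<in>F. (f i)\<^sup>2) \<le> B\<^sup>2"
proof -
  have "L2_set f F \<le> B \<longleftrightarrow> (L2_set f F)\<^sup>2 \<le> B\<^sup>2"
    using assms by (smt (verit) L2_set_nonneg power2_le_imp_le power_mono)
  then show ?thesis by (simp add: L2_set_def sum_nonneg)
qed

lemma ell2_support: "\<xi> \<in> ell2 S \<Longrightarrow> i \<notin> S \<Longrightarrow> \<xi> i = 0"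
  by (simp add: ell2_def)

lemma ell2_summable: "\<xi> \<in> ell2 S \<Longrightarrow> (\<lambda>i. (cmod (\<xi> i))\<^sup>2) summable_on S"
  by (simp add: ell2_def)

lemma ell2_norm_nonneg [simp]: "0 \<le> ell2_norm S \<xi>"
  by (simp add: ell2_norm_def infsum_nonneg)

lemma ell2_norm_sq: "(ell2_norm S \<xi>)\<^sup>2 = (\<Sum>\<^sub>\<infinity>i\<in>S. (cmod (\<xi> i))\<^sup>2)"
  by (simp add: ell2_norm_def infsum_nonneg)

lemma ell2_norm_finite_le:
  assumes "\<xi> \<in> ell2 S" "finite F" "F \<subseteq> S"
  shows "L2_set (\<lambda>i. cmod (\<xi> i)) F \<le> ell2_norm S \<xi>"
  using finite_sum_le_infsum[OF ell2_summable[OF assms(1)] assms(2,3)]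
  by (simp add: L2_le_iff ell2_norm_sq)

lemma ell2_bounded:
  assumes "\<And>i. i \<notin> S \<Longrightarrow> \<xi> i = 0" "B \<ge> 0"
    and "\<And>F. finite F \<Longrightarrow> F \<subseteq> S \<Longrightarrow> L2_set (\<lambda>i. cmod (\<xi> i)) F \<le> B"
  shows "\<xi> \<in> ell2 S" "ell2_norm S \<xi> \<le> B"
proof -
  have s: "(\<Sum>i\<in>F. (cmod (\<xi> i))\<^sup>2) \<le> B\<^sup>2" if "finite F" "F \<subseteq> S" for F
    using assms(3)[OF that] by (simp add: L2_le_iff[OF assms(2)])
  have "(\<lambda>i. (cmod (\<xi> i))\<^sup>2) summable_on S"
    by (rule nonneg_bdd_above_summable_on) (auto intro!: bdd_aboveI[of _ "B\<^sup>2"] s)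
  then show m: "\<xi> \<in> ell2 S" using assms(1) by (auto simp: ell2_def)
  have "(\<Sum>\<^sub>\<infinity>i\<in>S. (cmod (\<xi> i))\<^sup>2) \<le> B\<^sup>2"
    by (rule infsum_le_finite_sums[OF ell2_summable[OF m]]) (use s in auto)
  then show "ell2_norm S \<xi> \<le> B"
    by (simp add: ell2_norm_def assms(2) real_le_lsqrt infsum_nonneg real_sqrt_le_iff)
qed

lemma ell2_zero [simp]: "(\<lambda>_. 0) \<in> ell2 S"
  by (simp add: ell2_def)

lemma ell2_norm_zero [simp]: "ell2_norm S (\<lambda>_. 0) = 0"
  by (simp add: ell2_norm_def)

lemma ell2_add_aux:
  assumes "\<xi> \<in> ell2 S" "\<eta> \<in> ell2 S"
  shows "(\<lambda>i. \<xi> i + \<eta> i) \<in> ell2 S"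
    and "ell2_norm S (\<lambda>i. \<xi> i + \<eta> i) \<le> ell2_norm S \<xi> + ell2_norm S \<eta>"
proof -
  have "L2_set (\<lambda>i. cmod (\<xi> i + \<eta> i)) F \<le> ell2_norm S \<xi> + ell2_norm S \<eta>"
    if "finite F" "F \<subseteq> S" for F
  proof -
    have "L2_set (\<lambda>i. cmod (\<xi> i + \<eta> i)) F \<le> L2_set (\<lambda>i. cmod (\<xi> i) + cmod (\<eta> i)) F"
      by (rule L2_set_mono) (auto intro: norm_triangle_ineq)
    also have "\<dots> \<le> L2_set (\<lambda>i. cmod (\<xi> i)) F + L2_set (\<lambda>i. cmod (\<eta> i)) F"
      by (rule L2_set_triangle_ineq)
    finally show ?thesis
      using ell2_norm_finite_le[OF assms(1) that] ell2_norm_finite_le[OF assms(2) that] by simp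
  qed
  from ell2_bounded[OF _ _ this]
  show "(\<lambda>i. \<xi> i + \<eta> i) \<in> ell2 S"
    and "ell2_norm S (\<lambda>i. \<xi> i + \<eta> i) \<le> ell2_norm S \<xi> + ell2_norm S \<eta>"
    using assms by (auto simp: ell2_support)
qed

lemmas ell2_add [simp, intro] = ell2_add_aux(1)
lemmas ell2_norm_triangle = ell2_add_aux(2)

lemma ell2_scale [simp, intro]: "\<xi> \<in> ell2 S \<Longrightarrow> (\<lambda>i. c * \<xi> i) \<in> ell2 S"
  by (auto simp: ell2_def norm_mult power_mult_distrib intro: summable_on_cmult_right)

lemma ell2_norm_scale: "ell2_norm S (\<lambda>i. c * \<xi> i) = cmod c * ell2_norm S \<xi>"
  by (simp add: ell2_norm_def norm_mult power_mult_distrib infsum_cmult_right' real_sqrt_mult)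

lemma ell2_diff [simp, intro]:
  assumes "\<xi> \<in> ell2 S" "\<eta> \<in> ell2 S" shows "(\<lambda>i. \<xi> i - \<eta> i) \<in> ell2 S"
  using ell2_add[OF assms(1) ell2_scale[OF assms(2), of "-1"]] by simp

lemma ell2_norm_minus: "ell2_norm S (\<lambda>i. \<xi> i - \<eta> i) = ell2_norm S (\<lambda>i. \<eta> i - \<xi> i)"
  by (simp add: ell2_norm_def norm_minus_commute)

lemma ell2_norm_diff_triangle:
  assumes "\<xi> \<in> ell2 S" "\<eta> \<in> ell2 S" "\<zeta> \<in> ell2 S"
  shows "ell2_norm S (\<lambda>i. \<xi> i - \<zeta> i) \<le> ell2_norm S (\<lambda>i. \<xi> i - \<eta> i) + ell2_norm S (\<lambda>i. \<eta> i - \<zeta> i)"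
  using ell2_norm_triangle[OF ell2_diff[OF assms(1,2)] ell2_diff[OF assms(2,3)]] by simp

lemma ell2_norm_abs_diff:
  assumes "\<xi> \<in> ell2 S" "\<eta> \<in> ell2 S"
  shows "\<bar>ell2_norm S \<xi> - ell2_norm S \<eta>\<bar> \<le> ell2_norm S (\<lambda>i. \<xi> i - \<eta> i)"
  using ell2_norm_triangle[OF ell2_diff[OF assms] assms(2)]
    ell2_norm_triangle[OF ell2_diff[OF assms(2,1)] assms(1)]
  by (simp add: ell2_norm_minus[of S \<xi> \<eta>] abs_le_iff)

lemma ell2_coord_le:
  assumes "\<xi> \<in> ell2 S" shows "cmod (\<xi> i) \<le> ell2_norm S \<xi>"
proof (cases "i \<in> S")
  case True
  then show ?thesis using ell2_norm_finite_le[OF assms, of "{i}"] by simp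
qed (simp add: ell2_support[OF assms])

lemma ell2_norm_eq_0:
  assumes "\<xi> \<in> ell2 S" "ell2_norm S \<xi> = 0" shows "\<xi> = (\<lambda>_. 0)"
  using ell2_coord_le[OF assms(1)] assms(2) by auto

lemma ell2_inner_summable:
  assumes "\<xi> \<in> ell2 S" "\<eta> \<in> ell2 S"
  shows "(\<lambda>i. \<xi> i * cnj (\<eta> i)) summable_on S"
proof -
  let ?g = "\<lambda>i. (cmod (\<xi> i))\<^sup>2 + (cmod (\<eta> i))\<^sup>2"
  have "?g summable_on S"
    by (rule summable_on_add[OF ell2_summable[OF assms(1)] ell2_summable[OF assms(2)]])
  then have g: "(\<lambda>i. norm (?g i)) summable_on S"
    by (subst summable_on_iff_abs_summable_on_real[symmetric])
  have "norm (\<xi> i * cnj (\<eta> i)) \<le> norm (?g i)" for i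
    using sum_squares_bound[of "cmod (\<xi> i)" "cmod (\<eta> i)"]
      mult_nonneg_nonneg[OF norm_ge_zero[of "\<xi> i"] norm_ge_zero[of "\<eta> i"]]
    unfolding norm_mult complex_mod_cnj real_norm_def by linarith
  then have "(\<lambda>i. norm (\<xi> i * cnj (\<eta> i))) summable_on S"
    by (rule Infinite_Sum.abs_summable_on_comparison_test[OF g])
  then show ?thesis by (rule abs_summable_summable)
qed

lemma ell2_inner_add_left:
  assumes "\<xi> \<in> ell2 S" "\<eta> \<in> ell2 S" "\<zeta> \<in> ell2 S"
  shows "ell2_inner S (\<lambda>i. \<xi> i + \<eta> i) \<zeta> = ell2_inner S \<xi> \<zeta> + ell2_inner S \<eta> \<zeta>"
  unfolding ell2_inner_def distrib_right by (intro infsum_add ell2_inner_summable assms)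

lemma ell2_inner_scale_left: "ell2_inner S (\<lambda>i. c * \<xi> i) \<eta> = c * ell2_inner S \<xi> \<eta>"
  unfolding ell2_inner_def mult.assoc by (rule infsum_cmult_right')

lemma ell2_inner_cnj: "cnj (ell2_inner S \<xi> \<eta>) = ell2_inner S \<eta> \<xi>"
  unfolding ell2_inner_def infsum_cnj[symmetric] by (rule infsum_cong) (simp add: mult.commute)

lemma ell2_inner_add_right:
  assumes "\<xi> \<in> ell2 S" "\<eta> \<in> ell2 S" "\<zeta> \<in> ell2 S"
  shows "ell2_inner S \<zeta> (\<lambda>i. \<xi> i + \<eta> i) = ell2_inner S \<zeta> \<xi> + ell2_inner S \<zeta> \<eta>"
  using arg_cong[OF ell2_inner_add_left[OF assms], of cnj] by (simp add: ell2_inner_cnj)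

lemma ell2_inner_scale_right: "ell2_inner S \<xi> (\<lambda>i. c * \<eta> i) = cnj c * ell2_inner S \<xi> \<eta>"
  using arg_cong[OF ell2_inner_scale_left[of S c \<eta> \<xi>], of cnj] by (simp add: ell2_inner_cnj)

lemma ell2_inner_diff_left:
  assumes "\<xi> \<in> ell2 S" "\<eta> \<in> ell2 S" "\<zeta> \<in> ell2 S"
  shows "ell2_inner S (\<lambda>i. \<xi> i - \<eta> i) \<zeta> = ell2_inner S \<xi> \<zeta> - ell2_inner S \<eta> \<zeta>"
  using ell2_inner_add_left[OF assms(1) ell2_scale[OF assms(2), of "-1"] assms(3)]
    ell2_inner_scale_left[of S "-1" \<eta> \<zeta>] by simp

lemma ell2_inner_diff_right:
  assumes "\<xi> \<in> ell2 S" "\<eta> \<in> ell2 S" "\<zeta> \<in> ell2 S"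
  shows "ell2_inner S \<zeta> (\<lambda>i. \<xi> i - \<eta> i) = ell2_inner S \<zeta> \<xi> - ell2_inner S \<zeta> \<eta>"
  using arg_cong[OF ell2_inner_diff_left[OF assms], of cnj] by (simp add: ell2_inner_cnj)

lemma ell2_inner_self:
  assumes "\<xi> \<in> ell2 S" shows "ell2_inner S \<xi> \<xi> = of_real ((ell2_norm S \<xi>)\<^sup>2)"
  unfolding ell2_inner_def ell2_norm_sq complex_norm_square[symmetric]
  using has_sum_infsum[OF ell2_summable[OF assms]] by (intro infsumI) (simp only: has_sum_of_real_iff)

lemma ell2_norm_sq_diff:
  assumes "\<xi> \<in> ell2 S" "\<eta> \<in> ell2 S"
  shows "(ell2_norm S (\<lambda>i. \<xi> i - \<eta> i))\<^sup>2
    = (ell2_norm S \<xi>)\<^sup>2 - 2 * Re (ell2_inner S \<xi> \<eta>) + (ell2_norm S \<eta>)\<^sup>2"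
proof -
  have "complex_of_real ((ell2_norm S (\<lambda>i. \<xi> i - \<eta> i))\<^sup>2)
    = ell2_inner S \<xi> \<xi> - ell2_inner S \<xi> \<eta> - cnj (ell2_inner S \<xi> \<eta>) + ell2_inner S \<eta> \<eta>"
    unfolding ell2_inner_self[OF ell2_diff[OF assms], symmetric] ell2_inner_diff_left[OF assms ell2_diff[OF assms]]
      ell2_inner_diff_right[OF assms assms(1)] ell2_inner_diff_right[OF assms assms(2)] ell2_inner_cnj
    by simp
  then have "Re (complex_of_real ((ell2_norm S (\<lambda>i. \<xi> i - \<eta> i))\<^sup>2))
    = Re (ell2_inner S \<xi> \<xi> - ell2_inner S \<xi> \<eta> - cnj (ell2_inner S \<xi> \<eta>) + ell2_inner S \<eta> \<eta>)"
    by simp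
  then show ?thesis by (simp add: ell2_inner_self assms)
qed

lemma ell2_Cauchy_Schwarz:
  assumes "\<xi> \<in> ell2 S" "\<eta> \<in> ell2 S"
  shows "cmod (ell2_inner S \<xi> \<eta>) \<le> ell2_norm S \<xi> * ell2_norm S \<eta>"
proof -
  have "norm (sum (\<lambda>i. \<xi> i * cnj (\<eta> i)) F) \<le> ell2_norm S \<xi> * ell2_norm S \<eta>"
    if F: "finite F" "F \<subseteq> S" for F
  proof -
    have "norm (sum (\<lambda>i. \<xi> i * cnj (\<eta> i)) F) \<le> (\<Sum>i\<in>F. \<bar>cmod (\<xi> i)\<bar> * \<bar>cmod (\<eta> i)\<bar>)"
      by (rule sum_norm_le) (simp add: norm_mult)
    also have "\<dots> \<le> L2_set (\<lambda>i. cmod (\<xi> i)) F * L2_set (\<lambda>i. cmod (\<eta> i)) F"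
      by (rule L2_set_mult_ineq)
    also have "\<dots> \<le> ell2_norm S \<xi> * ell2_norm S \<eta>"
      by (intro mult_mono ell2_norm_finite_le assms F) auto
    finally show ?thesis .
  qed
  then have ev: "\<forall>\<^sub>F F in finite_subsets_at_top S.
      norm (sum (\<lambda>i. \<xi> i * cnj (\<eta> i)) F) \<le> ell2_norm S \<xi> * ell2_norm S \<eta>"
    by (rule eventually_finite_subsets_at_top_weakI)
  have "(sum (\<lambda>i. \<xi> i * cnj (\<eta> i)) \<longlongrightarrow> ell2_inner S \<xi> \<eta>) (finite_subsets_at_top S)"
    unfolding ell2_inner_def by (rule infsum_tendsto[OF ell2_inner_summable[OF assms]])
  from tendsto_upperbound[OF tendsto_norm[OF this] ev finite_subsets_at_top_neq_bot]
  show ?thesis .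
qed

lemma basis_vec_ell2 [simp, intro]:
  assumes "y \<in> S" shows "basis_vec y \<in> ell2 S"
proof -
  have "(\<lambda>i. (cmod (basis_vec y i))\<^sup>2) summable_on S"
    by (rule finite_nonzero_values_imp_summable_on)
      (auto simp: basis_vec_def intro: finite_subset[of _ "{y}"])
  then show ?thesis using assms by (auto simp: ell2_def basis_vec_def)
qed

lemma ell2_inner_basis:
  assumes "y \<in> S" shows "ell2_inner S \<xi> (basis_vec y) = \<xi> y"
proof -
  have "ell2_inner S \<xi> (basis_vec y) = (\<Sum>\<^sub>\<infinity>i\<in>{y}. \<xi> i * cnj (basis_vec y i))"
    unfolding ell2_inner_def using assms by (intro infsum_cong_neutral) (auto simp: basis_vec_def)
  then show ?thesis by (simp add: basis_vec_def)
qed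

lemma ell2_norm_basis [simp]:
  assumes "y \<in> S" shows "ell2_norm S (basis_vec y) = 1"
proof -
  have "complex_of_real ((ell2_norm S (basis_vec y))\<^sup>2) = 1"
    using ell2_inner_self[OF basis_vec_ell2[OF assms]] ell2_inner_basis[OF assms, of "basis_vec y"]
    by (simp add: basis_vec_def)
  then have "(ell2_norm S (basis_vec y))\<^sup>2 = 1" using of_real_eq_1_iff by blast
  then show ?thesis using ell2_norm_nonneg[of S "basis_vec y"] by (auto simp: power2_eq_1_iff)
qed

text \<open>
  Vectors dominated by \<open>\<xi>\<close> that vanish on a large finite set \<open>F\<close> are small. This controls both
  truncations of \<open>\<xi>\<close> and pointwise products of \<open>\<xi>\<close> with functions bounded by \<open>1\<close>.
\<close>

lemma ell2_tail_small:
  assumes "\<xi> \<in> ell2 S" "e > 0"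
  obtains F where "finite F" "F \<subseteq> S"
    "\<forall>\<zeta>. (\<forall>i. cmod (\<zeta> i) \<le> cmod (\<xi> i)) \<and> (\<forall>i\<in>F. \<zeta> i = 0) \<longrightarrow> ell2_norm S \<zeta> < e"
proof -
  let ?g = "\<lambda>i. (cmod (\<xi> i))\<^sup>2"
  note s = ell2_summable[OF assms(1)]
  obtain F where F: "finite F" "F \<subseteq> S" "dist (sum ?g F) (infsum ?g S) \<le> (e/2)\<^sup>2"
    using infsum_finite_approximation[OF s, of "(e/2)\<^sup>2"] assms(2) by auto
  have tail: "infsum ?g (S - F) \<le> (e/2)\<^sup>2"
  proof -
    have "infsum ?g S = infsum ?g F + infsum ?g (S - F)"
      using infsum_Un_disjoint[of ?g F "S - F"] F(1,2)
        summable_on_subset_banach[OF s, of "S - F"] by (simp add: Un_absorb1)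
    then show ?thesis using F by (simp add: dist_real_def)
  qed
  show thesis
  proof (rule that[OF F(1,2)], intro allI impI, elim conjE)
    fix \<zeta> :: "'a \<Rightarrow> complex"
    assume "\<forall>i. cmod (\<zeta> i) \<le> cmod (\<xi> i)" "\<forall>i\<in>F. \<zeta> i = 0"
    then have z: "\<And>i. cmod (\<zeta> i) \<le> cmod (\<xi> i)" "\<And>i. i \<in> F \<Longrightarrow> \<zeta> i = 0"
      by auto
    have "L2_set (\<lambda>i. cmod (\<zeta> i)) E \<le> e/2" if "finite E" "E \<subseteq> S" for E
    proof -
      have "(\<Sum>i\<in>E. (cmod (\<zeta> i))\<^sup>2) = (\<Sum>i\<in>E - F. (cmod (\<zeta> i))\<^sup>2)"
        by (rule sum.mono_neutral_right) (use that z in auto)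
      also have "\<dots> \<le> (\<Sum>i\<in>E - F. ?g i)"
        by (intro sum_mono power_mono z) auto
      also have "\<dots> \<le> infsum ?g (S - F)"
        by (rule finite_sum_le_infsum) (use that s in \<open>auto intro: summable_on_subset_banach\<close>)
      finally show ?thesis using tail assms(2) by (subst L2_le_iff) auto
    qed
    moreover have "\<zeta> i = 0" if "i \<notin> S" for i
      using z(1)[of i] ell2_support[OF assms(1) that] by simp
    ultimately have "ell2_norm S \<zeta> \<le> e/2" using assms(2) by (intro ell2_bounded(2)) auto
    then show "ell2_norm S \<zeta> < e" using assms(2) by simp
  qed
qed

lemma closed_subspace_sum:
  assumes "closed_subspace S W" "finite F" "\<And>j. j \<in> F \<Longrightarrow> \<xi> j \<in> W"
  shows "(\<lambda>i. \<Sum>j\<in>F. \<xi> j i) \<in> W"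
  using assms(2,3)
proof (induction F rule: finite_induct)
  case empty
  then show ?case using assms(1) by (simp add: closed_subspace_def)
next
  case (insert j F)
  then show ?case using assms(1) unfolding closed_subspace_def by simp
qed

lemma closed_subspace_approx:
  assumes W: "closed_subspace S W" and "\<xi> \<in> ell2 S"
    and "\<And>e. e > 0 \<Longrightarrow> \<exists>\<eta>\<in>W. ell2_norm S (\<lambda>i. \<eta> i - \<xi> i) < e"
  shows "\<xi> \<in> W"
proof -
  have "\<forall>n::nat. \<exists>\<eta>\<in>W. ell2_norm S (\<lambda>i. \<eta> i - \<xi> i) < inverse (real (Suc n))"
    using assms(3) by simp
  then obtain u where u: "\<And>n. u n \<in> W" "\<And>n::nat. ell2_norm S (\<lambda>i. u n i - \<xi> i) < inverse (real (Suc n))"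
    by metis
  have "(\<lambda>n. ell2_norm S (\<lambda>i. u n i - \<xi> i)) \<longlonglongrightarrow> 0"
    by (rule tendsto_sandwich[OF _ _ tendsto_const LIMSEQ_inverse_real_of_nat])
      (auto simp del: of_nat_Suc intro!: always_eventually less_imp_le[OF u(2)])
  then show ?thesis using W u(1) assms(2) unfolding closed_subspace_def by blast
qed

lemma closed_subspace_basis:
  assumes "closed_subspace S W" "\<And>y. y \<in> S \<Longrightarrow> basis_vec y \<in> W"
  shows "W = ell2 S"
proof
  show "W \<subseteq> ell2 S" using assms(1) by (simp add: closed_subspace_def)
  show "ell2 S \<subseteq> W"
  proof
    fix \<xi> assume x: "\<xi> \<in> ell2 S"
    show "\<xi> \<in> W"
    proof (rule closed_subspace_approx[OF assms(1) x])
      fix e :: real assume "e > 0"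
      obtain F where F: "finite F" "F \<subseteq> S"
        "\<forall>\<zeta>. (\<forall>i. cmod (\<zeta> i) \<le> cmod (\<xi> i)) \<and> (\<forall>i\<in>F. \<zeta> i = 0) \<longrightarrow> ell2_norm S \<zeta> < e"
        by (rule ell2_tail_small[OF x \<open>e > 0\<close>])
      let ?\<eta> = "\<lambda>i. \<Sum>j\<in>F. \<xi> j * basis_vec j i"
      have eq: "?\<eta> i = (if i \<in> F then \<xi> i else 0)" for i
        using F(1) by (simp add: basis_vec_def if_distrib cong: if_cong)
      have "?\<eta> \<in> W"
      proof (rule closed_subspace_sum[OF assms(1) F(1)])
        fix j assume "j \<in> F"
        then have "basis_vec j \<in> W" using assms(2) F(2) by blast
        then show "(\<lambda>i. \<xi> j * basis_vec j i) \<in> W"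
          using assms(1) by (simp add: closed_subspace_def)
      qed
      moreover have "ell2_norm S (\<lambda>i. ?\<eta> i - \<xi> i) < e"
        by (rule F(3)[rule_format]) (auto simp: eq)
      ultimately show "\<exists>\<eta>\<in>W. ell2_norm S (\<lambda>i. \<eta> i - \<xi> i) < e"
        by (rule bexI[where x = ?\<eta>, rotated])
    qed
  qed
qed

text \<open>
  Completeness: a Cauchy sequence converges coordinatewise, and the bounds on finite sets of
  coordinates pass to the limit.
\<close>

lemma ell2_complete:
  fixes u :: "nat \<Rightarrow> 'i \<Rightarrow> complex"
  assumes u: "\<And>n. u n \<in> ell2 S"
    and C: "\<And>e. e > 0 \<Longrightarrow> \<exists>N. \<forall>m\<ge>N. \<forall>n\<ge>N. ell2_norm S (\<lambda>i. u m i - u n i) \<le> e"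
  obtains \<xi> where "\<xi> \<in> ell2 S" "\<And>i. (\<lambda>n. u n i) \<longlonglongrightarrow> \<xi> i"
    "(\<lambda>n. ell2_norm S (\<lambda>i. u n i - \<xi> i)) \<longlonglongrightarrow> 0"
proof -
  have "Cauchy (\<lambda>n. u n i)" for i
  proof (rule metric_CauchyI)
    fix e :: real assume "e > 0"
    then obtain N where N: "\<forall>m\<ge>N. \<forall>n\<ge>N. ell2_norm S (\<lambda>i. u m i - u n i) \<le> e/2"
      using C[of "e/2"] by auto
    have "dist (u m i) (u n i) < e" if "m \<ge> N" "n \<ge> N" for m n
    proof -
      have "dist (u m i) (u n i) \<le> ell2_norm S (\<lambda>i. u m i - u n i)"
        unfolding dist_norm by (rule ell2_coord_le[OF ell2_diff[OF u[of m] u[of n]], of i])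
      also have "\<dots> \<le> e/2" using N that by simp
      finally show ?thesis using \<open>e > 0\<close> by simp
    qed
    then show "\<exists>M. \<forall>m\<ge>M. \<forall>n\<ge>M. dist (u m i) (u n i) < e" by blast
  qed
  then have "\<forall>i. \<exists>l. (\<lambda>n. u n i) \<longlonglongrightarrow> l"
    by (simp add: Cauchy_convergent_iff convergent_def)
  then obtain \<xi> where lim: "\<And>i. (\<lambda>n. u n i) \<longlonglongrightarrow> \<xi> i" by metis
  have z: "\<xi> i = 0" if "i \<notin> S" for i
    using lim[of i] ell2_support[OF u that] LIMSEQ_const_iff[of 0] by (simp add: LIMSEQ_const_iff)
  have near: "(\<lambda>i. u m i - \<xi> i) \<in> ell2 S \<and> ell2_norm S (\<lambda>i. u m i - \<xi> i) \<le> e"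
    if "e > 0" "\<forall>m\<ge>N. \<forall>n\<ge>N. ell2_norm S (\<lambda>i. u m i - u n i) \<le> e" "m \<ge> N" for e N m
  proof -
    have "L2_set (\<lambda>i. cmod (u m i - \<xi> i)) F \<le> e" if F: "finite F" "F \<subseteq> S" for F
    proof (rule tendsto_upperbound)
      show "(\<lambda>n. L2_set (\<lambda>i. cmod (u m i - u n i)) F) \<longlonglongrightarrow> L2_set (\<lambda>i. cmod (u m i - \<xi> i)) F"
        unfolding L2_set_def by (intro tendsto_intros lim)
      show "\<forall>\<^sub>F n in sequentially. L2_set (\<lambda>i. cmod (u m i - u n i)) F \<le> e"
        using eventually_ge_at_top[of N]
      proof eventually_elim
        case (elim n)
        then show ?case
          using ell2_norm_finite_le[OF ell2_diff[OF u[of m] u[of n]] F] \<open>m \<ge> N\<close>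
            \<open>\<forall>m\<ge>N. \<forall>n\<ge>N. ell2_norm S (\<lambda>i. u m i - u n i) \<le> e\<close>
          by (meson order_trans)
      qed
    qed simp
    from ell2_bounded[OF _ _ this] show ?thesis
      using ell2_support[OF u] z \<open>e > 0\<close> by auto
  qed
  obtain N where "\<forall>m\<ge>N. \<forall>n\<ge>N. ell2_norm S (\<lambda>i. u m i - u n i) \<le> 1" using C[of 1] by auto
  then have "(\<lambda>i. u N i - \<xi> i) \<in> ell2 S" using near[of 1 N N] by simp
  from ell2_diff[OF u[of N] this] have x: "\<xi> \<in> ell2 S" by simp
  have "(\<lambda>n. ell2_norm S (\<lambda>i. u n i - \<xi> i)) \<longlonglongrightarrow> 0"
  proof (rule LIMSEQ_I)
    fix e :: real assume "e > 0"
    then obtain N where "\<forall>m\<ge>N. \<forall>n\<ge>N. ell2_norm S (\<lambda>i. u m i - u n i) \<le> e/2"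
      using C[of "e/2"] by auto
    then have "\<forall>n\<ge>N. norm (ell2_norm S (\<lambda>i. u n i - \<xi> i) - 0) < e"
      using near[of "e/2" N] \<open>e > 0\<close> by fastforce
    then show "\<exists>no. \<forall>n\<ge>no. norm (ell2_norm S (\<lambda>i. u n i - \<xi> i) - 0) < e" by blast
  qed
  then show thesis using that x lim by blast
qed

subsection \<open>Bounded operators and their norms\<close>

lemma bounded_operatorD:
  assumes "bounded_operator S L"
  shows "\<xi> \<in> ell2 S \<Longrightarrow> L \<xi> \<in> ell2 S"
    and "\<xi> \<in> ell2 S \<Longrightarrow> \<eta> \<in> ell2 S \<Longrightarrow> L (\<lambda>i. \<xi> i + \<eta> i) = (\<lambda>i. L \<xi> i + L \<eta> i)"
    and "\<xi> \<in> ell2 S \<Longrightarrow> L (\<lambda>i. c * \<xi> i) = (\<lambda>i. c * L \<xi> i)"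
  using assms by (auto simp: bounded_operator_def)

lemma bounded_operator_diff:
  assumes "bounded_operator S L" "\<xi> \<in> ell2 S" "\<eta> \<in> ell2 S"
  shows "L (\<lambda>i. \<xi> i - \<eta> i) = (\<lambda>i. L \<xi> i - L \<eta> i)"
  using bounded_operatorD(2)[OF assms(1,2) ell2_scale[OF assms(3), of "-1"]]
    bounded_operatorD(3)[OF assms(1,3), of "-1"] by simp

lemma bounded_operator_zero:
  assumes "bounded_operator S L" shows "L (\<lambda>_. 0) = (\<lambda>_. 0)"
  using bounded_operatorD(3)[OF assms ell2_zero, of 0] by simp

lemma bounded_operator_bound:
  assumes "bounded_operator S L"
  obtains M where "M \<ge> 0" "\<And>\<xi>. \<xi> \<in> ell2 S \<Longrightarrow> ell2_norm S (L \<xi>) \<le> M * ell2_norm S \<xi>"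
proof -
  obtain M where M: "\<forall>\<xi>\<in>ell2 S. ell2_norm S (L \<xi>) \<le> M * ell2_norm S \<xi>"
    using assms unfolding bounded_operator_def by blast
  have "ell2_norm S (L \<xi>) \<le> max M 0 * ell2_norm S \<xi>" if "\<xi> \<in> ell2 S" for \<xi>
    using M that by (smt (verit) ell2_norm_nonneg mult_right_mono)
  then show thesis using that[of "max M 0"] by simp
qed

lemma op_norm_bound:
  assumes L: "bounded_operator S L" and x: "\<xi> \<in> ell2 S"
  shows "ell2_norm S (L \<xi>) \<le> op_norm S L * ell2_norm S \<xi>"
proof (cases "ell2_norm S \<xi> = 0")
  case True
  then show ?thesis using ell2_norm_eq_0[OF x] bounded_operator_zero[OF L] by simp
next
  case False
  then have pos: "ell2_norm S \<xi> > 0" using ell2_norm_nonneg[of S \<xi>] by linarith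
  obtain M where M: "M \<ge> 0" "\<And>\<xi>. \<xi> \<in> ell2 S \<Longrightarrow> ell2_norm S (L \<xi>) \<le> M * ell2_norm S \<xi>"
    using bounded_operator_bound[OF L] by blast
  let ?s = "complex_of_real (inverse (ell2_norm S \<xi>))"
  have bdd: "bdd_above {ell2_norm S (L \<xi>) | \<xi>. \<xi> \<in> ell2 S \<and> ell2_norm S \<xi> \<le> 1}"
  proof (rule bdd_aboveI[of _ M], clarify)
    fix \<xi> assume "\<xi> \<in> ell2 S" "ell2_norm S \<xi> \<le> 1"
    then show "ell2_norm S (L \<xi>) \<le> M"
      using M(2)[of \<xi>] mult_left_le[of "ell2_norm S \<xi>" M] M(1) by linarith
  qed
  have "ell2_norm S (\<lambda>i. ?s * \<xi> i) = 1"
    unfolding ell2_norm_scale norm_of_real using pos by simp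
  then have "ell2_norm S (L (\<lambda>i. ?s * \<xi> i)) \<le> op_norm S L"
    unfolding op_norm_def using ell2_scale[OF x, of ?s] by (intro cSup_upper[OF _ bdd]) fastforce
  then show ?thesis
    using pos unfolding bounded_operatorD(3)[OF L x] ell2_norm_scale norm_of_real
    by (simp add: field_simps)
qed

lemma op_norm_le:
  assumes "B \<ge> 0" "\<And>\<xi>. \<xi> \<in> ell2 S \<Longrightarrow> ell2_norm S (L \<xi>) \<le> B * ell2_norm S \<xi>"
  shows "op_norm S L \<le> B"
  unfolding op_norm_def
proof (rule cSup_least)
  show "{ell2_norm S (L \<xi>) | \<xi>. \<xi> \<in> ell2 S \<and> ell2_norm S \<xi> \<le> 1} \<noteq> {}"
  proof -
    have "ell2_norm S (L (\<lambda>_. 0)) \<in> {ell2_norm S (L \<xi>) | \<xi>. \<xi> \<in> ell2 S \<and> ell2_norm S \<xi> \<le> 1}"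
      by (rule CollectI, rule exI[of _ "\<lambda>_. 0"]) simp
    then show ?thesis by (metis empty_iff)
  qed
  show "\<And>x. x \<in> {ell2_norm S (L \<xi>) | \<xi>. \<xi> \<in> ell2 S \<and> ell2_norm S \<xi> \<le> 1} \<Longrightarrow> x \<le> B"
  proof clarify
    fix \<xi> assume "\<xi> \<in> ell2 S" "ell2_norm S \<xi> \<le> 1"
    then show "ell2_norm S (L \<xi>) \<le> B"
      using assms(2)[of \<xi>] mult_left_le[of "ell2_norm S \<xi>" B] assms(1) by linarith
  qed
qed

section \<open>Representations of *-algebras\<close>

lemma closed_subspace_limit:
  assumes W: "closed_subspace S W" and x: "\<xi> \<in> ell2 S" and u: "\<And>n::nat. u n \<in> W"
    and lim: "(\<lambda>n. ell2_norm S (\<lambda>i. u n i - \<xi> i)) \<longlonglongrightarrow> 0"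
  shows "\<xi> \<in> W"
proof -
  have "\<forall>u. \<forall>\<xi>\<in>ell2 S. (\<forall>n::nat. u n \<in> W) \<longrightarrow>
      (\<lambda>n. ell2_norm S (\<lambda>i. u n i - \<xi> i)) \<longlonglongrightarrow> 0 \<longrightarrow> \<xi> \<in> W"
    using W by (simp add: closed_subspace_def)
  from this[rule_format, OF x u lim] show ?thesis .
qed

lemma star_repD:
  assumes "star_rep A S \<rho>"
  shows "a \<in> elems A \<Longrightarrow> bounded_operator S (\<rho> a)"
    and "a \<in> elems A \<Longrightarrow> \<xi> \<in> ell2 S \<Longrightarrow> \<rho> a \<xi> \<in> ell2 S"
    and "a \<in> elems A \<Longrightarrow> b \<in> elems A \<Longrightarrow> \<xi> \<in> ell2 S \<Longrightarrow> \<rho> (add A a b) \<xi> = (\<lambda>i. \<rho> a \<xi> i + \<rho> b \<xi> i)"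
    and "a \<in> elems A \<Longrightarrow> \<xi> \<in> ell2 S \<Longrightarrow> \<rho> (smul A c a) \<xi> = (\<lambda>i. c * \<rho> a \<xi> i)"
    and "a \<in> elems A \<Longrightarrow> b \<in> elems A \<Longrightarrow> \<xi> \<in> ell2 S \<Longrightarrow> \<rho> (mul A a b) \<xi> = \<rho> a (\<rho> b \<xi>)"
    and "a \<in> elems A \<Longrightarrow> \<xi> \<in> ell2 S \<Longrightarrow> \<eta> \<in> ell2 S
      \<Longrightarrow> ell2_inner S (\<rho> (star A a) \<xi>) \<eta> = ell2_inner S \<xi> (\<rho> a \<eta>)"
  using assms unfolding star_rep_def bounded_operator_def by simp_all

text \<open>
  Cauchy--Schwarz bounds \<open>\<langle>\<zeta>, \<zeta>\<rangle>\<close> by a multiple of \<open>\<parallel>\<zeta>\<parallel>\<close>, one factor of which cancels.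
\<close>

lemma ell2_norm_le_by_inner:
  assumes "\<zeta> \<in> ell2 S" "cmod (ell2_inner S \<zeta> \<zeta>) \<le> B * ell2_norm S \<zeta>" "0 \<le> B"
  shows "ell2_norm S \<zeta> \<le> B"
proof (cases "ell2_norm S \<zeta> = 0")
  case False
  have "ell2_norm S \<zeta> * ell2_norm S \<zeta> \<le> B * ell2_norm S \<zeta>"
    using assms(2) unfolding ell2_inner_self[OF assms(1)] norm_of_real
    by (simp add: power2_eq_square)
  then show ?thesis using False ell2_norm_nonneg[of S \<zeta>] by simp
qed (use assms in simp)

lemma star_rep_star_bound:
  assumes \<rho>: "star_rep A S \<rho>" and a: "a \<in> elems A" "star A a \<in> elems A" and B: "0 \<le> B"
    and bd: "\<And>\<xi>. \<xi> \<in> ell2 S \<Longrightarrow> ell2_norm S (\<rho> a \<xi>) \<le> B * ell2_norm S \<xi>"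
    and \<xi>: "\<xi> \<in> ell2 S"
  shows "ell2_norm S (\<rho> (star A a) \<xi>) \<le> B * ell2_norm S \<xi>"
proof -
  let ?\<zeta> = "\<rho> (star A a) \<xi>"
  have z: "?\<zeta> \<in> ell2 S" by (rule star_repD(2)[OF \<rho> a(2) \<xi>])
  have "cmod (ell2_inner S ?\<zeta> ?\<zeta>) = cmod (ell2_inner S \<xi> (\<rho> a ?\<zeta>))"
    by (simp add: star_repD(6)[OF \<rho> a(1) \<xi> z])
  also have "\<dots> \<le> ell2_norm S \<xi> * ell2_norm S (\<rho> a ?\<zeta>)"
    by (rule ell2_Cauchy_Schwarz[OF \<xi> star_repD(2)[OF \<rho> a(1) z]])
  also have "\<dots> \<le> ell2_norm S \<xi> * (B * ell2_norm S ?\<zeta>)"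
    by (intro mult_left_mono bd z ell2_norm_nonneg)
  finally show ?thesis
    by (intro ell2_norm_le_by_inner[OF z]) (simp_all add: B mult_ac)
qed

subsection \<open>Transport along an injection of the index set\<close>

text \<open>
  Both \<open>prim\<close> and the universal seminorm range over index sets inside the element type of the
  algebra, whereas orbits are sets of points of \<open>X\<close>. Relabelling the orthonormal basis along an
  injection \<open>j\<close> identifies \<open>\<ell>\<^sup>2(S)\<close> with \<open>\<ell>\<^sup>2(j(S))\<close> and bridges the gap.
\<close>

definition ell2_pull :: "('i \<Rightarrow> 'j) \<Rightarrow> 'i set \<Rightarrow> ('j \<Rightarrow> complex) \<Rightarrow> 'i \<Rightarrow> complex" where
  "ell2_pull j S \<xi> = (\<lambda>i. if i \<in> S then \<xi> (j i) else 0)"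

definition ell2_push :: "('i \<Rightarrow> 'j) \<Rightarrow> 'i set \<Rightarrow> ('i \<Rightarrow> complex) \<Rightarrow> 'j \<Rightarrow> complex" where
  "ell2_push j S \<xi> = (\<lambda>i. if i \<in> j ` S then \<xi> (inv_into S j i) else 0)"

context
  fixes j :: "'i \<Rightarrow> 'j" and S :: "'i set"
  assumes inj: "inj_on j S"
begin

lemma ell2_pull_in: "\<xi> \<in> ell2 (j ` S) \<Longrightarrow> ell2_pull j S \<xi> \<in> ell2 S"
  unfolding ell2_def ell2_pull_def
  by (auto simp: summable_on_reindex[OF inj] o_def cong: summable_on_cong)

lemma ell2_push_in: "\<xi> \<in> ell2 S \<Longrightarrow> ell2_push j S \<xi> \<in> ell2 (j ` S)"
  unfolding ell2_def ell2_push_def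
  by (auto simp: summable_on_reindex[OF inj] o_def inv_into_f_f[OF inj] cong: summable_on_cong)

lemma ell2_pull_push: "\<xi> \<in> ell2 S \<Longrightarrow> ell2_pull j S (ell2_push j S \<xi>) = \<xi>"
  by (auto simp: ell2_pull_def ell2_push_def inv_into_f_f[OF inj] ell2_support)

lemma ell2_push_pull: "\<xi> \<in> ell2 (j ` S) \<Longrightarrow> ell2_push j S (ell2_pull j S \<xi>) = \<xi>"
  by (rule ext) (auto simp: ell2_pull_def ell2_push_def inv_into_f_f[OF inj] ell2_support)

lemma ell2_pull_norm: "ell2_norm S (ell2_pull j S \<xi>) = ell2_norm (j ` S) \<xi>"
  unfolding ell2_norm_def ell2_pull_def
  by (simp add: infsum_reindex[OF inj] o_def cong: infsum_cong)

lemma ell2_push_norm: "\<xi> \<in> ell2 S \<Longrightarrow> ell2_norm (j ` S) (ell2_push j S \<xi>) = ell2_norm S \<xi>"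
  using ell2_pull_norm[of "ell2_push j S \<xi>"] by (simp add: ell2_pull_push)

lemma ell2_pull_inner: "ell2_inner S (ell2_pull j S \<xi>) (ell2_pull j S \<eta>) = ell2_inner (j ` S) \<xi> \<eta>"
  unfolding ell2_inner_def ell2_pull_def
  by (simp add: infsum_reindex[OF inj] o_def cong: infsum_cong)

lemma ell2_push_inner_left:
  assumes "\<xi> \<in> ell2 S"
  shows "ell2_inner (j ` S) (ell2_push j S \<xi>) \<eta> = ell2_inner S \<xi> (ell2_pull j S \<eta>)"
  using ell2_pull_inner[of "ell2_push j S \<xi>" \<eta>] by (simp add: ell2_pull_push[OF assms])

lemma ell2_push_inner_right:
  assumes "\<xi> \<in> ell2 S"
  shows "ell2_inner (j ` S) \<eta> (ell2_push j S \<xi>) = ell2_inner S (ell2_pull j S \<eta>) \<xi>"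
  using ell2_pull_inner[of \<eta> "ell2_push j S \<xi>"] by (simp add: ell2_pull_push[OF assms])

lemma ell2_pull_linear:
  "ell2_pull j S (\<lambda>i. \<xi> i + \<eta> i) = (\<lambda>i. ell2_pull j S \<xi> i + ell2_pull j S \<eta> i)"
  "ell2_pull j S (\<lambda>i. \<xi> i - \<eta> i) = (\<lambda>i. ell2_pull j S \<xi> i - ell2_pull j S \<eta> i)"
  "ell2_pull j S (\<lambda>i. c * \<xi> i) = (\<lambda>i. c * ell2_pull j S \<xi> i)"
  by (auto simp: ell2_pull_def)

lemma ell2_push_linear:
  "ell2_push j S (\<lambda>i. \<xi> i + \<eta> i) = (\<lambda>i. ell2_push j S \<xi> i + ell2_push j S \<eta> i)"
  "ell2_push j S (\<lambda>i. \<xi> i - \<eta> i) = (\<lambda>i. ell2_push j S \<xi> i - ell2_push j S \<eta> i)"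
  "ell2_push j S (\<lambda>i. c * \<xi> i) = (\<lambda>i. c * ell2_push j S \<xi> i)"
  "ell2_push j S (\<lambda>i. 0) = (\<lambda>i. 0)"
  by (auto simp: ell2_push_def)

definition push_rep :: "('a \<Rightarrow> ('i \<Rightarrow> complex) \<Rightarrow> 'i \<Rightarrow> complex) \<Rightarrow> 'a \<Rightarrow> ('j \<Rightarrow> complex) \<Rightarrow> 'j \<Rightarrow> complex" where
  "push_rep \<rho> a \<xi> = ell2_push j S (\<rho> a (ell2_pull j S \<xi>))"

lemma push_rep_bounded:
  assumes "bounded_operator S (\<rho> a)"
  shows "bounded_operator (j ` S) (push_rep \<rho> a)"
proof -
  obtain M where M: "M \<ge> 0" "\<And>\<xi>. \<xi> \<in> ell2 S \<Longrightarrow> ell2_norm S (\<rho> a \<xi>) \<le> M * ell2_norm S \<xi>"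
    using bounded_operator_bound[OF assms] by metis
  have "ell2_norm (j ` S) (push_rep \<rho> a \<xi>) \<le> M * ell2_norm (j ` S) \<xi>" if "\<xi> \<in> ell2 (j ` S)" for \<xi>
    using M(2)[OF ell2_pull_in[OF that]]
    by (simp add: push_rep_def ell2_push_norm bounded_operatorD(1)[OF assms] ell2_pull_in[OF that] ell2_pull_norm)
  then show ?thesis
    unfolding bounded_operator_def
    by (auto simp: push_rep_def ell2_push_in ell2_pull_in bounded_operatorD[OF assms] ell2_pull_linear
        ell2_push_linear)
qed

lemma push_rep_star_rep:
  assumes \<rho>: "star_rep A S \<rho>" and st: "\<And>a. a \<in> elems A \<Longrightarrow> star A a \<in> elems A"
  shows "star_rep A (j ` S) (push_rep \<rho>)"
  unfolding star_rep_def
proof (intro conjI ballI allI)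
  fix a \<xi> \<eta> assume a: "a \<in> elems A" and x: "\<xi> \<in> ell2 (j ` S)" and y: "\<eta> \<in> ell2 (j ` S)"
  have *: "\<rho> (star A a) (ell2_pull j S \<xi>) \<in> ell2 S"
    by (rule star_repD(2)[OF \<rho> st[OF a] ell2_pull_in[OF x]])
  show "ell2_inner (j ` S) (push_rep \<rho> (star A a) \<xi>) \<eta> = ell2_inner (j ` S) \<xi> (push_rep \<rho> a \<eta>)"
    unfolding push_rep_def ell2_push_inner_left[OF *]
      ell2_push_inner_right[OF star_repD(2)[OF \<rho> a ell2_pull_in[OF y]]]
    by (rule star_repD(6)[OF \<rho> a ell2_pull_in[OF x] ell2_pull_in[OF y]])
qed (simp_all add: push_rep_bounded star_repD(1)[OF \<rho>] push_rep_def
    star_repD(2-5)[OF \<rho>] ell2_pull_in ell2_push_linear ell2_pull_push)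

lemma push_rep_ker:
  assumes \<rho>: "star_rep A S \<rho>"
  shows "rep_ker A (j ` S) (push_rep \<rho>) = rep_ker A S \<rho>"
proof -
  have "(\<forall>\<xi>\<in>ell2 (j ` S). push_rep \<rho> a \<xi> = (\<lambda>_. 0)) \<longleftrightarrow> (\<forall>\<xi>\<in>ell2 S. \<rho> a \<xi> = (\<lambda>_. 0))"
    if a: "a \<in> elems A" for a
  proof
    assume L: "\<forall>\<xi>\<in>ell2 (j ` S). push_rep \<rho> a \<xi> = (\<lambda>_. 0)"
    show "\<forall>\<xi>\<in>ell2 S. \<rho> a \<xi> = (\<lambda>_. 0)"
    proof
      fix \<xi> assume x: "\<xi> \<in> ell2 S"
      have "ell2_push j S (\<rho> a \<xi>) = (\<lambda>_. 0)"
        using L[rule_format, OF ell2_push_in[OF x]] by (simp add: push_rep_def ell2_pull_push[OF x])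
      then have "ell2_pull j S (ell2_push j S (\<rho> a \<xi>)) = (\<lambda>_. 0)"
        by (simp add: ell2_pull_def)
      then show "\<rho> a \<xi> = (\<lambda>_. 0)" by (simp add: ell2_pull_push star_repD(2)[OF \<rho> a x])
    qed
  qed (simp add: push_rep_def ell2_pull_in ell2_push_linear)
  then show ?thesis unfolding rep_ker_def by blast
qed

lemma push_rep_irreducible:
  assumes irr: "irreducible_rep A S \<rho>" and st: "\<And>a. a \<in> elems A \<Longrightarrow> star A a \<in> elems A"
  shows "irreducible_rep A (j ` S) (push_rep \<rho>)"
proof -
  have \<rho>: "star_rep A S \<rho>" using irr by (simp add: irreducible_rep_def)
  have "W = {\<lambda>_. 0} \<or> W = ell2 (j ` S)"
    if W: "closed_subspace (j ` S) W" and inv: "\<forall>a\<in>elems A. \<forall>\<xi>\<in>W. push_rep \<rho> a \<xi> \<in> W" for W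
  proof -
    define V where "V = ell2_pull j S ` W"
    have WE: "W \<subseteq> ell2 (j ` S)" using W by (simp add: closed_subspace_def)
    have WV: "W = ell2_push j S ` V"
      unfolding V_def image_image using WE by (simp add: ell2_push_pull subset_iff cong: image_cong)
    have VE: "V \<subseteq> ell2 S" unfolding V_def using WE ell2_pull_in by auto
    have VW: "\<xi> \<in> V \<Longrightarrow> ell2_push j S \<xi> \<in> W" for \<xi> using WV by blast
    have mem: "\<xi> \<in> V" if "\<xi> \<in> ell2 S" "ell2_push j S \<xi> \<in> W" for \<xi>
      unfolding V_def by (rule image_eqI[OF _ that(2)]) (simp add: ell2_pull_push that(1))
    have "closed_subspace S V"
      unfolding closed_subspace_def
    proof (intro conjI ballI allI impI)
      show "(\<lambda>_. 0) \<in> V" by (rule mem) (use W in \<open>auto simp: closed_subspace_def ell2_push_linear\<close>)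
    next
      fix \<xi> \<eta> assume "\<xi> \<in> V" "\<eta> \<in> V"
      then show "(\<lambda>i. \<xi> i + \<eta> i) \<in> V"
        using VE VW W by (intro mem) (auto simp: closed_subspace_def ell2_push_linear)
    next
      fix c \<xi> assume "\<xi> \<in> V"
      then show "(\<lambda>i. c * \<xi> i) \<in> V"
        using VE VW W by (intro mem) (auto simp: closed_subspace_def ell2_push_linear)
    next
      fix u \<xi> assume x: "\<xi> \<in> ell2 S" and u: "\<forall>n::nat. u n \<in> V"
        and lim: "(\<lambda>n. ell2_norm S (\<lambda>i. u n i - \<xi> i)) \<longlonglongrightarrow> 0"
      have "ell2_norm (j ` S) (\<lambda>i. ell2_push j S (u n) i - ell2_push j S \<xi> i)
          = ell2_norm S (\<lambda>i. u n i - \<xi> i)" for n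
        using ell2_push_norm[of "\<lambda>i. u n i - \<xi> i"] u VE x by (auto simp: ell2_push_linear)
      then have "(\<lambda>n. ell2_norm (j ` S) (\<lambda>i. ell2_push j S (u n) i - ell2_push j S \<xi> i)) \<longlonglongrightarrow> 0"
        using lim by simp
      moreover have "\<forall>n. ell2_push j S (u n) \<in> W" using u VW by blast
      ultimately have "ell2_push j S \<xi> \<in> W"
        by (intro closed_subspace_limit[OF W ell2_push_in[OF x], where u = "\<lambda>n. ell2_push j S (u n)"]) auto
      then show "\<xi> \<in> V" by (rule mem[OF x])
    qed (use VE in auto)
    moreover have "\<forall>a\<in>elems A. \<forall>\<xi>\<in>V. \<rho> a \<xi> \<in> V"
    proof (intro ballI)
      fix a \<xi> assume a: "a \<in> elems A" and x: "\<xi> \<in> V"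
      have "push_rep \<rho> a (ell2_push j S \<xi>) \<in> W" using inv a VW[OF x] by blast
      then show "\<rho> a \<xi> \<in> V"
        using x VE by (intro mem star_repD(2)[OF \<rho> a]) (auto simp: push_rep_def ell2_pull_push subset_iff)
    qed
    ultimately have "V = {\<lambda>_. 0} \<or> V = ell2 S" using irr unfolding irreducible_rep_def by blast
    then show ?thesis
    proof
      assume "V = {\<lambda>_. 0}"
      then show ?thesis unfolding WV by (simp add: ell2_push_linear)
    next
      assume V: "V = ell2 S"
      have "ell2 (j ` S) \<subseteq> W"
      proof
        fix \<xi> assume x: "\<xi> \<in> ell2 (j ` S)"
        show "\<xi> \<in> W" unfolding WV V
          by (rule image_eqI[OF _ ell2_pull_in[OF x]]) (simp add: ell2_push_pull[OF x])
      qed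
      then show ?thesis using WE by blast
    qed
  qed
  then show ?thesis
    using irr push_rep_star_rep[OF \<rho> st] push_rep_ker[OF \<rho>] unfolding irreducible_rep_def by simp
qed

end

section \<open>The universal seminorm\<close>

text \<open>
  A *-algebra in which every element has a bound common to all representations. The completion
  sees elements only through the seminorm, hence through their representations, where the
  algebraic laws are those of operators.
\<close>

locale bounded_star_algebra =
  fixes A :: "'a star_algebra"
  assumes nonempty: "elems A \<noteq> {}"
    and add_closed: "a \<in> elems A \<Longrightarrow> b \<in> elems A \<Longrightarrow> add A a b \<in> elems A"
    and smul_closed: "a \<in> elems A \<Longrightarrow> smul A c a \<in> elems A"
    and mul_closed: "a \<in> elems A \<Longrightarrow> b \<in> elems A \<Longrightarrow> mul A a b \<in> elems A"
    and star_closed: "a \<in> elems A \<Longrightarrow> star A a \<in> elems A"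
    and bounded_reps: "a \<in> elems A \<Longrightarrow> \<exists>B. \<forall>(S :: 'a set) \<rho>. star_rep A S \<rho> \<longrightarrow>
          (\<forall>\<xi>\<in>ell2 S. ell2_norm S (\<rho> a \<xi>) \<le> B * ell2_norm S \<xi>)"
begin

abbreviation N :: "'a \<Rightarrow> real" where "N \<equiv> universal_seminorm A"
abbreviation D :: "'a \<Rightarrow> 'a \<Rightarrow> real" where "D \<equiv> universal_dist A"

definition sub :: "'a \<Rightarrow> 'a \<Rightarrow> 'a" where "sub a b = add A a (smul A (-1) b)"

lemma sub_closed: "a \<in> elems A \<Longrightarrow> b \<in> elems A \<Longrightarrow> sub a b \<in> elems A"
  by (simp add: sub_def add_closed smul_closed)

lemma D_sub: "D a b = N (sub a b)"
  by (simp add: universal_dist_def sub_def)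

lemma rep_sub:
  assumes "star_rep A S \<rho>" "a \<in> elems A" "b \<in> elems A" "\<xi> \<in> ell2 S"
  shows "\<rho> (sub a b) \<xi> = (\<lambda>i. \<rho> a \<xi> i - \<rho> b \<xi> i)"
  using assms by (simp add: sub_def star_repD smul_closed)

text \<open>
  The representation on the zero space makes the supremum in the universal seminorm one over a
  nonempty set.
\<close>

lemma zero_rep: "star_rep A ({} :: 'a set) (\<lambda>_ _ _. 0)"
proof -
  have "ell2 ({} :: 'a set) = {\<lambda>_. 0}" by (auto simp: ell2_def)
  then show ?thesis by (simp add: star_rep_def bounded_operator_def)
qed

lemma reps_bdd_above:
  assumes a: "a \<in> elems A"
  shows "bdd_above {op_norm S (\<rho> a) | (S :: 'a set) \<rho>. star_rep A S \<rho>}"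
proof -
  obtain B where B: "\<forall>(S :: 'a set) \<rho>. star_rep A S \<rho> \<longrightarrow>
          (\<forall>\<xi>\<in>ell2 S. ell2_norm S (\<rho> a \<xi>) \<le> B * ell2_norm S \<xi>)"
    using bounded_reps[OF a] by blast
  show ?thesis
  proof (rule bdd_aboveI[of _ "max B 0"], clarify)
    fix S :: "'a set" and \<rho> assume r: "star_rep A S \<rho>"
    show "op_norm S (\<rho> a) \<le> max B 0"
    proof (rule op_norm_le)
      fix \<xi> assume "\<xi> \<in> ell2 S"
      then have "ell2_norm S (\<rho> a \<xi>) \<le> B * ell2_norm S \<xi>" using B r by simp
      also have "\<dots> \<le> max B 0 * ell2_norm S \<xi>" by (rule mult_right_mono) auto
      finally show "ell2_norm S (\<rho> a \<xi>) \<le> max B 0 * ell2_norm S \<xi>" .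
    qed simp
  qed
qed

lemma op_norm_le_N:
  fixes S :: "'a set"
  assumes "star_rep A S \<rho>" and "a \<in> elems A"
  shows "op_norm S (\<rho> a) \<le> N a"
  unfolding universal_seminorm_def
  by (rule cSup_upper[OF _ reps_bdd_above[OF assms(2)]]) (use assms in auto)

lemma rep_le_N:
  fixes S :: "'a set"
  assumes \<rho>: "star_rep A S \<rho>" and a: "a \<in> elems A" and x: "\<xi> \<in> ell2 S"
  shows "ell2_norm S (\<rho> a \<xi>) \<le> N a * ell2_norm S \<xi>"
  using op_norm_bound[OF star_repD(1)[OF \<rho> a] x]
    mult_right_mono[OF op_norm_le_N[OF \<rho> a] ell2_norm_nonneg, of S \<xi>] by linarith

lemma N_le:
  assumes "0 \<le> B"
    and "\<And>(S :: 'a set) \<rho> \<xi>. star_rep A S \<rho> \<Longrightarrow> \<xi> \<in> ell2 S \<Longrightarrow> ell2_norm S (\<rho> a \<xi>) \<le> B * ell2_norm S \<xi>"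
  shows "N a \<le> B"
  unfolding universal_seminorm_def
proof (rule cSup_least)
  show "{op_norm S (\<rho> a) | (S :: 'a set) \<rho>. star_rep A S \<rho>} \<noteq> {}"
    using zero_rep by auto
qed (use assms in \<open>auto intro!: op_norm_le\<close>)

lemma N_nonneg:
  assumes "a \<in> elems A" shows "0 \<le> N a"
proof -
  have "{ell2_norm ({} :: 'a set) (\<lambda>_. 0) | \<xi>. \<xi> \<in> ell2 ({} :: 'a set) \<and> ell2_norm {} \<xi> \<le> 1} = {0}"
    by (auto intro: exI[of _ "\<lambda>_. 0"])
  then show ?thesis using op_norm_le_N[OF zero_rep assms] by (simp add: op_norm_def)
qed

lemma N_mono:
  assumes "b \<in> elems A" "0 \<le> c"
    and "\<And>(S :: 'a set) \<rho> \<xi>. star_rep A S \<rho> \<Longrightarrow> \<xi> \<in> ell2 S \<Longrightarrow> ell2_norm S (\<rho> a \<xi>) \<le> c * ell2_norm S (\<rho> b \<xi>)"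
  shows "N a \<le> c * N b"
proof (rule N_le)
  fix S :: "'a set" and \<rho> \<xi> assume r: "star_rep A S \<rho>" "\<xi> \<in> ell2 S"
  have "ell2_norm S (\<rho> a \<xi>) \<le> c * ell2_norm S (\<rho> b \<xi>)" by (rule assms(3)[OF r])
  also have "\<dots> \<le> c * (N b * ell2_norm S \<xi>)" by (intro mult_left_mono rep_le_N r assms)
  finally show "ell2_norm S (\<rho> a \<xi>) \<le> c * N b * ell2_norm S \<xi>" by (simp add: mult_ac)
qed (simp add: N_nonneg assms)

lemma N_add:
  assumes "a \<in> elems A" "b \<in> elems A"
  shows "N (add A a b) \<le> N a + N b"
proof (rule N_le)
  fix S :: "'a set" and \<rho> \<xi> assume r: "star_rep A S \<rho>" "\<xi> \<in> ell2 S"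
  have "ell2_norm S (\<rho> (add A a b) \<xi>) \<le> ell2_norm S (\<rho> a \<xi>) + ell2_norm S (\<rho> b \<xi>)"
    unfolding star_repD(3)[OF r(1) assms r(2)]
    by (rule ell2_norm_triangle; rule star_repD(2)[OF r(1) _ r(2)]; rule assms)
  also have "\<dots> \<le> N a * ell2_norm S \<xi> + N b * ell2_norm S \<xi>"
    by (intro add_mono rep_le_N r assms)
  finally show "ell2_norm S (\<rho> (add A a b) \<xi>) \<le> (N a + N b) * ell2_norm S \<xi>" by (simp add: distrib_right)
qed (simp add: N_nonneg assms)

lemma N_smul: "a \<in> elems A \<Longrightarrow> N (smul A c a) \<le> cmod c * N a"
  by (rule N_mono) (simp_all add: star_repD(4) ell2_norm_scale)

lemma N_mul:
  assumes "a \<in> elems A" "b \<in> elems A"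
  shows "N (mul A a b) \<le> N a * N b"
  by (rule N_mono) (simp_all add: N_nonneg assms star_repD(2,5) rep_le_N)

lemma N_star:
  assumes "a \<in> elems A" shows "N (star A a) \<le> N a"
proof (rule N_le[OF N_nonneg[OF assms]])
  fix S :: "'a set" and \<rho> \<xi> assume r: "star_rep A S \<rho>" "\<xi> \<in> ell2 S"
  show "ell2_norm S (\<rho> (star A a) \<xi>) \<le> N a * ell2_norm S \<xi>"
    by (rule star_rep_star_bound[OF r(1) assms star_closed[OF assms] N_nonneg[OF assms] _ r(2)])
      (rule rep_le_N[OF r(1) assms])
qed

text \<open>
  All properties of the distance are read off in representations: there, elements become operators
  and identities of a *-algebra hold.
\<close>

lemma D_le_by_rep:
  assumes "a \<in> elems A" "b \<in> elems A" "0 \<le> B"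
    and "\<And>(S :: 'a set) \<rho> \<xi>. star_rep A S \<rho> \<Longrightarrow> \<xi> \<in> ell2 S
      \<Longrightarrow> ell2_norm S (\<lambda>i. \<rho> a \<xi> i - \<rho> b \<xi> i) \<le> B * ell2_norm S \<xi>"
  shows "D a b \<le> B"
  unfolding D_sub by (rule N_le[OF assms(3)]) (simp add: rep_sub assms)

lemma rep_le_D:
  fixes S :: "'a set"
  assumes "star_rep A S \<rho>" "a \<in> elems A" "b \<in> elems A" "\<xi> \<in> ell2 S"
  shows "ell2_norm S (\<lambda>i. \<rho> a \<xi> i - \<rho> b \<xi> i) \<le> D a b * ell2_norm S \<xi>"
  using rep_le_N[OF assms(1) sub_closed[OF assms(2,3)] assms(4)] by (simp add: rep_sub[OF assms] D_sub)

lemma D_nonneg: "a \<in> elems A \<Longrightarrow> b \<in> elems A \<Longrightarrow> 0 \<le> D a b"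
  by (simp add: D_sub N_nonneg sub_closed)

lemma D_refl: "a \<in> elems A \<Longrightarrow> D a a = 0"
  using D_le_by_rep[of a a 0] D_nonneg[of a a] by simp

lemma D_sym_le: "a \<in> elems A \<Longrightarrow> b \<in> elems A \<Longrightarrow> D a b \<le> D b a"
  by (rule D_le_by_rep) (simp_all add: D_nonneg ell2_norm_minus[of _ "_ a _"] rep_le_D)

lemma D_sym: "a \<in> elems A \<Longrightarrow> b \<in> elems A \<Longrightarrow> D a b = D b a"
  by (intro antisym D_sym_le)

lemma D_triangle:
  assumes "a \<in> elems A" "b \<in> elems A" "c \<in> elems A"
  shows "D a c \<le> D a b + D b c"
proof (rule D_le_by_rep)
  fix S :: "'a set" and \<rho> \<xi> assume r: "star_rep A S \<rho>" "\<xi> \<in> ell2 S"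
  have "ell2_norm S (\<lambda>i. \<rho> a \<xi> i - \<rho> c \<xi> i)
      \<le> ell2_norm S (\<lambda>i. \<rho> a \<xi> i - \<rho> b \<xi> i) + ell2_norm S (\<lambda>i. \<rho> b \<xi> i - \<rho> c \<xi> i)"
    by (intro ell2_norm_diff_triangle star_repD(2)[OF r(1)] assms r)
  also have "\<dots> \<le> D a b * ell2_norm S \<xi> + D b c * ell2_norm S \<xi>"
    by (intro add_mono rep_le_D r assms)
  finally show "ell2_norm S (\<lambda>i. \<rho> a \<xi> i - \<rho> c \<xi> i) \<le> (D a b + D b c) * ell2_norm S \<xi>"
    by (simp add: distrib_right)
qed (simp_all add: D_nonneg assms)

lemma D_add:
  assumes "a \<in> elems A" "b \<in> elems A" "a' \<in> elems A" "b' \<in> elems A"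
  shows "D (add A a b) (add A a' b') \<le> D a a' + D b b'"
proof (rule D_le_by_rep)
  fix S :: "'a set" and \<rho> \<xi> assume r: "star_rep A S \<rho>" "\<xi> \<in> ell2 S"
  note m = star_repD(2)[OF r(1) _ r(2)]
  have "ell2_norm S (\<lambda>i. (\<rho> a \<xi> i - \<rho> a' \<xi> i) + (\<rho> b \<xi> i - \<rho> b' \<xi> i))
      \<le> ell2_norm S (\<lambda>i. \<rho> a \<xi> i - \<rho> a' \<xi> i) + ell2_norm S (\<lambda>i. \<rho> b \<xi> i - \<rho> b' \<xi> i)"
    by (intro ell2_norm_triangle ell2_diff m assms)
  also have "\<dots> \<le> D a a' * ell2_norm S \<xi> + D b b' * ell2_norm S \<xi>"
    by (intro add_mono rep_le_D r assms)
  finally show "ell2_norm S (\<lambda>i. \<rho> (add A a b) \<xi> i - \<rho> (add A a' b') \<xi> i) \<le> (D a a' + D b b') * ell2_norm S \<xi>"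
    by (simp add: distrib_right star_repD(3)[OF r(1)] assms r algebra_simps)
qed (simp_all add: D_nonneg assms add_closed)

lemma D_smul:
  assumes "a \<in> elems A" "b \<in> elems A"
  shows "D (smul A c a) (smul A c b) \<le> cmod c * D a b"
proof (rule D_le_by_rep)
  fix S :: "'a set" and \<rho> \<xi> assume r: "star_rep A S \<rho>" "\<xi> \<in> ell2 S"
  have "cmod c * ell2_norm S (\<lambda>i. \<rho> a \<xi> i - \<rho> b \<xi> i) \<le> cmod c * (D a b * ell2_norm S \<xi>)"
    by (intro mult_left_mono rep_le_D r assms) simp
  then show "ell2_norm S (\<lambda>i. \<rho> (smul A c a) \<xi> i - \<rho> (smul A c b) \<xi> i) \<le> cmod c * D a b * ell2_norm S \<xi>"
    by (simp add: star_repD(4)[OF r(1)] assms r ell2_norm_scale mult.assoc flip: right_diff_distrib)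
qed (simp_all add: D_nonneg assms smul_closed)

lemma D_mul:
  assumes "a \<in> elems A" "b \<in> elems A" "a' \<in> elems A" "b' \<in> elems A"
  shows "D (mul A a b) (mul A a' b') \<le> N a * D b b' + D a a' * N b'"
proof (rule D_le_by_rep)
  fix S :: "'a set" and \<rho> \<xi> assume r: "star_rep A S \<rho>" "\<xi> \<in> ell2 S"
  note m = star_repD(2)[OF r(1)]
  have eq: "\<rho> a (\<lambda>i. \<rho> b \<xi> i - \<rho> b' \<xi> i) = (\<lambda>i. \<rho> a (\<rho> b \<xi>) i - \<rho> a (\<rho> b' \<xi>) i)"
    by (rule bounded_operator_diff[OF star_repD(1)[OF r(1)]]) (intro m assms r)+
  have "ell2_norm S (\<lambda>i. \<rho> a (\<rho> b \<xi>) i - \<rho> a' (\<rho> b' \<xi>) i)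
      \<le> ell2_norm S (\<lambda>i. \<rho> a (\<rho> b \<xi>) i - \<rho> a (\<rho> b' \<xi>) i) + ell2_norm S (\<lambda>i. \<rho> a (\<rho> b' \<xi>) i - \<rho> a' (\<rho> b' \<xi>) i)"
    by (intro ell2_norm_diff_triangle m assms r)
  also have "\<dots> \<le> N a * ell2_norm S (\<lambda>i. \<rho> b \<xi> i - \<rho> b' \<xi> i) + D a a' * ell2_norm S (\<rho> b' \<xi>)"
    unfolding eq[symmetric] by (intro add_mono rep_le_D rep_le_N r assms m ell2_diff)
  also have "\<dots> \<le> N a * (D b b' * ell2_norm S \<xi>) + D a a' * (N b' * ell2_norm S \<xi>)"
    by (intro add_mono mult_left_mono rep_le_D rep_le_N r assms D_nonneg N_nonneg)
  finally show "ell2_norm S (\<lambda>i. \<rho> (mul A a b) \<xi> i - \<rho> (mul A a' b') \<xi> i)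
      \<le> (N a * D b b' + D a a' * N b') * ell2_norm S \<xi>"
    by (simp add: star_repD(5)[OF r(1)] assms r algebra_simps)
qed (simp_all add: D_nonneg N_nonneg assms mul_closed)

lemma D_star:
  assumes "a \<in> elems A" "b \<in> elems A"
  shows "D (star A a) (star A b) \<le> D a b"
proof (rule D_le_by_rep)
  fix S :: "'a set" and \<rho> \<xi> assume r: "star_rep A S \<rho>" "\<xi> \<in> ell2 S"
  note m = star_repD(2)[OF r(1)]
  let ?\<zeta> = "\<lambda>i. \<rho> (star A a) \<xi> i - \<rho> (star A b) \<xi> i"
  have z: "?\<zeta> \<in> ell2 S" by (intro ell2_diff m assms r star_closed)
  have "ell2_inner S ?\<zeta> ?\<zeta> = ell2_inner S (\<rho> (star A a) \<xi>) ?\<zeta> - ell2_inner S (\<rho> (star A b) \<xi>) ?\<zeta>"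
    by (rule ell2_inner_diff_left[OF _ _ z]) (intro m assms r star_closed)+
  also have "\<dots> = ell2_inner S \<xi> (\<rho> a ?\<zeta>) - ell2_inner S \<xi> (\<rho> b ?\<zeta>)"
    by (simp add: star_repD(6)[OF r(1)] assms r z)
  also have "\<dots> = ell2_inner S \<xi> (\<lambda>i. \<rho> a ?\<zeta> i - \<rho> b ?\<zeta> i)"
    by (rule ell2_inner_diff_right[symmetric]) (intro m assms r z)+
  finally have "cmod (ell2_inner S ?\<zeta> ?\<zeta>) \<le> ell2_norm S \<xi> * ell2_norm S (\<lambda>i. \<rho> a ?\<zeta> i - \<rho> b ?\<zeta> i)"
    using ell2_Cauchy_Schwarz[OF r(2) ell2_diff[OF m m], of a ?\<zeta> b ?\<zeta>] assms z by simp
  also have "\<dots> \<le> ell2_norm S \<xi> * (D a b * ell2_norm S ?\<zeta>)"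
    by (intro mult_left_mono rep_le_D r assms z) simp
  finally show "ell2_norm S ?\<zeta> \<le> D a b * ell2_norm S \<xi>"
    by (intro ell2_norm_le_by_inner[OF z]) (simp_all add: mult_ac D_nonneg assms)
qed (simp_all add: D_nonneg assms star_closed)

lemma N_diff_le:
  assumes "a \<in> elems A" "b \<in> elems A" shows "N a \<le> D a b + N b"
proof (rule N_le)
  fix S :: "'a set" and \<rho> \<xi> assume r: "star_rep A S \<rho>" "\<xi> \<in> ell2 S"
  note m = star_repD(2)[OF r(1) _ r(2)]
  have "ell2_norm S (\<rho> a \<xi>) \<le> ell2_norm S (\<lambda>i. \<rho> a \<xi> i - \<rho> b \<xi> i) + ell2_norm S (\<rho> b \<xi>)"
    using ell2_norm_triangle[OF ell2_diff[OF m m] m, of a b b] assms by simp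
  also have "\<dots> \<le> D a b * ell2_norm S \<xi> + N b * ell2_norm S \<xi>"
    by (intro add_mono rep_le_D rep_le_N r assms)
  finally show "ell2_norm S (\<rho> a \<xi>) \<le> (D a b + N b) * ell2_norm S \<xi>" by (simp add: distrib_right)
qed (simp add: D_nonneg N_nonneg assms)

end

section \<open>The enveloping C*-algebra\<close>

definition ell2_conv :: "'i set \<Rightarrow> (nat \<Rightarrow> 'i \<Rightarrow> complex) \<Rightarrow> ('i \<Rightarrow> complex) \<Rightarrow> bool" where
  "ell2_conv S x a \<longleftrightarrow> (\<forall>n. x n \<in> ell2 S) \<and> a \<in> ell2 S \<and> (\<lambda>n. ell2_norm S (\<lambda>i. x n i - a i)) \<longlonglongrightarrow> 0"

lemma ell2_convD:
  assumes "ell2_conv S x a"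
  shows "x n \<in> ell2 S" "a \<in> ell2 S" "(\<lambda>n. ell2_norm S (\<lambda>i. x n i - a i)) \<longlonglongrightarrow> 0"
  using assms by (auto simp: ell2_conv_def)

lemma ell2_convI:
  assumes "\<And>n. x n \<in> ell2 S" "a \<in> ell2 S"
    and "\<And>n. ell2_norm S (\<lambda>i. x n i - a i) \<le> f n" "f \<longlonglongrightarrow> 0"
  shows "ell2_conv S x a"
  unfolding ell2_conv_def
proof (intro conjI allI assms)
  show "(\<lambda>n. ell2_norm S (\<lambda>i. x n i - a i)) \<longlonglongrightarrow> 0"
    by (rule tendsto_sandwich[OF _ _ tendsto_const assms(4)]) (auto simp: assms(3))
qed

lemma ell2_conv_const: "a \<in> ell2 S \<Longrightarrow> ell2_conv S (\<lambda>_. a) a"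
  by (simp add: ell2_conv_def)

lemma ell2_conv_near:
  assumes "ell2_conv S x a" "\<And>n. y n \<in> ell2 S" "(\<lambda>n. ell2_norm S (\<lambda>i. y n i - x n i)) \<longlonglongrightarrow> 0"
  shows "ell2_conv S y a"
proof (rule ell2_convI[OF assms(2) ell2_convD(2)[OF assms(1)]])
  show "ell2_norm S (\<lambda>i. y n i - a i) \<le> ell2_norm S (\<lambda>i. y n i - x n i) + ell2_norm S (\<lambda>i. x n i - a i)" for n
    by (intro ell2_norm_diff_triangle assms ell2_convD[OF assms(1)])
  show "(\<lambda>n. ell2_norm S (\<lambda>i. y n i - x n i) + ell2_norm S (\<lambda>i. x n i - a i)) \<longlonglongrightarrow> 0"
    using tendsto_add[OF assms(3) ell2_convD(3)[OF assms(1)]] by simp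
qed

lemma ell2_conv_unique:
  assumes "ell2_conv S x a" "ell2_conv S x b" shows "a = b"
proof -
  note d = ell2_convD[OF assms(1)] ell2_convD[OF assms(2)]
  have "ell2_norm S (\<lambda>i. a i - b i) \<le> ell2_norm S (\<lambda>i. x n i - a i) + ell2_norm S (\<lambda>i. x n i - b i)" for n
    using ell2_norm_diff_triangle[OF d(2) d(1) d(5), of n] by (simp add: ell2_norm_minus[of S a])
  moreover have "(\<lambda>n. ell2_norm S (\<lambda>i. x n i - a i) + ell2_norm S (\<lambda>i. x n i - b i)) \<longlonglongrightarrow> 0"
    using tendsto_add[OF d(3) d(6)] by simp
  ultimately have "ell2_norm S (\<lambda>i. a i - b i) \<le> 0"
    by (intro tendsto_lowerbound[of _ 0 sequentially]) auto
  then have "(\<lambda>i. a i - b i) = (\<lambda>_. 0)"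
    by (intro ell2_norm_eq_0[OF ell2_diff[OF d(2) d(5)]] antisym) auto
  then show ?thesis by (metis (no_types) eq_iff_diff_eq_0 ext)
qed

lemma ell2_conv_add:
  assumes "ell2_conv S x a" "ell2_conv S y b"
  shows "ell2_conv S (\<lambda>n i. x n i + y n i) (\<lambda>i. a i + b i)"
proof -
  note d = ell2_convD[OF assms(1)] ell2_convD[OF assms(2)]
  show ?thesis
  proof (rule ell2_convI)
    show "ell2_norm S (\<lambda>i. x n i + y n i - (a i + b i))
        \<le> ell2_norm S (\<lambda>i. x n i - a i) + ell2_norm S (\<lambda>i. y n i - b i)" for n
      using ell2_norm_triangle[OF ell2_diff[OF d(1) d(2)] ell2_diff[OF d(4) d(5)], of n n]
      by (simp add: algebra_simps)
    show "(\<lambda>n. ell2_norm S (\<lambda>i. x n i - a i) + ell2_norm S (\<lambda>i. y n i - b i)) \<longlonglongrightarrow> 0"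
      using tendsto_add[OF d(3) d(6)] by simp
  qed (intro ell2_add d)+
qed

lemma ell2_conv_scale:
  assumes "ell2_conv S x a" shows "ell2_conv S (\<lambda>n i. c * x n i) (\<lambda>i. c * a i)"
proof (rule ell2_convI)
  show "ell2_norm S (\<lambda>i. c * x n i - c * a i) \<le> cmod c * ell2_norm S (\<lambda>i. x n i - a i)" for n
    by (simp add: ell2_norm_scale flip: right_diff_distrib)
  show "(\<lambda>n. cmod c * ell2_norm S (\<lambda>i. x n i - a i)) \<longlonglongrightarrow> 0"
    using tendsto_mult_left[OF ell2_convD(3)[OF assms], of "cmod c"] by simp
qed (intro ell2_scale ell2_convD[OF assms])+

lemma ell2_conv_norm_le:
  assumes "ell2_conv S x a" "\<And>n. ell2_norm S (x n) \<le> B" shows "ell2_norm S a \<le> B"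
proof -
  note d = ell2_convD[OF assms(1)]
  have "ell2_norm S a \<le> B + ell2_norm S (\<lambda>i. x n i - a i)" for n
    using ell2_norm_abs_diff[OF d(1) d(2), of n] assms(2)[of n] by linarith
  moreover have "(\<lambda>n. B + ell2_norm S (\<lambda>i. x n i - a i)) \<longlonglongrightarrow> B"
    using tendsto_add[OF tendsto_const d(3), of B] by simp
  ultimately show ?thesis by (intro tendsto_lowerbound[of _ B sequentially]) auto
qed

lemma ell2_conv_inner:
  assumes "ell2_conv S x a" "\<eta> \<in> ell2 S"
  shows "(\<lambda>n. ell2_inner S (x n) \<eta>) \<longlonglongrightarrow> ell2_inner S a \<eta>"
    and "(\<lambda>n. ell2_inner S \<eta> (x n)) \<longlonglongrightarrow> ell2_inner S \<eta> a"
proof -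
  note d = ell2_convD[OF assms(1)]
  have "(\<lambda>n. ell2_inner S (x n) \<eta> - ell2_inner S a \<eta>) \<longlonglongrightarrow> 0"
  proof (rule Lim_null_comparison)
    show "\<forall>\<^sub>F n in sequentially. norm (ell2_inner S (x n) \<eta> - ell2_inner S a \<eta>)
        \<le> ell2_norm S (\<lambda>i. x n i - a i) * ell2_norm S \<eta>"
      by (intro always_eventually allI)
        (simp add: ell2_inner_diff_left[OF d(1,2) assms(2), symmetric] ell2_Cauchy_Schwarz[OF ell2_diff[OF d(1,2)] assms(2)])
    show "(\<lambda>n. ell2_norm S (\<lambda>i. x n i - a i) * ell2_norm S \<eta>) \<longlonglongrightarrow> 0"
      using tendsto_mult_right[OF d(3), of "ell2_norm S \<eta>"] by simp
  qed
  then show *: "(\<lambda>n. ell2_inner S (x n) \<eta>) \<longlonglongrightarrow> ell2_inner S a \<eta>" by (rule LIM_zero_cancel)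
  show "(\<lambda>n. ell2_inner S \<eta> (x n)) \<longlonglongrightarrow> ell2_inner S \<eta> a"
    using tendsto_cnj[OF *] by (simp add: ell2_inner_cnj)
qed

context bounded_star_algebra
begin

abbreviation E :: "(nat \<Rightarrow> 'a) set star_algebra" where "E \<equiv> enveloping_cstar A"

definition cls :: "(nat \<Rightarrow> 'a) \<Rightarrow> (nat \<Rightarrow> 'a) set" where "cls u = null_rel A `` {u}"

lemma cauchy_elem: "u \<in> cauchy_seqs A \<Longrightarrow> u n \<in> elems A"
  by (simp add: cauchy_seqs_def)

lemma cauchy_seqsD:
  "u \<in> cauchy_seqs A \<Longrightarrow> e > 0 \<Longrightarrow> \<exists>M. \<forall>m\<ge>M. \<forall>n\<ge>M. D (u m) (u n) < e"
  unfolding cauchy_seqs_def by blast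

text \<open>
  Two sequences on the right, because the operations of the algebra have up to two arguments.
\<close>

lemma cauchy_by_bound:
  assumes "\<And>n. w n \<in> elems A" "u \<in> cauchy_seqs A" "v \<in> cauchy_seqs A" "0 \<le> K"
    and "\<And>m n. D (w m) (w n) \<le> K * (D (u m) (u n) + D (v m) (v n))"
  shows "w \<in> cauchy_seqs A"
  unfolding cauchy_seqs_def
proof (intro CollectI conjI allI impI assms(1))
  fix e :: real assume "e > 0"
  then have e: "e / (2 * (K + 1)) > 0" using assms(4) by simp
  obtain M1 where M1: "\<forall>m\<ge>M1. \<forall>n\<ge>M1. D (u m) (u n) < e / (2 * (K + 1))"
    using cauchy_seqsD[OF assms(2) e] by auto
  obtain M2 where M2: "\<forall>m\<ge>M2. \<forall>n\<ge>M2. D (v m) (v n) < e / (2 * (K + 1))"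
    using cauchy_seqsD[OF assms(3) e] by auto
  have "D (w m) (w n) < e" if "m \<ge> max M1 M2" "n \<ge> max M1 M2" for m n
  proof -
    have "D (u m) (u n) < e / (2 * (K + 1))" "D (v m) (v n) < e / (2 * (K + 1))"
      using M1 M2 that by simp_all
    then have h: "D (u m) (u n) + D (v m) (v n) \<le> 2 * (e / (2 * (K + 1)))" by linarith
    have "D (w m) (w n) \<le> K * (2 * (e / (2 * (K + 1))))"
      by (rule order_trans[OF assms(5) mult_left_mono[OF h assms(4)]])
    also have "\<dots> = K * (e / (K + 1))" using assms(4) by (simp add: field_simps)
    also have "\<dots> < e" using \<open>e > 0\<close> assms(4) by (simp add: field_simps)
    finally show ?thesis .
  qed
  then show "\<exists>M. \<forall>m\<ge>M. \<forall>n\<ge>M. D (w m) (w n) < e" by blast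
qed

lemma cauchy_bounded:
  assumes u: "u \<in> cauchy_seqs A"
  shows "\<exists>K\<ge>0. \<forall>n. N (u n) \<le> K"
proof -
  note el = cauchy_elem[OF u]
  obtain M where M: "\<forall>m\<ge>M. \<forall>n\<ge>M. D (u m) (u n) < 1" using cauchy_seqsD[OF u, of 1] by auto
  have s: "N (u n) \<le> (\<Sum>n\<le>M. N (u n))" if "n \<le> M" for n
    by (rule member_le_sum) (use that el N_nonneg in auto)
  show ?thesis
  proof (intro exI[of _ "1 + (\<Sum>n\<le>M. N (u n))"] conjI allI)
    fix n
    show "N (u n) \<le> 1 + (\<Sum>n\<le>M. N (u n))"
    proof (cases "n \<le> M")
      case True
      then show ?thesis using s by fastforce
    next
      case False
      then have "D (u n) (u M) < 1" using M by simp
      then show ?thesis using N_diff_le[OF el el, of n M] s[of M] by simp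
    qed
    show "0 \<le> 1 + (\<Sum>n\<le>M. N (u n))"
      by (intro add_nonneg_nonneg sum_nonneg N_nonneg el) simp
  qed
qed

lemma null_rel_iff:
  "(u, v) \<in> null_rel A \<longleftrightarrow> u \<in> cauchy_seqs A \<and> v \<in> cauchy_seqs A \<and> (\<lambda>n. D (u n) (v n)) \<longlonglongrightarrow> 0"
  by (simp add: null_rel_def)

lemma null_by_bound:
  assumes "w \<in> cauchy_seqs A" "w' \<in> cauchy_seqs A" "f \<longlonglongrightarrow> 0" "\<And>n. D (w n) (w' n) \<le> f n"
  shows "(w, w') \<in> null_rel A"
  unfolding null_rel_iff
proof (intro conjI assms)
  show "(\<lambda>n. D (w n) (w' n)) \<longlonglongrightarrow> 0"
    by (rule tendsto_sandwich[OF _ _ tendsto_const assms(3)])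
      (auto simp: assms(4) D_nonneg cauchy_elem assms(1,2))
qed

lemma equiv_null_rel: "equiv (cauchy_seqs A) (null_rel A)"
proof (rule equivI)
  show "null_rel A \<subseteq> cauchy_seqs A \<times> cauchy_seqs A" by (auto simp: null_rel_def)
  show "refl_on (cauchy_seqs A) (null_rel A)"
    by (auto simp: refl_on_def null_rel_iff D_refl cauchy_elem)
  show "sym (null_rel A)"
  proof (rule symI)
    fix u v assume *: "(u, v) \<in> null_rel A"
    then have "D (v n) (u n) = D (u n) (v n)" for n
      by (intro D_sym) (auto simp: null_rel_iff cauchy_elem)
    then show "(v, u) \<in> null_rel A" using * by (simp add: null_rel_iff)
  qed
  show "trans (null_rel A)"
  proof (rule transI)
    fix u v w assume *: "(u, v) \<in> null_rel A" "(v, w) \<in> null_rel A"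
    then have "(\<lambda>n. D (u n) (v n) + D (v n) (w n)) \<longlonglongrightarrow> 0"
      by (auto simp: null_rel_iff intro: tendsto_add_zero)
    then show "(u, w) \<in> null_rel A"
      by (rule null_by_bound[rotated 2]) (use * in \<open>auto simp: null_rel_iff cauchy_elem intro!: D_triangle\<close>)
  qed
qed

lemma cls_eq: "(u, v) \<in> null_rel A \<Longrightarrow> cls u = cls v"
  unfolding cls_def by (rule equiv_class_eq[OF equiv_null_rel])

lemma cls_mem: "v \<in> cls u \<longleftrightarrow> (u, v) \<in> null_rel A"
  by (simp add: cls_def)

lemma cls_self: "u \<in> cauchy_seqs A \<Longrightarrow> u \<in> cls u"
  by (simp add: cls_mem null_rel_iff D_refl cauchy_elem)

lemma cls_elem: "u \<in> cauchy_seqs A \<Longrightarrow> cls u \<in> elems E"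
  by (simp add: enveloping_cstar_def cls_def quotientI)

lemma elems_E:
  assumes "P \<in> elems E" obtains u where "u \<in> cauchy_seqs A" "P = cls u"
  using assms by (auto simp: enveloping_cstar_def cls_def elim!: quotientE)

lemma const_cauchy: "a \<in> elems A \<Longrightarrow> (\<lambda>_. a) \<in> cauchy_seqs A"
  by (simp add: cauchy_seqs_def D_refl)

lemma embed_cls: "enveloping_embed A a = cls (\<lambda>_. a)"
  by (simp add: enveloping_embed_def cls_def)

lemma cauchy_add:
  assumes "u \<in> cauchy_seqs A" "v \<in> cauchy_seqs A"
  shows "(\<lambda>n. add A (u n) (v n)) \<in> cauchy_seqs A"
  by (rule cauchy_by_bound[OF _ assms, of _ 1]) (auto simp: add_closed cauchy_elem assms intro!: D_add)

lemma cauchy_smul: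
  assumes "u \<in> cauchy_seqs A" shows "(\<lambda>n. smul A c (u n)) \<in> cauchy_seqs A"
proof (rule cauchy_by_bound[OF _ assms assms, of _ "cmod c"])
  fix m n
  have "D (smul A c (u m)) (smul A c (u n)) \<le> cmod c * D (u m) (u n)"
    by (rule D_smul) (intro cauchy_elem assms)+
  also have "\<dots> \<le> cmod c * (D (u m) (u n) + D (u m) (u n))"
    by (rule mult_left_mono) (simp_all add: D_nonneg cauchy_elem assms)
  finally show "D (smul A c (u m)) (smul A c (u n)) \<le> cmod c * (D (u m) (u n) + D (u m) (u n))" .
qed (simp_all add: smul_closed cauchy_elem assms)

lemma cauchy_star:
  assumes "u \<in> cauchy_seqs A" shows "(\<lambda>n. star A (u n)) \<in> cauchy_seqs A"
proof (rule cauchy_by_bound[OF _ assms assms, of _ 1])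
  fix m n
  have "D (star A (u m)) (star A (u n)) \<le> D (u m) (u n)"
    by (rule D_star) (intro cauchy_elem assms)+
  then show "D (star A (u m)) (star A (u n)) \<le> 1 * (D (u m) (u n) + D (u m) (u n))"
    using D_nonneg[of "u m" "u n"] by (simp add: cauchy_elem assms)
qed (simp_all add: star_closed cauchy_elem assms)

lemma cauchy_mul:
  assumes u: "u \<in> cauchy_seqs A" and v: "v \<in> cauchy_seqs A"
  shows "(\<lambda>n. mul A (u n) (v n)) \<in> cauchy_seqs A"
proof -
  obtain K1 where K1: "0 \<le> K1" "\<And>n. N (u n) \<le> K1" using cauchy_bounded[OF u] by auto
  obtain K2 where K2: "0 \<le> K2" "\<And>n. N (v n) \<le> K2" using cauchy_bounded[OF v] by auto
  show ?thesis
  proof (rule cauchy_by_bound[OF _ u v, of _ "K1 + K2"])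
    fix m n
    have nn: "0 \<le> D (u m) (u n)" "0 \<le> D (v m) (v n)" by (simp_all add: D_nonneg cauchy_elem u v)
    have "D (mul A (u m) (v m)) (mul A (u n) (v n)) \<le> N (u m) * D (v m) (v n) + D (u m) (u n) * N (v n)"
      by (rule D_mul) (intro cauchy_elem u v)+
    also have "\<dots> \<le> K1 * D (v m) (v n) + D (u m) (u n) * K2"
      by (intro add_mono mult_right_mono mult_left_mono nn K1 K2)
    also have "\<dots> \<le> (K1 + K2) * (D (u m) (u n) + D (v m) (v n))"
      using nn K1(1) K2(1) by (simp add: algebra_simps)
    finally show "D (mul A (u m) (v m)) (mul A (u n) (v n)) \<le> (K1 + K2) * (D (u m) (u n) + D (v m) (v n))" .
  qed (use K1 K2 in \<open>simp_all add: mul_closed cauchy_elem u v\<close>)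
qed

lemma E_add:
  assumes "u \<in> cauchy_seqs A" "v \<in> cauchy_seqs A"
  shows "add E (cls u) (cls v) = cls (\<lambda>n. add A (u n) (v n))"
proof -
  have c: "congruent2 (null_rel A) (null_rel A) (\<lambda>u v. null_rel A `` {\<lambda>n. add A (u n) (v n)})"
  proof (rule congruent2I', rule cls_eq[unfolded cls_def])
    fix u u' v v' assume uv: "(u, u') \<in> null_rel A" "(v, v') \<in> null_rel A"
    then have "(\<lambda>n. D (u n) (u' n) + D (v n) (v' n)) \<longlonglongrightarrow> 0"
      by (auto simp: null_rel_iff intro: tendsto_add_zero)
    then show "(\<lambda>n. add A (u n) (v n), \<lambda>n. add A (u' n) (v' n)) \<in> null_rel A"
      by (rule null_by_bound[rotated 2]) (use uv in \<open>auto simp: null_rel_iff cauchy_elem cauchy_add intro!: D_add\<close>)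
  qed
  show ?thesis
    using UN_equiv_class2[OF equiv_null_rel equiv_null_rel c assms] by (simp add: enveloping_cstar_def cls_def)
qed

lemma E_smul:
  assumes "u \<in> cauchy_seqs A"
  shows "smul E c (cls u) = cls (\<lambda>n. smul A c (u n))"
proof -
  have c: "congruent (null_rel A) (\<lambda>u. null_rel A `` {\<lambda>n. smul A c (u n)})"
  proof (rule congruentI, rule cls_eq[unfolded cls_def])
    fix u u' assume uv: "(u, u') \<in> null_rel A"
    then have "(\<lambda>n. cmod c * D (u n) (u' n)) \<longlonglongrightarrow> 0"
      by (auto simp: null_rel_iff intro: tendsto_mult_right_zero)
    then show "(\<lambda>n. smul A c (u n), \<lambda>n. smul A c (u' n)) \<in> null_rel A"
      by (rule null_by_bound[rotated 2]) (use uv in \<open>auto simp: null_rel_iff cauchy_elem cauchy_smul intro!: D_smul\<close>)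
  qed
  show ?thesis
    using UN_equiv_class[OF equiv_null_rel c assms] by (simp add: enveloping_cstar_def cls_def)
qed

lemma E_star:
  assumes "u \<in> cauchy_seqs A"
  shows "star E (cls u) = cls (\<lambda>n. star A (u n))"
proof -
  have c: "congruent (null_rel A) (\<lambda>u. null_rel A `` {\<lambda>n. star A (u n)})"
  proof (rule congruentI, rule cls_eq[unfolded cls_def])
    fix u u' assume uv: "(u, u') \<in> null_rel A"
    then have "(\<lambda>n. D (u n) (u' n)) \<longlonglongrightarrow> 0" by (simp add: null_rel_iff)
    then show "(\<lambda>n. star A (u n), \<lambda>n. star A (u' n)) \<in> null_rel A"
      by (rule null_by_bound[rotated 2]) (use uv in \<open>auto simp: null_rel_iff cauchy_elem cauchy_star intro!: D_star\<close>)
  qed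
  show ?thesis
    using UN_equiv_class[OF equiv_null_rel c assms] by (simp add: enveloping_cstar_def cls_def)
qed

lemma E_mul:
  assumes "u \<in> cauchy_seqs A" "v \<in> cauchy_seqs A"
  shows "mul E (cls u) (cls v) = cls (\<lambda>n. mul A (u n) (v n))"
proof -
  have c: "congruent2 (null_rel A) (null_rel A) (\<lambda>u v. null_rel A `` {\<lambda>n. mul A (u n) (v n)})"
  proof (rule congruent2I', rule cls_eq[unfolded cls_def])
    fix u u' v v' assume uv: "(u, u') \<in> null_rel A" "(v, v') \<in> null_rel A"
    then have mem: "u \<in> cauchy_seqs A" "u' \<in> cauchy_seqs A" "v \<in> cauchy_seqs A" "v' \<in> cauchy_seqs A"
      and lim: "(\<lambda>n. D (u n) (u' n)) \<longlonglongrightarrow> 0" "(\<lambda>n. D (v n) (v' n)) \<longlonglongrightarrow> 0"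
      by (auto simp: null_rel_iff)
    obtain K1 where K1: "0 \<le> K1" "\<And>n. N (u n) \<le> K1" using cauchy_bounded[OF mem(1)] by auto
    obtain K2 where K2: "0 \<le> K2" "\<And>n. N (v' n) \<le> K2" using cauchy_bounded[OF mem(4)] by auto
    have "(\<lambda>n. K1 * D (v n) (v' n) + D (u n) (u' n) * K2) \<longlonglongrightarrow> 0"
      by (intro tendsto_add_zero tendsto_mult_right_zero tendsto_mult_left_zero lim)
    then show "(\<lambda>n. mul A (u n) (v n), \<lambda>n. mul A (u' n) (v' n)) \<in> null_rel A"
    proof (rule null_by_bound[OF cauchy_mul[OF mem(1,3)] cauchy_mul[OF mem(2,4)]])
      fix n
      have "D (mul A (u n) (v n)) (mul A (u' n) (v' n)) \<le> N (u n) * D (v n) (v' n) + D (u n) (u' n) * N (v' n)"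
        by (rule D_mul) (intro cauchy_elem mem)+
      also have "\<dots> \<le> K1 * D (v n) (v' n) + D (u n) (u' n) * K2"
        by (intro add_mono mult_right_mono mult_left_mono K1 K2 D_nonneg cauchy_elem mem)
      finally show "D (mul A (u n) (v n)) (mul A (u' n) (v' n)) \<le> K1 * D (v n) (v' n) + D (u n) (u' n) * K2" .
    qed
  qed
  show ?thesis
    using UN_equiv_class2[OF equiv_null_rel equiv_null_rel c assms] by (simp add: enveloping_cstar_def cls_def)
qed

lemma E_closed:
  assumes "P \<in> elems E" "Q \<in> elems E"
  shows "add E P Q \<in> elems E" "smul E c P \<in> elems E" "mul E P Q \<in> elems E" "star E P \<in> elems E"
proof -
  obtain u v where "u \<in> cauchy_seqs A" "P = cls u" "v \<in> cauchy_seqs A" "Q = cls v"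
    using assms by (auto elim!: elems_E)
  then show "add E P Q \<in> elems E" "smul E c P \<in> elems E" "mul E P Q \<in> elems E" "star E P \<in> elems E"
    by (simp_all add: E_add E_smul E_mul E_star cls_elem cauchy_add cauchy_smul cauchy_mul cauchy_star)
qed

lemma embed_elem: "a \<in> elems A \<Longrightarrow> enveloping_embed A a \<in> elems E"
  by (simp add: embed_cls cls_elem const_cauchy)

lemma embed_hom:
  assumes "a \<in> elems A" "b \<in> elems A"
  shows "enveloping_embed A (add A a b) = add E (enveloping_embed A a) (enveloping_embed A b)"
    and "enveloping_embed A (smul A c a) = smul E c (enveloping_embed A a)"
    and "enveloping_embed A (mul A a b) = mul E (enveloping_embed A a) (enveloping_embed A b)"
    and "enveloping_embed A (star A a) = star E (enveloping_embed A a)"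
  using assms by (simp_all add: embed_cls E_add E_smul E_mul E_star const_cauchy)

subsection \<open>Extending representations\<close>

text \<open>
  The extension of \<open>\<pi>\<close> to the completion is a limit along a Cauchy sequence, taken coordinatewise;
  the chosen representative is immaterial, and the limit exists in norm.
\<close>

definition ext_rep :: "('a \<Rightarrow> ('i \<Rightarrow> complex) \<Rightarrow> 'i \<Rightarrow> complex) \<Rightarrow> (nat \<Rightarrow> 'a) set \<Rightarrow> ('i \<Rightarrow> complex) \<Rightarrow> 'i \<Rightarrow> complex" where
  "ext_rep \<pi> P \<xi> = (\<lambda>i. lim (\<lambda>n. \<pi> ((SOME u. u \<in> P) n) \<xi> i))"

context
  fixes \<pi> :: "'a \<Rightarrow> ('i \<Rightarrow> complex) \<Rightarrow> 'i \<Rightarrow> complex" and S :: "'i set"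
  assumes \<pi>: "star_rep A S \<pi>"
    and contr: "\<And>a \<xi>. a \<in> elems A \<Longrightarrow> \<xi> \<in> ell2 S \<Longrightarrow> ell2_norm S (\<pi> a \<xi>) \<le> N a * ell2_norm S \<xi>"
begin

lemma contr_D:
  assumes "a \<in> elems A" "b \<in> elems A" "\<xi> \<in> ell2 S"
  shows "ell2_norm S (\<lambda>i. \<pi> a \<xi> i - \<pi> b \<xi> i) \<le> D a b * ell2_norm S \<xi>"
  using contr[OF sub_closed[OF assms(1,2)] assms(3)] by (simp add: rep_sub[OF \<pi> assms] D_sub)

lemma ext_rep_conv:
  assumes u: "u \<in> cauchy_seqs A" and x: "\<xi> \<in> ell2 S"
  shows "ell2_conv S (\<lambda>n. \<pi> (u n) \<xi>) (ext_rep \<pi> (cls u) \<xi>)"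
proof -
  define v where "v = (SOME v. v \<in> cls u)"
  have "v \<in> cls u" unfolding v_def using cls_self[OF u] by (rule someI[where P = "\<lambda>v. v \<in> cls u"])
  then have v: "v \<in> cauchy_seqs A" and uv: "(\<lambda>n. D (u n) (v n)) \<longlonglongrightarrow> 0"
    by (auto simp: cls_mem null_rel_iff)
  have m: "\<pi> (w n) \<xi> \<in> ell2 S" if "w \<in> cauchy_seqs A" for w n
    by (rule star_repD(2)[OF \<pi> cauchy_elem[OF that] x])
  have C: "\<exists>M. \<forall>m\<ge>M. \<forall>n\<ge>M. ell2_norm S (\<lambda>i. \<pi> (v m) \<xi> i - \<pi> (v n) \<xi> i) \<le> e" if "e > 0" for e
  proof -
    have nz: "ell2_norm S \<xi> + 1 > 0" by (rule add_nonneg_pos) simp_all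
    have pos: "e / (ell2_norm S \<xi> + 1) > 0" by (rule divide_pos_pos[OF that nz])
    obtain M where M: "\<forall>m\<ge>M. \<forall>n\<ge>M. D (v m) (v n) < e / (ell2_norm S \<xi> + 1)"
      using cauchy_seqsD[OF v pos] by blast
    have "ell2_norm S (\<lambda>i. \<pi> (v m) \<xi> i - \<pi> (v n) \<xi> i) \<le> e" if mn: "m \<ge> M" "n \<ge> M" for m n
    proof -
      have "ell2_norm S (\<lambda>i. \<pi> (v m) \<xi> i - \<pi> (v n) \<xi> i) \<le> D (v m) (v n) * ell2_norm S \<xi>"
        by (intro contr_D cauchy_elem v x)
      also have "\<dots> \<le> e / (ell2_norm S \<xi> + 1) * (ell2_norm S \<xi> + 1)"
        using M mn pos by (intro mult_mono) (auto intro: less_imp_le)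
      also have "\<dots> = e" using nz by simp
      finally show ?thesis .
    qed
    then show ?thesis by blast
  qed
  have "\<exists>\<zeta>. \<zeta> \<in> ell2 S \<and> (\<forall>i. (\<lambda>n. \<pi> (v n) \<xi> i) \<longlonglongrightarrow> \<zeta> i)
      \<and> (\<lambda>n. ell2_norm S (\<lambda>i. \<pi> (v n) \<xi> i - \<zeta> i)) \<longlonglongrightarrow> 0"
  proof (rule ell2_complete[of "\<lambda>n. \<pi> (v n) \<xi>", OF m[OF v] C])
    fix \<zeta> assume "\<zeta> \<in> ell2 S" "\<And>i. (\<lambda>n. \<pi> (v n) \<xi> i) \<longlonglongrightarrow> \<zeta> i"
      "(\<lambda>n. ell2_norm S (\<lambda>i. \<pi> (v n) \<xi> i - \<zeta> i)) \<longlonglongrightarrow> 0"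
    then show ?thesis by (intro exI[of _ \<zeta>] conjI allI)
  qed simp
  then obtain \<zeta> where z: "\<zeta> \<in> ell2 S" "\<forall>i. (\<lambda>n. \<pi> (v n) \<xi> i) \<longlonglongrightarrow> \<zeta> i"
      "(\<lambda>n. ell2_norm S (\<lambda>i. \<pi> (v n) \<xi> i - \<zeta> i)) \<longlonglongrightarrow> 0"
    by (elim exE conjE)
  have "ext_rep \<pi> (cls u) \<xi> = \<zeta>"
    unfolding ext_rep_def v_def[symmetric] using z(2) by (intro ext limI) simp
  moreover have "ell2_conv S (\<lambda>n. \<pi> (u n) \<xi>) \<zeta>"
  proof (rule ell2_conv_near)
    show "ell2_conv S (\<lambda>n. \<pi> (v n) \<xi>) \<zeta>" using z m[OF v] by (simp add: ell2_conv_def)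
    show "(\<lambda>n. ell2_norm S (\<lambda>i. \<pi> (u n) \<xi> i - \<pi> (v n) \<xi> i)) \<longlonglongrightarrow> 0"
    proof (rule tendsto_sandwich[OF _ _ tendsto_const])
      show "(\<lambda>n. D (u n) (v n) * ell2_norm S \<xi>) \<longlonglongrightarrow> 0"
        by (rule tendsto_mult_left_zero[OF uv])
      show "\<forall>\<^sub>F n in sequentially. ell2_norm S (\<lambda>i. \<pi> (u n) \<xi> i - \<pi> (v n) \<xi> i) \<le> D (u n) (v n) * ell2_norm S \<xi>"
        by (intro always_eventually allI contr_D cauchy_elem u v x)
    qed simp
  qed (rule m[OF u])
  ultimately show ?thesis by simp
qed

lemma ext_rep_embed:
  assumes "a \<in> elems A" "\<xi> \<in> ell2 S"
  shows "ext_rep \<pi> (enveloping_embed A a) \<xi> = \<pi> a \<xi>"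
  unfolding embed_cls
  by (rule ell2_conv_unique[OF ext_rep_conv[OF const_cauchy[OF assms(1)] assms(2)]])
    (rule ell2_conv_const[OF star_repD(2)[OF \<pi> assms]])

lemma ext_rep_bounded:
  assumes u: "u \<in> cauchy_seqs A"
  shows "bounded_operator S (ext_rep \<pi> (cls u))"
  unfolding bounded_operator_def
proof (intro conjI ballI allI)
  note e = ext_rep_conv[OF u]
  note b = star_repD(1)[OF \<pi> cauchy_elem[OF u]]
  show "ext_rep \<pi> (cls u) \<xi> \<in> ell2 S" if "\<xi> \<in> ell2 S" for \<xi>
    using ell2_convD(2)[OF e[OF that]] .
  show "ext_rep \<pi> (cls u) (\<lambda>i. \<xi> i + \<eta> i) = (\<lambda>i. ext_rep \<pi> (cls u) \<xi> i + ext_rep \<pi> (cls u) \<eta> i)"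
    if "\<xi> \<in> ell2 S" "\<eta> \<in> ell2 S" for \<xi> \<eta>
    using ell2_conv_unique[OF e[OF ell2_add[OF that]]] ell2_conv_add[OF e[OF that(1)] e[OF that(2)]]
    by (simp add: bounded_operatorD(2)[OF b that])
  show "ext_rep \<pi> (cls u) (\<lambda>i. c * \<xi> i) = (\<lambda>i. c * ext_rep \<pi> (cls u) \<xi> i)" if "\<xi> \<in> ell2 S" for c \<xi>
    using ell2_conv_unique[OF e[OF ell2_scale[OF that]]] ell2_conv_scale[OF e[OF that]]
    by (simp add: bounded_operatorD(3)[OF b that])
  obtain K where K: "0 \<le> K" "\<And>n. N (u n) \<le> K" using cauchy_bounded[OF u] by auto
  have "ell2_norm S (ext_rep \<pi> (cls u) \<xi>) \<le> K * ell2_norm S \<xi>" if x: "\<xi> \<in> ell2 S" for \<xi>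
    by (rule ell2_conv_norm_le[OF e[OF x]])
      (rule order_trans[OF contr[OF cauchy_elem[OF u] x] mult_right_mono[OF K(2) ell2_norm_nonneg]])
  then show "\<exists>M. \<forall>\<xi>\<in>ell2 S. ell2_norm S (ext_rep \<pi> (cls u) \<xi>) \<le> M * ell2_norm S \<xi>"
    by (intro exI[of _ K] ballI)
qed

lemma ext_rep_star_rep: "star_rep E S (ext_rep \<pi>)"
  unfolding star_rep_def
proof (intro conjI ballI allI)
  fix P \<xi> assume "P \<in> elems E" and x: "\<xi> \<in> ell2 S"
  then obtain u where u: "u \<in> cauchy_seqs A" and P: "P = cls u" by (auto elim: elems_E)
  note el = cauchy_elem[OF u]
  show "ext_rep \<pi> (smul E c P) \<xi> = (\<lambda>i. c * ext_rep \<pi> P \<xi> i)" for c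
    using ell2_conv_unique[OF ext_rep_conv[OF cauchy_smul[OF u] x]] ell2_conv_scale[OF ext_rep_conv[OF u x]]
    by (simp add: P E_smul[OF u] star_repD(4)[OF \<pi> el x])
  show "ell2_inner S (ext_rep \<pi> (star E P) \<xi>) \<eta> = ell2_inner S \<xi> (ext_rep \<pi> P \<eta>)"
    if y: "\<eta> \<in> ell2 S" for \<eta>
  proof (rule LIMSEQ_unique)
    show "(\<lambda>n. ell2_inner S (\<pi> (star A (u n)) \<xi>) \<eta>) \<longlonglongrightarrow> ell2_inner S (ext_rep \<pi> (star E P) \<xi>) \<eta>"
      unfolding P E_star[OF u] by (rule ell2_conv_inner(1)[OF ext_rep_conv[OF cauchy_star[OF u] x] y])
    show "(\<lambda>n. ell2_inner S (\<pi> (star A (u n)) \<xi>) \<eta>) \<longlonglongrightarrow> ell2_inner S \<xi> (ext_rep \<pi> P \<eta>)"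
      unfolding P star_repD(6)[OF \<pi> el x y] by (rule ell2_conv_inner(2)[OF ext_rep_conv[OF u y] x])
  qed
  fix Q assume "Q \<in> elems E"
  then obtain v where v: "v \<in> cauchy_seqs A" and Q: "Q = cls v" by (auto elim: elems_E)
  note el' = cauchy_elem[OF v]
  show "ext_rep \<pi> (add E P Q) \<xi> = (\<lambda>i. ext_rep \<pi> P \<xi> i + ext_rep \<pi> Q \<xi> i)"
    using ell2_conv_unique[OF ext_rep_conv[OF cauchy_add[OF u v] x]]
      ell2_conv_add[OF ext_rep_conv[OF u x] ext_rep_conv[OF v x]]
    by (simp add: P Q E_add[OF u v] star_repD(3)[OF \<pi> el el' x])
  let ?y = "ext_rep \<pi> Q \<xi>"
  have cv: "ell2_conv S (\<lambda>n. \<pi> (v n) \<xi>) ?y" unfolding Q by (rule ext_rep_conv[OF v x])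
  note y = ell2_convD(2)[OF cv] and yn = ell2_convD(1)[OF cv]
  obtain K where K: "0 \<le> K" "\<And>n. N (u n) \<le> K" using cauchy_bounded[OF u] by auto
  have "ell2_conv S (\<lambda>n. \<pi> (u n) (\<pi> (v n) \<xi>)) (ext_rep \<pi> P ?y)"
  proof (rule ell2_conv_near[OF ext_rep_conv[OF u y, folded P]])
    show "(\<lambda>n. ell2_norm S (\<lambda>i. \<pi> (u n) (\<pi> (v n) \<xi>) i - \<pi> (u n) ?y i)) \<longlonglongrightarrow> 0"
    proof (rule tendsto_sandwich[OF _ _ tendsto_const])
      show "(\<lambda>n. K * ell2_norm S (\<lambda>i. \<pi> (v n) \<xi> i - ?y i)) \<longlonglongrightarrow> 0"
        by (rule tendsto_mult_right_zero[OF ell2_convD(3)[OF cv]])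
      show "\<forall>\<^sub>F n in sequentially. ell2_norm S (\<lambda>i. \<pi> (u n) (\<pi> (v n) \<xi>) i - \<pi> (u n) ?y i)
          \<le> K * ell2_norm S (\<lambda>i. \<pi> (v n) \<xi> i - ?y i)"
      proof (intro always_eventually allI)
        fix n
        have "ell2_norm S (\<lambda>i. \<pi> (u n) (\<pi> (v n) \<xi>) i - \<pi> (u n) ?y i)
            \<le> N (u n) * ell2_norm S (\<lambda>i. \<pi> (v n) \<xi> i - ?y i)"
          unfolding bounded_operator_diff[OF star_repD(1)[OF \<pi> el] yn y, symmetric]
          by (rule contr[OF el ell2_diff[OF yn y]])
        also have "\<dots> \<le> K * ell2_norm S (\<lambda>i. \<pi> (v n) \<xi> i - ?y i)"
          by (intro mult_right_mono K ell2_norm_nonneg)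
        finally show "ell2_norm S (\<lambda>i. \<pi> (u n) (\<pi> (v n) \<xi>) i - \<pi> (u n) ?y i)
            \<le> K * ell2_norm S (\<lambda>i. \<pi> (v n) \<xi> i - ?y i)" .
      qed
    qed simp
  qed (rule star_repD(2)[OF \<pi> el yn])
  then show "ext_rep \<pi> (mul E P Q) \<xi> = ext_rep \<pi> P ?y"
    using ell2_conv_unique[OF ext_rep_conv[OF cauchy_mul[OF u v] x]]
    by (simp add: P Q E_mul[OF u v] star_repD(5)[OF \<pi> el el' x])
next
  fix P assume "P \<in> elems E"
  then show "bounded_operator S (ext_rep \<pi> P)" by (auto elim!: elems_E intro: ext_rep_bounded)
qed

end

end

subsection \<open>Automatic continuity\<close>

context bounded_star_algebra
begin

text \<open>
  The partial sums \<open>u + u\<^sup>2 + \<dots> + u\<^sup>n\<^sup>+\<^sup>1\<close> of the geometric series.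
\<close>

primrec neumann :: "'a \<Rightarrow> nat \<Rightarrow> 'a" where
  "neumann u 0 = u"
| "neumann u (Suc n) = add A u (mul A (neumann u n) u)"

lemma neumann_closed: "u \<in> elems A \<Longrightarrow> neumann u n \<in> elems A"
  by (induction n) (simp_all add: add_closed mul_closed)

lemma neumann_N:
  assumes u: "u \<in> elems A" "N u \<le> q" and q: "0 \<le> q" "q < 1"
  shows "N (neumann u n) \<le> q / (1 - q)"
proof (induction n)
  case 0
  have "q * (1 - q) \<le> q" using q by (simp add: mult_left_le)
  then show ?case using u(2) q by (simp add: pos_le_divide_eq) (smt (verit) mult_right_mono)
next
  case (Suc n)
  have "N (neumann u (Suc n)) \<le> N u + N (neumann u n) * N u"
    using N_add[OF u(1) mul_closed[OF neumann_closed[OF u(1)] u(1)], of n]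
      N_mul[OF neumann_closed[OF u(1)] u(1), of n] by simp
  also have "\<dots> \<le> q + q / (1 - q) * q"
    using Suc u(2) q by (intro add_mono mult_mono N_nonneg u) auto
  also have "\<dots> = q / (1 - q)" using q by (simp add: field_simps)
  finally show ?case .
qed

lemma neumann_step:
  assumes u: "u \<in> elems A" "N u \<le> q" and q: "0 \<le> q"
  shows "D (neumann u (Suc n)) (neumann u n) \<le> q ^ Suc (Suc n)"
proof (induction n)
  case 0
  note m = mul_closed[OF u(1) u(1)]
  have "D (add A u (mul A u u)) u \<le> N (mul A u u)"
  proof (rule D_le_by_rep[OF add_closed[OF u(1) m] u(1) N_nonneg[OF m]])
    fix S :: "'a set" and \<rho> \<xi> assume r: "star_rep A S \<rho>" "\<xi> \<in> ell2 S"
    show "ell2_norm S (\<lambda>i. \<rho> (add A u (mul A u u)) \<xi> i - \<rho> u \<xi> i) \<le> N (mul A u u) * ell2_norm S \<xi>"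
      using rep_le_N[OF r(1) m r(2)] by (simp add: star_repD(3)[OF r(1) u(1) m r(2)])
  qed
  also have "\<dots> \<le> N u * N u" by (rule N_mul[OF u(1) u(1)])
  also have "\<dots> \<le> q * q" by (intro mult_mono u q N_nonneg)
  finally show ?case by simp
next
  case (Suc n)
  note c = neumann_closed[OF u(1)]
  have "D (neumann u (Suc (Suc n))) (neumann u (Suc n))
      \<le> D u u + D (mul A (neumann u (Suc n)) u) (mul A (neumann u n) u)"
    unfolding neumann.simps(2)[of u "Suc n"] neumann.simps(2)[of u n, symmetric]
    by (subst (2) neumann.simps(2)) (intro D_add u mul_closed c)
  also have "\<dots> \<le> 0 + (N (neumann u (Suc n)) * D u u + D (neumann u (Suc n)) (neumann u n) * N u)"
    using D_mul[OF c u(1) c u(1), of "Suc n" n] by (simp only: D_refl[OF u(1)])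
  also have "\<dots> \<le> q ^ Suc (Suc n) * q"
    using Suc u q unfolding D_refl[OF u(1)] by (simp del: neumann.simps add: mult_mono N_nonneg)
  finally show ?case by (simp add: mult_ac)
qed

text \<open>
  If \<open>\<parallel>b\<parallel> < 1\<close> then the geometric series \<open>k = b + b\<^sup>2 + \<dots>\<close> converges in the completion,
  so \<open>1 + k\<close> inverts \<open>1 - b\<close>. The diagonal sequence of partial sums represents \<open>k\<close>.
\<close>

lemma quasi_inverse:
  assumes u: "u \<in> cauchy_seqs A" and q: "\<And>n. N (u n) \<le> q" "0 \<le> q" "q < 1"
  shows "\<exists>k\<in>elems E. k = add E (cls u) (mul E k (cls u))"
proof -
  define v where "v n = neumann (u n) n" for n
  define w where "w n = neumann (u n) (Suc n)" for n
  define C where "C = q / (1 - q)"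
  note el = cauchy_elem[OF u]
  have vel: "v n \<in> elems A" and wel: "w n \<in> elems A" for n
    by (simp_all only: v_def w_def neumann_closed[OF el])
  have w: "w n = add A (u n) (mul A (v n) (u n))" for n by (simp add: v_def w_def)
  have C: "N (v n) \<le> C" for n unfolding v_def C_def by (rule neumann_N[OF el q])
  have C0: "0 \<le> C" using q by (simp add: C_def)
  have wv: "D (w n) (v n) \<le> q ^ n" for n
  proof -
    have "D (w n) (v n) \<le> q ^ Suc (Suc n)" unfolding v_def w_def by (rule neumann_step[OF el q(1,2)])
    also have "\<dots> \<le> q ^ n" by (rule power_decreasing) (use q in auto)
    finally show ?thesis .
  qed
  \<comment> \<open>\<open>w\<close> is almost \<open>v\<close>, and \<open>v \<mapsto> u + v u\<close> contracts by the factor \<open>q\<close>\<close>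
  have main: "D (v n) (v m) * (1 - q) \<le> (1 + C) * D (u n) (u m) + q ^ n + q ^ m" for n m
  proof -
    have "D (w n) (w m) \<le> D (u n) (u m) + D (mul A (v n) (u n)) (mul A (v m) (u m))"
      unfolding w by (intro D_add el mul_closed vel)
    also have "\<dots> \<le> D (u n) (u m) + (N (v n) * D (u n) (u m) + D (v n) (v m) * N (u m))"
      by (intro add_left_mono D_mul el vel)
    also have "\<dots> \<le> D (u n) (u m) + (C * D (u n) (u m) + D (v n) (v m) * q)"
      by (intro add_left_mono add_mono mult_right_mono mult_left_mono C q D_nonneg el vel)
    finally have "D (w n) (w m) \<le> D (u n) (u m) + (C * D (u n) (u m) + D (v n) (v m) * q)" .
    moreover have "D (v n) (v m) \<le> D (v n) (w n) + (D (w n) (w m) + D (w m) (v m))"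
      using D_triangle[OF vel[of n] wel[of n] vel[of m]] D_triangle[OF wel[of n] wel[of m] vel[of m]] by linarith
    moreover have "D (v n) (w n) \<le> q ^ n" using wv[of n] D_sym[OF vel wel, of n n] by simp
    ultimately show ?thesis using wv[of m] by (simp add: algebra_simps)
  qed
  have v: "v \<in> cauchy_seqs A"
    unfolding cauchy_seqs_def
  proof (intro CollectI conjI allI impI vel)
    fix e :: real assume "e > 0"
    define e' where "e' = e * (1 - q) / 4"
    have e': "e' > 0" using \<open>e > 0\<close> q by (simp add: e'_def)
    then have "e' / (1 + C) > 0" using C0 by simp
    from cauchy_seqsD[OF u this]
    obtain M1 where M1: "\<forall>m\<ge>M1. \<forall>n\<ge>M1. D (u m) (u n) < e' / (1 + C)" by blast
    have "(\<lambda>n. q ^ n) \<longlonglongrightarrow> 0" by (rule LIMSEQ_realpow_zero[OF q(2,3)])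
    from LIMSEQ_D[OF this e'] q(2) obtain M2 where M2: "\<forall>n\<ge>M2. q ^ n < e'" by auto
    have "D (v m) (v n) < e" if "m \<ge> max M1 M2" "n \<ge> max M1 M2" for m n
    proof -
      have "D (u m) (u n) < e' / (1 + C)" using M1 that by simp
      then have "(1 + C) * D (u m) (u n) < e'" using C0 by (simp add: field_simps)
      moreover have "q ^ m < e'" "q ^ n < e'" using M2 that by simp_all
      ultimately have "D (v m) (v n) * (1 - q) < 4 * e'" using main[of m n] e' by linarith
      then have "D (v m) (v n) * (1 - q) < e * (1 - q)" by (simp add: e'_def)
      then show ?thesis using q by simp
    qed
    then show "\<exists>M. \<forall>m\<ge>M. \<forall>n\<ge>M. D (v m) (v n) < e" by blast
  qed
  have wc: "w \<in> cauchy_seqs A" unfolding w by (intro cauchy_add cauchy_mul u v)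
  have "cls w = cls v"
    by (rule cls_eq[OF null_by_bound[OF wc v LIMSEQ_realpow_zero[OF q(2,3)] wv]])
  moreover have "cls w = add E (cls u) (mul E (cls v) (cls u))"
    unfolding w E_mul[OF v u] E_add[OF u cauchy_mul[OF v u]] ..
  ultimately show ?thesis using cls_elem[OF v] by (intro bexI[of _ "cls v"]) simp_all
qed

text \<open>
  Suppose that \<open>T = \<rho>(a)\<close> had norm \<open>r > \<parallel>a\<parallel>\<close>. Then \<open>r\<^sup>2\<close> is an approximate eigenvalue of
  \<open>T\<^sup>*T\<close>, although \<open>1 - a\<^sup>*a/r\<^sup>2\<close> is invertible. Quantitatively, with \<open>b = a\<^sup>*a/r\<^sup>2\<close> and
  \<open>k = b + k b\<close>, applying \<open>\<rho>(k)\<close> to \<open>\<xi> - \<rho>(b) \<xi>\<close> gives \<open>\<rho>(b) \<xi>\<close>. So \<open>\<parallel>\<xi>\<parallel>\<close> is at most a fixed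
  multiple of \<open>\<parallel>\<xi> - \<rho>(b) \<xi>\<parallel>\<close>, which keeps \<open>\<parallel>T \<xi>\<parallel>\<close> below \<open>r' \<parallel>\<xi>\<parallel>\<close> for some \<open>r' < r\<close>.
\<close>

lemma rep_contractive:
  assumes \<rho>: "star_rep E S \<rho>" and u: "u \<in> cauchy_seqs A"
    and q: "\<And>n. N (u n) \<le> q" "0 \<le> q" and x: "\<xi> \<in> ell2 S"
  shows "ell2_norm S (\<rho> (cls u) \<xi>) \<le> q * ell2_norm S \<xi>"
proof -
  define T where "T = \<rho> (cls u)"
  define r where "r = op_norm S T"
  note el = cauchy_elem[OF u]
  have Tb: "bounded_operator S T" unfolding T_def by (rule star_repD(1)[OF \<rho> cls_elem[OF u]])
  have Tr: "ell2_norm S (T \<xi>) \<le> r * ell2_norm S \<xi>" if "\<xi> \<in> ell2 S" for \<xi>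
    unfolding r_def by (rule op_norm_bound[OF Tb that])
  have "r \<le> q"
  proof (rule ccontr)
    assume "\<not> r \<le> q"
    then have r: "r > q" "r > 0" using q(2) by auto
    define b where "b n = smul A (complex_of_real (1 / r\<^sup>2)) (mul A (star A (u n)) (u n))" for n
    have bc: "b \<in> cauchy_seqs A" unfolding b_def by (intro cauchy_smul cauchy_mul cauchy_star u)
    have bN: "N (b n) \<le> (q / r)\<^sup>2" for n
    proof -
      have "N (b n) \<le> 1 / r\<^sup>2 * N (mul A (star A (u n)) (u n))"
        using N_smul[OF mul_closed[OF star_closed[OF el] el], of "complex_of_real (1 / r\<^sup>2)" n n]
        unfolding b_def norm_of_real by simp
      also have "\<dots> \<le> 1 / r\<^sup>2 * (N (star A (u n)) * N (u n))"
        by (intro mult_left_mono N_mul el star_closed) simp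
      also have "\<dots> \<le> 1 / r\<^sup>2 * (q * q)"
        using N_star[OF el, of n] q by (intro mult_left_mono mult_mono) (auto intro: order_trans N_nonneg el)
      finally show ?thesis by (simp add: power2_eq_square)
    qed
    have "q / r < 1" using r by simp
    then have lt: "(q / r)\<^sup>2 < 1" using q(2) r by (simp add: power_less_one_iff)
    obtain k where k: "k \<in> elems E" "k = add E (cls b) (mul E k (cls b))"
      using quasi_inverse[OF bc bN _ lt] by auto
    obtain M where M: "M \<ge> 0" "\<And>\<xi>. \<xi> \<in> ell2 S \<Longrightarrow> ell2_norm S (\<rho> k \<xi>) \<le> M * ell2_norm S \<xi>"
      using bounded_operator_bound[OF star_repD(1)[OF \<rho> k(1)]] by metis
    \<comment> \<open>\<open>s\<close> solves \<open>2 (1 + M)\<^sup>2 (1 - s) = 1\<close>\<close>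
    define s where "s = 1 - 1 / (2 * (1 + M)\<^sup>2)"
    have s: "0 \<le> s" "s < 1"
    proof -
      have "(1 + M)\<^sup>2 \<ge> 1" using M(1) by (simp add: one_le_power)
      moreover have "0 < 1 / (2 * a) \<and> 1 / (2 * a) \<le> 1" if "1 \<le> a" for a :: real
        using that by (simp add: field_simps)
      ultimately have "0 < 1 / (2 * (1 + M)\<^sup>2) \<and> 1 / (2 * (1 + M)\<^sup>2) \<le> 1" by blast
      then show "0 \<le> s" "s < 1" by (simp_all add: s_def)
    qed
    have Ts: "ell2_norm S (T \<xi>) \<le> (r * sqrt s) * ell2_norm S \<xi>" if x: "\<xi> \<in> ell2 S" for \<xi>
    proof -
      let ?t = "star E (cls u)"
      have sE: "?t \<in> elems E" "cls u \<in> elems E" "cls b \<in> elems E"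
        using E_closed cls_elem[OF u] cls_elem[OF bc] by auto
      have Tx: "T \<xi> \<in> ell2 S" by (rule bounded_operatorD(1)[OF Tb x])
      define B where "B = \<rho> (cls b) \<xi>"
      have Bx: "B \<in> ell2 S" unfolding B_def by (rule star_repD(2)[OF \<rho> sE(3) x])
      have cb: "cls b = smul E (complex_of_real (1 / r\<^sup>2)) (mul E ?t (cls u))"
        unfolding E_star[OF u] E_mul[OF cauchy_star[OF u] u] E_smul[OF cauchy_mul[OF cauchy_star[OF u] u]] b_def ..
      have B: "B = (\<lambda>i. complex_of_real (1 / r\<^sup>2) * \<rho> ?t (T \<xi>) i)"
        unfolding B_def cb T_def
        using star_repD(4)[OF \<rho> _ x] star_repD(5)[OF \<rho> sE(1,2) x] E_closed(3)[OF sE(1,2)] by simp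
      have nB: "ell2_norm S B \<le> ell2_norm S \<xi>"
      proof -
        have "ell2_norm S (\<rho> ?t (T \<xi>)) \<le> r * ell2_norm S (T \<xi>)"
          by (rule star_rep_star_bound[OF \<rho> sE(2,1) _ _ Tx]) (use Tr r in \<open>auto simp: T_def\<close>)
        also have "\<dots> \<le> r * (r * ell2_norm S \<xi>)" by (intro mult_left_mono Tr x) (use r in simp)
        finally show ?thesis
          unfolding B ell2_norm_scale norm_of_real using r by (simp add: field_simps power2_eq_square)
      qed
      \<comment> \<open>\<open>\<parallel>\<xi> - B\<parallel>\<^sup>2 = \<parallel>\<xi>\<parallel>\<^sup>2 - 2 Re \<langle>\<xi>, B\<rangle> + \<parallel>B\<parallel>\<^sup>2\<close> is small only if \<open>\<langle>\<xi>, B\<rangle>\<close> is large\<close>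
      have iB: "Re (ell2_inner S \<xi> B) = (ell2_norm S (T \<xi>))\<^sup>2 / r\<^sup>2"
      proof -
        have "ell2_inner S B \<xi> = complex_of_real (1 / r\<^sup>2) * ell2_inner S (T \<xi>) (T \<xi>)"
          unfolding B ell2_inner_scale_left
          using star_repD(6)[OF \<rho> sE(2) Tx x] by (simp add: T_def)
        then have "ell2_inner S B \<xi> = complex_of_real ((ell2_norm S (T \<xi>))\<^sup>2 / r\<^sup>2)"
          by (simp add: ell2_inner_self[OF Tx])
        then have "ell2_inner S \<xi> B = complex_of_real ((ell2_norm S (T \<xi>))\<^sup>2 / r\<^sup>2)"
          using ell2_inner_cnj[of S B \<xi>] by simp
        then show ?thesis by simp
      qed
      have d: "(\<lambda>i. \<xi> i - B i) \<in> ell2 S" by (intro ell2_diff x Bx)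
      have "\<rho> k \<xi> = (\<lambda>i. B i + \<rho> k B i)"
        using star_repD(3)[OF \<rho> sE(3) E_closed(3)[OF k(1) sE(3)] x] star_repD(5)[OF \<rho> k(1) sE(3) x] k(2)
        by (simp add: B_def)
      then have "\<rho> k (\<lambda>i. \<xi> i - B i) = B"
        unfolding bounded_operator_diff[OF star_repD(1)[OF \<rho> k(1)] x Bx] by simp
      then have "ell2_norm S B \<le> M * ell2_norm S (\<lambda>i. \<xi> i - B i)" using M(2)[OF d] by simp
      moreover have "ell2_norm S \<xi> \<le> ell2_norm S (\<lambda>i. \<xi> i - B i) + ell2_norm S B"
        using ell2_norm_triangle[OF d Bx] by simp
      ultimately have "ell2_norm S \<xi> \<le> (1 + M) * ell2_norm S (\<lambda>i. \<xi> i - B i)"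
        by (simp add: algebra_simps)
      then have "(ell2_norm S \<xi>)\<^sup>2 \<le> ((1 + M) * ell2_norm S (\<lambda>i. \<xi> i - B i))\<^sup>2"
        by (rule power_mono) simp
      also have "\<dots> = (1 + M)\<^sup>2 * (ell2_norm S (\<lambda>i. \<xi> i - B i))\<^sup>2" by (simp add: power_mult_distrib)
      also have "\<dots> \<le> (1 + M)\<^sup>2 * (2 * (ell2_norm S \<xi>)\<^sup>2 - 2 * ((ell2_norm S (T \<xi>))\<^sup>2 / r\<^sup>2))"
      proof (rule mult_left_mono)
        have "(ell2_norm S B)\<^sup>2 \<le> (ell2_norm S \<xi>)\<^sup>2" by (rule power_mono[OF nB]) simp
        then show "(ell2_norm S (\<lambda>i. \<xi> i - B i))\<^sup>2 \<le> 2 * (ell2_norm S \<xi>)\<^sup>2 - 2 * ((ell2_norm S (T \<xi>))\<^sup>2 / r\<^sup>2)"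
          unfolding ell2_norm_sq_diff[OF x Bx] iB by simp
      qed simp
      finally have "(ell2_norm S (T \<xi>))\<^sup>2 / r\<^sup>2 \<le> s * (ell2_norm S \<xi>)\<^sup>2"
      proof -
        assume *: "(ell2_norm S \<xi>)\<^sup>2 \<le> (1 + M)\<^sup>2 * (2 * (ell2_norm S \<xi>)\<^sup>2 - 2 * ((ell2_norm S (T \<xi>))\<^sup>2 / r\<^sup>2))"
        have p: "(1 + M)\<^sup>2 > 0" using M(1) by simp
        from * have "(ell2_norm S \<xi>)\<^sup>2 / (1 + M)\<^sup>2 \<le> 2 * (ell2_norm S \<xi>)\<^sup>2 - 2 * ((ell2_norm S (T \<xi>))\<^sup>2 / r\<^sup>2)"
          using p by (simp add: pos_divide_le_eq mult.commute)
        then show ?thesis by (simp add: s_def algebra_simps)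
      qed
      then have "(ell2_norm S (T \<xi>))\<^sup>2 \<le> r\<^sup>2 * (s * (ell2_norm S \<xi>)\<^sup>2)"
        using r by (simp add: pos_divide_le_eq mult.commute)
      also have "\<dots> = ((r * sqrt s) * ell2_norm S \<xi>)\<^sup>2" using s by (simp add: power_mult_distrib)
      finally show ?thesis
        by (rule power2_le_imp_le) (use r s in simp)
    qed
    have "r \<le> r * sqrt s"
      unfolding r_def[symmetric] using op_norm_le[of "r * sqrt s" S T, OF _ Ts] r s by (simp add: r_def)
    then show False using r s by simp
  qed
  then show ?thesis
    using Tr[OF x] mult_right_mono[OF _ ell2_norm_nonneg, of r q S \<xi>] unfolding T_def by linarith
qed

text \<open>
  The approximation in the completion is by elements of \<open>A\<close>, and contractivity turns it into one
  that is uniform in the representation.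
\<close>

lemma rep_approx:
  assumes P: "P \<in> elems E" and e: "e > 0"
  shows "\<exists>a\<in>elems A. \<forall>(S :: 'i set) \<rho> \<xi>. star_rep E S \<rho> \<longrightarrow> \<xi> \<in> ell2 S \<longrightarrow>
    ell2_norm S (\<lambda>i. \<rho> P \<xi> i - \<rho> (enveloping_embed A a) \<xi> i) \<le> e * ell2_norm S \<xi>"
proof -
  obtain u where u: "u \<in> cauchy_seqs A" and Pu: "P = cls u" using P by (rule elems_E)
  obtain M where M: "\<forall>m\<ge>M. \<forall>n\<ge>M. D (u m) (u n) < e" using cauchy_seqsD[OF u e] by blast
  define v where "v n = u (n + M)" for n
  have v: "v \<in> cauchy_seqs A"
    unfolding cauchy_seqs_def
  proof (intro CollectI conjI allI impI)
    fix d :: real assume "d > 0"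
    from cauchy_seqsD[OF u this] obtain K where K: "\<forall>m\<ge>K. \<forall>n\<ge>K. D (u m) (u n) < d" by blast
    then have "\<forall>m\<ge>K. \<forall>n\<ge>K. D (v m) (v n) < d" by (simp add: v_def)
    then show "\<exists>K. \<forall>m\<ge>K. \<forall>n\<ge>K. D (v m) (v n) < d" by blast
  qed (simp add: v_def cauchy_elem[OF u])
  have "(u, v) \<in> null_rel A"
    unfolding null_rel_iff
  proof (intro conjI u v LIMSEQ_I)
    fix d :: real assume "d > 0"
    from cauchy_seqsD[OF u this] obtain K where K: "\<forall>m\<ge>K. \<forall>n\<ge>K. D (u m) (u n) < d" by blast
    then have "\<forall>n\<ge>K. norm (D (u n) (v n) - 0) < d" by (simp add: v_def D_nonneg cauchy_elem[OF u])
    then show "\<exists>K. \<forall>n\<ge>K. norm (D (u n) (v n) - 0) < d" by blast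
  qed
  then have Pv: "P = cls v" unfolding Pu by (rule cls_eq)
  define a where "a = u M"
  have a: "a \<in> elems A" unfolding a_def by (rule cauchy_elem[OF u])
  define w where "w n = add A (v n) (smul A (-1) a)" for n
  have w: "w \<in> cauchy_seqs A" unfolding w_def by (intro cauchy_add v const_cauchy smul_closed a)
  have cw: "cls w = add E P (smul E (-1) (enveloping_embed A a))"
    unfolding w_def Pv embed_cls E_smul[OF const_cauchy[OF a]]
      E_add[OF v const_cauchy[OF smul_closed[OF a]]] ..
  have wN: "N (w n) \<le> e" for n
  proof -
    have "D (v n) a < e" using M by (simp add: v_def a_def)
    then show ?thesis by (simp add: D_sub sub_def w_def)
  qed
  show ?thesis
  proof (intro bexI[OF _ a] allI impI)
    fix S :: "'i set" and \<rho> \<xi> assume \<rho>: "star_rep E S \<rho>" and x: "\<xi> \<in> ell2 S"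
    note ea = embed_elem[OF a]
    have "\<rho> (cls w) \<xi> = (\<lambda>i. \<rho> P \<xi> i - \<rho> (enveloping_embed A a) \<xi> i)"
      unfolding cw using star_repD(3)[OF \<rho> P E_closed(2)[OF ea ea] x] star_repD(4)[OF \<rho> ea x] by simp
    then show "ell2_norm S (\<lambda>i. \<rho> P \<xi> i - \<rho> (enveloping_embed A a) \<xi> i) \<le> e * ell2_norm S \<xi>"
      using rep_contractive[OF \<rho> w wN less_imp_le[OF e] x] by simp
  qed
qed

end

section \<open>Deaconu--Renault groupoids\<close>

lemma local_homeo_loc:
  assumes "local_homeo X f" "x \<in> topspace X"
  obtains U where "openin X U" "x \<in> U" "inj_on f U" "continuous_map (subtopology X U) X f"
    "\<And>W. openin X W \<Longrightarrow> W \<subseteq> U \<Longrightarrow> openin X (f ` W)"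
proof -
  obtain U where U: "openin X U" "x \<in> U" "openin X (f ` U)"
    "homeomorphic_map (subtopology X U) (subtopology X (f ` U)) f"
    using assms unfolding local_homeo_def by blast
  have t: "topspace (subtopology X U) = U"
    using openin_subset[OF U(1)] by auto
  have inj: "inj_on f U" using homeomorphic_imp_injective_map[OF U(4)] t by simp
  have c: "continuous_map (subtopology X U) X f"
    using homeomorphic_imp_continuous_map[OF U(4)] continuous_map_into_fulltopology by blast
  have "openin X (f ` W)" if "openin X W" "W \<subseteq> U" for W
  proof -
    have "openin (subtopology X U) W" using that U(1) by (simp add: openin_open_subtopology)
    then have "openin (subtopology X (f ` U)) (f ` W)"
      using homeomorphic_imp_open_map[OF U(4)] by (simp add: open_map_def)
    then show ?thesis using U(3) openin_open_subtopology by blast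
  qed
  then show thesis using that U(1,2) inj c by blast
qed

lemma local_homeo_continuous:
  assumes "local_homeo X f" shows "continuous_map X X f"
  unfolding continuous_map_def
proof (intro conjI allI impI)
  show "f \<in> topspace X \<rightarrow> topspace X" using assms by (auto simp: local_homeo_def)
  fix V assume V: "openin X V"
  show "openin X {x \<in> topspace X. f x \<in> V}"
  proof (subst openin_subopen, clarify)
    fix x assume x: "x \<in> topspace X" "f x \<in> V"
    obtain U where U: "openin X U" "x \<in> U" "continuous_map (subtopology X U) X f"
      using local_homeo_loc[OF assms x(1)] by metis
    have "openin (subtopology X U) {y \<in> topspace (subtopology X U). f y \<in> V}"
      by (rule openin_continuous_map_preimage[OF U(3) V])
    then have "openin X {y \<in> topspace (subtopology X U). f y \<in> V}"
      using U(1) openin_open_subtopology by blast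
    then show "\<exists>W. openin X W \<and> x \<in> W \<and> W \<subseteq> {x \<in> topspace X. f x \<in> V}"
      using U x by (intro exI[of _ "{y \<in> topspace (subtopology X U). f y \<in> V}"]) auto
  qed
qed

lemma local_homeo_open:
  assumes "local_homeo X f" "openin X W" shows "openin X (f ` W)"
proof (subst openin_subopen, clarify)
  fix x assume x: "x \<in> W"
  then have "x \<in> topspace X" using openin_subset[OF assms(2)] by blast
  then obtain U where U: "openin X U" "x \<in> U" "\<And>W. openin X W \<Longrightarrow> W \<subseteq> U \<Longrightarrow> openin X (f ` W)"
    using local_homeo_loc[OF assms(1)] by metis
  have "openin X (f ` (U \<inter> W))" by (rule U(3)) (use U(1) assms(2) in auto)
  then show "\<exists>V. openin X V \<and> f x \<in> V \<and> V \<subseteq> f ` W"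
    using U(2) x by (intro exI[of _ "f ` (U \<inter> W)"]) auto
qed

lemma continuous_map_zero_extension:
  fixes h :: "'x \<Rightarrow> complex"
  assumes V: "openin X V" and K: "closedin X K" "K \<subseteq> V"
    and c: "continuous_map (subtopology X V) euclidean h" and z: "\<And>y. y \<notin> K \<Longrightarrow> h y = 0"
  shows "continuous_map X euclidean h"
  unfolding continuous_map_def
proof (intro conjI allI impI)
  show "h \<in> topspace X \<rightarrow> topspace euclidean" by simp
  fix W :: "complex set" assume W: "openin euclidean W"
  let ?P = "{y \<in> topspace (subtopology X V). h y \<in> W}"
  have "openin (subtopology X V) ?P" by (rule openin_continuous_map_preimage[OF c W])
  then have P: "openin X ?P" using V openin_open_subtopology by blast
  have "{x \<in> topspace X. h x \<in> W} = ?P \<union> (if 0 \<in> W then topspace X - K else {})"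
    using K(2) z by (auto split: if_splits) (metis subsetD)
  moreover have "openin X (if 0 \<in> W then topspace X - K else {})"
    using K(1) by (simp add: openin_diff)
  ultimately show "openin X {x \<in> topspace X. h x \<in> W}" using P by (simp add: openin_Un del: topspace_subtopology)
qed

lemma int_diff_eq_iff: "int_diff p q = int_diff p' q' \<longleftrightarrow> p + q' = p' + q"
  unfolding int_diff_def vec_eq_iff by (auto simp: algebra_simps) (metis add.commute of_nat_add of_nat_eq_iff diff_eq_eq add_diff_eq)+

locale deaconu_renault =
  fixes X :: "'x topology" and T :: "nat ^ 'k \<Rightarrow> 'x \<Rightarrow> 'x"
  assumes locally_compact: "locally_compact_space X" and Hausdorff: "Hausdorff_space X"
    and action: "local_homeo_action X T"
begin

abbreviation M :: "'x set" where "M \<equiv> topspace X"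
abbreviation G :: "('x \<times> (int ^ 'k) \<times> 'x, 'x) top_groupoid" where "G \<equiv> DR_groupoid X T"
abbreviation GT :: "('x \<times> (int ^ 'k) \<times> 'x) topology" where "GT \<equiv> gtop G"

lemma T_local_homeo: "local_homeo X (T n)"
  using action by (simp add: local_homeo_action_def)

lemma T_add: "x \<in> M \<Longrightarrow> T (m + n) x = T m (T n x)"
  using action by (simp add: local_homeo_action_def)

lemma T_zero [simp]: "x \<in> M \<Longrightarrow> T 0 x = x"
  using action by (simp add: local_homeo_action_def)

lemma T_in: "x \<in> M \<Longrightarrow> T n x \<in> M"
  using T_local_homeo by (auto simp: local_homeo_def)

lemma T_swap: "x \<in> M \<Longrightarrow> T m (T n x) = T n (T m x)"
  by (metis T_add add.commute)

lemma T_preimage_open: "openin X W \<Longrightarrow> openin X {x \<in> M. T n x \<in> W}"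
  by (rule openin_continuous_map_preimage[OF local_homeo_continuous[OF T_local_homeo]])

lemma T_locally_injective:
  assumes "x \<in> M" obtains U where "openin X U" "x \<in> U" "inj_on (T n) U"
  using local_homeo_loc[OF T_local_homeo assms] by metis

lemma gtop_G: "GT = topology_generated_by {DR_basic T U p q V | U p q V. openin X U \<and> openin X V}"
  by (simp add: DR_groupoid_def)

lemma arrows_iff:
  "\<gamma> \<in> arrows G \<longleftrightarrow> (\<exists>x p q y. \<gamma> = (x, int_diff p q, y) \<and> x \<in> M \<and> y \<in> M \<and> T p x = T q y)"
proof
  assume "\<gamma> \<in> arrows G"
  then obtain U p q V where "openin X U" "openin X V" "\<gamma> \<in> DR_basic T U p q V"
    unfolding gtop_G by auto
  then show "\<exists>x p q y. \<gamma> = (x, int_diff p q, y) \<and> x \<in> M \<and> y \<in> M \<and> T p x = T q y"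
    unfolding DR_basic_def using openin_subset by blast
next
  assume "\<exists>x p q y. \<gamma> = (x, int_diff p q, y) \<and> x \<in> M \<and> y \<in> M \<and> T p x = T q y"
  then obtain p q where "\<gamma> \<in> DR_basic T M p q M" unfolding DR_basic_def by blast
  moreover have "DR_basic T M p q M \<in> {DR_basic T U p q V | U p q V. openin X U \<and> openin X V}"
    by (intro CollectI exI conjI refl) auto
  ultimately show "\<gamma> \<in> arrows G" unfolding gtop_G topology_generated_by_topspace by (rule UnionI[rotated])
qed

lemma arrowE:
  assumes "(x, m, y) \<in> arrows G"
  obtains p q where "m = int_diff p q" "x \<in> M" "y \<in> M" "T p x = T q y"
  using assms by (auto simp: arrows_iff)

text \<open>
  If \<open>p - q = p' - q'\<close>, then \<open>T p' x = T q' y\<close> implies \<open>T p' (T p x) = T p' (T q y)\<close>, and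
  \<open>T p'\<close> is injective near the common value of \<open>T p x\<^sub>0\<close> and \<open>T q y\<^sub>0\<close>.
\<close>

lemma local_implication:
  assumes x0: "x0 \<in> M" "y0 \<in> M" and d: "int_diff p q = int_diff p' q'" and eq: "T p x0 = T q y0"
  shows "\<exists>U V. openin X U \<and> openin X V \<and> x0 \<in> U \<and> y0 \<in> V \<and>
    (\<forall>x\<in>U. \<forall>y\<in>V. T p' x = T q' y \<longrightarrow> T p x = T q y)"
proof -
  obtain W where W: "openin X W" "T p x0 \<in> W" "inj_on (T p') W"
    by (rule T_locally_injective[OF T_in[OF x0(1)]])
  let ?U = "{x \<in> M. T p x \<in> W}" and ?V = "{y \<in> M. T q y \<in> W}"
  have "T p x = T q y" if "x \<in> ?U" "y \<in> ?V" "T p' x = T q' y" for x y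
  proof -
    have "T p' (T p x) = T p (T q' y)" using that T_swap[of x p' p] by simp
    also have "\<dots> = T (p + q') y" using that by (simp add: T_add)
    also have "\<dots> = T (p' + q) y" using d by (simp add: int_diff_eq_iff)
    also have "\<dots> = T p' (T q y)" using that by (simp add: T_add)
    finally show ?thesis using W(3) that by (auto dest: inj_onD)
  qed
  then show ?thesis
    using T_preimage_open[OF W(1)] x0 eq W(2) by (intro exI[of _ ?U] exI[of _ ?V]) auto
qed

lemma local_equivalence:
  assumes x0: "x0 \<in> M" "y0 \<in> M" and d: "int_diff p q = int_diff p' q'"
    and eq: "T p x0 = T q y0" "T p' x0 = T q' y0"
  shows "\<exists>U V. openin X U \<and> openin X V \<and> x0 \<in> U \<and> y0 \<in> V \<and>
    (\<forall>x\<in>U. \<forall>y\<in>V. T p' x = T q' y \<longleftrightarrow> T p x = T q y)"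
proof -
  obtain U V where 1: "openin X U" "openin X V" "x0 \<in> U" "y0 \<in> V"
    "\<forall>x\<in>U. \<forall>y\<in>V. T p' x = T q' y \<longrightarrow> T p x = T q y"
    using local_implication[OF x0 d eq(1)] by (elim exE conjE)
  obtain U' V' where 2: "openin X U'" "openin X V'" "x0 \<in> U'" "y0 \<in> V'"
    "\<forall>x\<in>U'. \<forall>y\<in>V'. T p x = T q y \<longrightarrow> T p' x = T q' y"
    using local_implication[OF x0 d[symmetric] eq(2)] by (elim exE conjE)
  show ?thesis
  proof (rule exI[of _ "U \<inter> U'"], rule exI[of _ "V \<inter> V'"], intro conjI ballI)
    fix x y assume "x \<in> U \<inter> U'" "y \<in> V \<inter> V'"
    then show "T p' x = T q' y \<longleftrightarrow> T p x = T q y" using 1(5) 2(5) by (metis IntD1 IntD2)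
  qed (use 1 2 in \<open>simp_all add: openin_Int\<close>)
qed

lemma G_openI:
  assumes "\<And>\<gamma>. \<gamma> \<in> Q \<Longrightarrow> \<exists>x p q y U V. \<gamma> = (x, int_diff p q, y) \<and> openin X U \<and> openin X V \<and>
      x \<in> U \<and> y \<in> V \<and> T p x = T q y \<and> DR_basic T U p q V \<subseteq> Q"
  shows "openin GT Q"
proof (subst openin_subopen, clarify)
  fix x m y assume "(x, m, y) \<in> Q"
  from assms[OF this] obtain p q U V where *: "m = int_diff p q" "openin X U" "openin X V"
      "x \<in> U" "y \<in> V" "T p x = T q y" "DR_basic T U p q V \<subseteq> Q" by blast
  have "openin GT (DR_basic T U p q V)"
    unfolding gtop_G by (rule topology_generated_by_Basis) (use * in blast)
  moreover have "(x, m, y) \<in> DR_basic T U p q V" using * by (auto simp: DR_basic_def)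
  ultimately show "\<exists>O'. openin GT O' \<and> (x, m, y) \<in> O' \<and> O' \<subseteq> Q" using *(7) by blast
qed

text \<open>
  The neighbourhoods of an arrow \<open>(x, p - q, y)\<close> are described by the given pair \<open>(p, q)\<close> alone:
  basic sets for other pairs with the same difference agree with it locally.
\<close>

lemma G_openD:
  assumes "openin GT Q" "(x, int_diff p q, y) \<in> Q" "x \<in> M" "y \<in> M" "T p x = T q y"
  shows "\<exists>U V. openin X U \<and> openin X V \<and> x \<in> U \<and> y \<in> V \<and> DR_basic T U p q V \<subseteq> Q"
proof -
  have "generate_topology_on {DR_basic T U p q V | U p q V. openin X U \<and> openin X V} Q"
    using assms(1) unfolding gtop_G by (rule openin_topology_generated_by)
  then show ?thesis using assms(2)
  proof (induction rule: generate_topology_on.induct)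
    case (Int a b)
    then obtain U V U' V' where "openin X U" "openin X V" "x \<in> U" "y \<in> V" "DR_basic T U p q V \<subseteq> a"
      "openin X U'" "openin X V'" "x \<in> U'" "y \<in> V'" "DR_basic T U' p q V' \<subseteq> b" by blast
    then show ?case
      by (intro exI[of _ "U \<inter> U'"] exI[of _ "V \<inter> V'"]) (auto simp: DR_basic_def)
  next
    case (UN K)
    then obtain k where "k \<in> K" "(x, int_diff p q, y) \<in> k" by blast
    then obtain U V where "openin X U" "openin X V" "x \<in> U" "y \<in> V" "DR_basic T U p q V \<subseteq> k"
      using UN.IH by blast
    then show ?case using \<open>k \<in> K\<close> by blast
  next
    case (Basis s)
    then obtain U' p' q' V' where s: "s = DR_basic T U' p' q' V'" "openin X U'" "openin X V'" by blast
    then have *: "int_diff p' q' = int_diff p q" "x \<in> U'" "y \<in> V'" "T p' x = T q' y"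
      using Basis.prems by (auto simp: DR_basic_def)
    obtain U V where UV: "openin X U" "openin X V" "x \<in> U" "y \<in> V"
      "\<forall>x\<in>U. \<forall>y\<in>V. T p x = T q y \<longrightarrow> T p' x = T q' y"
      using local_implication[OF assms(3,4) *(1) *(4)] by (elim exE conjE)
    then show ?case
      using s *(1-3) by (intro exI[of _ "U \<inter> U'"] exI[of _ "V \<inter> V'"]) (auto simp: DR_basic_def)
  qed simp
qed

end

subsection \<open>Elementary functions\<close>

lemma continuous_map_tendsto:
  fixes f :: "'x \<Rightarrow> 'b::real_normed_vector"
  shows "continuous_map X euclidean f \<longleftrightarrow> (\<forall>x\<in>topspace X. (f \<longlongrightarrow> f x) (atin X x))"
  by (simp add: continuous_map_atin)

context deaconu_renault
begin

text \<open>
  A local section \<open>y \<mapsto> (\<phi> y, p - q, y)\<close> of the source map. Near each of its points \<open>\<phi>\<close> is a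
  branch of \<open>(T p)\<^sup>-\<^sup>1 \<circ> T q\<close>, hence an open map.
\<close>

definition sect :: "nat ^ 'k \<Rightarrow> nat ^ 'k \<Rightarrow> 'x set \<Rightarrow> ('x \<Rightarrow> 'x) \<Rightarrow> bool" where
  "sect p q V \<phi> \<longleftrightarrow> openin X V \<and> continuous_map (subtopology X V) X \<phi> \<and> inj_on \<phi> V \<and> (\<forall>y\<in>V. T p (\<phi> y) = T q y)"

definition sg :: "nat ^ 'k \<Rightarrow> nat ^ 'k \<Rightarrow> ('x \<Rightarrow> 'x) \<Rightarrow> 'x \<Rightarrow> 'x \<times> (int ^ 'k) \<times> 'x" where
  "sg p q \<phi> y = (\<phi> y, int_diff p q, y)"

lemma sectD:
  assumes "sect p q V \<phi>"
  shows "openin X V" "V \<subseteq> M" "inj_on \<phi> V" "y \<in> V \<Longrightarrow> T p (\<phi> y) = T q y" "y \<in> V \<Longrightarrow> y \<in> M" "y \<in> V \<Longrightarrow> \<phi> y \<in> M"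
proof -
  show *: "openin X V" "inj_on \<phi> V" "y \<in> V \<Longrightarrow> T p (\<phi> y) = T q y" using assms by (auto simp: sect_def)
  show V: "V \<subseteq> M" by (rule openin_subset[OF *(1)])
  then show "y \<in> V \<Longrightarrow> y \<in> M" by blast
  show "y \<in> V \<Longrightarrow> \<phi> y \<in> M"
    using assms V unfolding sect_def continuous_map_def by auto
qed

lemma sect_preimage:
  assumes "sect p q V \<phi>" "openin X W" shows "openin X {y \<in> V. \<phi> y \<in> W}"
proof -
  have V: "openin X V" "V \<subseteq> M" by (rule sectD[OF assms(1)])+
  have "openin (subtopology X V) {y \<in> topspace (subtopology X V). \<phi> y \<in> W}"
    using assms by (intro openin_continuous_map_preimage) (auto simp: sect_def)
  moreover have "{y \<in> topspace (subtopology X V). \<phi> y \<in> W} = {y \<in> V. \<phi> y \<in> W}" using V(2) by auto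
  ultimately show ?thesis using V(1) openin_open_subtopology by metis
qed

lemma sect_exists:
  assumes x: "x \<in> M" "y \<in> M" "T p x = T q y"
  shows "\<exists>V \<phi>. sect p q V \<phi> \<and> y \<in> V \<and> \<phi> y = x"
proof -
  obtain U where U: "openin X U" "x \<in> U" "inj_on (T p) U" by (rule T_locally_injective[OF x(1)])
  obtain V0 where V0: "openin X V0" "y \<in> V0" "inj_on (T q) V0" by (rule T_locally_injective[OF x(2)])
  define V where "V = V0 \<inter> {y' \<in> M. T q y' \<in> T p ` U}"
  define \<phi> where "\<phi> y' = inv_into U (T p) (T q y')" for y'
  have UM: "U \<subseteq> M" by (rule openin_subset[OF U(1)])
  have V: "openin X V"
    unfolding V_def by (intro openin_Int V0 T_preimage_open local_homeo_open[OF T_local_homeo U(1)])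
  have VM: "V \<subseteq> M" by (rule openin_subset[OF V])
  have ph: "\<phi> y' \<in> U" "T p (\<phi> y') = T q y'" if "y' \<in> V" for y'
    using that unfolding \<phi>_def V_def by (auto intro: inv_into_into f_inv_into_f)
  have ph_eq: "\<phi> y' = u" if "u \<in> U" "T q y' = T p u" for y' u
    unfolding \<phi>_def that(2) by (rule inv_into_f_f[OF U(3) that(1)])
  have c: "continuous_map (subtopology X V) X \<phi>"
    unfolding continuous_map_def
  proof (intro conjI allI impI)
    show "\<phi> \<in> topspace (subtopology X V) \<rightarrow> M" using ph(1) UM by auto
    fix W assume W: "openin X W"
    have "openin X {y' \<in> M. T q y' \<in> T p ` (U \<inter> W)}"
      by (intro T_preimage_open local_homeo_open[OF T_local_homeo] openin_Int U W)
    then have "openin (subtopology X V) (V \<inter> {y' \<in> M. T q y' \<in> T p ` (U \<inter> W)})"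
      by (rule openin_subtopology_Int2)
    moreover have "{y' \<in> topspace (subtopology X V). \<phi> y' \<in> W} = V \<inter> {y' \<in> M. T q y' \<in> T p ` (U \<inter> W)}"
    proof (intro equalityI subsetI)
      fix y' assume "y' \<in> {y' \<in> topspace (subtopology X V). \<phi> y' \<in> W}"
      then have "y' \<in> V" "\<phi> y' \<in> W" "y' \<in> M" by auto
      then show "y' \<in> V \<inter> {y' \<in> M. T q y' \<in> T p ` (U \<inter> W)}"
        using ph[of y'] by (auto intro!: image_eqI[of _ "T p" "\<phi> y'"])
    next
      fix y' assume "y' \<in> V \<inter> {y' \<in> M. T q y' \<in> T p ` (U \<inter> W)}"
      then show "y' \<in> {y' \<in> topspace (subtopology X V). \<phi> y' \<in> W}" using ph_eq by auto
    qed
    ultimately show "openin (subtopology X V) {y' \<in> topspace (subtopology X V). \<phi> y' \<in> W}" by simp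
  qed
  have "inj_on \<phi> V"
  proof (rule inj_onI)
    fix a b assume ab: "a \<in> V" "b \<in> V" "\<phi> a = \<phi> b"
    then have "T q a = T q b" using ph(2)[of a] ph(2)[of b] by simp
    then show "a = b" using ab V0(3) unfolding V_def by (auto dest: inj_onD)
  qed
  then have "sect p q V \<phi>" using V c ph(2) by (simp add: sect_def)
  moreover have "T q y \<in> T p ` U" using imageI[OF U(2), of "T p"] x(3) by simp
  then have "y \<in> V" unfolding V_def using V0 x by simp
  moreover have "\<phi> y = x" by (rule ph_eq[OF U(2)]) (simp add: x)
  ultimately show ?thesis by blast
qed

lemma sect_restrict:
  assumes "sect p q V \<phi>" "openin X W" "W \<subseteq> V" shows "sect p q W \<phi>"
  using assms unfolding sect_def
  by (auto intro: continuous_map_from_subtopology_mono inj_on_subset)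

lemma sect_open_image:
  assumes s: "sect p q V \<phi>" and Q: "openin X Q" "Q \<subseteq> V"
  shows "openin X (\<phi> ` Q)"
proof (subst openin_subopen, clarify)
  fix y assume y: "y \<in> Q"
  note D = sectD[OF s]
  have yV: "y \<in> V" using y Q by blast
  obtain U where U: "openin X U" "\<phi> y \<in> U" "inj_on (T p) U" by (rule T_locally_injective[OF D(6)[OF yV]])
  have UM: "U \<subseteq> M" by (rule openin_subset[OF U(1)])
  define Q1 where "Q1 = Q \<inter> {y \<in> V. \<phi> y \<in> U}"
  have Q1: "openin X Q1" unfolding Q1_def by (intro openin_Int Q sect_preimage[OF s U(1)])
  define R where "R = U \<inter> {x \<in> M. T p x \<in> T q ` Q1}"
  have R: "openin X R"
    unfolding R_def by (intro openin_Int U T_preimage_open local_homeo_open[OF T_local_homeo Q1])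
  have "R \<subseteq> \<phi> ` Q"
  proof
    fix x assume "x \<in> R"
    then obtain y' where y': "x \<in> U" "y' \<in> Q1" "T p x = T q y'" by (auto simp: R_def)
    have "T p x = T p (\<phi> y')" using y' D(4)[of y'] by (simp add: Q1_def)
    then have "x = \<phi> y'" using U(3) y' by (auto simp: Q1_def dest: inj_onD)
    then show "x \<in> \<phi> ` Q" using y' by (auto simp: Q1_def)
  qed
  moreover have "\<phi> y \<in> R"
    using U y yV D(4)[OF yV] D(6)[OF yV] by (auto simp: R_def Q1_def intro!: image_eqI[of _ "T q" y])
  ultimately show "\<exists>W. openin X W \<and> \<phi> y \<in> W \<and> W \<subseteq> \<phi> ` Q" using R by blast
qed

lemma DR_basic_arrows: "U \<subseteq> M \<Longrightarrow> V \<subseteq> M \<Longrightarrow> DR_basic T U p q V \<subseteq> arrows G"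
  by (auto simp: DR_basic_def arrows_iff) blast

lemma sg_arrow: "sect p q V \<phi> \<Longrightarrow> y \<in> V \<Longrightarrow> sg p q \<phi> y \<in> arrows G"
  unfolding arrows_iff sg_def using sectD(4-6) by blast

lemma sg_open:
  assumes s: "sect p q V \<phi>" shows "openin GT (sg p q \<phi> ` V)"
proof (rule G_openI)
  fix \<gamma> assume "\<gamma> \<in> sg p q \<phi> ` V"
  then obtain y where y: "y \<in> V" and g: "\<gamma> = sg p q \<phi> y" by blast
  note D = sectD[OF s]
  obtain U where U: "openin X U" "\<phi> y \<in> U" "inj_on (T p) U" by (rule T_locally_injective[OF D(6)[OF y]])
  have "DR_basic T U p q {y \<in> V. \<phi> y \<in> U} \<subseteq> sg p q \<phi> ` V"
  proof
    fix \<gamma> assume "\<gamma> \<in> DR_basic T U p q {y \<in> V. \<phi> y \<in> U}"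
    then obtain x' y' where g: "\<gamma> = (x', int_diff p q, y')" "x' \<in> U" "y' \<in> V" "\<phi> y' \<in> U" "T p x' = T q y'"
      by (auto simp: DR_basic_def)
    have "T p x' = T p (\<phi> y')" using g D(4)[OF g(3)] by simp
    then have "x' = \<phi> y'" by (rule inj_onD[OF U(3) _ g(2,4)])
    then show "\<gamma> \<in> sg p q \<phi> ` V" using g by (auto simp: sg_def)
  qed
  then show "\<exists>x p' q' y' U V'. \<gamma> = (x, int_diff p' q', y') \<and> openin X U \<and> openin X V' \<and>
      x \<in> U \<and> y' \<in> V' \<and> T p' x = T q' y' \<and> DR_basic T U p' q' V' \<subseteq> sg p q \<phi> ` V"
    using U y D(4)[OF y] sect_preimage[OF s U(1)]
    by (intro exI[of _ "\<phi> y"] exI[of _ p] exI[of _ q] exI[of _ y] exI[of _ U] exI[of _ "{y \<in> V. \<phi> y \<in> U}"])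
      (simp add: sg_def g)
qed

lemma sg_continuous:
  assumes s: "sect p q V \<phi>" shows "continuous_map (subtopology X V) GT (sg p q \<phi>)"
  unfolding continuous_map_def
proof (intro conjI allI impI)
  note D = sectD[OF s]
  show "sg p q \<phi> \<in> topspace (subtopology X V) \<rightarrow> arrows G" using sg_arrow[OF s] by auto
  fix W assume W: "openin GT W"
  have "openin X {y \<in> V. sg p q \<phi> y \<in> W}"
  proof (subst openin_subopen, clarify)
    fix y assume y: "y \<in> V" "sg p q \<phi> y \<in> W"
    obtain U' V' where UV: "openin X U'" "openin X V'" "\<phi> y \<in> U'" "y \<in> V'" "DR_basic T U' p q V' \<subseteq> W"
      using G_openD[OF W y(2)[unfolded sg_def] D(6)[OF y(1)] D(5)[OF y(1)] D(4)[OF y(1)]] by blast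
    have "{y \<in> V. \<phi> y \<in> U'} \<inter> V' \<subseteq> {y \<in> V. sg p q \<phi> y \<in> W}"
    proof
      fix y' assume "y' \<in> {y \<in> V. \<phi> y \<in> U'} \<inter> V'"
      then have "y' \<in> V" "sg p q \<phi> y' \<in> DR_basic T U' p q V'"
        using D(4) by (auto simp: sg_def DR_basic_def)
      then show "y' \<in> {y \<in> V. sg p q \<phi> y \<in> W}" using UV(5) by blast
    qed
    then show "\<exists>Q. openin X Q \<and> y \<in> Q \<and> Q \<subseteq> {y \<in> V. sg p q \<phi> y \<in> W}"
      using UV y sect_preimage[OF s UV(1)]
      by (intro exI[of _ "{y \<in> V. \<phi> y \<in> U'} \<inter> V'"]) (simp add: openin_Int)
  qed
  moreover have "{y \<in> topspace (subtopology X V). sg p q \<phi> y \<in> W} = {y \<in> V. sg p q \<phi> y \<in> W}"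
    using D(2) by auto
  ultimately show "openin (subtopology X V) {y \<in> topspace (subtopology X V). sg p q \<phi> y \<in> W}"
    using D(1) by (simp add: openin_open_subtopology)
qed

text \<open>
  Arrows outside the image of \<open>K\<close> are separated from it by their degree, by their source, or else
  by their range, where \<open>X\<close> is Hausdorff.
\<close>

lemma sg_compact:
  assumes s: "sect p q V \<phi>" and K: "compactin X K" "K \<subseteq> V"
  shows "compactin GT (sg p q \<phi> ` K)" "closedin GT (sg p q \<phi> ` K)"
proof -
  note D = sectD[OF s]
  show "compactin GT (sg p q \<phi> ` K)"
    using K by (intro image_compactin[OF _ sg_continuous[OF s]]) (simp add: compactin_subtopology)
  have Kc: "closedin X K" by (rule compactin_imp_closedin[OF Hausdorff K(1)])
  have "openin GT (arrows G - sg p q \<phi> ` K)"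
  proof (rule G_openI)
    fix \<gamma> assume g: "\<gamma> \<in> arrows G - sg p q \<phi> ` K"
    then obtain x0 p0 q0 y0 where g0: "\<gamma> = (x0, int_diff p0 q0, y0)" "x0 \<in> M" "y0 \<in> M" "T p0 x0 = T q0 y0"
      by (auto simp: arrows_iff)
    have "\<exists>U V'. openin X U \<and> openin X V' \<and> x0 \<in> U \<and> y0 \<in> V' \<and>
        (\<forall>x\<in>U. \<forall>y\<in>V'. (x, int_diff p0 q0, y) \<notin> sg p q \<phi> ` K)"
    proof (cases "int_diff p0 q0 = int_diff p q \<and> y0 \<in> K")
      case True
      then have "x0 \<noteq> \<phi> y0" "y0 \<in> V" using g g0 K(2) by (auto simp: sg_def)
      then obtain U U' where U: "openin X U" "openin X U'" "x0 \<in> U" "\<phi> y0 \<in> U'" "disjnt U U'"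
        using Hausdorff g0(2) D(6) unfolding Hausdorff_space_def by metis
      then have "\<forall>x\<in>U. \<forall>y\<in>{y \<in> V. \<phi> y \<in> U'}. (x, int_diff p0 q0, y) \<notin> sg p q \<phi> ` K"
        by (auto simp: sg_def disjnt_iff)
      then show ?thesis using U \<open>y0 \<in> V\<close> sect_preimage[OF s U(2)] by blast
    next
      case False
      then show ?thesis
      proof (cases "y0 \<in> K")
        case True
        then have "\<forall>x\<in>M. \<forall>y\<in>M. (x, int_diff p0 q0, y) \<notin> sg p q \<phi> ` K"
          using False by (auto simp: sg_def)
        then show ?thesis using g0 by blast
      next
        case False
        have "\<forall>x\<in>M. \<forall>y\<in>M - K. (x, int_diff p0 q0, y) \<notin> sg p q \<phi> ` K" by (auto simp: sg_def)
        moreover have "openin X (M - K)" using Kc by blast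
        ultimately show ?thesis using g0 False by blast
      qed
    qed
    then obtain U V' where UV: "openin X U" "openin X V'" "x0 \<in> U" "y0 \<in> V'"
        "\<forall>x\<in>U. \<forall>y\<in>V'. (x, int_diff p0 q0, y) \<notin> sg p q \<phi> ` K" by blast
    have "DR_basic T U p0 q0 V' \<subseteq> arrows G - sg p q \<phi> ` K"
    proof
      fix \<delta> assume d: "\<delta> \<in> DR_basic T U p0 q0 V'"
      then have "\<delta> \<in> arrows G"
        using DR_basic_arrows[OF openin_subset[OF UV(1)] openin_subset[OF UV(2)]] by blast
      moreover obtain x y where "\<delta> = (x, int_diff p0 q0, y)" "x \<in> U" "y \<in> V'"
        using d unfolding DR_basic_def by auto
      ultimately show "\<delta> \<in> arrows G - sg p q \<phi> ` K" using UV(5) by simp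
    qed
    then show "\<exists>x p' q' y U V'. \<gamma> = (x, int_diff p' q', y) \<and> openin X U \<and> openin X V' \<and> x \<in> U \<and> y \<in> V' \<and>
        T p' x = T q' y \<and> DR_basic T U p' q' V' \<subseteq> arrows G - sg p q \<phi> ` K"
      using g0 UV(1-4)
      by (intro exI[of _ x0] exI[of _ p0] exI[of _ q0] exI[of _ y0] exI[of _ U] exI[of _ V']) simp
  qed
  moreover have "sg p q \<phi> ` K \<subseteq> arrows G" using sg_arrow[OF s] K(2) by blast
  ultimately show "closedin GT (sg p q \<phi> ` K)" by (simp add: closedin_def)
qed

definition bump :: "'x set \<Rightarrow> ('x \<Rightarrow> complex) \<Rightarrow> bool" where
  "bump V h \<longleftrightarrow> continuous_map X euclidean h \<and> (\<exists>K. compactin X K \<and> K \<subseteq> V \<and> (\<forall>y. y \<notin> K \<longrightarrow> h y = 0))"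

text \<open>
  The function that vanishes off the open bisection \<open>{(\<phi> y, p - q, y) | y \<in> V}\<close> and corresponds
  to \<open>h\<close> on it, when the bisection is identified with \<open>V\<close> by the source map.
\<close>

definition elemf :: "nat ^ 'k \<Rightarrow> nat ^ 'k \<Rightarrow> 'x set \<Rightarrow> ('x \<Rightarrow> 'x) \<Rightarrow> ('x \<Rightarrow> complex) \<Rightarrow> 'x \<times> (int ^ 'k) \<times> 'x \<Rightarrow> complex" where
  "elemf p q V \<phi> h = (\<lambda>(x, m, y). if m = int_diff p q \<and> y \<in> V \<and> x = \<phi> y then h y else 0)"

lemma elemf_sg: "y \<in> V \<Longrightarrow> elemf p q V \<phi> h (sg p q \<phi> y) = h y"
  by (simp add: elemf_def sg_def)

lemma elemf_nonzero: "elemf p q V \<phi> h \<gamma> \<noteq> 0 \<Longrightarrow> \<exists>y\<in>V. \<gamma> = sg p q \<phi> y \<and> h y \<noteq> 0"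
  by (auto simp: elemf_def sg_def split: prod.splits if_splits)

lemma elemf_Cc:
  assumes s: "sect p q V \<phi>" and h: "bump V h"
  shows "elemf p q V \<phi> h \<in> Cc G"
proof -
  note D = sectD[OF s]
  let ?e = "elemf p q V \<phi> h"
  obtain K where K: "compactin X K" "K \<subseteq> V" "\<forall>y. y \<notin> K \<longrightarrow> h y = 0"
    and hc: "continuous_map X euclidean h" using h by (auto simp: bump_def)
  note cl = sg_compact[OF s K(1,2)]
  have off: "?e \<gamma> = 0" if "\<gamma> \<notin> sg p q \<phi> ` K" for \<gamma>
  proof (rule ccontr)
    assume "?e \<gamma> \<noteq> 0"
    from elemf_nonzero[OF this] obtain y where "y \<in> V" "\<gamma> = sg p q \<phi> y" "h y \<noteq> 0" by blast
    then show False using that K(3) by blast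
  qed
  have sub: "sg p q \<phi> ` K \<subseteq> arrows G" using closedin_subset[OF cl(2)] .
  have "continuous_map GT euclidean ?e"
    unfolding continuous_map_def
  proof (intro conjI allI impI)
    fix W :: "complex set" assume W: "openin euclidean W"
    let ?Q = "{y \<in> V. h y \<in> W}"
    have "openin X {y \<in> M. h y \<in> W}" by (rule openin_continuous_map_preimage[OF hc W])
    then have "openin X (V \<inter> {y \<in> M. h y \<in> W})" using D(1) by blast
    moreover have "V \<inter> {y \<in> M. h y \<in> W} = ?Q" using D(2) by auto
    ultimately have Q: "openin X ?Q" by simp
    have Qs: "openin GT (sg p q \<phi> ` ?Q)" by (rule sg_open[OF sect_restrict[OF s Q]]) auto
    have Z: "openin GT (if 0 \<in> W then arrows G - sg p q \<phi> ` K else {})"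
      using cl(2) by (simp add: openin_diff)
    have "{\<gamma> \<in> arrows G. ?e \<gamma> \<in> W} = (if 0 \<in> W then arrows G - sg p q \<phi> ` K else {}) \<union> sg p q \<phi> ` ?Q"
    proof (intro equalityI subsetI)
      fix \<gamma> assume g: "\<gamma> \<in> {\<gamma> \<in> arrows G. ?e \<gamma> \<in> W}"
      show "\<gamma> \<in> (if 0 \<in> W then arrows G - sg p q \<phi> ` K else {}) \<union> sg p q \<phi> ` ?Q"
      proof (cases "\<gamma> \<in> sg p q \<phi> ` K")
        case True
        then obtain y where y: "y \<in> K" "\<gamma> = sg p q \<phi> y" by blast
        have "y \<in> V" using y K(2) by blast
        then have "h y \<in> W" using g y elemf_sg[of y V p q \<phi> h] by simp
        then show ?thesis using y \<open>y \<in> V\<close> by blast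
      next
        case False
        then show ?thesis using off[OF False] g by simp
      qed
    next
      fix \<gamma> assume g: "\<gamma> \<in> (if 0 \<in> W then arrows G - sg p q \<phi> ` K else {}) \<union> sg p q \<phi> ` ?Q"
      show "\<gamma> \<in> {\<gamma> \<in> arrows G. ?e \<gamma> \<in> W}"
      proof (cases "\<gamma> \<in> sg p q \<phi> ` ?Q")
        case True
        then obtain y where "y \<in> V" "h y \<in> W" "\<gamma> = sg p q \<phi> y" by blast
        then show ?thesis using elemf_sg[of y V p q \<phi> h] sg_arrow[OF s] by simp
      next
        case False
        then have "0 \<in> W" "\<gamma> \<in> arrows G" "\<gamma> \<notin> sg p q \<phi> ` K" using g by (auto split: if_splits)
        then show ?thesis using off by simp
      qed
    qed
    then show "openin GT {\<gamma> \<in> arrows G. ?e \<gamma> \<in> W}" using Qs Z by (simp only: openin_Un)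
  qed simp
  moreover have "compactin GT (GT closure_of {\<gamma> \<in> arrows G. ?e \<gamma> \<noteq> 0})"
  proof (rule closed_compactin[OF cl(1)])
    show "GT closure_of {\<gamma> \<in> arrows G. ?e \<gamma> \<noteq> 0} \<subseteq> sg p q \<phi> ` K"
      by (rule closure_of_minimal[OF _ cl(2)]) (use off in auto)
  qed simp
  moreover have "\<forall>\<gamma>. \<gamma> \<notin> arrows G \<longrightarrow> ?e \<gamma> = 0" using off sub by blast
  ultimately show ?thesis by (simp add: Cc_def)
qed

definition elementary :: "('x \<times> (int ^ 'k) \<times> 'x \<Rightarrow> complex) \<Rightarrow> bool" where
  "elementary f \<longleftrightarrow> (\<exists>p q V \<phi> h. sect p q V \<phi> \<and> bump V h \<and> f = elemf p q V \<phi> h)"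

lemma bump_exists:
  assumes V: "openin X V" "y \<in> V"
  shows "\<exists>h. bump V (\<lambda>x. complex_of_real (h x)) \<and> h y = 1 \<and> (\<forall>x. 0 \<le> h x \<and> h x \<le> 1)"
proof -
  have "neighbourhood_base_of (compactin X) X"
    using locally_compact Hausdorff by (simp add: locally_compact_space_neighbourhood_base)
  then obtain U K where UK: "openin X U" "compactin X K" "y \<in> U" "U \<subseteq> K" "K \<subseteq> V"
    using V unfolding neighbourhood_base_of by metis
  have "completely_regular_space X"
    using locally_compact_Hausdorff_imp_regular_space[OF locally_compact Hausdorff]
    by (intro locally_compact_regular_imp_completely_regular_space locally_compact)
      (simp add: Hausdorff)
  moreover have "closedin X (M - U)" "y \<in> M - (M - U)" using UK(1,3) openin_subset[OF V(1)] V(2) by auto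
  ultimately obtain g :: "'x \<Rightarrow> real" where g: "continuous_map X (top_of_set {0..1}) g" "g y = 0" "g ` (M - U) \<subseteq> {1}"
    unfolding completely_regular_space_def by blast
  have gc: "continuous_map X euclideanreal g" using g(1) continuous_map_in_subtopology by blast
  define h where "h x = (if x \<in> U then 1 - g x else 0)" for x
  have UM: "U \<subseteq> M" by (rule openin_subset[OF UK(1)])
  have hM: "h x = 1 - g x" if "x \<in> M" for x using g(3) that by (auto simp: h_def)
  have "continuous_map X euclideanreal (\<lambda>x. 1 - g x)"
    by (intro continuous_map_diff gc) simp
  then have hc: "continuous_map X euclideanreal h" by (rule continuous_map_eq) (simp add: hM)
  have "continuous_map X euclidean (\<lambda>x. complex_of_real (h x))"
    using hc unfolding continuous_map_tendsto by (auto intro: tendsto_of_real)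
  moreover have "\<forall>x. x \<notin> K \<longrightarrow> h x = 0" using UK(4) by (auto simp: h_def)
  ultimately have "bump V (\<lambda>x. complex_of_real (h x))" using UK by (auto simp: bump_def)
  moreover have "h y = 1" using UK(3) g(2) by (simp add: h_def)
  moreover have "0 \<le> h x \<and> h x \<le> 1" for x
  proof (cases "x \<in> U")
    case True
    then have "g x \<in> {0..1}" using g(1) UM unfolding continuous_map_in_subtopology by (auto simp: Pi_iff)
    then show ?thesis using True by (simp add: h_def)
  qed (simp add: h_def)
  ultimately show ?thesis by blast
qed

end

(* Quantifiers over arrows stay quantifiers over one variable. *)
declare split_paired_All [simp del] split_paired_Ex [simp del]

context deaconu_renault
begin

lemma CcD:
  assumes "f \<in> Cc G"
  shows "continuous_map GT euclidean f" "\<gamma> \<notin> arrows G \<Longrightarrow> f \<gamma> = 0"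
    "compactin GT (GT closure_of {\<gamma> \<in> arrows G. f \<gamma> \<noteq> 0})"
  using assms unfolding Cc_def by blast+

lemma CcI:
  assumes "continuous_map GT euclidean f" "\<And>\<gamma>. \<gamma> \<notin> arrows G \<Longrightarrow> f \<gamma> = 0"
    "compactin GT (GT closure_of {\<gamma> \<in> arrows G. f \<gamma> \<noteq> 0})"
  shows "f \<in> Cc G"
  using assms unfolding Cc_def by blast

lemma Cc_zero: "(\<lambda>_. 0) \<in> Cc G"
  by (rule CcI) simp_all

lemma Cc_add:
  assumes "f \<in> Cc G" "g \<in> Cc G" shows "(\<lambda>\<gamma>. f \<gamma> + g \<gamma>) \<in> Cc G"
proof -
  have "GT closure_of {\<gamma> \<in> arrows G. f \<gamma> + g \<gamma> \<noteq> 0}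
      \<subseteq> GT closure_of ({\<gamma> \<in> arrows G. f \<gamma> \<noteq> 0} \<union> {\<gamma> \<in> arrows G. g \<gamma> \<noteq> 0})"
    by (rule closure_of_mono) auto
  then have "GT closure_of {\<gamma> \<in> arrows G. f \<gamma> + g \<gamma> \<noteq> 0}
      \<subseteq> GT closure_of {\<gamma> \<in> arrows G. f \<gamma> \<noteq> 0} \<union> GT closure_of {\<gamma> \<in> arrows G. g \<gamma> \<noteq> 0}"
    by simp
  then have "compactin GT (GT closure_of {\<gamma> \<in> arrows G. f \<gamma> + g \<gamma> \<noteq> 0})"
    by (intro closed_compactin[OF compactin_Un[OF CcD(3)[OF assms(1)] CcD(3)[OF assms(2)]]]) simp_all
  moreover have "continuous_map GT euclidean (\<lambda>\<gamma>. f \<gamma> + g \<gamma>)"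
    by (intro continuous_map_add CcD(1) assms)
  ultimately show ?thesis using CcD(2)[OF assms(1)] CcD(2)[OF assms(2)] by (intro CcI) simp_all
qed

lemma Cc_smul:
  assumes "f \<in> Cc G" shows "(\<lambda>\<gamma>. c * f \<gamma>) \<in> Cc G"
proof -
  have "GT closure_of {\<gamma> \<in> arrows G. c * f \<gamma> \<noteq> 0} \<subseteq> GT closure_of {\<gamma> \<in> arrows G. f \<gamma> \<noteq> 0}"
    by (rule closure_of_mono) auto
  then have "compactin GT (GT closure_of {\<gamma> \<in> arrows G. c * f \<gamma> \<noteq> 0})"
    by (intro closed_compactin[OF CcD(3)[OF assms]]) simp_all
  moreover have "continuous_map GT euclidean (\<lambda>\<gamma>. c * f \<gamma>)"
    using CcD(1)[OF assms] unfolding continuous_map_tendsto by (auto intro: tendsto_mult_left)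
  ultimately show ?thesis using CcD(2)[OF assms] by (intro CcI) simp_all
qed

inductive elem_span :: "('x \<times> (int ^ 'k) \<times> 'x \<Rightarrow> complex) \<Rightarrow> bool" where
  zero: "elem_span (\<lambda>_. 0)"
| plus: "elementary e \<Longrightarrow> elem_span f \<Longrightarrow> elem_span (\<lambda>\<gamma>. e \<gamma> + f \<gamma>)"

lemma elementary_Cc: "elementary e \<Longrightarrow> e \<in> Cc G"
  by (auto simp: elementary_def elemf_Cc)

lemma elem_span_Cc: "elem_span f \<Longrightarrow> f \<in> Cc G"
  by (induction rule: elem_span.induct) (simp_all add: Cc_zero Cc_add elementary_Cc)

lemma elem_span_sum:
  assumes "finite I" "\<And>i. i \<in> I \<Longrightarrow> elementary (e i)"
  shows "elem_span (\<lambda>\<gamma>. \<Sum>i\<in>I. e i \<gamma>)"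
  using assms by (induction I rule: finite_induct) (auto intro: elem_span.intros)

lemma bump_on_section:
  assumes V: "openin X V" and hb: "bump V h" and g: "continuous_map (subtopology X V) euclidean g"
  shows "bump V (\<lambda>y. if y \<in> V then g y * h y else 0)"
proof -
  obtain K where K: "compactin X K" "K \<subseteq> V" "\<forall>y. y \<notin> K \<longrightarrow> h y = 0" and hc: "continuous_map X euclidean h"
    using hb by (auto simp: bump_def)
  have Kc: "closedin X K" by (rule compactin_imp_closedin[OF Hausdorff K(1)])
  have VM: "V \<subseteq> M" by (rule openin_subset[OF V])
  have "continuous_map (subtopology X V) euclidean (\<lambda>y. g y * h y)"
    using g continuous_map_from_subtopology[OF hc, of V] unfolding continuous_map_tendsto
    by (auto intro: tendsto_mult)
  then have "continuous_map (subtopology X V) euclidean (\<lambda>y. if y \<in> V then g y * h y else 0)"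
    by (rule continuous_map_eq) auto
  then have "continuous_map X euclidean (\<lambda>y. if y \<in> V then g y * h y else 0)"
    by (rule continuous_map_zero_extension[OF V Kc K(2)]) (use K(3) in auto)
  then show ?thesis using K by (auto simp: bump_def)
qed

text \<open>
  A partition of unity: finitely many bumps sum to at least \<open>1/2\<close> on the support of \<open>f\<close>, and
  \<open>f\<close> is distributed over them in proportion.
\<close>

lemma Cc_elem_span:
  assumes f: "f \<in> Cc G" shows "elem_span f"
proof -
  define K where "K = GT closure_of {\<gamma> \<in> arrows G. f \<gamma> \<noteq> 0}"
  have K: "compactin GT K" unfolding K_def by (rule CcD(3)[OF f])
  have KG: "K \<subseteq> arrows G" unfolding K_def by (rule closure_of_subset_topspace)
  have fK: "f \<gamma> = 0" if "\<gamma> \<notin> K" for \<gamma>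
  proof (rule ccontr)
    assume "f \<gamma> \<noteq> 0"
    then have "\<gamma> \<in> {\<gamma> \<in> arrows G. f \<gamma> \<noteq> 0}" using CcD(2)[OF f] by blast
    then show False using that closure_of_subset[of "{\<gamma> \<in> arrows G. f \<gamma> \<noteq> 0}" GT] unfolding K_def by blast
  qed
  have "\<exists>p q V \<phi> h. sect p q V \<phi> \<and> bump V (\<lambda>y. complex_of_real (h y)) \<and> (\<forall>y. 0 \<le> h y \<and> h y \<le> 1) \<and>
      elemf p q V \<phi> (\<lambda>y. complex_of_real (h y)) \<gamma> = 1" if gK: "\<gamma> \<in> K" for \<gamma>
  proof -
    have "\<gamma> \<in> arrows G" using gK KG by blast
    then obtain x p q y where g: "\<gamma> = (x, int_diff p q, y)" "x \<in> M" "y \<in> M" "T p x = T q y"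
      unfolding arrows_iff by (elim exE conjE)
    obtain V \<phi> where V: "sect p q V \<phi>" "y \<in> V" "\<phi> y = x" using sect_exists[OF g(2-4)] by blast
    obtain h where h: "bump V (\<lambda>x. complex_of_real (h x))" "h y = 1" "\<forall>x. 0 \<le> h x \<and> h x \<le> 1"
      using bump_exists[OF sectD(1)[OF V(1)] V(2)] by blast
    have "elemf p q V \<phi> (\<lambda>y. complex_of_real (h y)) \<gamma> = 1"
      using V h(2) by (simp add: elemf_def g(1))
    then show ?thesis using V(1) h by blast
  qed
  then obtain P Q V \<Phi> h where sec: "\<And>\<gamma>. \<gamma> \<in> K \<Longrightarrow> sect (P \<gamma>) (Q \<gamma>) (V \<gamma>) (\<Phi> \<gamma>)"
    and bmp: "\<And>\<gamma>. \<gamma> \<in> K \<Longrightarrow> bump (V \<gamma>) (\<lambda>y. complex_of_real (h \<gamma> y))"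
    and pos: "\<And>\<gamma> y. \<gamma> \<in> K \<Longrightarrow> 0 \<le> h \<gamma> y \<and> h \<gamma> y \<le> 1"
    and one: "\<And>\<gamma>. \<gamma> \<in> K \<Longrightarrow> elemf (P \<gamma>) (Q \<gamma>) (V \<gamma>) (\<Phi> \<gamma>) (\<lambda>y. complex_of_real (h \<gamma> y)) \<gamma> = 1"
    by metis
  define E where "E \<gamma> = elemf (P \<gamma>) (Q \<gamma>) (V \<gamma>) (\<Phi> \<gamma>) (\<lambda>y. complex_of_real (h \<gamma> y))" for \<gamma>
  have Ec: "continuous_map GT euclidean (E \<gamma>)" if "\<gamma> \<in> K" for \<gamma>
    unfolding E_def by (rule CcD(1)[OF elemf_Cc[OF sec[OF that] bmp[OF that]]])
  have Ere: "E \<gamma> \<delta> = complex_of_real (Re (E \<gamma> \<delta>))" for \<gamma> \<delta>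
    by (cases \<delta>) (simp add: E_def elemf_def)
  have REc: "continuous_map GT euclideanreal (\<lambda>\<delta>. Re (E \<gamma> \<delta>))" if "\<gamma> \<in> K" for \<gamma>
    using Ec[OF that] unfolding continuous_map_tendsto by (auto intro: tendsto_Re)
  define B where "B \<gamma> = {\<delta> \<in> arrows G. Re (E \<gamma> \<delta>) \<in> {1/2<..}}" for \<gamma>
  have Bo: "openin GT (B \<gamma>)" if "\<gamma> \<in> K" for \<gamma>
    unfolding B_def by (rule openin_continuous_map_preimage[OF REc[OF that]]) simp
  have "K \<subseteq> \<Union> (B ` K)"
  proof
    fix \<gamma> assume g: "\<gamma> \<in> K"
    then have "\<gamma> \<in> B \<gamma>" using one[OF g] KG by (auto simp: B_def E_def)
    then show "\<gamma> \<in> \<Union> (B ` K)" using g by blast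
  qed
  moreover have "\<And>U. U \<in> B ` K \<Longrightarrow> openin GT U" using Bo by blast
  ultimately obtain \<F> where F: "finite \<F>" "\<F> \<subseteq> B ` K" "K \<subseteq> \<Union> \<F>"
    using compactinD[OF K, of "B ` K"] by blast
  obtain I where I: "I \<subseteq> K" "finite I" "\<F> = B ` I" using finite_subset_image[OF F(1,2)] by blast
  \<comment> \<open>the maximum changes nothing on \<open>K\<close> and makes \<open>H\<close> a continuous divisor everywhere\<close>
  define H where "H \<delta> = max (1/2) (\<Sum>\<gamma>\<in>I. Re (E \<gamma> \<delta>))" for \<delta>
  have Hc: "continuous_map GT euclideanreal H"
    unfolding H_def using I REc
    by (intro continuous_map_real_max continuous_map_sum) (simp_all add: subset_iff)
  have H0: "H \<delta> > 0" for \<delta> by (simp add: H_def)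
  have Epos: "0 \<le> Re (E \<gamma> \<delta>)" if "\<gamma> \<in> K" for \<gamma> \<delta>
    using pos[OF that] by (cases \<delta>) (simp add: E_def elemf_def)
  have HK: "complex_of_real (H \<delta>) = (\<Sum>\<gamma>\<in>I. E \<gamma> \<delta>)" if dK: "\<delta> \<in> K" for \<delta>
  proof -
    obtain \<gamma> where g: "\<gamma> \<in> I" "\<delta> \<in> B \<gamma>" using dK F(3) I(3) by blast
    have "Re (E \<gamma> \<delta>) \<le> (\<Sum>\<gamma>\<in>I. Re (E \<gamma> \<delta>))"
      by (rule member_le_sum[OF g(1) _ I(2)]) (rule Epos[OF subsetD[OF I(1) DiffD1]])
    then have "H \<delta> = (\<Sum>\<gamma>\<in>I. Re (E \<gamma> \<delta>))" using g(2) by (simp add: H_def B_def)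
    then show ?thesis using Ere by simp
  qed
  define k where "k \<gamma> y = (if y \<in> V \<gamma> then
      f (sg (P \<gamma>) (Q \<gamma>) (\<Phi> \<gamma>) y) / complex_of_real (H (sg (P \<gamma>) (Q \<gamma>) (\<Phi> \<gamma>) y)) * complex_of_real (h \<gamma> y) else 0)" for \<gamma> y
  have "elementary (\<lambda>\<delta>. f \<delta> / H \<delta> * E \<gamma> \<delta>)" if g: "\<gamma> \<in> K" for \<gamma>
  proof -
    let ?s = "sg (P \<gamma>) (Q \<gamma>) (\<Phi> \<gamma>)"
    have "continuous_map GT euclidean (\<lambda>\<delta>. f \<delta> / complex_of_real (H \<delta>))"
      using CcD(1)[OF f] Hc H0 unfolding continuous_map_tendsto
      by (auto intro!: tendsto_divide tendsto_of_real simp: less_imp_neq[symmetric])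
    then have "continuous_map (subtopology X (V \<gamma>)) euclidean (\<lambda>y. f (?s y) / complex_of_real (H (?s y)))"
      using continuous_map_compose[OF sg_continuous[OF sec[OF g]]] by (simp add: o_def)
    then have "bump (V \<gamma>) (k \<gamma>)"
      unfolding k_def by (rule bump_on_section[OF sectD(1)[OF sec[OF g]] bmp[OF g]])
    moreover have "(\<lambda>\<delta>. f \<delta> / H \<delta> * E \<gamma> \<delta>) = elemf (P \<gamma>) (Q \<gamma>) (V \<gamma>) (\<Phi> \<gamma>) (k \<gamma>)"
      by (rule ext) (auto simp: E_def elemf_def k_def sg_def)
    ultimately show ?thesis unfolding elementary_def using sec[OF g] by blast
  qed
  then have "elem_span (\<lambda>\<delta>. \<Sum>\<gamma>\<in>I. f \<delta> / H \<delta> * E \<gamma> \<delta>)"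
    using I by (intro elem_span_sum) auto
  moreover have "(\<Sum>\<gamma>\<in>I. f \<delta> / H \<delta> * E \<gamma> \<delta>) = f \<delta>" for \<delta>
  proof (cases "\<delta> \<in> K")
    case True
    have "(\<Sum>\<gamma>\<in>I. f \<delta> / H \<delta> * E \<gamma> \<delta>) = f \<delta> / complex_of_real (H \<delta>) * complex_of_real (H \<delta>)"
      unfolding HK[OF True] sum_distrib_left ..
    then show ?thesis using H0[of \<delta>] by simp
  qed (simp add: fK)
  ultimately show ?thesis by simp
qed

text \<open>
  Statements that are additive in \<open>f\<close> need only be checked on elementary functions.
\<close>

lemma Cc_induct [consumes 1, case_names zero plus]:
  assumes "f \<in> Cc G" "P (\<lambda>_. 0)"
    and "\<And>e f. elementary e \<Longrightarrow> f \<in> Cc G \<Longrightarrow> P e \<Longrightarrow> P f \<Longrightarrow> P (\<lambda>\<gamma>. e \<gamma> + f \<gamma>)"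
    and el: "\<And>e. elementary e \<Longrightarrow> P e"
  shows "P f"
  using Cc_elem_span[OF assms(1)]
  by (induction rule: elem_span.induct) (use assms(2,3) el elem_span_Cc in auto)

subsection \<open>Convolution\<close>

text \<open>
  The support of \<open>f\<close> in the range fibre over \<open>x\<close>. It is finite, so convolution and the
  representations on orbits are given by finite sums.
\<close>

definition row :: "('x \<times> (int ^ 'k) \<times> 'x \<Rightarrow> complex) \<Rightarrow> 'x \<Rightarrow> ((int ^ 'k) \<times> 'x) set" where
  "row f x = {(m, y). f (x, m, y) \<noteq> 0}"

lemma row_finite: "f \<in> Cc G \<Longrightarrow> finite (row f x)"
proof (induction rule: Cc_induct)
  case (plus e f)
  have "row (\<lambda>\<gamma>. e \<gamma> + f \<gamma>) x \<subseteq> row e x \<union> row f x" by (auto simp: row_def)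
  then show ?case by (rule finite_subset) (simp add: plus)
next
  fix e assume "elementary e"
  then obtain p q V \<phi> h where e: "sect p q V \<phi>" "e = elemf p q V \<phi> h" by (auto simp: elementary_def)
  have "row e x \<subseteq> Pair (int_diff p q) ` {y \<in> V. \<phi> y = x}"
    by (auto simp: row_def e(2) elemf_def split: if_splits)
  moreover have "finite {y \<in> V. \<phi> y = x}"
    by (rule inj_on_finite[OF inj_on_subset[OF sectD(3)[OF e(1)]], of _ "{x}"]) auto
  ultimately show "finite (row e x)" by (rule finite_subset[OF _ finite_imageI])
qed (simp add: row_def)

lemma convolution_sum:
  assumes f: "f \<in> Cc G" and g: "g \<in> Cc G" and R: "finite R" "row f x \<subseteq> R"
  shows "convolution G f g (x, l, w) = (\<Sum>(m, y)\<in>R. f (x, m, y) * g (y, l - m, w))"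
proof -
  let ?I = "{(\<alpha>, \<beta>). \<alpha> \<in> arrows G \<and> \<beta> \<in> arrows G \<and> src G \<alpha> = rng G \<beta> \<and> comp G \<alpha> \<beta> = (x, l, w)}"
  let ?j = "\<lambda>(m, y). ((x, m, y), (y, l - m, w))"
  have inj: "inj_on ?j R" by (auto simp: inj_on_def)
  have "convolution G f g (x, l, w) = (\<Sum>\<^sub>\<infinity>(\<alpha>, \<beta>)\<in>?j ` R. f \<alpha> * g \<beta>)"
    unfolding convolution_def
  proof (rule infsum_cong_neutral)
    fix z assume "z \<in> ?j ` R - ?I"
    then obtain m y where z: "z = ((x, m, y), (y, l - m, w))" and "z \<notin> ?I" by auto
    then have "(x, m, y) \<notin> arrows G \<or> (y, l - m, w) \<notin> arrows G" by (auto simp: DR_groupoid_def)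
    then show "(case z of (\<alpha>, \<beta>) \<Rightarrow> f \<alpha> * g \<beta>) = 0" using CcD(2)[OF f] CcD(2)[OF g] by (auto simp: z)
  next
    fix z assume z: "z \<in> ?I - ?j ` R"
    obtain x' m y y' n w' where zz: "z = ((x', m, y), (y', n, w'))" by (cases z) auto
    have *: "x' = x" "y' = y" "n = l - m" "w' = w" using z by (auto simp: zz DR_groupoid_def)
    then have "(m, y) \<notin> R" using z by (auto simp: zz)
    then have "f (x, m, y) = 0" using R(2) by (auto simp: row_def)
    then show "(case z of (\<alpha>, \<beta>) \<Rightarrow> f \<alpha> * g \<beta>) = 0" by (simp add: zz *)
  qed simp
  also have "\<dots> = (\<Sum>(\<alpha>, \<beta>)\<in>?j ` R. f \<alpha> * g \<beta>)" using R(1) by simp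
  also have "\<dots> = (\<Sum>(m, y)\<in>R. f (x, m, y) * g (y, l - m, w))"
    by (subst sum.reindex[OF inj]) (auto intro: sum.cong)
  finally show ?thesis .
qed

lemma convolution_add_left:
  assumes "f \<in> Cc G" "f' \<in> Cc G" "g \<in> Cc G"
  shows "convolution G (\<lambda>\<gamma>. f \<gamma> + f' \<gamma>) g = (\<lambda>\<gamma>. convolution G f g \<gamma> + convolution G f' g \<gamma>)"
proof
  fix \<gamma> :: "'x \<times> (int ^ 'k) \<times> 'x"
  obtain x l w where g: "\<gamma> = (x, l, w)" by (cases \<gamma>)
  let ?R = "row f x \<union> row f' x"
  have R: "finite ?R" using assms row_finite by simp
  have "row (\<lambda>\<gamma>. f \<gamma> + f' \<gamma>) x \<subseteq> ?R" by (auto simp: row_def)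
  then show "convolution G (\<lambda>\<gamma>. f \<gamma> + f' \<gamma>) g \<gamma> = convolution G f g \<gamma> + convolution G f' g \<gamma>"
    unfolding g using R assms
    by (simp add: convolution_sum[of _ _ ?R] Cc_add distrib_right case_prod_unfold sum.distrib)
qed

lemma convolution_add_right:
  assumes "f \<in> Cc G" "g \<in> Cc G" "g' \<in> Cc G"
  shows "convolution G f (\<lambda>\<gamma>. g \<gamma> + g' \<gamma>) = (\<lambda>\<gamma>. convolution G f g \<gamma> + convolution G f g' \<gamma>)"
proof
  fix \<gamma> :: "'x \<times> (int ^ 'k) \<times> 'x"
  obtain x l w where g: "\<gamma> = (x, l, w)" by (cases \<gamma>)
  show "convolution G f (\<lambda>\<gamma>. g \<gamma> + g' \<gamma>) \<gamma> = convolution G f g \<gamma> + convolution G f g' \<gamma>"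
    unfolding g using assms
    by (simp add: convolution_sum[of _ _ "row f x"] Cc_add row_finite distrib_left case_prod_unfold sum.distrib)
qed

lemma convolution_zero:
  "convolution G (\<lambda>_. 0) f = (\<lambda>_. 0)" "convolution G f (\<lambda>_. 0) = (\<lambda>_. 0)"
  by (simp_all add: fun_eq_iff convolution_def case_prod_unfold)

text \<open>
  Elementary functions multiply like weighted partial bijections.
\<close>

lemma sect_compose:
  assumes s1: "sect p1 q1 V1 \<phi>1" and s2: "sect p2 q2 V2 \<phi>2"
  shows "sect (p1 + p2) (q1 + q2) {y \<in> V2. \<phi>2 y \<in> V1} (\<lambda>y. \<phi>1 (\<phi>2 y))"
proof -
  note D1 = sectD[OF s1] and D2 = sectD[OF s2]
  let ?V = "{y \<in> V2. \<phi>2 y \<in> V1}"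
  have V: "openin X ?V" by (rule sect_preimage[OF s2 D1(1)])
  have "continuous_map (subtopology X ?V) (subtopology X V1) \<phi>2"
    using s2 by (auto simp: continuous_map_in_subtopology sect_def intro: continuous_map_from_subtopology_mono)
  then have "continuous_map (subtopology X ?V) X (\<phi>1 \<circ> \<phi>2)"
    by (rule continuous_map_compose) (use s1 in \<open>simp add: sect_def\<close>)
  moreover have "inj_on (\<lambda>y. \<phi>1 (\<phi>2 y)) ?V"
  proof (rule inj_onI)
    fix a b assume "a \<in> ?V" "b \<in> ?V" "\<phi>1 (\<phi>2 a) = \<phi>1 (\<phi>2 b)"
    then show "a = b" using D1(3) D2(3) by (auto dest!: inj_onD)
  qed
  moreover have "T (p1 + p2) (\<phi>1 (\<phi>2 y)) = T (q1 + q2) y" if y: "y \<in> ?V" for y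
  proof -
    have m: "y \<in> V2" "\<phi>2 y \<in> V1" "y \<in> M" "\<phi>2 y \<in> M" "\<phi>1 (\<phi>2 y) \<in> M" using y D1 D2 by auto
    have "T (p1 + p2) (\<phi>1 (\<phi>2 y)) = T p2 (T p1 (\<phi>1 (\<phi>2 y)))" using m by (metis T_add add.commute)
    also have "\<dots> = T q1 (T p2 (\<phi>2 y))" using m D1(4)[OF m(2)] T_swap[OF m(4)] by simp
    also have "\<dots> = T (q1 + q2) y" using m D2(4)[OF m(1)] by (simp add: T_add)
    finally show ?thesis .
  qed
  ultimately show ?thesis using V by (simp add: sect_def o_def)
qed

lemma int_diff_add: "int_diff (p1 + p2) (q1 + q2) = int_diff p1 q1 + int_diff p2 q2"
  by (simp add: int_diff_def vec_eq_iff)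

lemma int_diff_swap: "int_diff q p = - int_diff p q"
  by (simp add: int_diff_def vec_eq_iff)

lemma bump_compose:
  assumes s2: "sect p2 q2 V2 \<phi>2" and b1: "bump V1 h1" and b2: "bump V2 h2" and V1: "openin X V1"
  shows "bump {y \<in> V2. \<phi>2 y \<in> V1} (\<lambda>y. if y \<in> V2 then h1 (\<phi>2 y) * h2 y else 0)"
proof -
  note D2 = sectD[OF s2]
  obtain K1 where K1: "compactin X K1" "K1 \<subseteq> V1" "\<forall>y. y \<notin> K1 \<longrightarrow> h1 y = 0" and h1: "continuous_map X euclidean h1"
    using b1 by (auto simp: bump_def)
  obtain K2 where K2: "compactin X K2" "K2 \<subseteq> V2" "\<forall>y. y \<notin> K2 \<longrightarrow> h2 y = 0" and h2: "continuous_map X euclidean h2"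
    using b2 by (auto simp: bump_def)
  have "continuous_map (subtopology X V2) euclidean (h1 \<circ> \<phi>2)"
    by (rule continuous_map_compose[OF _ h1]) (use s2 in \<open>simp add: sect_def\<close>)
  then have "bump V2 (\<lambda>y. if y \<in> V2 then h1 (\<phi>2 y) * h2 y else 0)"
    using bump_on_section[OF D2(1) b2, of "h1 \<circ> \<phi>2"] by (simp only: o_apply)
  then have c: "continuous_map X euclidean (\<lambda>y. if y \<in> V2 then h1 (\<phi>2 y) * h2 y else 0)"
    by (simp add: bump_def)
  have K1c: "closedin X K1" by (rule compactin_imp_closedin[OF Hausdorff K1(1)])
  have K2c: "closedin X K2" by (rule compactin_imp_closedin[OF Hausdorff K2(1)])
  let ?K = "{y \<in> K2. \<phi>2 y \<in> K1}"
  have Keq: "?K = K2 - {y \<in> V2. \<phi>2 y \<in> M - K1}"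
    using K2(2) D2(6) by auto
  have "openin X {y \<in> V2. \<phi>2 y \<in> M - K1}" by (rule sect_preimage[OF s2]) (use K1c in blast)
  then have "closedin X ?K" unfolding Keq by (rule closedin_diff[OF K2c])
  then have "compactin X ?K" by (intro closed_compactin[OF K2(1)]) auto
  moreover have "?K \<subseteq> {y \<in> V2. \<phi>2 y \<in> V1}" using K1(2) K2(2) by auto
  moreover have "\<forall>y. y \<notin> ?K \<longrightarrow> (if y \<in> V2 then h1 (\<phi>2 y) * h2 y else 0) = 0" using K1(3) K2(3) by auto
  ultimately show ?thesis unfolding bump_def by (intro conjI[OF c] exI[of _ ?K] conjI)
qed

lemma elemf_convolution:
  assumes s1: "sect p1 q1 V1 \<phi>1" and b1: "bump V1 h1" and s2: "sect p2 q2 V2 \<phi>2" and b2: "bump V2 h2"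
  shows "convolution G (elemf p1 q1 V1 \<phi>1 h1) (elemf p2 q2 V2 \<phi>2 h2) =
    elemf (p1 + p2) (q1 + q2) {y \<in> V2. \<phi>2 y \<in> V1} (\<lambda>y. \<phi>1 (\<phi>2 y)) (\<lambda>y. if y \<in> V2 then h1 (\<phi>2 y) * h2 y else 0)"
proof
  fix \<gamma> :: "'x \<times> (int ^ 'k) \<times> 'x"
  obtain x l w where g: "\<gamma> = (x, l, w)" by (cases \<gamma>)
  let ?e = "elemf p1 q1 V1 \<phi>1 h1" and ?f = "elemf p2 q2 V2 \<phi>2 h2"
  let ?z = "(int_diff p1 q1, \<phi>2 w)"
  let ?R = "insert ?z (row ?e x)"
  have R: "finite ?R" using row_finite[OF elemf_Cc[OF s1 b1]] by simp
  have "convolution G ?e ?f (x, l, w) = (\<Sum>(m, y)\<in>?R. ?e (x, m, y) * ?f (y, l - m, w))"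
    by (rule convolution_sum[OF elemf_Cc[OF s1 b1] elemf_Cc[OF s2 b2] R]) auto
  also have "\<dots> = (\<Sum>(m, y)\<in>{?z}. ?e (x, m, y) * ?f (y, l - m, w))"
  proof (rule sum.mono_neutral_right[OF R])
    show "\<forall>i\<in>?R - {?z}. (case i of (m, y) \<Rightarrow> ?e (x, m, y) * ?f (y, l - m, w)) = 0"
    proof
      fix i assume "i \<in> ?R - {?z}"
      then obtain m y where "i = (m, y)" "m \<noteq> int_diff p1 q1 \<or> y \<noteq> \<phi>2 w" by (cases i) auto
      then show "(case i of (m, y) \<Rightarrow> ?e (x, m, y) * ?f (y, l - m, w)) = 0" by (auto simp: elemf_def)
    qed
  qed simp
  also have "\<dots> = ?e (x, int_diff p1 q1, \<phi>2 w) * ?f (\<phi>2 w, l - int_diff p1 q1, w)" by simp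
  also have "\<dots> = elemf (p1 + p2) (q1 + q2) {y \<in> V2. \<phi>2 y \<in> V1} (\<lambda>y. \<phi>1 (\<phi>2 y))
      (\<lambda>y. if y \<in> V2 then h1 (\<phi>2 y) * h2 y else 0) (x, l, w)"
    by (auto simp: elemf_def int_diff_add algebra_simps)
  finally show "convolution G ?e ?f \<gamma> = elemf (p1 + p2) (q1 + q2) {y \<in> V2. \<phi>2 y \<in> V1} (\<lambda>y. \<phi>1 (\<phi>2 y))
      (\<lambda>y. if y \<in> V2 then h1 (\<phi>2 y) * h2 y else 0) \<gamma>" unfolding g .
qed

lemma elementaryI: "sect p q V \<phi> \<Longrightarrow> bump V h \<Longrightarrow> elementary (elemf p q V \<phi> h)"
  unfolding elementary_def by blast

lemma elementary_convolution:
  assumes "elementary e" "elementary f" shows "elementary (convolution G e f)"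
proof -
  obtain p1 q1 V1 \<phi>1 h1 where 1: "sect p1 q1 V1 \<phi>1" "bump V1 h1" "e = elemf p1 q1 V1 \<phi>1 h1"
    using assms(1) by (auto simp: elementary_def)
  obtain p2 q2 V2 \<phi>2 h2 where 2: "sect p2 q2 V2 \<phi>2" "bump V2 h2" "f = elemf p2 q2 V2 \<phi>2 h2"
    using assms(2) by (auto simp: elementary_def)
  show ?thesis
    unfolding 1(3) 2(3) elemf_convolution[OF 1(1,2) 2(1,2)]
    by (rule elementaryI[OF sect_compose[OF 1(1) 2(1)] bump_compose[OF 2(1) 1(2) 2(2) sectD(1)[OF 1(1)]]])
qed

lemma Cc_convolution:
  assumes "f \<in> Cc G" "g \<in> Cc G" shows "convolution G f g \<in> Cc G"
  using assms
proof (induction f rule: Cc_induct)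
  case (plus e f)
  then show ?case by (simp add: convolution_add_left elementary_Cc Cc_add)
next
  fix e assume e: "elementary e"
  show "convolution G e g \<in> Cc G" using assms(2)
  proof (induction g rule: Cc_induct)
    case (plus e' f)
    then show ?case using e by (simp add: convolution_add_right elementary_Cc Cc_add)
  qed (simp_all add: convolution_zero elementary_Cc e elementary_convolution Cc_zero)
qed (simp_all add: convolution_zero Cc_zero)

end

context deaconu_renault
begin

subsection \<open>Involution\<close>

abbreviation A :: "('x \<times> (int ^ 'k) \<times> 'x \<Rightarrow> complex) star_algebra" where "A \<equiv> Cc_algebra G"

lemma A_simps [simp]:
  "elems A = Cc G" "add A f g = (\<lambda>\<gamma>. f \<gamma> + g \<gamma>)" "smul A c f = (\<lambda>\<gamma>. c * f \<gamma>)"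
  "mul A f g = convolution G f g"
  by (simp_all add: Cc_algebra_def)

lemma star_A: "star A f (x, m, y) = cnj (f (y, - m, x))"
  by (simp add: Cc_algebra_def DR_groupoid_def)

lemma star_plus: "star A (\<lambda>\<gamma>. f \<gamma> + g \<gamma>) = (\<lambda>\<gamma>. star A f \<gamma> + star A g \<gamma>)"
  by (simp add: Cc_algebra_def)

lemma sect_inverse:
  assumes s: "sect p q V \<phi>" shows "sect q p (\<phi> ` V) (inv_into V \<phi>)"
proof -
  note D = sectD[OF s]
  have inv: "inv_into V \<phi> (\<phi> y) = y" if "y \<in> V" for y by (rule inv_into_f_f[OF D(3) that])
  have op: "openin X (\<phi> ` V)" by (rule sect_open_image[OF s D(1)]) simp
  have "continuous_map (subtopology X (\<phi> ` V)) X (inv_into V \<phi>)"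
    unfolding continuous_map_def
  proof (intro conjI allI impI)
    show "inv_into V \<phi> \<in> topspace (subtopology X (\<phi> ` V)) \<rightarrow> M"
      using D(5) by (auto simp: inv)
    fix W assume W: "openin X W"
    have "openin X (\<phi> ` (V \<inter> W))" by (rule sect_open_image[OF s openin_Int[OF D(1) W]]) simp
    moreover have "{x \<in> topspace (subtopology X (\<phi> ` V)). inv_into V \<phi> x \<in> W} = \<phi> ` (V \<inter> W)"
      using D(6) by (auto simp: inv)
    ultimately show "openin (subtopology X (\<phi> ` V)) {x \<in> topspace (subtopology X (\<phi> ` V)). inv_into V \<phi> x \<in> W}"
      using op by (auto simp: openin_open_subtopology)
  qed
  then show ?thesis
    using op D(4) by (auto simp: sect_def inv intro: inj_on_inv_into)
qed

lemma bump_inverse: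
  assumes s: "sect p q V \<phi>" and h: "bump V h"
  shows "bump (\<phi> ` V) (\<lambda>x. if x \<in> \<phi> ` V then cnj (h (inv_into V \<phi> x)) else 0)"
proof -
  note D = sectD[OF s] and s' = sect_inverse[OF s]
  obtain K where K: "compactin X K" "K \<subseteq> V" "\<forall>y. y \<notin> K \<longrightarrow> h y = 0" and hc: "continuous_map X euclidean h"
    using h by (auto simp: bump_def)
  have inv: "inv_into V \<phi> (\<phi> y) = y" if "y \<in> V" for y by (rule inv_into_f_f[OF D(3) that])
  have K': "compactin X (\<phi> ` K)"
    using s K by (intro image_compactin[of "subtopology X V"]) (auto simp: compactin_subtopology sect_def)
  have K'c: "closedin X (\<phi> ` K)" by (rule compactin_imp_closedin[OF Hausdorff K'])
  have "continuous_map (subtopology X (\<phi> ` V)) euclidean (h \<circ> inv_into V \<phi>)"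
    by (rule continuous_map_compose[OF _ hc]) (use s' in \<open>simp add: sect_def\<close>)
  then have "continuous_map (subtopology X (\<phi> ` V)) euclidean (\<lambda>x. cnj (h (inv_into V \<phi> x)))"
    unfolding continuous_map_tendsto by (auto intro: tendsto_cnj simp: o_def)
  then have "continuous_map (subtopology X (\<phi> ` V)) euclidean (\<lambda>x. if x \<in> \<phi> ` V then cnj (h (inv_into V \<phi> x)) else 0)"
    by (rule continuous_map_eq) auto
  moreover have z: "(if x \<in> \<phi> ` V then cnj (h (inv_into V \<phi> x)) else 0) = 0" if "x \<notin> \<phi> ` K" for x
    using that K(3) by (auto simp: inv)
  ultimately have "continuous_map X euclidean (\<lambda>x. if x \<in> \<phi> ` V then cnj (h (inv_into V \<phi> x)) else 0)"
    by (intro continuous_map_zero_extension[OF sectD(1)[OF s'] K'c]) (use K(2) in auto)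
  then show ?thesis unfolding bump_def
    by (intro conjI exI[of _ "\<phi> ` K"] K' image_mono K(2) allI impI z)
qed

lemma elemf_star:
  assumes s: "sect p q V \<phi>"
  shows "star A (elemf p q V \<phi> h) =
    elemf q p (\<phi> ` V) (inv_into V \<phi>) (\<lambda>x. if x \<in> \<phi> ` V then cnj (h (inv_into V \<phi> x)) else 0)"
proof
  fix \<gamma> :: "'x \<times> (int ^ 'k) \<times> 'x"
  obtain x m y where g: "\<gamma> = (x, m, y)" by (cases \<gamma>)
  have inv: "inv_into V \<phi> (\<phi> y) = y" if "y \<in> V" for y by (rule inv_into_f_f[OF sectD(3)[OF s] that])
  have "- m = int_diff p q \<longleftrightarrow> m = int_diff q p" by (metis int_diff_swap minus_minus)
  then show "star A (elemf p q V \<phi> h) \<gamma> =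
      elemf q p (\<phi> ` V) (inv_into V \<phi>) (\<lambda>x. if x \<in> \<phi> ` V then cnj (h (inv_into V \<phi> x)) else 0) \<gamma>"
    unfolding g star_A by (auto simp: elemf_def inv)
qed

lemma elementary_star:
  assumes "elementary e" shows "elementary (star A e)"
proof -
  obtain p q V \<phi> h where e: "sect p q V \<phi>" "bump V h" "e = elemf p q V \<phi> h"
    using assms by (auto simp: elementary_def)
  show ?thesis
    unfolding e(3) elemf_star[OF e(1)] by (rule elementaryI[OF sect_inverse[OF e(1)] bump_inverse[OF e(1,2)]])
qed

lemma Cc_star: "f \<in> Cc G \<Longrightarrow> star A f \<in> Cc G"
proof (induction f rule: Cc_induct)
  case zero
  have "star A (\<lambda>_. 0) = (\<lambda>_. 0)" by (simp add: Cc_algebra_def)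
  then show ?case by (simp add: Cc_zero)
qed (simp_all add: star_plus Cc_add elementary_Cc elementary_star)

subsection \<open>Functions on the unit space\<close>

definition diag :: "('x \<Rightarrow> complex) \<Rightarrow> 'x \<times> (int ^ 'k) \<times> 'x \<Rightarrow> complex" where
  "diag h = elemf 0 0 M (\<lambda>y. y) h"

lemma sect_id: "sect 0 0 M (\<lambda>y. y)"
  by (simp add: sect_def continuous_map_from_subtopology continuous_map_id[unfolded id_def])

lemma diag_apply: "diag h (x, m, y) = (if m = 0 \<and> y \<in> M \<and> x = y then h y else 0)"
  by (simp add: diag_def elemf_def int_diff_def zero_vec_def)

lemma bump_zero_off: "bump V h \<Longrightarrow> y \<notin> V \<Longrightarrow> h y = 0"
  unfolding bump_def by blast

lemma diag_elementary: "bump M h \<Longrightarrow> elementary (diag h)"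
  unfolding diag_def by (rule elementaryI[OF sect_id])

lemma diag_Cc: "bump M h \<Longrightarrow> diag h \<in> Cc G"
  by (rule elementary_Cc[OF diag_elementary])

lemma diag_mul:
  assumes "bump M h" "bump M k"
  shows "convolution G (diag h) (diag k) = diag (\<lambda>y. h y * k y)"
  unfolding diag_def elemf_convolution[OF sect_id assms(1) sect_id assms(2)]
  by (rule ext) (auto simp: elemf_def)

lemma diag_star: "star A (diag h) = diag (\<lambda>y. cnj (h y))"
proof
  fix \<gamma> :: "'x \<times> (int ^ 'k) \<times> 'x"
  obtain x m y where g: "\<gamma> = (x, m, y)" by (cases \<gamma>)
  show "star A (diag h) \<gamma> = diag (\<lambda>y. cnj (h y)) \<gamma>"
    unfolding g star_A diag_apply by auto
qed

text \<open>
  The support of \<open>e\<close> is a bisection, so \<open>e\<^sup>*e\<close> is supported on units.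
\<close>

lemma elemf_star_mul:
  assumes s: "sect p q V \<phi>" and h: "bump V h"
  shows "convolution G (star A (elemf p q V \<phi> h)) (elemf p q V \<phi> h) = diag (\<lambda>y. complex_of_real ((cmod (h y))\<^sup>2))"
proof
  fix \<gamma> :: "'x \<times> (int ^ 'k) \<times> 'x"
  obtain x m y where g: "\<gamma> = (x, m, y)" by (cases \<gamma>)
  note D = sectD[OF s]
  have inv: "inv_into V \<phi> (\<phi> y) = y" if "y \<in> V" for y by (rule inv_into_f_f[OF D(3) that])
  have cn: "cnj (h y) * h y = (complex_of_real (cmod (h y)))\<^sup>2"
    using complex_norm_square[of "h y"] by (simp add: mult.commute)
  have "int_diff (q + p) (p + q) = 0" by (simp add: int_diff_def zero_vec_def vec_eq_iff)
  then show "convolution G (star A (elemf p q V \<phi> h)) (elemf p q V \<phi> h) \<gamma> = diag (\<lambda>y. complex_of_real ((cmod (h y))\<^sup>2)) \<gamma>"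
    unfolding elemf_star[OF s] elemf_convolution[OF sect_inverse[OF s] bump_inverse[OF s h] s h] g diag_apply
    using D(5) bump_zero_off[OF h, of y] by (auto simp: elemf_def inv cn)
qed

lemma bump_bounded:
  assumes "bump V h" shows "\<exists>C>0. \<forall>y. cmod (h y) \<le> C"
proof -
  obtain K where K: "compactin X K" "\<forall>y. y \<notin> K \<longrightarrow> h y = 0" and hc: "continuous_map X euclidean h"
    using assms by (auto simp: bump_def)
  have "compactin euclidean (h ` K)" by (rule image_compactin[OF K(1) hc])
  then have "bounded (h ` K)" by (simp add: compact_imp_bounded)
  then obtain C where C: "C > 0" "\<forall>z\<in>h ` K. norm z \<le> C" unfolding bounded_pos by blast
  have "cmod (h y) \<le> C" for y
    using C K(2) by (cases "y \<in> K") auto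
  then show ?thesis using C(1) by blast
qed

lemma bump_comp:
  assumes h: "bump V h" and c: "continuous_on UNIV F" "F 0 = 0" and VW: "V \<subseteq> W"
  shows "bump W (\<lambda>y. F (h y))"
proof -
  obtain K where K: "compactin X K" "K \<subseteq> V" "\<forall>y. y \<notin> K \<longrightarrow> h y = 0" and hc: "continuous_map X euclidean h"
    using h by (auto simp: bump_def)
  have "continuous_map X euclidean (F \<circ> h)"
    by (rule continuous_map_compose[OF hc]) (use c in simp)
  moreover have "\<forall>y. y \<notin> K \<longrightarrow> F (h y) = 0" using K(3) c(2) by simp
  ultimately show ?thesis using K VW unfolding bump_def o_def by blast
qed

subsection \<open>The universal seminorm of \<open>C\<^sub>c(G)\<close> is finite\<close>

text \<open>
  For an elementary \<open>e\<close> with coefficient function \<open>h\<close>, \<open>e\<^sup>*e\<close> is the function \<open>\<bar>h\<bar>\<^sup>2\<close> on the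
  unit space. If \<open>\<bar>h\<bar> \<le> C\<close>, then \<open>k = C - sqrt (C\<^sup>2 - \<bar>h\<bar>\<^sup>2)\<close> has compact support too, and
  \<open>(C - k)\<^sup>2 = C\<^sup>2 - e\<^sup>*e\<close> shows that \<open>e\<^sup>*e \<le> C\<^sup>2\<close> in every representation.
\<close>

lemma elementary_rep_bound:
  assumes s: "sect p q V \<phi>" and h: "bump V h" and C: "C > 0" "\<And>y. cmod (h y) \<le> C"
    and \<rho>: "star_rep A S \<rho>" and x: "\<xi> \<in> ell2 S"
  shows "ell2_norm S (\<rho> (elemf p q V \<phi> h) \<xi>) \<le> C * ell2_norm S \<xi>"
proof -
  define k where "k y = complex_of_real (C - sqrt (C\<^sup>2 - (cmod (h y))\<^sup>2))" for y
  define n where "n y = complex_of_real ((cmod (h y))\<^sup>2)" for y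
  let ?e = "elemf p q V \<phi> h"
  have VM: "V \<subseteq> M" by (rule sectD(2)[OF s])
  have kb: "bump M k"
    unfolding k_def
    by (rule bump_comp[OF h _ _ VM, of "\<lambda>z. complex_of_real (C - sqrt (C\<^sup>2 - (cmod z)\<^sup>2))"])
      (use C in \<open>auto intro!: continuous_intros\<close>)
  have nb: "bump M n"
    unfolding n_def
    by (rule bump_comp[OF h _ _ VM, of "\<lambda>z. complex_of_real ((cmod z)\<^sup>2)"]) (auto intro!: continuous_intros)
  have kk: "k y * k y = 2 * complex_of_real C * k y + (-1) * n y" for y
  proof -
    have "(cmod (h y))\<^sup>2 \<le> C\<^sup>2" by (rule power_mono[OF C(2)]) simp
    then have r: "(sqrt (C\<^sup>2 - (cmod (h y))\<^sup>2))\<^sup>2 = C\<^sup>2 - (cmod (h y))\<^sup>2" by simp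
    have "(C - sqrt (C\<^sup>2 - (cmod (h y))\<^sup>2)) * (C - sqrt (C\<^sup>2 - (cmod (h y))\<^sup>2))
        = 2 * C * (C - sqrt (C\<^sup>2 - (cmod (h y))\<^sup>2)) + (-1) * (cmod (h y))\<^sup>2"
      using r by (simp add: power2_eq_square algebra_simps)
    then have "complex_of_real ((C - sqrt (C\<^sup>2 - (cmod (h y))\<^sup>2)) * (C - sqrt (C\<^sup>2 - (cmod (h y))\<^sup>2)))
        = complex_of_real (2 * C * (C - sqrt (C\<^sup>2 - (cmod (h y))\<^sup>2)) + (-1) * (cmod (h y))\<^sup>2)" by (rule arg_cong)
    then show ?thesis unfolding k_def n_def of_real_mult of_real_add by simp
  qed
  have eC: "?e \<in> elems A" "diag k \<in> elems A" "diag n \<in> elems A" "star A ?e \<in> elems A"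
    using elemf_Cc[OF s h] diag_Cc kb nb Cc_star by simp_all
  let ?v = "\<rho> (diag k) \<xi>" and ?w = "\<rho> ?e \<xi>"
  note mem = star_repD(2)[OF \<rho> _ x]
  have v: "?v \<in> ell2 S" and w: "?w \<in> ell2 S" and nx: "\<rho> (diag n) \<xi> \<in> ell2 S" using mem eC by auto
  have dkk: "mul A (diag k) (diag k) = add A (smul A (2 * complex_of_real C) (diag k)) (smul A (-1) (diag n))"
  proof -
    have "diag (\<lambda>y. k y * k y) \<gamma> = 2 * complex_of_real C * diag k \<gamma> + (-1) * diag n \<gamma>" for \<gamma>
      by (cases \<gamma>) (simp add: diag_apply kk)
    then show ?thesis by (simp add: diag_mul[OF kb kb] fun_eq_iff)
  qed
  have ck: "cnj (k y) = k y" for y unfolding k_def by (rule complex_cnj_complex_of_real)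
  have sd: "star A (diag k) = diag k" by (simp add: diag_star ck)
  have "ell2_inner S ?v ?v = ell2_inner S (\<rho> (mul A (diag k) (diag k)) \<xi>) \<xi>"
    unfolding star_repD(5)[OF \<rho> eC(2) eC(2) x] using star_repD(6)[OF \<rho> eC(2) v x] unfolding sd by simp
  also have "\<rho> (mul A (diag k) (diag k)) \<xi> = (\<lambda>i. 2 * complex_of_real C * ?v i + (-1) * \<rho> (diag n) \<xi> i)"
  proof -
    have c: "smul A c (diag k) \<in> elems A" "smul A c (diag n) \<in> elems A" for c using eC by (simp_all add: Cc_smul)
    show ?thesis
      unfolding dkk star_repD(3)[OF \<rho> c x] star_repD(4)[OF \<rho> eC(2) x] star_repD(4)[OF \<rho> eC(3) x] ..
  qed
  also have "ell2_inner S (\<lambda>i. 2 * complex_of_real C * ?v i + (-1) * \<rho> (diag n) \<xi> i) \<xi>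
      = 2 * complex_of_real C * ell2_inner S ?v \<xi> - ell2_inner S (\<rho> (diag n) \<xi>) \<xi>"
    unfolding ell2_inner_add_left[OF ell2_scale[OF v] ell2_scale[OF nx] x] ell2_inner_scale_left by simp
  also have "ell2_inner S (\<rho> (diag n) \<xi>) \<xi> = ell2_inner S ?w ?w"
  proof -
    have "n = (\<lambda>y. complex_of_real ((cmod (h y))\<^sup>2))" by (rule ext) (rule n_def)
    then have "diag n = mul A (star A ?e) ?e" unfolding A_simps elemf_star_mul[OF s h] by (rule arg_cong)
    then have "\<rho> (diag n) \<xi> = \<rho> (star A ?e) ?w" using star_repD(5)[OF \<rho> eC(4) eC(1) x] by simp
    then show ?thesis using star_repD(6)[OF \<rho> eC(1) w x] by simp
  qed
  finally have "Re (ell2_inner S ?v ?v) = Re (2 * complex_of_real C * ell2_inner S ?v \<xi> - ell2_inner S ?w ?w)"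
    by simp
  then have vv: "(ell2_norm S ?v)\<^sup>2 = 2 * C * Re (ell2_inner S ?v \<xi>) - (ell2_norm S ?w)\<^sup>2"
    by (simp add: ell2_inner_self v w)
  have "0 \<le> (ell2_norm S (\<lambda>i. complex_of_real C * \<xi> i - ?v i))\<^sup>2" by simp
  also have "\<dots> = C\<^sup>2 * (ell2_norm S \<xi>)\<^sup>2 - 2 * (C * Re (ell2_inner S ?v \<xi>)) + (ell2_norm S ?v)\<^sup>2"
    unfolding ell2_norm_sq_diff[OF ell2_scale[OF x] v] ell2_norm_scale ell2_inner_scale_left
    using ell2_inner_cnj[of S ?v \<xi>, symmetric] by (simp add: power_mult_distrib)
  also have "\<dots> = (C * ell2_norm S \<xi>)\<^sup>2 - (ell2_norm S ?w)\<^sup>2" unfolding vv by (simp add: power_mult_distrib)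
  finally have "(ell2_norm S ?w)\<^sup>2 \<le> (C * ell2_norm S \<xi>)\<^sup>2" by simp
  then show ?thesis by (rule power2_le_imp_le) (use C in simp)
qed

lemma Cc_rep_bound:
  assumes "f \<in> Cc G"
  shows "\<exists>B\<ge>0. \<forall>(S :: 'i set) \<rho> \<xi>. star_rep A S \<rho> \<longrightarrow> \<xi> \<in> ell2 S \<longrightarrow> ell2_norm S (\<rho> f \<xi>) \<le> B * ell2_norm S \<xi>"
  using assms
proof (induction f rule: Cc_induct)
  case zero
  show ?case
  proof (intro exI[of _ 0] conjI allI impI)
    fix S :: "'i set" and \<rho> \<xi> assume "star_rep A S \<rho>" "\<xi> \<in> ell2 S"
    from star_repD(4)[OF this(1) _ this(2), of "\<lambda>_. 0" 0]
    show "ell2_norm S (\<rho> (\<lambda>_. 0) \<xi>) \<le> 0 * ell2_norm S \<xi>" by (simp add: Cc_zero)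
  qed simp
next
  case (plus e f)
  then obtain B1 B2 where B: "B1 \<ge> 0" "B2 \<ge> 0"
    "\<forall>(S :: 'i set) \<rho> \<xi>. star_rep A S \<rho> \<longrightarrow> \<xi> \<in> ell2 S \<longrightarrow> ell2_norm S (\<rho> e \<xi>) \<le> B1 * ell2_norm S \<xi>"
    "\<forall>(S :: 'i set) \<rho> \<xi>. star_rep A S \<rho> \<longrightarrow> \<xi> \<in> ell2 S \<longrightarrow> ell2_norm S (\<rho> f \<xi>) \<le> B2 * ell2_norm S \<xi>"
    by (elim exE conjE)
  show ?case
  proof (intro exI[of _ "B1 + B2"] conjI allI impI)
    fix S :: "'i set" and \<rho> \<xi> assume r: "star_rep A S \<rho>" and x: "\<xi> \<in> ell2 S"
    have ef: "e \<in> elems A" "f \<in> elems A" using plus elementary_Cc by simp_all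
    have "\<rho> (\<lambda>\<gamma>. e \<gamma> + f \<gamma>) \<xi> = (\<lambda>i. \<rho> e \<xi> i + \<rho> f \<xi> i)"
      using star_repD(3)[OF r ef x] by simp
    then have "ell2_norm S (\<rho> (\<lambda>\<gamma>. e \<gamma> + f \<gamma>) \<xi>) \<le> ell2_norm S (\<rho> e \<xi>) + ell2_norm S (\<rho> f \<xi>)"
      using ell2_norm_triangle[OF star_repD(2)[OF r ef(1) x] star_repD(2)[OF r ef(2) x]] by simp
    also have "\<dots> \<le> (B1 + B2) * ell2_norm S \<xi>"
      unfolding distrib_right using B(3,4) r x by (intro add_mono) simp_all
    finally show "ell2_norm S (\<rho> (\<lambda>\<gamma>. e \<gamma> + f \<gamma>) \<xi>) \<le> (B1 + B2) * ell2_norm S \<xi>" .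
  qed (use B in simp)
next
  fix e assume "elementary e"
  then obtain p q V \<phi> h where e: "sect p q V \<phi>" "bump V h" "e = elemf p q V \<phi> h" by (auto simp: elementary_def)
  obtain C where C: "C > 0" "\<forall>y. cmod (h y) \<le> C" using bump_bounded[OF e(2)] by blast
  show "\<exists>B\<ge>0. \<forall>(S :: 'i set) \<rho> \<xi>. star_rep A S \<rho> \<longrightarrow> \<xi> \<in> ell2 S \<longrightarrow> ell2_norm S (\<rho> e \<xi>) \<le> B * ell2_norm S \<xi>"
    unfolding e(3) using elementary_rep_bound[OF e(1,2) C(1)] C
    by (intro exI[of _ C] conjI allI impI) simp_all
qed

end

sublocale deaconu_renault \<subseteq> cstar: bounded_star_algebra "Cc_algebra (DR_groupoid X T)"
proof
  show "elems A \<noteq> {}" using Cc_zero by auto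
  fix a assume a: "a \<in> elems A"
  obtain B where "\<forall>(S :: ('x \<times> (int ^ 'k) \<times> 'x \<Rightarrow> complex) set) \<rho> \<xi>. star_rep A S \<rho> \<longrightarrow> \<xi> \<in> ell2 S \<longrightarrow> ell2_norm S (\<rho> a \<xi>) \<le> B * ell2_norm S \<xi>"
    using Cc_rep_bound[of a] a by auto
  then show "\<exists>B. \<forall>(S :: ('x \<times> (int ^ 'k) \<times> 'x \<Rightarrow> complex) set) \<rho>. star_rep A S \<rho> \<longrightarrow>
      (\<forall>\<xi>\<in>ell2 S. ell2_norm S (\<rho> a \<xi>) \<le> B * ell2_norm S \<xi>)"
    by (intro exI[of _ B]) simp
qed (simp_all add: Cc_add Cc_smul Cc_convolution Cc_star)

section \<open>The representations \<open>\<pi>\<^sub>x\<^sub>,\<^sub>z\<close>\<close>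

lemma torus_nonzero: "z \<in> torus \<Longrightarrow> z $ i \<noteq> 0"
  by (auto simp: torus_def dest!: spec[of _ i])

lemma torus_power_0 [simp]: "torus_power z 0 = 1"
  by (simp add: torus_power_def)

lemma torus_power_add: "z \<in> torus \<Longrightarrow> torus_power z (m + n) = torus_power z m * torus_power z n"
  by (simp add: torus_power_def power_int_add torus_nonzero prod.distrib)

lemma torus_power_norm [simp]: "z \<in> torus \<Longrightarrow> cmod (torus_power z m) = 1"
  by (simp add: torus_power_def torus_def prod_norm[symmetric] norm_power_int)

lemma torus_power_cnj: "z \<in> torus \<Longrightarrow> torus_power z (- m) = cnj (torus_power z m)"
proof -
  assume z: "z \<in> torus"
  have "torus_power z (- m) * torus_power z m = 1"
    using torus_power_add[OF z, of "- m" m] by simp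
  moreover have "cnj (torus_power z m) * torus_power z m = 1"
    using complex_norm_square[of "torus_power z m"] z by (simp add: mult.commute)
  moreover have "torus_power z m \<noteq> 0" using torus_power_norm[OF z, of m] by force
  ultimately show ?thesis by (metis mult_right_cancel)
qed

context deaconu_renault
begin

lemma arrow_comp:
  assumes "(x, m, y) \<in> arrows G" "(y, n, w) \<in> arrows G" shows "(x, m + n, w) \<in> arrows G"
proof -
  obtain p q where 1: "m = int_diff p q" "x \<in> M" "y \<in> M" "T p x = T q y" by (rule arrowE[OF assms(1)])
  obtain p' q' where 2: "n = int_diff p' q'" "y \<in> M" "w \<in> M" "T p' y = T q' w" by (rule arrowE[OF assms(2)])
  have "T (p + p') x = T p' (T p x)" using 1 by (metis T_add add.commute)
  also have "\<dots> = T q (T p' y)" using 1 T_swap by simp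
  also have "\<dots> = T (q + q') w" using 2 by (simp add: T_add)
  finally show ?thesis
    unfolding arrows_iff 1(1) 2(1) int_diff_add[symmetric] using 1(2) 2(3) by blast
qed

lemma arrow_inv: "(x, m, y) \<in> arrows G \<Longrightarrow> (y, - m, x) \<in> arrows G"
proof -
  assume "(x, m, y) \<in> arrows G"
  then obtain p q where 1: "m = int_diff p q" "x \<in> M" "y \<in> M" "T p x = T q y" by (rule arrowE)
  have "(y, int_diff q p, x) \<in> arrows G" unfolding arrows_iff using 1(2,3) 1(4)[symmetric] by blast
  then show ?thesis unfolding 1(1) int_diff_swap[of q p] by simp
qed

lemma arrow_unit: "x \<in> M \<Longrightarrow> (x, 0, x) \<in> arrows G"
proof -
  assume x: "x \<in> M"
  have "int_diff 0 0 = (0 :: int ^ 'k)" by (simp add: int_diff_def vec_eq_iff)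
  then show ?thesis using x unfolding arrows_iff by metis
qed

lemma orbit_iff: "w \<in> orbit G x \<longleftrightarrow> (\<exists>m. (w, m, x) \<in> arrows G)"
  unfolding orbit_def by (auto simp: DR_groupoid_def) force+

lemma orbit_self: "x \<in> M \<Longrightarrow> x \<in> orbit G x"
  using arrow_unit orbit_iff by blast

lemma orbit_M: "w \<in> orbit G x \<Longrightarrow> w \<in> M"
  unfolding orbit_iff by (auto elim: arrowE)

lemma orbit_arrow:
  assumes "(w, m, y) \<in> arrows G" shows "w \<in> orbit G x \<longleftrightarrow> y \<in> orbit G x"
  unfolding orbit_iff using arrow_comp[OF assms] arrow_comp[OF arrow_inv[OF assms]] by blast

text \<open>
  The representation \<open>\<pi>\<^sub>x\<^sub>,\<^sub>z\<close> on \<open>C\<^sub>c(G)\<close>, in terms of matrix rows. The formula does not involve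
  \<open>x\<close>; it acts on \<open>\<ell>\<^sup>2(S)\<close> for every invariant set \<open>S\<close>, in particular for an orbit.
\<close>

definition orbit_rep :: "complex ^ 'k \<Rightarrow> ('x \<times> (int ^ 'k) \<times> 'x \<Rightarrow> complex) \<Rightarrow> ('x \<Rightarrow> complex) \<Rightarrow> 'x \<Rightarrow> complex" where
  "orbit_rep z f \<xi> w = (\<Sum>(m, y)\<in>row f w. torus_power z m * f (w, m, y) * \<xi> y)"

lemma orbit_rep_sum:
  assumes "finite R" "row f w \<subseteq> R"
  shows "orbit_rep z f \<xi> w = (\<Sum>(m, y)\<in>R. torus_power z m * f (w, m, y) * \<xi> y)"
  unfolding orbit_rep_def
  by (rule sum.mono_neutral_left) (use assms in \<open>auto simp: row_def\<close>)

lemma orbit_rep_add: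
  assumes "f \<in> Cc G" "g \<in> Cc G"
  shows "orbit_rep z (\<lambda>\<gamma>. f \<gamma> + g \<gamma>) \<xi> = (\<lambda>w. orbit_rep z f \<xi> w + orbit_rep z g \<xi> w)"
proof
  fix w
  let ?R = "row f w \<union> row g w"
  have R: "finite ?R" using assms row_finite by simp
  have "row (\<lambda>\<gamma>. f \<gamma> + g \<gamma>) w \<subseteq> ?R" by (auto simp: row_def)
  then show "orbit_rep z (\<lambda>\<gamma>. f \<gamma> + g \<gamma>) \<xi> w = orbit_rep z f \<xi> w + orbit_rep z g \<xi> w"
    using R by (simp add: orbit_rep_sum[of ?R] case_prod_unfold sum.distrib[symmetric] algebra_simps)
qed

lemma orbit_rep_smul:
  assumes "f \<in> Cc G"
  shows "orbit_rep z (\<lambda>\<gamma>. c * f \<gamma>) \<xi> = (\<lambda>w. c * orbit_rep z f \<xi> w)"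
proof
  fix w
  have "row (\<lambda>\<gamma>. c * f \<gamma>) w \<subseteq> row f w" by (auto simp: row_def)
  then show "orbit_rep z (\<lambda>\<gamma>. c * f \<gamma>) \<xi> w = c * orbit_rep z f \<xi> w"
    unfolding orbit_rep_def[of z f] sum_distrib_left
    by (subst orbit_rep_sum[OF row_finite[OF assms]]) (auto intro!: sum.cong simp: mult_ac)
qed

lemma orbit_rep_zero: "orbit_rep z (\<lambda>_. 0) \<xi> = (\<lambda>_. 0)"
  by (simp add: orbit_rep_def fun_eq_iff)

lemma orbit_rep_linear:
  "orbit_rep z f (\<lambda>i. \<xi> i + \<eta> i) = (\<lambda>w. orbit_rep z f \<xi> w + orbit_rep z f \<eta> w)"
  "orbit_rep z f (\<lambda>i. c * \<xi> i) = (\<lambda>w. c * orbit_rep z f \<xi> w)"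
  by (simp_all add: orbit_rep_def fun_eq_iff case_prod_unfold sum.distrib[symmetric] sum_distrib_left algebra_simps)

text \<open>
  Elementary functions act as weighted partial permutations of the basis vectors.
\<close>

lemma orbit_rep_elemf:
  assumes s: "sect p q V \<phi>"
  shows "orbit_rep z (elemf p q V \<phi> h) \<xi> w =
    (if w \<in> \<phi> ` V then torus_power z (int_diff p q) * h (inv_into V \<phi> w) * \<xi> (inv_into V \<phi> w) else 0)"
proof (cases "w \<in> \<phi> ` V")
  case True
  then obtain y where y: "y \<in> V" "w = \<phi> y" by blast
  have inv: "inv_into V \<phi> (\<phi> y) = y" by (rule inv_into_f_f[OF sectD(3)[OF s] y(1)])
  have "row (elemf p q V \<phi> h) w \<subseteq> {(int_diff p q, y)}"
    using y inj_onD[OF sectD(3)[OF s]] by (auto simp: row_def elemf_def split: if_splits)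
  then have "orbit_rep z (elemf p q V \<phi> h) \<xi> w
      = (\<Sum>(m, y)\<in>{(int_diff p q, y)}. torus_power z m * elemf p q V \<phi> h (w, m, y) * \<xi> y)"
    by (intro orbit_rep_sum) auto
  then show ?thesis using y by (simp add: inv elemf_def)
next
  case False
  then have "row (elemf p q V \<phi> h) w = {}" by (auto simp: row_def elemf_def split: if_splits)
  then show ?thesis using False by (simp add: orbit_rep_def)
qed

context
  fixes z :: "complex ^ 'k" and S :: "'x set"
  assumes z: "z \<in> torus"
    and S: "\<And>x m y. (x, m, y) \<in> arrows G \<Longrightarrow> x \<in> S \<longleftrightarrow> y \<in> S"
begin

lemma orbit_rep_off:
  assumes f: "f \<in> Cc G" and x: "\<xi> \<in> ell2 S" and w: "w \<notin> S"
  shows "orbit_rep z f \<xi> w = 0"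
  unfolding orbit_rep_def
proof (rule sum.neutral, clarify)
  fix m y assume "(m, y) \<in> row f w"
  then have "(w, m, y) \<in> arrows G" using CcD(2)[OF f] by (auto simp: row_def)
  then have "y \<notin> S" using S w by blast
  then show "torus_power z m * f (w, m, y) * \<xi> y = 0" using ell2_support[OF x] by simp
qed

lemma orbit_rep_elemf_bound:
  assumes s: "sect p q V \<phi>" and h: "bump V h" and C: "C > 0" "\<And>y. cmod (h y) \<le> C" and x: "\<xi> \<in> ell2 S"
  shows "orbit_rep z (elemf p q V \<phi> h) \<xi> \<in> ell2 S"
    "ell2_norm S (orbit_rep z (elemf p q V \<phi> h) \<xi>) \<le> C * ell2_norm S \<xi>"
proof -
  let ?v = "orbit_rep z (elemf p q V \<phi> h) \<xi>"
  let ?i = "inv_into V \<phi>"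
  have nn: "0 \<le> C * ell2_norm S \<xi>" using C by simp
  have "L2_set (\<lambda>i. cmod (?v i)) F \<le> C * ell2_norm S \<xi>" if F: "finite F" "F \<subseteq> S" for F
  proof -
    let ?F = "F \<inter> \<phi> ` V"
    have inj: "inj_on ?i ?F" by (rule inj_on_subset[OF inj_on_inv_into[of "\<phi> ` V"]]) auto
    have iS: "?i ` ?F \<subseteq> S"
    proof
      fix y assume "y \<in> ?i ` ?F"
      then obtain y' where y: "\<phi> y' \<in> F" "y' \<in> V" "y = y'"
        using inv_into_f_f[OF sectD(3)[OF s]] by auto
      have "(\<phi> y', int_diff p q, y') \<in> arrows G" using sg_arrow[OF s y(2)] by (simp add: sg_def)
      then show "y \<in> S" using S F(2) y by blast
    qed
    have "(\<Sum>w\<in>F. (cmod (?v w))\<^sup>2) = (\<Sum>w\<in>?F. (cmod (?v w))\<^sup>2)"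
      by (rule sum.mono_neutral_right) (use F in \<open>auto simp: orbit_rep_elemf[OF s]\<close>)
    also have "\<dots> \<le> (\<Sum>w\<in>?F. C\<^sup>2 * (cmod (\<xi> (?i w)))\<^sup>2)"
    proof (rule sum_mono)
      fix w assume "w \<in> ?F"
      then have "cmod (?v w) \<le> C * cmod (\<xi> (?i w))"
        using C(2)[of "?i w"] by (simp add: orbit_rep_elemf[OF s] norm_mult z mult_right_mono)
      then have "(cmod (?v w))\<^sup>2 \<le> (C * cmod (\<xi> (?i w)))\<^sup>2" by (rule power_mono) simp
      then show "(cmod (?v w))\<^sup>2 \<le> C\<^sup>2 * (cmod (\<xi> (?i w)))\<^sup>2" by (simp add: power_mult_distrib)
    qed
    also have "\<dots> = C\<^sup>2 * (\<Sum>y\<in>?i ` ?F. (cmod (\<xi> y))\<^sup>2)"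
      by (simp add: sum.reindex[OF inj] sum_distrib_left)
    also have "\<dots> \<le> C\<^sup>2 * (ell2_norm S \<xi>)\<^sup>2"
      using ell2_norm_finite_le[OF x _ iS] F(1) by (intro mult_left_mono) (auto simp: L2_le_iff)
    finally show ?thesis using nn by (simp add: L2_le_iff power_mult_distrib)
  qed
  from ell2_bounded[OF _ nn this]
  show "?v \<in> ell2 S" "ell2_norm S ?v \<le> C * ell2_norm S \<xi>"
    using orbit_rep_off[OF elemf_Cc[OF s h] x] by auto
qed

lemma orbit_rep_bound:
  assumes "f \<in> Cc G"
  shows "\<exists>B\<ge>0. \<forall>\<xi>\<in>ell2 S. orbit_rep z f \<xi> \<in> ell2 S \<and> ell2_norm S (orbit_rep z f \<xi>) \<le> B * ell2_norm S \<xi>"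
  using assms
proof (induction f rule: Cc_induct)
  case zero
  then show ?case by (intro exI[of _ 0]) (simp add: orbit_rep_zero)
next
  case (plus e f)
  then obtain B1 B2 where B: "B1 \<ge> 0" "B2 \<ge> 0"
    "\<forall>\<xi>\<in>ell2 S. orbit_rep z e \<xi> \<in> ell2 S \<and> ell2_norm S (orbit_rep z e \<xi>) \<le> B1 * ell2_norm S \<xi>"
    "\<forall>\<xi>\<in>ell2 S. orbit_rep z f \<xi> \<in> ell2 S \<and> ell2_norm S (orbit_rep z f \<xi>) \<le> B2 * ell2_norm S \<xi>"
    by (elim exE conjE)
  show ?case
  proof (intro exI[of _ "B1 + B2"] conjI ballI)
    fix \<xi> assume x: "\<xi> \<in> ell2 S"
    note eq = orbit_rep_add[OF elementary_Cc[OF plus(1)] plus(2), of z \<xi>]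
    show "orbit_rep z (\<lambda>\<gamma>. e \<gamma> + f \<gamma>) \<xi> \<in> ell2 S" unfolding eq using B x by simp
    have "ell2_norm S (\<lambda>w. orbit_rep z e \<xi> w + orbit_rep z f \<xi> w)
        \<le> ell2_norm S (orbit_rep z e \<xi>) + ell2_norm S (orbit_rep z f \<xi>)"
      using B x by (intro ell2_norm_triangle) simp_all
    also have "\<dots> \<le> (B1 + B2) * ell2_norm S \<xi>"
      unfolding distrib_right using B(3,4) x by (intro add_mono) simp_all
    finally show "ell2_norm S (orbit_rep z (\<lambda>\<gamma>. e \<gamma> + f \<gamma>) \<xi>) \<le> (B1 + B2) * ell2_norm S \<xi>" unfolding eq .
  qed (use B in simp)
next
  fix e assume "elementary e"
  then obtain p q V \<phi> h where e: "sect p q V \<phi>" "bump V h" "e = elemf p q V \<phi> h" by (auto simp: elementary_def)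
  obtain C where C: "C > 0" "\<forall>y. cmod (h y) \<le> C" using bump_bounded[OF e(2)] by blast
  show "\<exists>B\<ge>0. \<forall>\<xi>\<in>ell2 S. orbit_rep z e \<xi> \<in> ell2 S \<and> ell2_norm S (orbit_rep z e \<xi>) \<le> B * ell2_norm S \<xi>"
    unfolding e(3) using orbit_rep_elemf_bound[OF e(1,2) C(1)] C
    by (intro exI[of _ C] conjI ballI) simp_all
qed

lemma orbit_rep_in: "f \<in> Cc G \<Longrightarrow> \<xi> \<in> ell2 S \<Longrightarrow> orbit_rep z f \<xi> \<in> ell2 S"
  using orbit_rep_bound by blast

lemma orbit_rep_bounded: "f \<in> Cc G \<Longrightarrow> bounded_operator S (orbit_rep z f)"
  unfolding bounded_operator_def using orbit_rep_bound[of f] by (auto simp: orbit_rep_linear)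

lemma orbit_rep_elemf_mul:
  assumes s1: "sect p1 q1 V1 \<phi>1" and b1: "bump V1 h1" and s2: "sect p2 q2 V2 \<phi>2" and b2: "bump V2 h2"
  shows "orbit_rep z (convolution G (elemf p1 q1 V1 \<phi>1 h1) (elemf p2 q2 V2 \<phi>2 h2)) \<xi> =
    orbit_rep z (elemf p1 q1 V1 \<phi>1 h1) (orbit_rep z (elemf p2 q2 V2 \<phi>2 h2) \<xi>)"
proof
  fix w
  let ?V = "{y \<in> V2. \<phi>2 y \<in> V1}"
  note s = sect_compose[OF s1 s2]
  note i1 = inv_into_f_f[OF sectD(3)[OF s1]] and i2 = inv_into_f_f[OF sectD(3)[OF s2]] and i = inv_into_f_f[OF sectD(3)[OF s]]
  show "orbit_rep z (convolution G (elemf p1 q1 V1 \<phi>1 h1) (elemf p2 q2 V2 \<phi>2 h2)) \<xi> w =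
    orbit_rep z (elemf p1 q1 V1 \<phi>1 h1) (orbit_rep z (elemf p2 q2 V2 \<phi>2 h2) \<xi>) w"
  proof (cases "w \<in> (\<lambda>y. \<phi>1 (\<phi>2 y)) ` ?V")
    case True
    then obtain y where y: "y \<in> V2" "\<phi>2 y \<in> V1" "w = \<phi>1 (\<phi>2 y)" by blast
    have "inv_into ?V (\<lambda>y. \<phi>1 (\<phi>2 y)) (\<phi>1 (\<phi>2 y)) = y" by (rule i) (use y in simp)
    then show ?thesis
      unfolding elemf_convolution[OF s1 b1 s2 b2] orbit_rep_elemf[OF s] orbit_rep_elemf[OF s1] orbit_rep_elemf[OF s2]
      using y True by (simp add: i1 i2 int_diff_add torus_power_add z)
  next
    case False
    have "w \<in> \<phi>1 ` V1 \<Longrightarrow> inv_into V1 \<phi>1 w \<notin> \<phi>2 ` V2"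
    proof
      assume "w \<in> \<phi>1 ` V1" "inv_into V1 \<phi>1 w \<in> \<phi>2 ` V2"
      then obtain y y' where "y \<in> V1" "w = \<phi>1 y" "y' \<in> V2" "y = \<phi>2 y'" using i1 by auto
      then show False using False by blast
    qed
    then show ?thesis
      unfolding elemf_convolution[OF s1 b1 s2 b2] orbit_rep_elemf[OF s] orbit_rep_elemf[OF s1] orbit_rep_elemf[OF s2]
      using False by simp
  qed
qed

lemma orbit_rep_mul:
  assumes "f \<in> Cc G" "g \<in> Cc G"
  shows "orbit_rep z (convolution G f g) \<xi> = orbit_rep z f (orbit_rep z g \<xi>)"
  using assms
proof (induction f rule: Cc_induct)
  case (plus e f)
  then show ?case by (simp add: convolution_add_left elementary_Cc orbit_rep_add Cc_convolution)
next
  fix e assume e: "elementary e"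
  show "orbit_rep z (convolution G e g) \<xi> = orbit_rep z e (orbit_rep z g \<xi>)" using assms(2)
  proof (induction g rule: Cc_induct)
    case zero
    have "orbit_rep z e (\<lambda>_. 0) = (\<lambda>_. 0)" by (simp add: orbit_rep_def fun_eq_iff)
    then show ?case by (simp add: convolution_zero orbit_rep_zero)
  next
    case (plus e' f)
    then show ?case
      using e by (simp add: convolution_add_right elementary_Cc orbit_rep_add Cc_convolution orbit_rep_linear)
  next
    fix e' assume "elementary e'"
    then show "orbit_rep z (convolution G e e') \<xi> = orbit_rep z e (orbit_rep z e' \<xi>)"
      using e orbit_rep_elemf_mul unfolding elementary_def by (elim exE conjE) simp
  qed
qed (simp add: convolution_zero orbit_rep_zero)

lemma orbit_rep_star:
  assumes "f \<in> Cc G" and x: "\<xi> \<in> ell2 S" and y: "\<eta> \<in> ell2 S"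
  shows "ell2_inner S (orbit_rep z (star A f) \<xi>) \<eta> = ell2_inner S \<xi> (orbit_rep z f \<eta>)"
  using assms(1)
proof (induction f rule: Cc_induct)
  case zero
  have "star A (\<lambda>_. 0) = (\<lambda>_. 0)" by (simp add: Cc_algebra_def)
  then show ?case by (simp add: orbit_rep_zero ell2_inner_def)
next
  case (plus e f)
  note ec = elementary_Cc[OF plus(1)]
  show ?case
    using plus x y
    by (simp add: star_plus orbit_rep_add ec Cc_star orbit_rep_in ell2_inner_add_left ell2_inner_add_right)
next
  fix e assume "elementary e"
  then obtain p q V \<phi> h where s: "sect p q V \<phi>" and h: "bump V h" and e: "e = elemf p q V \<phi> h"
    by (auto simp: elementary_def)
  note inv = inv_into_f_f[OF sectD(3)[OF s]]
  note s' = sect_inverse[OF s]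
  have img: "inv_into V \<phi> ` \<phi> ` V = V" using inv by (auto simp: image_image)
  have inv': "inv_into (\<phi> ` V) (inv_into V \<phi>) y = \<phi> y" if "y \<in> V" for y
    using inv_into_f_f[OF sectD(3)[OF s'], of "\<phi> y"] that inv by simp
  have arr: "\<phi> y \<in> S \<longleftrightarrow> y \<in> S" if "y \<in> V" for y
    using S sg_arrow[OF s that] by (simp add: sg_def)
  let ?t = "torus_power z (int_diff p q)"
  let ?g = "\<lambda>y. cnj ?t * cnj (h y) * \<xi> (\<phi> y) * cnj (\<eta> y)"
  have bij: "bij_betw \<phi> (S \<inter> V) (S \<inter> \<phi> ` V)"
    unfolding bij_betw_def using arr by (auto intro: inj_on_subset[OF sectD(3)[OF s]])
  have "ell2_inner S (orbit_rep z (star A e) \<xi>) \<eta> = (\<Sum>\<^sub>\<infinity>y\<in>S \<inter> V. ?g y)"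
    unfolding ell2_inner_def
  proof (rule infsum_cong_neutral)
    fix y assume y: "y \<in> S \<inter> (S \<inter> V)"
    have "torus_power z (int_diff q p) = cnj ?t"
      unfolding int_diff_swap[of q p] by (rule torus_power_cnj[OF z])
    then show "orbit_rep z (star A e) \<xi> y * cnj (\<eta> y) = ?g y"
      unfolding e elemf_star[OF s] orbit_rep_elemf[OF s'] img using y by (simp add: inv inv')
  next
    fix y assume "y \<in> S - S \<inter> V"
    then show "orbit_rep z (star A e) \<xi> y * cnj (\<eta> y) = 0"
      unfolding e elemf_star[OF s] orbit_rep_elemf[OF s'] img by simp
  qed auto
  also have "\<dots> = (\<Sum>\<^sub>\<infinity>y\<in>S \<inter> V. \<xi> (\<phi> y) * cnj (orbit_rep z e \<eta> (\<phi> y)))"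
    by (rule infsum_cong) (simp add: e orbit_rep_elemf[OF s] inv mult_ac)
  also have "\<dots> = (\<Sum>\<^sub>\<infinity>w\<in>S \<inter> \<phi> ` V. \<xi> w * cnj (orbit_rep z e \<eta> w))"
    by (rule infsum_reindex_bij_betw[OF bij])
  also have "\<dots> = ell2_inner S \<xi> (orbit_rep z e \<eta>)"
    unfolding ell2_inner_def
    by (rule infsum_cong_neutral) (auto simp: e orbit_rep_elemf[OF s])
  finally show "ell2_inner S (orbit_rep z (star A e) \<xi>) \<eta> = ell2_inner S \<xi> (orbit_rep z e \<eta>)" .
qed

lemma orbit_rep_star_rep: "star_rep A S (orbit_rep z)"
  unfolding star_rep_def
  by (auto simp: orbit_rep_bounded orbit_rep_add orbit_rep_smul orbit_rep_mul orbit_rep_star)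

text \<open>
  The universal seminorm dominates the copy of the representation on an index set inside
  the type of functions on \<open>G\<close>.
\<close>

lemma orbit_rep_contractive:
  assumes f: "f \<in> elems A" and x: "\<xi> \<in> ell2 S"
  shows "ell2_norm S (orbit_rep z f \<xi>) \<le> cstar.N f * ell2_norm S \<xi>"
proof -
  define j :: "'x \<Rightarrow> 'x \<times> (int ^ 'k) \<times> 'x \<Rightarrow> complex" where "j y = (\<lambda>\<gamma>. if fst \<gamma> = y then 1 else 0)" for y
  have "inj j"
  proof (rule injI)
    fix a b assume "j a = j b"
    then have "j a (a, 0, a) = j b (a, 0, a)" by simp
    then show "a = b" by (simp add: j_def split: if_splits)
  qed
  then have inj: "inj_on j S" by (rule inj_on_subset) simp
  let ?r = "push_rep j S (orbit_rep z)"
  have r: "star_rep A (j ` S) ?r"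
    by (rule push_rep_star_rep[OF inj orbit_rep_star_rep]) (simp add: Cc_star)
  have "ell2_norm (j ` S) (?r f (ell2_push j S \<xi>)) \<le> cstar.N f * ell2_norm (j ` S) (ell2_push j S \<xi>)"
    by (rule cstar.rep_le_N[OF r f ell2_push_in[OF inj x]])
  then show ?thesis
    using orbit_rep_in f x by (simp add: push_rep_def[OF inj] ell2_pull_push[OF inj] ell2_push_norm[OF inj])
qed

end

text \<open>
  The entry \<open>\<langle>\<pi>\<^sub>x\<^sub>,\<^sub>z(f) e\<^sub>y, e\<^sub>w\<rangle>\<close>, for \<open>y\<close> and \<open>w\<close> in the orbit of \<open>x\<close>.
\<close>

definition matrix_coef :: "complex ^ 'k \<Rightarrow> ('x \<times> (int ^ 'k) \<times> 'x \<Rightarrow> complex) \<Rightarrow> 'x \<Rightarrow> 'x \<Rightarrow> complex" where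
  "matrix_coef z f w y = (\<Sum>m | f (w, m, y) \<noteq> 0. torus_power z m * f (w, m, y))"

lemma coef_finite: "f \<in> Cc G \<Longrightarrow> finite {m. f (w, m, y) \<noteq> 0}"
proof -
  assume "f \<in> Cc G"
  then have "finite (row f w)" by (rule row_finite)
  moreover have "{m. f (w, m, y) \<noteq> 0} \<subseteq> fst ` row f w" by (force simp: row_def)
  ultimately show ?thesis by (meson finite_imageI finite_subset)
qed

lemma coef_eq:
  assumes "finite R" "{m. f (w, m, y) \<noteq> 0} \<subseteq> R"
  shows "matrix_coef z f w y = (\<Sum>m\<in>R. torus_power z m * f (w, m, y))"
  unfolding matrix_coef_def by (rule sum.mono_neutral_left) (use assms in auto)

lemma orbit_rep_basis:
  assumes f: "f \<in> Cc G"
  shows "orbit_rep z f (basis_vec y) w = matrix_coef z f w y"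
proof -
  let ?R = "{m. f (w, m, y) \<noteq> 0}"
  have "orbit_rep z f (basis_vec y) w = (\<Sum>(m, y')\<in>(\<lambda>m. (m, y)) ` ?R. torus_power z m * f (w, m, y') * basis_vec y y')"
    unfolding orbit_rep_def
    by (rule sum.mono_neutral_right[OF row_finite[OF f]]) (auto simp: row_def basis_vec_def)
  also have "\<dots> = matrix_coef z f w y"
    unfolding matrix_coef_def by (subst sum.reindex) (auto simp: inj_on_def basis_vec_def)
  finally show ?thesis .
qed

lemma infsum_coef:
  assumes f: "f \<in> Cc G"
  shows "(\<Sum>\<^sub>\<infinity>\<gamma>\<in>{\<gamma> \<in> arrows G. src G \<gamma> = y}. torus_power z (DR_cocycle \<gamma>) * f \<gamma> * basis_vec (rng G \<gamma>) w) = matrix_coef z f w y"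
proof -
  let ?R = "{m. f (w, m, y) \<noteq> 0}"
  let ?h = "\<lambda>\<gamma>. torus_power z (DR_cocycle \<gamma>) * f \<gamma> * basis_vec (rng G \<gamma>) w"
  have "infsum ?h {\<gamma> \<in> arrows G. src G \<gamma> = y} = infsum ?h ((\<lambda>m. (w, m, y)) ` ?R)"
  proof (rule infsum_cong_neutral)
    fix \<gamma> assume "\<gamma> \<in> (\<lambda>m. (w, m, y)) ` ?R - {\<gamma> \<in> arrows G. src G \<gamma> = y}"
    then show "?h \<gamma> = 0" using CcD(2)[OF f] by (auto simp: DR_groupoid_def)
  next
    fix \<gamma> assume g: "\<gamma> \<in> {\<gamma> \<in> arrows G. src G \<gamma> = y} - (\<lambda>m. (w, m, y)) ` ?R"
    obtain w' m y' where gg: "\<gamma> = (w', m, y')" by (cases \<gamma>)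
    have "y' = y" using g by (simp add: gg DR_groupoid_def)
    then have "w' \<noteq> w \<or> f \<gamma> = 0" using g by (auto simp: gg)
    then show "?h \<gamma> = 0" by (auto simp: gg basis_vec_def DR_groupoid_def)
  qed simp
  also have "\<dots> = sum ?h ((\<lambda>m. (w, m, y)) ` ?R)" using coef_finite[OF f] by simp
  also have "\<dots> = matrix_coef z f w y"
    unfolding matrix_coef_def by (subst sum.reindex) (auto simp: inj_on_def basis_vec_def DR_groupoid_def DR_cocycle_def)
  finally show ?thesis .
qed

abbreviation E :: "(nat \<Rightarrow> 'x \<times> (int ^ 'k) \<times> 'x \<Rightarrow> complex) set star_algebra" where
  "E \<equiv> enveloping_cstar A"

lemma E_groupoid_cstar: "groupoid_cstar G = E"
  by (simp add: groupoid_cstar_def)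

text \<open>
  The choice in \<open>DR_rep\<close> is from a nonempty set, since the representation on \<open>C\<^sub>c(G)\<close> extends to
  the completion.
\<close>

lemma DR_rep_spec:
  assumes z: "z \<in> torus"
  shows "star_rep E (orbit G x) (DR_rep X T x z)"
    and "f \<in> Cc G \<Longrightarrow> y \<in> orbit G x \<Longrightarrow> DR_rep X T x z (enveloping_embed A f) (basis_vec y) = (\<lambda>w. matrix_coef z f w y)"
proof -
  let ?S = "orbit G x"
  let ?P = "\<lambda>\<rho>. star_rep (groupoid_cstar G) ?S \<rho> \<and>
        (\<forall>f\<in>Cc G. \<forall>y\<in>?S. \<rho> (enveloping_embed A f) (basis_vec y) =
           (\<lambda>w. \<Sum>\<^sub>\<infinity>\<gamma>\<in>{\<gamma> \<in> arrows G. src G \<gamma> = y}.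
              torus_power z (DR_cocycle \<gamma>) * f \<gamma> * basis_vec (rng G \<gamma>) w))"
  note c = z orbit_arrow[where x = x]
  have "?P (cstar.ext_rep (orbit_rep z))"
    unfolding E_groupoid_cstar
  proof (intro conjI ballI)
    show "star_rep E ?S (cstar.ext_rep (orbit_rep z))"
      by (rule cstar.ext_rep_star_rep[OF orbit_rep_star_rep[OF c] orbit_rep_contractive[OF c]])
    fix f y assume f: "f \<in> Cc G" and y: "y \<in> ?S"
    have "cstar.ext_rep (orbit_rep z) (enveloping_embed A f) (basis_vec y) = orbit_rep z f (basis_vec y)"
      by (rule cstar.ext_rep_embed[OF orbit_rep_star_rep[OF c] orbit_rep_contractive[OF c]]) (simp_all add: f y)
    then show "cstar.ext_rep (orbit_rep z) (enveloping_embed A f) (basis_vec y) = (\<lambda>w. \<Sum>\<^sub>\<infinity>\<gamma>\<in>{\<gamma> \<in> arrows G. src G \<gamma> = y}.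
              torus_power z (DR_cocycle \<gamma>) * f \<gamma> * basis_vec (rng G \<gamma>) w)"
      by (simp add: infsum_coef[OF f] orbit_rep_basis[OF f] fun_eq_iff)
  qed
  then have "?P (SOME \<rho>. ?P \<rho>)" by (rule someI[where P = ?P])
  then have P: "?P (DR_rep X T x z)" unfolding DR_rep_def Let_def .
  then show "star_rep E ?S (DR_rep X T x z)" unfolding E_groupoid_cstar by blast
  show "DR_rep X T x z (enveloping_embed A f) (basis_vec y) = (\<lambda>w. matrix_coef z f w y)" if "f \<in> Cc G" "y \<in> ?S"
    using P that by (simp add: infsum_coef)
qed

end

section \<open>Irreducibility\<close>

context deaconu_renault
begin

abbreviation emb :: "('x \<times> (int ^ 'k) \<times> 'x \<Rightarrow> complex) \<Rightarrow> (nat \<Rightarrow> 'x \<times> (int ^ 'k) \<times> 'x \<Rightarrow> complex) set" where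
  "emb \<equiv> enveloping_embed A"

lemma emb_E: "f \<in> Cc G \<Longrightarrow> emb f \<in> elems E"
  by (simp add: cstar.embed_elem)

lemma coef_diag: "matrix_coef z (diag h) v w = (if w \<in> M \<and> v = w then h w else 0)"
proof -
  have "matrix_coef z (diag h) v w = (\<Sum>m\<in>{0}. torus_power z m * diag h (v, m, w))"
    by (rule coef_eq) (auto simp: diag_apply split: if_splits)
  then show ?thesis by (auto simp: diag_apply)
qed

lemma coef_elemf: "matrix_coef z (elemf p q V \<phi> h) v y = (if y \<in> V \<and> v = \<phi> y then torus_power z (int_diff p q) * h y else 0)"
proof -
  have "matrix_coef z (elemf p q V \<phi> h) v y = (\<Sum>m\<in>{int_diff p q}. torus_power z m * elemf p q V \<phi> h (v, m, y))"
    by (rule coef_eq) (auto simp: elemf_def split: if_splits)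
  then show ?thesis by (auto simp: elemf_def)
qed

context
  fixes x :: 'x and z :: "complex ^ 'k" and S :: "'x set"
    and \<rho> :: "(nat \<Rightarrow> 'x \<times> (int ^ 'k) \<times> 'x \<Rightarrow> complex) set \<Rightarrow> ('x \<Rightarrow> complex) \<Rightarrow> 'x \<Rightarrow> complex"
  assumes x: "x \<in> M" and z: "z \<in> torus" and S: "S = orbit G x" and \<rho>: "\<rho> = DR_rep X T x z"
begin

lemma rho_rep: "star_rep E S \<rho>"
  unfolding S \<rho> by (rule DR_rep_spec(1)[OF z])

lemma rho_basis: "f \<in> Cc G \<Longrightarrow> y \<in> S \<Longrightarrow> \<rho> (emb f) (basis_vec y) = (\<lambda>w. matrix_coef z f w y)"
  unfolding S \<rho> by (rule DR_rep_spec(2)[OF z])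

text \<open>
  Functions on the unit space act by multiplication. On basis vectors this is the defining formula,
  and taking adjoints carries it over to all vectors, in each coordinate.
\<close>

lemma rho_diag:
  assumes h: "bump M h" and v: "\<xi> \<in> ell2 S" and w: "w \<in> S"
  shows "\<rho> (emb (diag h)) \<xi> w = h w * \<xi> w"
proof -
  let ?h = "\<lambda>y. cnj (h y)"
  have h': "bump M ?h" by (rule bump_comp[OF h]) (auto intro!: continuous_intros)
  have "star A (diag ?h) = diag h" unfolding diag_star by simp
  then have st: "star E (emb (diag ?h)) = emb (diag h)"
    using cstar.embed_hom(4)[of "diag ?h" "diag ?h"] diag_Cc[OF h'] by simp
  have "\<rho> (emb (diag h)) \<xi> w = ell2_inner S (\<rho> (star E (emb (diag ?h))) \<xi>) (basis_vec w)"
    unfolding st by (rule ell2_inner_basis[OF w, symmetric])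
  also have "\<dots> = ell2_inner S \<xi> (\<rho> (emb (diag ?h)) (basis_vec w))"
    by (rule star_repD(6)[OF rho_rep emb_E[OF diag_Cc[OF h']] v basis_vec_ell2[OF w]])
  also have "\<rho> (emb (diag ?h)) (basis_vec w) = (\<lambda>i. cnj (h w) * basis_vec w i)"
    unfolding rho_basis[OF diag_Cc[OF h'] w] coef_diag using w orbit_M[of w x] S
    by (auto simp: basis_vec_def fun_eq_iff)
  also have "ell2_inner S \<xi> (\<lambda>i. cnj (h w) * basis_vec w i) = h w * \<xi> w"
    unfolding ell2_inner_scale_right ell2_inner_basis[OF w] by simp
  finally show ?thesis .
qed

text \<open>
  A bump on a bisection through an arrow from \<open>y\<close> to \<open>w\<close>.
\<close>

lemma rho_move:
  assumes y: "y \<in> S" and w: "w \<in> S"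
  shows "\<exists>f c. f \<in> Cc G \<and> cmod c = 1 \<and> \<rho> (emb f) (basis_vec y) = (\<lambda>i. c * basis_vec w i)"
proof -
  obtain m n where "(w, m, x) \<in> arrows G" "(y, n, x) \<in> arrows G" using y w unfolding S orbit_iff by blast
  then have "(w, m + - n, y) \<in> arrows G" by (intro arrow_comp[OF _ arrow_inv])
  then obtain p q where pq: "m + - n = int_diff p q" "w \<in> M" "y \<in> M" "T p w = T q y" by (rule arrowE)
  obtain V \<phi> where V: "sect p q V \<phi>" "y \<in> V" "\<phi> y = w" using sect_exists[OF pq(2-4)] by blast
  obtain h where h: "bump V (\<lambda>x. complex_of_real (h x))" "h y = 1"
    using bump_exists[OF sectD(1)[OF V(1)] V(2)] by blast
  let ?f = "elemf p q V \<phi> (\<lambda>x. complex_of_real (h x))"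
  have f: "?f \<in> Cc G" by (rule elemf_Cc[OF V(1) h(1)])
  have "\<rho> (emb ?f) (basis_vec y) = (\<lambda>i. torus_power z (int_diff p q) * basis_vec w i)"
    unfolding rho_basis[OF f y] coef_elemf using V h(2) by (auto simp: basis_vec_def fun_eq_iff)
  then show ?thesis using f torus_power_norm[OF z] by blast
qed

text \<open>
  Multiplying \<open>\<xi>\<close> by bumps around \<open>y\<close> that vanish at finitely many other points isolates its
  component at \<open>y\<close> in the limit. So an invariant closed subspace that contains \<open>\<xi>\<close> contains \<open>e\<^sub>y\<close>,
  and then all \<open>e\<^sub>w\<close>.
\<close>

lemma rho_invariant_subspace:
  assumes W: "closed_subspace S W" and inv: "\<forall>a\<in>elems E. \<forall>\<xi>\<in>W. \<rho> a \<xi> \<in> W" and v: "\<xi> \<in> W" "\<xi> y \<noteq> 0"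
  shows "W = ell2 S"
proof -
  have vE: "\<xi> \<in> ell2 S" using W v by (auto simp: closed_subspace_def)
  have y: "y \<in> S" using ell2_support[OF vE] v(2) by blast
  then have yM: "y \<in> M" using orbit_M[of y x] S by simp
  have scale: "(\<lambda>i. c * \<eta> i) \<in> W" if "\<eta> \<in> W" for c \<eta> using W that by (simp add: closed_subspace_def)
  have "(\<lambda>i. \<xi> y * basis_vec y i) \<in> W"
  proof (rule closed_subspace_approx[OF W])
    show "(\<lambda>i. \<xi> y * basis_vec y i) \<in> ell2 S" by (rule ell2_scale[OF basis_vec_ell2[OF y]])
    fix e :: real assume "e > 0"
    obtain F where F: "finite F" "F \<subseteq> S"
      "\<forall>\<zeta>. (\<forall>i. cmod (\<zeta> i) \<le> cmod (\<xi> i)) \<and> (\<forall>i\<in>F. \<zeta> i = 0) \<longrightarrow> ell2_norm S \<zeta> < e"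
      by (rule ell2_tail_small[OF vE \<open>e > 0\<close>])
    \<comment> \<open>the bump is \<open>1\<close> at \<open>y\<close> and vanishes at the other points of \<open>F\<close>\<close>
    let ?V = "M - (F - {y})"
    have "compactin X (F - {y})"
      using F orbit_M[of _ x] unfolding S by (intro finite_imp_compactin) auto
    then have "closedin X (F - {y})" by (rule compactin_imp_closedin[OF Hausdorff])
    then have V: "openin X ?V" by blast
    have yV: "y \<in> ?V" using yM by simp
    obtain h where h: "bump ?V (\<lambda>x. complex_of_real (h x))" "h y = 1" "\<forall>x. 0 \<le> h x \<and> h x \<le> 1"
      using bump_exists[OF V yV] by blast
    have hM: "bump M (\<lambda>x. complex_of_real (h x))"
      using bump_comp[OF h(1), of "\<lambda>c. c" M] by auto
    let ?\<eta> = "\<rho> (emb (diag (\<lambda>x. complex_of_real (h x)))) \<xi>"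
    have eW: "?\<eta> \<in> W" using inv emb_E[OF diag_Cc[OF hM]] v(1) by blast
    have eE: "?\<eta> \<in> ell2 S" using W eW by (auto simp: closed_subspace_def)
    have eta: "?\<eta> i = complex_of_real (h i) * \<xi> i" for i
      using rho_diag[OF hM vE, of i] ell2_support[OF eE, of i] ell2_support[OF vE, of i] by (cases "i \<in> S") auto
    have "ell2_norm S (\<lambda>i. ?\<eta> i - \<xi> y * basis_vec y i) < e"
    proof (rule F(3)[rule_format], intro conjI allI ballI)
      fix i
      have "cmod (complex_of_real (h i) * \<xi> i) \<le> cmod (\<xi> i)"
        using h(3) by (simp add: norm_mult mult_left_le_one_le)
      then show "cmod (?\<eta> i - \<xi> y * basis_vec y i) \<le> cmod (\<xi> i)"
        unfolding eta by (cases "i = y") (simp_all add: basis_vec_def h(2))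
    next
      fix i assume "i \<in> F"
      then have "i \<noteq> y \<Longrightarrow> h i = 0" using bump_zero_off[OF h(1), of i] by simp
      then show "?\<eta> i - \<xi> y * basis_vec y i = 0"
        unfolding eta by (cases "i = y") (simp_all add: basis_vec_def h(2))
    qed
    then show "\<exists>\<eta>\<in>W. ell2_norm S (\<lambda>i. \<eta> i - \<xi> y * basis_vec y i) < e"
      by (rule bexI[where x = ?\<eta>]) (rule eW)
  qed
  from scale[OF this, of "inverse (\<xi> y)"] have bW: "basis_vec y \<in> W" using v(2) by (simp add: mult.assoc[symmetric])
  show ?thesis
  proof (rule closed_subspace_basis[OF W])
    fix w assume w: "w \<in> S"
    obtain f c where f: "f \<in> Cc G" "cmod c = 1" "\<rho> (emb f) (basis_vec y) = (\<lambda>i. c * basis_vec w i)"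
      using rho_move[OF y w] by (elim exE conjE)
    have "\<rho> (emb f) (basis_vec y) \<in> W" by (rule inv[rule_format, OF emb_E[OF f(1)] bW])
    then have "(\<lambda>i. c * basis_vec w i) \<in> W" unfolding f(3) .
    moreover have "c \<noteq> 0" using f(2) by auto
    ultimately show "basis_vec w \<in> W"
      using scale[of "\<lambda>i. c * basis_vec w i" "inverse c"] by (simp add: mult.assoc[symmetric])
  qed
qed

lemma rho_irreducible: "irreducible_rep E S \<rho>"
  unfolding irreducible_rep_def
proof (intro conjI allI impI)
  show "star_rep E S \<rho>" by (rule rho_rep)
  have xS: "x \<in> S" unfolding S by (rule orbit_self[OF x])
  obtain f c where f: "f \<in> Cc G" "cmod c = 1" "\<rho> (emb f) (basis_vec x) = (\<lambda>i. c * basis_vec x i)"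
    using rho_move[OF xS xS] by (elim exE conjE)
  have "c * basis_vec x x \<noteq> 0" using f(2) by (auto simp: basis_vec_def)
  then have "\<rho> (emb f) (basis_vec x) \<noteq> (\<lambda>_. 0)" unfolding f(3) by metis
  then have "emb f \<notin> rep_ker E S \<rho>" using basis_vec_ell2[OF xS] by (auto simp: rep_ker_def)
  then show "rep_ker E S \<rho> \<noteq> elems E" using emb_E[OF f(1)] by blast
next
  fix W assume W: "closed_subspace S W \<and> (\<forall>a\<in>elems E. \<forall>\<xi>\<in>W. \<rho> a \<xi> \<in> W)"
  show "W = {\<lambda>_. 0} \<or> W = ell2 S"
  proof (cases "\<exists>\<xi>\<in>W. \<exists>y. \<xi> y \<noteq> 0")
    case True
    then show ?thesis using rho_invariant_subspace W by blast
  next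
    case False
    then have "\<xi> = (\<lambda>_. 0)" if "\<xi> \<in> W" for \<xi> using that by (auto simp: fun_eq_iff)
    moreover have "(\<lambda>_. 0) \<in> W" using W by (simp add: closed_subspace_def)
    ultimately show ?thesis by blast
  qed
qed

end

lemma DR_prim_in_prim:
  assumes x: "x \<in> M" and z: "z \<in> torus"
  shows "DR_prim X T (x, z) \<in> prim E"
proof -
  define g :: "'x \<Rightarrow> nat \<Rightarrow> 'x \<times> (int ^ 'k) \<times> 'x \<Rightarrow> complex"
    where "g y n \<gamma> = (if fst \<gamma> = y then 1 else 0)" for y n \<gamma>
  define j where "j y = {g y}" for y
  have "inj j"
  proof (rule injI)
    fix a b assume "j a = j b"
    then have "g a 0 (a, 0, a) = g b 0 (a, 0, a)" by (simp add: j_def)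
    then show "a = b" by (simp add: g_def split: if_splits)
  qed
  then have inj: "inj_on j (orbit G x)" by (rule inj_on_subset) simp
  note irr = rho_irreducible[OF x z refl refl]
  have st: "a \<in> elems E \<Longrightarrow> star E a \<in> elems E" for a using cstar.E_closed(4) by blast
  have "irreducible_rep E (j ` orbit G x) (push_rep j (orbit G x) (DR_rep X T x z))"
    by (rule push_rep_irreducible[OF inj irr st])
  then have "rep_ker E (j ` orbit G x) (push_rep j (orbit G x) (DR_rep X T x z)) \<in> prim E"
    unfolding prim_def by blast
  then show ?thesis
    using push_rep_ker[OF inj DR_rep_spec(1)[OF z]] by (simp add: DR_prim_def E_groupoid_cstar)
qed

end

section \<open>Averaging trigonometric polynomials over subgroups\<close>

definition ibox :: "nat \<Rightarrow> (int ^ 'k) set" where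
  "ibox n = {m. \<forall>i. \<bar>m $ i\<bar> \<le> int n}"

lemma ibox_PiE: "ibox n = (\<lambda>f. \<chi> i. f i) ` (PiE (UNIV :: 'k::finite set) (\<lambda>_. {- int n..int n}))"
proof (intro equalityI subsetI)
  fix m :: "int ^ 'k" assume m: "m \<in> ibox n"
  show "m \<in> (\<lambda>f. \<chi> i. f i) ` (PiE UNIV (\<lambda>_. {- int n..int n}))"
  proof (rule image_eqI)
    show "m = (\<chi> i. m $ i)" by simp
    have "\<bar>m $ i\<bar> \<le> int n" for i using m by (simp add: ibox_def)
    then show "(\<lambda>i. m $ i) \<in> PiE UNIV (\<lambda>_. {- int n..int n})"
      by (auto simp: abs_le_iff minus_le_iff)
  qed
qed (auto simp: ibox_def PiE_iff abs_le_iff minus_le_iff)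

lemma ibox_finite: "finite (ibox n :: (int ^ 'k::finite) set)"
  unfolding ibox_PiE by (intro finite_imageI finite_PiE) auto

lemma ibox_card: "card (ibox n :: (int ^ 'k) set) \<le> (2 * n + 1) ^ CARD('k::finite)"
proof -
  have "card (ibox n :: (int ^ 'k) set) \<le> card (PiE (UNIV :: 'k set) (\<lambda>_. {- int n..int n}))"
    unfolding ibox_PiE by (rule card_image_le) (intro finite_PiE; simp)
  also have "\<dots> = (2 * n + 1) ^ CARD('k)"
    by (simp add: card_PiE nat_add_distrib nat_mult_distrib algebra_simps)
  finally show ?thesis .
qed

lemma ibox_mono: "m \<le> n \<Longrightarrow> ibox m \<subseteq> ibox n"
proof -
  assume "m \<le> n"
  then have "k \<le> int m \<Longrightarrow> k \<le> int n" for k by simp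
  then show ?thesis by (simp add: ibox_def subset_iff)
qed

lemma ibox_0: "0 \<in> ibox n"
  by (simp add: ibox_def)

lemma ibox_add: "a \<in> ibox m \<Longrightarrow> b \<in> ibox n \<Longrightarrow> a + b \<in> ibox (m + n)"
  unfolding ibox_def by (auto intro: order_trans[OF abs_triangle_ineq] add_mono)

lemma ibox_minus: "a \<in> ibox m \<Longrightarrow> - a \<in> ibox m"
  by (simp add: ibox_def)

lemma ibox_diff: "a \<in> ibox m \<Longrightarrow> b \<in> ibox n \<Longrightarrow> a - b \<in> ibox (m + n)"
  using ibox_add[of a m "- b" n] ibox_minus[of b n] by simp

lemma finite_in_ibox:
  assumes "finite (Z :: (int ^ 'k::finite) set)" shows "\<exists>n. Z \<subseteq> ibox n"
proof (intro exI subsetI)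
  fix m assume m: "m \<in> Z"
  have "\<bar>m $ i\<bar> \<le> int (\<Sum>m\<in>Z. \<Sum>i\<in>UNIV. nat \<bar>m $ i\<bar>)" for i
  proof -
    have "nat \<bar>m $ i\<bar> \<le> (\<Sum>i\<in>UNIV. nat \<bar>m $ i\<bar>)" by (rule member_le_sum) auto
    also have "\<dots> \<le> (\<Sum>m\<in>Z. \<Sum>i\<in>UNIV. nat \<bar>m $ i\<bar>)"
      by (rule member_le_sum[where f = "\<lambda>m. \<Sum>i\<in>UNIV. nat \<bar>m $ i\<bar>"]) (use m assms in auto)
    finally show ?thesis by linarith
  qed
  then show "m \<in> ibox (\<Sum>m\<in>Z. \<Sum>i\<in>UNIV. nat \<bar>m $ i\<bar>)" by (simp add: ibox_def)
qed

lemma geometric_beats_polynomial: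
  fixes r a b :: real
  assumes r: "0 \<le> r" "r < 1" and K: "0 < K"
  shows "(\<lambda>n. r ^ n * (a * real n + b) ^ K) \<longlonglongrightarrow> 0"
proof -
  define t where "t = root K r"
  have t: "0 \<le> t" "t < 1" "t ^ K = r" using r K by (simp_all add: t_def)
  have "(\<lambda>n. a * (real n * t ^ n) + b * t ^ n) \<longlonglongrightarrow> a * 0 + b * 0"
    using t by (intro tendsto_add tendsto_mult tendsto_const powser_times_n_limit_0 LIMSEQ_realpow_zero) auto
  then have "(\<lambda>n. (a * (real n * t ^ n) + b * t ^ n) ^ K) \<longlonglongrightarrow> 0 ^ K"
    by (intro tendsto_power) simp
  moreover have "(a * (real n * t ^ n) + b * t ^ n) ^ K = r ^ n * (a * real n + b) ^ K" for n
  proof -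
    have "a * (real n * t ^ n) + b * t ^ n = t ^ n * (a * real n + b)" by (simp add: algebra_simps)
    then show ?thesis by (simp add: power_mult_distrib t(3)[symmetric] power_mult[symmetric] mult.commute)
  qed
  ultimately show ?thesis using K by (simp add: power_0_left)
qed

text \<open>
  Averaging over the \<open>L\<close>-torsion points of the torus, with \<open>L\<close> larger than the absolute values of
  all exponents involved, extracts constant terms.
\<close>

lemma torsion_orthogonality:
  assumes "finite (Z :: (int ^ 'k::finite) set)"
  shows "\<exists>(J :: ('k \<Rightarrow> nat) set) \<omega>. finite J \<and> J \<noteq> {} \<and> (\<forall>j\<in>J. \<omega> j \<in> torus) \<and>
    (\<forall>n\<in>Z. (\<Sum>j\<in>J. torus_power (\<omega> j) n) = (if n = 0 then of_nat (card J) else 0))"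
proof -
  obtain l where l: "Z \<subseteq> ibox l" using finite_in_ibox[OF assms] by blast
  \<comment> \<open>the exponents lie strictly between \<open>-L\<close> and \<open>L\<close>, so only \<open>0\<close> is divisible by \<open>L\<close>\<close>
  define L where "L = l + 1"
  define J where "J = PiE (UNIV :: 'k set) (\<lambda>_. {..<L})"
  define \<omega> :: "('k \<Rightarrow> nat) \<Rightarrow> complex ^ 'k" where "\<omega> j = (\<chi> i. cis (2 * pi * real (j i) / real L))" for j
  have J: "finite J" "J \<noteq> {}" "card J = L ^ CARD('k)"
    unfolding J_def by (auto simp: L_def card_PiE PiE_eq_empty_iff intro: finite_PiE)
  have one: "(\<Sum>j<L. cis (2 * pi * real j / real L) powi n) = (if n = 0 then of_nat L else 0)" if n: "\<bar>n\<bar> < int L" for n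
  proof (cases "n = 0")
    case False
    define r where "r = cis (2 * pi * of_int n / real L)"
    have "cis (2 * pi * real j / real L) powi n = r ^ j" for j
      unfolding r_def cis_power_int Complex.DeMoivre by (simp add: algebra_simps)
    then have s: "(\<Sum>j<L. cis (2 * pi * real j / real L) powi n) = (\<Sum>j<L. r ^ j)" by simp
    have "r ^ L = 1"
    proof -
      have "r ^ L = cis (2 * pi * of_int n)" unfolding r_def Complex.DeMoivre by (simp add: L_def)
      also have "\<dots> = 1" by (rule cis_multiple_2pi) simp
      finally show ?thesis .
    qed
    moreover have "r \<noteq> 1"
    proof
      assume "r = 1"
      then have "Re r = 1" by simp
      then have "cos (2 * pi * of_int n / real L) = 1" unfolding r_def by simp
      then obtain k :: int where k: "2 * pi * of_int n / real L = of_int k * 2 * pi" by (auto simp: cos_one_2pi_int)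
      have "2 * pi * of_int n = (2 * pi * of_int n / real L) * real L" by (simp add: L_def)
      also have "\<dots> = of_int k * 2 * pi * real L" unfolding k ..
      finally have "2 * pi * of_int n = of_int k * 2 * pi * real L" .
      then have "(2 * pi) * real_of_int n = (2 * pi) * real_of_int (k * int L)" by (simp add: mult_ac)
      then have "real_of_int n = real_of_int (k * int L)" by (subst (asm) mult_cancel_left) simp
      then have "n = k * int L" by (simp only: of_int_eq_iff)
      moreover from this False have "k \<noteq> 0" by auto
      ultimately have "\<bar>n\<bar> \<ge> int L"
        using mult_right_mono[of 1 "\<bar>k\<bar>" "int L"] by (simp add: abs_mult)
      then show False using n by simp
    qed
    moreover have "1 - r ^ L = (1 - r) * (\<Sum>j<L. r ^ j)" by (rule one_diff_power_eq)
    ultimately have "(\<Sum>j<L. r ^ j) = 0" by simp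
    then show ?thesis using s False by simp
  qed simp
  have "(\<Sum>j\<in>J. torus_power (\<omega> j) n) = (if n = 0 then of_nat (card J) else 0)" if "n \<in> Z" for n
  proof -
    have nl: "\<bar>n $ i\<bar> < int L" for i using l that by (auto simp: ibox_def L_def dest!: subsetD spec[of _ i])
    have "(\<Sum>j\<in>J. torus_power (\<omega> j) n) = (\<Sum>j\<in>J. \<Prod>i\<in>UNIV. cis (2 * pi * real (j i) / real L) powi (n $ i))"
      by (simp add: torus_power_def \<omega>_def)
    also have "\<dots> = (\<Prod>i\<in>UNIV. \<Sum>j<L. cis (2 * pi * real j / real L) powi (n $ i))"
      unfolding J_def by (rule prod_sum_PiE[symmetric]) auto
    also have "\<dots> = (\<Prod>i\<in>UNIV. if n $ i = 0 then of_nat L else 0)"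
      by (rule prod.cong[OF refl]) (rule one[OF nl])
    also have "\<dots> = (if n = 0 then of_nat (card J) else 0)"
    proof (cases "n = 0")
      case False
      then obtain i where "n $ i \<noteq> 0" by (auto simp: vec_eq_iff)
      then show ?thesis using False by (auto intro!: prod_zero)
    qed (simp add: J(3))
    finally show ?thesis .
  qed
  moreover have "\<omega> j \<in> torus" for j by (simp add: \<omega>_def torus_def)
  ultimately show ?thesis using J(1,2) by blast
qed

lemma torus_power_diff:
  "z \<in> torus \<Longrightarrow> torus_power z (a - b) = torus_power z a * cnj (torus_power z b)"
  using torus_power_add[of z a "- b"] by (simp add: torus_power_cnj)

lemma trig_cmod_sq:
  assumes "z \<in> torus"
  shows "complex_of_real ((cmod (\<Sum>a\<in>S. c a * torus_power z (e a)))\<^sup>2)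
    = (\<Sum>a\<in>S. \<Sum>b\<in>S. c a * cnj (c b) * torus_power z (e a - e b))"
  unfolding complex_norm_square cnj_sum sum_product
  by (intro sum.cong refl) (simp add: torus_power_diff[OF assms] mult_ac)

text \<open>
  The sum of the coefficients over a subgroup \<open>H\<close> is a positive functional on trigonometric
  polynomials; it is approximated by averages against \<open>\<bar>v\<bar>\<^sup>2\<close>, where \<open>v\<close> is the sum of the
  characters in \<open>H\<close> inside a large box. Since the number of points of \<open>H\<close> in a box grows
  polynomially, some box is almost invariant under small translations. All of this happens in a
  box of fixed size, so \<open>H\<close> need only be closed under differences there.
\<close>

lemma local_subgroup_positivity:
  fixes D :: "(int ^ 'k::finite) set"
  assumes D: "finite D" "D \<subseteq> ibox d" and \<epsilon>: "0 < \<epsilon>" and P: "0 \<le> P"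
  shows "\<exists>R\<ge>d. \<forall>H p Q c e \<beta> \<eta>. 0 \<in> H \<longrightarrow> H \<subseteq> ibox R \<longrightarrow> (\<forall>a\<in>H. \<forall>b\<in>H. a - b \<in> ibox R \<longrightarrow> a - b \<in> H) \<longrightarrow>
    (\<Sum>n\<in>D. cmod (p n)) \<le> P \<longrightarrow> finite (Q :: 'q set) \<longrightarrow> (\<forall>b\<in>Q. 0 \<le> \<beta> b) \<longrightarrow> 0 \<le> c \<longrightarrow>
    (\<forall>w\<in>torus. c * (cmod (\<Sum>b\<in>Q. complex_of_real (\<beta> b) * torus_power w (e b)))\<^sup>2 - \<eta>
        \<le> Re (\<Sum>n\<in>D. p n * torus_power w n)) \<longrightarrow>
    c * (\<Sum>b\<in>Q. (\<beta> b)\<^sup>2) - \<eta> - \<epsilon> \<le> Re (\<Sum>n\<in>D \<inter> H. p n)"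
proof -
  \<comment> \<open>if a set is invariant under \<open>D\<close> up to a fraction \<open>1 - r\<close>, the error is at most \<open>P (1 - r) \<le> \<epsilon>\<close>\<close>
  define r where "r = 1 - \<epsilon> / (P + \<epsilon>)"
  have r: "0 \<le> r" "r < 1" using \<epsilon> P by (simp_all add: r_def)
  have Pr: "P * (1 - r) \<le> \<epsilon>"
  proof -
    have "P * \<epsilon> \<le> \<epsilon> * (P + \<epsilon>)" using \<epsilon> P by (simp add: algebra_simps)
    then show ?thesis using \<epsilon> P by (simp add: r_def pos_divide_le_eq)
  qed
  let ?K = "CARD('k)"
  have "(\<lambda>n. r ^ n * ((2 * real d) * real n + 1) ^ ?K) \<longlonglongrightarrow> 0"
    by (rule geometric_beats_polynomial[OF r]) simp
  from LIMSEQ_D[OF this, of 1] obtain N where "\<forall>n\<ge>N. \<bar>r ^ n * ((2 * real d) * real n + 1) ^ ?K\<bar> < 1" by auto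
  then have N: "r ^ N * ((2 * real d) * real N + 1) ^ ?K < 1" by fastforce
  \<comment> \<open>room for differences of two elements of the box of size \<open>d N\<close>, and for the steps in \<open>D\<close>\<close>
  define R where "R = 2 * (d * N) + d"
  show ?thesis
  proof (intro exI[of _ R] conjI allI impI)
    show "d \<le> R" by (simp add: R_def)
    fix H :: "(int ^ 'k) set" and p Q c and e :: "'q \<Rightarrow> int ^ 'k" and \<beta> \<eta>
    assume H0: "0 \<in> H" and HR: "H \<subseteq> ibox R" and Hd: "\<forall>a\<in>H. \<forall>b\<in>H. a - b \<in> ibox R \<longrightarrow> a - b \<in> H"
      and p: "(\<Sum>n\<in>D. cmod (p n)) \<le> P" and Q: "finite (Q :: 'q set)" and \<beta>: "\<forall>b\<in>Q. 0 \<le> \<beta> b" and c: "0 \<le> c"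
      and lower: "\<forall>w\<in>torus. c * (cmod (\<Sum>b\<in>Q. complex_of_real (\<beta> b) * torus_power w (e b)))\<^sup>2 - \<eta>
        \<le> Re (\<Sum>n\<in>D. p n * torus_power w n)"
    define h where "h j = card (H \<inter> ibox (d * j))" for j
    have fin: "finite (H \<inter> ibox n)" for n using ibox_finite[of n] by blast
    \<comment> \<open>otherwise the number of points would grow exponentially\<close>
    have "\<exists>j<N. r * real (h (Suc j)) \<le> real (h j)"
    proof (rule ccontr)
      assume "\<not> (\<exists>j<N. r * real (h (Suc j)) \<le> real (h j))"
      then have step: "real (h j) \<le> r * real (h (Suc j))" if "j < N" for j using that by force
      have "real (h 0) \<le> r ^ j * real (h j)" if "j \<le> N" for j
        using that
      proof (induction j)
        case (Suc j)
        then have "real (h 0) \<le> r ^ j * real (h j)" by simp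
        also have "\<dots> \<le> r ^ j * (r * real (h (Suc j)))"
          using Suc step r by (intro mult_left_mono) auto
        finally show ?case by (simp add: mult_ac)
      qed simp
      then have "real (h 0) \<le> r ^ N * real (h N)" by simp
      also have "\<dots> \<le> r ^ N * ((2 * real d) * real N + 1) ^ ?K"
      proof (rule mult_left_mono)
        have "h N \<le> card (ibox (d * N) :: (int ^ 'k) set)"
          unfolding h_def by (intro card_mono ibox_finite) auto
        also have "\<dots> \<le> (2 * (d * N) + 1) ^ ?K" by (rule ibox_card)
        finally have "real (h N) \<le> real ((2 * (d * N) + 1) ^ ?K)" by (rule of_nat_mono)
        then show "real (h N) \<le> ((2 * real d) * real N + 1) ^ ?K" by (simp add: algebra_simps)
      qed (use r in simp)
      also have "\<dots> < 1" by (rule N)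
      finally have "h 0 = 0" by simp
      then show False using H0 ibox_0[of "d * 0"] fin[of "d * 0"] by (auto simp: h_def)
    qed
    then obtain j where j: "j < N" "r * real (h (Suc j)) \<le> real (h j)" by blast
    define S where "S = H \<inter> ibox (d * Suc j)"
    define S0 where "S0 = H \<inter> ibox (d * j)"
    have S: "finite S" "S0 \<subseteq> S" "card S = h (Suc j)" "card S0 = h j"
      using fin ibox_mono[of "d * j" "d * Suc j"] by (auto simp: S_def S0_def h_def)
    have "0 \<in> S" using H0 ibox_0 by (simp add: S_def)
    then have Spos: "card S > 0" using S(1) by (auto simp: card_gt_0_iff)
    have djN: "d * Suc j \<le> d * N" using j(1) by (intro mult_le_mono2) simp
    have SR: "a - b \<in> H" if "a \<in> S" "b \<in> S" for a b
    proof -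
      have box: "a - b \<in> ibox (d * Suc j + d * Suc j)" using that by (intro ibox_diff) (auto simp: S_def)
      have "d * Suc j + d * Suc j \<le> R" using djN unfolding R_def by linarith
      from subsetD[OF ibox_mono[OF this] box] have "a - b \<in> ibox R" .
      then show ?thesis using Hd that by (auto simp: S_def)
    qed
    \<comment> \<open>sums are differences \<open>a - (0 - n)\<close>\<close>
    have shift: "a + n \<in> S" if "a \<in> S0" "n \<in> D \<inter> H" for a n
    proof -
      have nd: "n \<in> ibox d" using that D by blast
      have dR: "d \<le> R" by (simp add: R_def)
      have nH: "n \<in> H" and aH: "a \<in> H" using that by (auto simp: S0_def)
      have "0 - n \<in> ibox R" using ibox_minus[OF nd] ibox_mono[OF dR] by auto
      then have mH: "0 - n \<in> H" by (rule Hd[rule_format, OF H0 nH])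
      have box: "a + n \<in> ibox (d * j + d)" using that nd by (intro ibox_add) (auto simp: S0_def)
      have "d * j + d \<le> R" using djN unfolding R_def mult_Suc_right by linarith
      from subsetD[OF ibox_mono[OF this] box] have "a + n \<in> ibox R" .
      then have "a - (0 - n) \<in> H" using Hd[rule_format, OF aH mH] by simp
      then show ?thesis using box by (simp add: S_def add.commute)
    qed
    \<comment> \<open>the \<open>n\<close>-th coefficient of \<open>\<bar>v\<bar>\<^sup>2\<close>, where \<open>v\<close> is the sum of the characters in \<open>S\<close>\<close>
    define m where "m n = card {a \<in> S. a + n \<in> S}" for n
    have m_le: "m n \<le> card S" for n unfolding m_def by (rule card_mono[OF S(1)]) auto
    have m_ge: "r * real (card S) \<le> real (m n)" if "n \<in> D \<inter> H" for n
    proof -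
      have "card S0 \<le> m n" unfolding m_def by (rule card_mono) (use S shift[OF _ that] in auto)
      then show ?thesis using j(2) S by simp
    qed
    have m_0: "m n = 0" if "n \<notin> H" for n
    proof -
      have "a + n \<notin> S" if "a \<in> S" for a using SR[of "a + n" a] that \<open>n \<notin> H\<close> by auto
      then have "{a \<in> S. a + n \<in> S} = {}" by blast
      then show ?thesis by (simp only: m_def card.empty)
    qed
    \<comment> \<open>all exponents that occur in the averages below\<close>
    define Z where "Z = (\<lambda>(n, a, b). n + (a - b)) ` (D \<times> S \<times> S)
      \<union> (\<lambda>((x, y), a, b). e x - e y + (a - b)) ` ((Q \<times> Q) \<times> S \<times> S) \<union> (\<lambda>(a, b). a - b) ` (S \<times> S)"
    have finZ: "finite Z" unfolding Z_def using D Q S by (intro finite_UnI finite_imageI finite_cartesian_product)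
    obtain J :: "('k \<Rightarrow> nat) set" and \<omega> where J: "finite J" "J \<noteq> {}" "\<forall>j\<in>J. \<omega> j \<in> torus"
      "\<forall>n\<in>Z. (\<Sum>j\<in>J. torus_power (\<omega> j) n) = (if n = 0 then of_nat (card J) else 0)"
      using torsion_orthogonality[OF finZ] by (elim exE conjE)
    have Z1: "n + (a - b) \<in> Z" if "n \<in> D" "a \<in> S" "b \<in> S" for n a b
      using that unfolding Z_def by (intro UnI1 image_eqI[of _ _ "(n, a, b)"]) auto
    have Z2: "e x - e y + (a - b) \<in> Z" if "x \<in> Q" "y \<in> Q" "a \<in> S" "b \<in> S" for x y a b
      using that unfolding Z_def by (intro UnI1 UnI2 image_eqI[of _ _ "((x, y), a, b)"]) auto
    have Z3: "a - b \<in> Z" if "a \<in> S" "b \<in> S" for a b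
      using that unfolding Z_def by (intro UnI2 image_eqI[of _ _ "(a, b)"]) auto
    define C where "C = real (card J)"
    have C: "C > 0" using J by (simp add: C_def card_gt_0_iff)
    define v where "v w = (cmod (\<Sum>a\<in>S. torus_power w a))\<^sup>2" for w
    have v: "complex_of_real (v w) = (\<Sum>a\<in>S. \<Sum>b\<in>S. torus_power w (a - b))" if "w \<in> torus" for w
      using trig_cmod_sq[OF that, where S = S and c = "\<lambda>_. 1" and e = "\<lambda>a. a"] by (simp add: v_def)
    \<comment> \<open>the average of \<open>\<bar>v\<bar>\<^sup>2\<close>\<close>
    have avg_v: "(\<Sum>j\<in>J. v (\<omega> j)) = C * real (card S)"
    proof -
      have "complex_of_real (\<Sum>j\<in>J. v (\<omega> j)) = (\<Sum>j\<in>J. \<Sum>a\<in>S. \<Sum>b\<in>S. torus_power (\<omega> j) (a - b))"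
        unfolding of_real_sum using J(3) by (intro sum.cong refl v) auto
      also have "\<dots> = (\<Sum>a\<in>S. \<Sum>b\<in>S. \<Sum>j\<in>J. torus_power (\<omega> j) (a - b))"
        by (subst sum.swap, rule sum.cong[OF refl], rule sum.swap)
      also have "\<dots> = (\<Sum>a\<in>S. \<Sum>b\<in>S. if b = a then of_nat (card J) else 0)"
        by (intro sum.cong refl) (use J(4) Z3 in auto)
      also have "\<dots> = complex_of_real (C * real (card S))"
        using S(1) by (simp add: C_def)
      finally show ?thesis by (simp only: of_real_eq_iff)
    qed
    \<comment> \<open>the average of \<open>p \<bar>v\<bar>\<^sup>2\<close>\<close>
    have avg_p: "(\<Sum>j\<in>J. (\<Sum>n\<in>D. p n * torus_power (\<omega> j) n) * complex_of_real (v (\<omega> j)))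
        = complex_of_real C * (\<Sum>n\<in>D. p n * of_nat (m n))"
    proof -
      have "(\<Sum>j\<in>J. (\<Sum>n\<in>D. p n * torus_power (\<omega> j) n) * complex_of_real (v (\<omega> j)))
          = (\<Sum>j\<in>J. \<Sum>n\<in>D. \<Sum>a\<in>S. \<Sum>b\<in>S. p n * torus_power (\<omega> j) (n + (a - b)))"
      proof (rule sum.cong[OF refl])
        fix j assume "j \<in> J"
        then have w: "\<omega> j \<in> torus" using J(3) by blast
        show "(\<Sum>n\<in>D. p n * torus_power (\<omega> j) n) * complex_of_real (v (\<omega> j))
            = (\<Sum>n\<in>D. \<Sum>a\<in>S. \<Sum>b\<in>S. p n * torus_power (\<omega> j) (n + (a - b)))"
          unfolding v[OF w] torus_power_add[OF w] sum_distrib_right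
          unfolding sum_distrib_left mult.assoc ..
      qed
      also have "\<dots> = (\<Sum>n\<in>D. \<Sum>a\<in>S. \<Sum>b\<in>S. \<Sum>j\<in>J. p n * torus_power (\<omega> j) (n + (a - b)))"
        by (subst sum.swap, rule sum.cong[OF refl], subst sum.swap, rule sum.cong[OF refl], rule sum.swap)
      also have "\<dots> = (\<Sum>n\<in>D. \<Sum>a\<in>S. \<Sum>b\<in>S. if b = a + n then p n * of_nat (card J) else 0)"
      proof (intro sum.cong refl)
        fix n a b assume "n \<in> D" "a \<in> S" "b \<in> S"
        then have "(\<Sum>j\<in>J. torus_power (\<omega> j) (n + (a - b))) = (if n + (a - b) = 0 then of_nat (card J) else 0)"
          using J(4) Z1 by blast
        moreover have "n + (a - b) = 0 \<longleftrightarrow> b = a + n" by (auto simp: algebra_simps)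
        ultimately show "(\<Sum>j\<in>J. p n * torus_power (\<omega> j) (n + (a - b))) = (if b = a + n then p n * of_nat (card J) else 0)"
          by (simp add: sum_distrib_left[symmetric])
      qed
      also have "\<dots> = (\<Sum>n\<in>D. \<Sum>a\<in>S. if a + n \<in> S then p n * of_nat (card J) else 0)"
        using S(1) by simp
      also have "\<dots> = (\<Sum>n\<in>D. p n * of_nat (card J) * of_nat (m n))"
        by (intro sum.cong refl) (simp add: sum.If_cases[OF S(1)] m_def Int_def mult_ac)
      also have "\<dots> = complex_of_real C * (\<Sum>n\<in>D. p n * of_nat (m n))"
        by (simp add: sum_distrib_left C_def mult_ac)
      finally show ?thesis .
    qed
    define q where "q w = (cmod (\<Sum>b\<in>Q. complex_of_real (\<beta> b) * torus_power w (e b)))\<^sup>2" for w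
    \<comment> \<open>the average of \<open>\<bar>q v\<bar>\<^sup>2\<close>: all terms are nonnegative, and the diagonal ones suffice\<close>
    have avg_q: "C * ((\<Sum>b\<in>Q. (\<beta> b)\<^sup>2) * real (card S)) \<le> (\<Sum>j\<in>J. q (\<omega> j) * v (\<omega> j))"
    proof -
      have "complex_of_real (\<Sum>j\<in>J. q (\<omega> j) * v (\<omega> j))
          = (\<Sum>j\<in>J. \<Sum>x\<in>Q. \<Sum>y\<in>Q. \<Sum>a\<in>S. \<Sum>b\<in>S. complex_of_real (\<beta> x * \<beta> y) * torus_power (\<omega> j) (e x - e y + (a - b)))"
        unfolding of_real_sum
      proof (rule sum.cong[OF refl])
        fix j assume "j \<in> J"
        then have w: "\<omega> j \<in> torus" using J(3) by blast
        show "complex_of_real (q (\<omega> j) * v (\<omega> j)) = (\<Sum>x\<in>Q. \<Sum>y\<in>Q. \<Sum>a\<in>S. \<Sum>b\<in>S. complex_of_real (\<beta> x * \<beta> y) * torus_power (\<omega> j) (e x - e y + (a - b)))"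
          unfolding of_real_mult v[OF w] q_def trig_cmod_sq[OF w] torus_power_add[OF w] sum_distrib_right
          unfolding sum_distrib_left mult.assoc complex_cnj_complex_of_real ..
      qed
      also have "\<dots> = (\<Sum>x\<in>Q. \<Sum>y\<in>Q. \<Sum>a\<in>S. \<Sum>b\<in>S. \<Sum>j\<in>J. complex_of_real (\<beta> x * \<beta> y) * torus_power (\<omega> j) (e x - e y + (a - b)))"
        by (subst sum.swap, rule sum.cong[OF refl], subst sum.swap, rule sum.cong[OF refl],
            subst sum.swap, rule sum.cong[OF refl], rule sum.swap)
      also have "\<dots> = (\<Sum>x\<in>Q. \<Sum>y\<in>Q. \<Sum>a\<in>S. \<Sum>b\<in>S. complex_of_real (if e x - e y + (a - b) = 0 then \<beta> x * \<beta> y * C else 0))"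
      proof (intro sum.cong refl)
        fix x y a b assume "x \<in> Q" "y \<in> Q" "a \<in> S" "b \<in> S"
        then have "(\<Sum>j\<in>J. torus_power (\<omega> j) (e x - e y + (a - b))) = (if e x - e y + (a - b) = 0 then of_nat (card J) else 0)"
          using J(4) Z2 by blast
        then show "(\<Sum>j\<in>J. complex_of_real (\<beta> x * \<beta> y) * torus_power (\<omega> j) (e x - e y + (a - b)))
            = complex_of_real (if e x - e y + (a - b) = 0 then \<beta> x * \<beta> y * C else 0)"
          by (simp add: sum_distrib_left[symmetric] C_def)
      qed
      also have "\<dots> = complex_of_real (\<Sum>x\<in>Q. \<Sum>y\<in>Q. \<Sum>a\<in>S. \<Sum>b\<in>S. if e x - e y + (a - b) = 0 then \<beta> x * \<beta> y * C else 0)"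
        by (simp only: of_real_sum)
      finally have eq: "(\<Sum>j\<in>J. q (\<omega> j) * v (\<omega> j))
          = (\<Sum>x\<in>Q. \<Sum>y\<in>Q. \<Sum>a\<in>S. \<Sum>b\<in>S. if e x - e y + (a - b) = 0 then \<beta> x * \<beta> y * C else 0)"
        by (simp only: of_real_eq_iff)
      have "C * ((\<Sum>b\<in>Q. (\<beta> b)\<^sup>2) * real (card S)) = (\<Sum>x\<in>Q. \<Sum>a\<in>S. \<beta> x * \<beta> x * C)"
        by (simp add: sum_distrib_left sum_distrib_right power2_eq_square mult_ac)
      also have "\<dots> \<le> (\<Sum>x\<in>Q. \<Sum>a\<in>S. \<Sum>b\<in>S. if e x - e x + (a - b) = 0 then \<beta> x * \<beta> x * C else 0)"
        using S(1) by (intro sum_mono) simp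
      also have "\<dots> \<le> (\<Sum>x\<in>Q. \<Sum>y\<in>Q. \<Sum>a\<in>S. \<Sum>b\<in>S. if e x - e y + (a - b) = 0 then \<beta> x * \<beta> y * C else 0)"
      proof (rule sum_mono)
        fix x assume x: "x \<in> Q"
        show "(\<Sum>a\<in>S. \<Sum>b\<in>S. if e x - e x + (a - b) = 0 then \<beta> x * \<beta> x * C else 0)
            \<le> (\<Sum>y\<in>Q. \<Sum>a\<in>S. \<Sum>b\<in>S. if e x - e y + (a - b) = 0 then \<beta> x * \<beta> y * C else 0)"
          by (rule member_le_sum[OF x, where f = "\<lambda>y. \<Sum>a\<in>S. \<Sum>b\<in>S. if e x - e y + (a - b) = 0 then \<beta> x * \<beta> y * C else 0"])
            (use \<beta> x C Q in \<open>auto intro!: sum_nonneg\<close>)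
      qed
      finally show ?thesis unfolding eq .
    qed
    have "c * (C * ((\<Sum>b\<in>Q. (\<beta> b)\<^sup>2) * real (card S))) - \<eta> * (C * real (card S))
        \<le> c * (\<Sum>j\<in>J. q (\<omega> j) * v (\<omega> j)) - \<eta> * (\<Sum>j\<in>J. v (\<omega> j))"
      unfolding avg_v using mult_left_mono[OF avg_q c] by simp
    also have "\<dots> = (\<Sum>j\<in>J. (c * q (\<omega> j) - \<eta>) * v (\<omega> j))"
      by (simp add: sum_distrib_left sum_subtractf algebra_simps)
    also have "\<dots> \<le> (\<Sum>j\<in>J. Re (\<Sum>n\<in>D. p n * torus_power (\<omega> j) n) * v (\<omega> j))"
      using lower J(3) by (intro sum_mono mult_right_mono) (auto simp: q_def v_def)
    also have "\<dots> = Re (\<Sum>j\<in>J. (\<Sum>n\<in>D. p n * torus_power (\<omega> j) n) * complex_of_real (v (\<omega> j)))"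
      by simp
    also have "\<dots> = C * Re (\<Sum>n\<in>D. p n * of_nat (m n))" unfolding avg_p by simp
    finally have "C * ((c * (\<Sum>b\<in>Q. (\<beta> b)\<^sup>2) - \<eta>) * real (card S)) \<le> C * Re (\<Sum>n\<in>D. p n * of_nat (m n))"
      by (simp add: algebra_simps)
    then have "(c * (\<Sum>b\<in>Q. (\<beta> b)\<^sup>2) - \<eta>) * real (card S) \<le> Re (\<Sum>n\<in>D. p n * of_nat (m n))"
      using C by simp
    also have "(\<Sum>n\<in>D. p n * of_nat (m n)) = (\<Sum>n\<in>D \<inter> H. p n * of_nat (m n))"
      by (rule sum.mono_neutral_right) (use D m_0 in auto)
    also have "Re \<dots> \<le> Re (\<Sum>n\<in>D \<inter> H. p n * of_nat (card S)) + \<epsilon> * real (card S)"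
    proof -
      have "cmod ((\<Sum>n\<in>D \<inter> H. p n * of_nat (m n)) - (\<Sum>n\<in>D \<inter> H. p n * of_nat (card S)))
          \<le> (\<Sum>n\<in>D \<inter> H. cmod (p n) * ((1 - r) * real (card S)))"
        unfolding sum_subtractf[symmetric]
      proof (rule sum_norm_le)
        fix n assume n: "n \<in> D \<inter> H"
        have "p n * of_nat (m n) - p n * of_nat (card S) = p n * complex_of_real (real (m n) - real (card S))"
          by (simp add: right_diff_distrib)
        then have "cmod (p n * of_nat (m n) - p n * of_nat (card S)) = cmod (p n) * \<bar>real (m n) - real (card S)\<bar>"
          by (simp only: norm_mult norm_of_real)
        also have "\<dots> \<le> cmod (p n) * ((1 - r) * real (card S))"
          using m_le[of n] m_ge[OF n] by (intro mult_left_mono) (auto simp: algebra_simps)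
        finally show "cmod (p n * of_nat (m n) - p n * of_nat (card S)) \<le> cmod (p n) * ((1 - r) * real (card S))" .
      qed
      also have "\<dots> = (\<Sum>n\<in>D \<inter> H. cmod (p n)) * (1 - r) * real (card S)"
        by (simp only: sum_distrib_right mult.assoc)
      also have "\<dots> \<le> (P * (1 - r)) * real (card S)"
      proof (intro mult_right_mono)
        show "(\<Sum>n\<in>D \<inter> H. cmod (p n)) \<le> P"
          using p D by (intro order_trans[OF sum_mono2[of D "D \<inter> H"]]) auto
      qed (use r in auto)
      also have "\<dots> \<le> \<epsilon> * real (card S)" by (rule mult_right_mono[OF Pr]) simp
      finally have "Re ((\<Sum>n\<in>D \<inter> H. p n * of_nat (m n)) - (\<Sum>n\<in>D \<inter> H. p n * of_nat (card S))) \<le> \<epsilon> * real (card S)"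
        by (rule order_trans[OF complex_Re_le_cmod])
      then show ?thesis by simp
    qed
    also have "Re (\<Sum>n\<in>D \<inter> H. p n * of_nat (card S)) = Re (\<Sum>n\<in>D \<inter> H. p n) * real (card S)"
      by (simp flip: sum_distrib_right)
    finally have "(c * (\<Sum>b\<in>Q. (\<beta> b)\<^sup>2) - \<eta> - \<epsilon>) * real (card S) \<le> Re (\<Sum>n\<in>D \<inter> H. p n) * real (card S)"
      by (simp add: algebra_simps)
    then show "c * (\<Sum>b\<in>Q. (\<beta> b)\<^sup>2) - \<eta> - \<epsilon> \<le> Re (\<Sum>n\<in>D \<inter> H. p n)"
      using Spos by simp
  qed
qed

text \<open>
  The powers of \<open>\<Prod>\<^sub>i (1 + w\<^sub>i)/2\<close> concentrate at \<open>w = 1\<close>: away from this point they decay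
  exponentially, whereas the sum of the squares of the coefficients decays at most polynomially.
\<close>

lemma concentrating_polynomial:
  assumes \<delta>: "0 < \<delta>" and \<eta>: "0 < \<eta>"
  shows "\<exists>(Q :: ('k::finite \<Rightarrow> nat) set) \<beta> e. finite Q \<and> (\<forall>b\<in>Q. 0 \<le> \<beta> b) \<and> 0 < (\<Sum>b\<in>Q. (\<beta> b)\<^sup>2) \<and>
    (\<forall>w\<in>torus. (cmod (\<Sum>b\<in>Q. complex_of_real (\<beta> b) * torus_power w (e b :: int ^ 'k)))\<^sup>2 \<le> 1 \<and>
      ((\<exists>i. \<delta> \<le> cmod (w $ i - 1)) \<longrightarrow>
        (cmod (\<Sum>b\<in>Q. complex_of_real (\<beta> b) * torus_power w (e b)))\<^sup>2 \<le> \<eta> * (\<Sum>b\<in>Q. (\<beta> b)\<^sup>2)))"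
proof -
  define \<theta> where "\<theta> = max 0 (1 - \<delta>\<^sup>2 / 4)"
  have \<theta>: "0 \<le> \<theta>" "\<theta> < 1" using \<delta> by (auto simp: \<theta>_def)
  let ?K = "CARD('k)"
  have "(\<lambda>n. \<theta> ^ n * (1 * real n + 1) ^ ?K) \<longlonglongrightarrow> 0"
    by (rule geometric_beats_polynomial[OF \<theta>]) simp
  from LIMSEQ_D[OF this \<eta>] obtain N where "\<forall>n\<ge>N. \<bar>\<theta> ^ n * (1 * real n + 1) ^ ?K\<bar> < \<eta>" by auto
  then have "\<bar>\<theta> ^ N * (1 * real N + 1) ^ ?K\<bar> < \<eta>" by blast
  then have N: "\<theta> ^ N * (real N + 1) ^ ?K < \<eta>" by simp
  define Q where "Q = PiE (UNIV :: 'k set) (\<lambda>_. {..N})"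
  define \<beta> where "\<beta> b = (\<Prod>i\<in>UNIV. real (N choose (b i)) / 2 ^ N)" for b :: "'k \<Rightarrow> nat"
  define e :: "('k \<Rightarrow> nat) \<Rightarrow> int ^ 'k" where "e b = (\<chi> i. int (b i))" for b
  have Q: "finite Q" "card Q = (N + 1) ^ ?K" unfolding Q_def by (auto simp: card_PiE intro: finite_PiE)
  have \<beta>0: "0 \<le> \<beta> b" for b unfolding \<beta>_def by (intro prod_nonneg) auto
  have poly: "(\<Sum>b\<in>Q. complex_of_real (\<beta> b) * torus_power w (e b)) = (\<Prod>i\<in>UNIV. ((1 + w $ i) / 2) ^ N)" for w
  proof -
    have "((1 + w $ i) / 2) ^ N = (\<Sum>k\<le>N. of_nat (N choose k) / 2 ^ N * (w $ i) ^ k)" for i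
      unfolding power_divide add.commute[of 1] binomial_ring by (simp add: sum_divide_distrib)
    then have "(\<Prod>i\<in>UNIV. ((1 + w $ i) / 2) ^ N)
        = (\<Sum>b\<in>Q. \<Prod>i\<in>UNIV. of_nat (N choose (b i)) / 2 ^ N * (w $ i) ^ (b i))"
      unfolding Q_def by (simp add: prod_sum_PiE)
    also have "\<dots> = (\<Sum>b\<in>Q. complex_of_real (\<beta> b) * torus_power w (e b))"
      by (simp only: \<beta>_def torus_power_def e_def prod.distrib of_real_prod of_real_divide
          of_real_of_nat_eq of_real_power of_real_numeral vec_lambda_beta power_int_of_nat)
    finally show ?thesis ..
  qed
  have "(\<Sum>b\<in>Q. \<beta> b) = 1"
  proof -
    have "complex_of_real (\<Sum>b\<in>Q. \<beta> b) = (\<Sum>b\<in>Q. complex_of_real (\<beta> b) * torus_power 1 (e b))"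
      by (simp add: torus_power_def)
    also have "\<dots> = 1" unfolding poly by simp
    finally show ?thesis by (simp only: of_real_eq_1_iff)
  qed
  \<comment> \<open>Cauchy--Schwarz for \<open>\<Sum>\<beta> = 1\<close>, with \<open>(N + 1)\<^sup>k\<close> terms\<close>
  then have \<kappa>: "1 \<le> (\<Sum>b\<in>Q. (\<beta> b)\<^sup>2) * (real N + 1) ^ ?K"
    using sum_squared_le_sum_of_squares[of \<beta> Q] by (simp add: Q add.commute)
  have \<kappa>0: "0 < (\<Sum>b\<in>Q. (\<beta> b)\<^sup>2)"
  proof (rule ccontr)
    assume "\<not> 0 < (\<Sum>b\<in>Q. (\<beta> b)\<^sup>2)"
    then have "(\<Sum>b\<in>Q. (\<beta> b)\<^sup>2) * (real N + 1) ^ ?K \<le> 0" by (intro mult_nonpos_nonneg) auto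
    then show False using \<kappa> by simp
  qed
  \<comment> \<open>the parallelogram law on the unit circle\<close>
  have half: "(cmod ((1 + u) / 2))\<^sup>2 = 1 - (cmod (u - 1))\<^sup>2 / 4" if "cmod u = 1" for u
  proof -
    have "(Re u)\<^sup>2 + (Im u)\<^sup>2 = 1" using that cmod_power2[of u] by simp
    then have "(cmod (1 + u))\<^sup>2 = 2 + 2 * Re u" "(cmod (u - 1))\<^sup>2 = 2 - 2 * Re u"
      unfolding cmod_power2 by (simp_all add: power2_eq_square algebra_simps)
    then show ?thesis by (simp add: norm_divide power_divide field_simps)
  qed
  have "(cmod (\<Sum>b\<in>Q. complex_of_real (\<beta> b) * torus_power w (e b)))\<^sup>2 = (\<Prod>i\<in>UNIV. (cmod ((1 + w $ i) / 2))\<^sup>2 ^ N)" for w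
    unfolding poly prod_norm[symmetric] norm_power prod_power_distrib by (simp add: power_mult[symmetric] mult.commute)
  note sq = this
  have unit: "cmod (w $ i) = 1" if "w \<in> torus" for w :: "complex ^ 'k" and i using that by (simp add: torus_def)
  have le1: "(cmod ((1 + w $ i) / 2))\<^sup>2 ^ N \<le> 1" if "w \<in> torus" for w :: "complex ^ 'k" and i
  proof (rule power_le_one)
    show "(cmod ((1 + w $ i) / 2))\<^sup>2 \<le> 1" unfolding half[OF unit[OF that]] by simp
  qed simp
  have "(cmod (\<Sum>b\<in>Q. complex_of_real (\<beta> b) * torus_power w (e b)))\<^sup>2 \<le> 1" if "w \<in> torus" for w
    unfolding sq by (rule prod_le_1) (use le1[OF that] in auto)
  moreover have "(cmod (\<Sum>b\<in>Q. complex_of_real (\<beta> b) * torus_power w (e b)))\<^sup>2 \<le> \<eta> * (\<Sum>b\<in>Q. (\<beta> b)\<^sup>2)"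
    if w: "w \<in> torus" and i: "\<delta> \<le> cmod (w $ i - 1)" for w i
  proof -
    have "(\<Prod>i\<in>UNIV. (cmod ((1 + w $ i) / 2))\<^sup>2 ^ N)
        = (cmod ((1 + w $ i) / 2))\<^sup>2 ^ N * (\<Prod>i\<in>UNIV - {i}. (cmod ((1 + w $ i) / 2))\<^sup>2 ^ N)"
      by (rule prod.remove) auto
    also have "\<dots> \<le> (cmod ((1 + w $ i) / 2))\<^sup>2 ^ N * 1"
      by (intro mult_left_mono prod_le_1) (use le1[OF w] in auto)
    also have "\<dots> \<le> \<theta> ^ N"
    proof -
      have "\<delta>\<^sup>2 \<le> (cmod (w $ i - 1))\<^sup>2" using i \<delta> by (intro power_mono) auto
      then have "(cmod ((1 + w $ i) / 2))\<^sup>2 \<le> \<theta>" unfolding half[OF unit[OF w]] by (simp add: \<theta>_def)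
      then show ?thesis by (simp add: power_mono)
    qed
    also have "\<dots> \<le> \<theta> ^ N * ((\<Sum>b\<in>Q. (\<beta> b)\<^sup>2) * (real N + 1) ^ ?K)"
      using mult_left_mono[OF \<kappa>, of "\<theta> ^ N"] \<theta> by simp
    also have "\<dots> = (\<theta> ^ N * (real N + 1) ^ ?K) * (\<Sum>b\<in>Q. (\<beta> b)\<^sup>2)" by (simp add: mult_ac)
    also have "\<dots> \<le> \<eta> * (\<Sum>b\<in>Q. (\<beta> b)\<^sup>2)" using N \<kappa>0 by (intro mult_right_mono) auto
    finally show ?thesis unfolding sq .
  qed
  ultimately show ?thesis using Q(1) \<beta>0 \<kappa>0
    by (intro exI[of _ Q] exI[of _ \<beta>] exI[of _ e] conjI ballI impI) (auto simp del: of_real_mult)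
qed

section \<open>Matrix coefficients near a point\<close>

context deaconu_renault
begin

lemma finite_neighbourhoods:
  assumes "finite L" "x0 \<in> M" "\<And>l. l \<in> L \<Longrightarrow> \<exists>U. openin X U \<and> x0 \<in> U \<and> (\<forall>x\<in>U. F l x)"
  shows "\<exists>U. openin X U \<and> x0 \<in> U \<and> (\<forall>x\<in>U. \<forall>l\<in>L. F l x)"
  using assms(1,3)
proof (induction L rule: finite_induct)
  case empty
  then show ?case using assms(2) by (intro exI[of _ M]) simp
next
  case (insert l L)
  obtain U where U: "openin X U" "x0 \<in> U" "\<forall>x\<in>U. F l x" using insert.prems[of l] by auto
  obtain V where V: "openin X V" "x0 \<in> V" "\<forall>x\<in>V. \<forall>l\<in>L. F l x" using insert.IH insert.prems by auto
  show ?case using U V by (intro exI[of _ "U \<inter> V"]) auto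
qed

context
  fixes x0 :: 'x and P Q :: "int ^ 'k \<Rightarrow> nat ^ 'k"
  assumes x0: "x0 \<in> M"
    and germs: "\<forall>n. (x0, n, x0) \<in> arrows G \<longrightarrow> n = int_diff (P n) (Q n) \<and> T (P n) x0 = T (Q n) x0"
begin

text \<open>
  An isotropy element \<open>n\<close> of \<open>x\<^sub>0\<close> is represented as \<open>P n - Q n\<close> with \<open>T (P n) x\<^sub>0 = T (Q n) x\<^sub>0\<close>;
  its germ fixes a nearby point \<open>x\<close> if the last equation holds at \<open>x\<close>. The isotropy group of \<open>x\<close>
  itself would not serve: its elements need not lie in the isotropy of \<open>x\<^sub>0\<close>, let alone arise from germs there.
\<close>

definition near_iso :: "'x \<Rightarrow> (int ^ 'k) set" where
  "near_iso x = {n. (x0, n, x0) \<in> arrows G \<and> T (P n) x = T (Q n) x}"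

lemma near_iso_zero: "x \<in> M \<Longrightarrow> 0 \<in> near_iso x"
proof -
  assume x: "x \<in> M"
  have a: "(x0, 0, x0) \<in> arrows G" by (rule arrow_unit[OF x0])
  have "int_diff (P 0) (Q 0) = 0" using germs[rule_format, OF a] by simp
  then have "P 0 = Q 0" by (simp add: int_diff_def vec_eq_iff)
  then show ?thesis using a by (simp add: near_iso_def)
qed

text \<open>
  Near \<open>x\<^sub>0\<close> the germ of \<open>a - b\<close> is the composite of that of \<open>a\<close> with the inverse of that of \<open>b\<close>. The
  neighbourhood depends on \<open>a\<close> and \<open>b\<close>, so only finitely many pairs can be treated at once.
\<close>

lemma near_iso_diff:
  assumes "finite L"
  shows "\<exists>U. openin X U \<and> x0 \<in> U \<and> (\<forall>x\<in>U. \<forall>a\<in>near_iso x \<inter> L. \<forall>b\<in>near_iso x \<inter> L. a - b \<in> near_iso x)"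
proof -
  define F where "F = (\<lambda>(a, b) x. a \<in> near_iso x \<longrightarrow> b \<in> near_iso x \<longrightarrow> a - b \<in> near_iso x)"
  have "\<exists>U. openin X U \<and> x0 \<in> U \<and> (\<forall>x\<in>U. \<forall>l\<in>L \<times> L. F l x)"
  proof (rule finite_neighbourhoods[OF _ x0])
    fix l assume "l \<in> L \<times> L"
    obtain a b where l: "l = (a, b)" by (cases l)
    show "\<exists>U. openin X U \<and> x0 \<in> U \<and> (\<forall>x\<in>U. F l x)"
    proof (cases "(x0, a, x0) \<in> arrows G \<and> (x0, b, x0) \<in> arrows G")
      case True
      have ab: "(x0, a - b, x0) \<in> arrows G"
        using arrow_comp[OF conjunct1[OF True] arrow_inv[OF conjunct2[OF True]]] by simp
      note A = germs[rule_format, OF conjunct1[OF True]] and B = germs[rule_format, OF conjunct2[OF True]] and AB = germs[rule_format, OF ab]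
      have "int_diff (P a + Q b) (Q a + P b) = a - b"
        using A B int_diff_add[of "P a" "Q b" "Q a" "P b"] int_diff_swap[of "Q b" "P b"] by simp
      then have d: "int_diff (P (a - b)) (Q (a - b)) = int_diff (P a + Q b) (Q a + P b)" using AB by simp
      obtain U V where UV: "openin X U" "openin X V" "x0 \<in> U" "x0 \<in> V"
        "\<forall>x\<in>U. \<forall>y\<in>V. T (P a + Q b) x = T (Q a + P b) y \<longrightarrow> T (P (a - b)) x = T (Q (a - b)) y"
        using local_implication[OF x0 x0 d conjunct2[OF AB]] by (elim exE conjE)
      have "F l x" if x: "x \<in> U \<inter> V" for x
        unfolding F_def l prod.case
      proof (intro impI)
        have xM: "x \<in> M" using x openin_subset[OF UV(1)] by blast
        assume "a \<in> near_iso x" "b \<in> near_iso x"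
        then have eq: "T (P a) x = T (Q a) x" "T (P b) x = T (Q b) x" by (simp_all add: near_iso_def)
        have "T (P a + Q b) x = T (Q b) (T (P a) x)" using T_add[OF xM, of "Q b" "P a"] by (simp add: add.commute)
        also have "\<dots> = T (Q a) (T (P b) x)" unfolding eq by (rule T_swap[OF xM])
        also have "\<dots> = T (Q a + P b) x" by (rule T_add[OF xM, symmetric])
        finally have "T (P (a - b)) x = T (Q (a - b)) x" using UV(5) x by blast
        then show "a - b \<in> near_iso x" using ab by (simp add: near_iso_def)
      qed
      then show ?thesis using UV by (intro exI[of _ "U \<inter> V"]) auto
    next
      case False
      then have "F l x" for x by (auto simp: F_def l near_iso_def)
      then show ?thesis using x0 by (intro exI[of _ M]) simp
    qed
  qed (use assms in simp)
  then obtain U where "openin X U" "x0 \<in> U" "\<forall>x\<in>U. \<forall>l\<in>L \<times> L. F l x" by (elim exE conjE)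
  then show ?thesis by (intro exI[of _ U]) (auto simp: F_def)
qed

text \<open>
  On the isotropy at nearby points, \<open>b \<in> C\<^sub>c(G)\<close> is close to its values on the isotropy at \<open>x\<^sub>0\<close>,
  cut down to those elements whose germs fix the nearby point. Isotropy at \<open>x\<close> that is
  not of this form is an arrow at which all elementary summands of \<open>b\<close> vanish.
\<close>

lemma Cc_near_iso:
  assumes "b \<in> Cc G"
  shows "\<exists>D. finite D \<and> (\<forall>\<epsilon>>0. \<exists>U. openin X U \<and> x0 \<in> U \<and> (\<forall>x\<in>U. \<forall>n. (n \<notin> D \<longrightarrow> b (x, n, x) = 0) \<and>
    cmod (b (x, n, x) - (if n \<in> near_iso x then b (x0, n, x0) else 0)) \<le> \<epsilon>))"
  using assms
proof (induction b rule: Cc_induct)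
  case zero
  show ?case using x0 by (intro exI[of _ "{}"] conjI allI impI exI[of _ M]) auto
next
  case (plus e f)
  let ?near = "\<lambda>b D \<epsilon> U. openin X U \<and> x0 \<in> U \<and> (\<forall>x\<in>U. \<forall>n. (n \<notin> D \<longrightarrow> b (x, n, x) = 0) \<and>
    cmod (b (x, n, x) - (if n \<in> near_iso x then b (x0, n, x0) else 0)) \<le> \<epsilon>)"
  obtain D1 where D1: "finite D1" "\<forall>\<epsilon>>0. \<exists>U. ?near e D1 \<epsilon> U" using plus(3) by (elim exE conjE)
  obtain D2 where D2: "finite D2" "\<forall>\<epsilon>>0. \<exists>U. ?near f D2 \<epsilon> U" using plus(4) by (elim exE conjE)
  show ?case
  proof (intro exI[of _ "D1 \<union> D2"] conjI allI impI)
    show "finite (D1 \<union> D2)" using D1 D2 by simp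
    fix \<epsilon> :: real assume "\<epsilon> > 0"
    then have e2: "\<epsilon> / 2 > 0" by simp
    obtain U where U: "?near e D1 (\<epsilon> / 2) U" using D1(2)[rule_format, OF e2] by (elim exE)
    obtain V where V: "?near f D2 (\<epsilon> / 2) V" using D2(2)[rule_format, OF e2] by (elim exE)
    have "(n \<notin> D1 \<union> D2 \<longrightarrow> e (x, n, x) + f (x, n, x) = 0) \<and>
      cmod (e (x, n, x) + f (x, n, x) - (if n \<in> near_iso x then e (x0, n, x0) + f (x0, n, x0) else 0)) \<le> \<epsilon>"
      if x: "x \<in> U \<inter> V" for x n
    proof
      show "n \<notin> D1 \<union> D2 \<longrightarrow> e (x, n, x) + f (x, n, x) = 0" using U V x by simp
      let ?r = "\<lambda>g. if n \<in> near_iso x then g (x0, n, x0) else 0 :: complex"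
      have "e (x, n, x) + f (x, n, x) - (if n \<in> near_iso x then e (x0, n, x0) + f (x0, n, x0) else 0)
        = (e (x, n, x) - ?r e) + (f (x, n, x) - ?r f)" by simp
      also have "cmod \<dots> \<le> cmod (e (x, n, x) - ?r e) + cmod (f (x, n, x) - ?r f)" by (rule norm_triangle_ineq)
      also have "\<dots> \<le> \<epsilon> / 2 + \<epsilon> / 2" using U V x by (intro add_mono) blast+
      finally show "cmod (e (x, n, x) + f (x, n, x) - (if n \<in> near_iso x then e (x0, n, x0) + f (x0, n, x0) else 0)) \<le> \<epsilon>"
        by simp
    qed
    then show "\<exists>U. ?near (\<lambda>\<gamma>. e \<gamma> + f \<gamma>) (D1 \<union> D2) \<epsilon> U"
      using U V by (intro exI[of _ "U \<inter> V"]) auto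
  qed
next
  fix e assume "elementary e"
  then obtain p q V \<phi> h where s: "sect p q V \<phi>" and h: "bump V h" and e: "e = elemf p q V \<phi> h"
    by (auto simp: elementary_def)
  note Ds = sectD[OF s]
  obtain K where K: "compactin X K" "K \<subseteq> V" "\<forall>y. y \<notin> K \<longrightarrow> h y = 0" and hc: "continuous_map X euclidean h"
    using h by (auto simp: bump_def)
  have Kc: "closedin X K" by (rule compactin_imp_closedin[OF Hausdorff K(1)])
  let ?m = "int_diff p q"
  have e0: "e (x, n, x) = (if n = ?m \<and> x \<in> V \<and> x = \<phi> x then h x else 0)" for x n
    by (simp add: e elemf_def)
  have triv: "\<exists>U. openin X U \<and> x0 \<in> U \<and> (\<forall>x\<in>U. \<forall>n. (n \<notin> {?m} \<longrightarrow> e (x, n, x) = 0) \<and>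
      cmod (e (x, n, x) - (if n \<in> near_iso x then e (x0, n, x0) else 0)) \<le> \<epsilon>)"
    if U: "openin X U" "x0 \<in> U" "\<And>x n. x \<in> U \<Longrightarrow> e (x, n, x) = 0" and \<epsilon>: "\<epsilon> > 0" for U \<epsilon>
    using U(3) U(3)[OF U(2)] \<epsilon> by (intro exI[of _ U] conjI U(1,2)) simp
  show "\<exists>D. finite D \<and> (\<forall>\<epsilon>>0. \<exists>U. openin X U \<and> x0 \<in> U \<and> (\<forall>x\<in>U. \<forall>n. (n \<notin> D \<longrightarrow> e (x, n, x) = 0) \<and>
    cmod (e (x, n, x) - (if n \<in> near_iso x then e (x0, n, x0) else 0)) \<le> \<epsilon>))"
  proof (intro exI[of _ "{?m}"] conjI allI impI)
    fix \<epsilon> :: real assume \<epsilon>: "\<epsilon> > 0"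
    show "\<exists>U. openin X U \<and> x0 \<in> U \<and> (\<forall>x\<in>U. \<forall>n. (n \<notin> {?m} \<longrightarrow> e (x, n, x) = 0) \<and>
      cmod (e (x, n, x) - (if n \<in> near_iso x then e (x0, n, x0) else 0)) \<le> \<epsilon>)"
    proof (cases "x0 \<in> K")
      case False
      show ?thesis
      proof (rule triv[OF _ _ _ \<epsilon>])
        show "openin X (M - K)" using Kc by blast
        show "x0 \<in> M - K" using x0 False by simp
        show "e (x, n, x) = 0" if "x \<in> M - K" for x n using K(3) that by (simp add: e0)
      qed
    next
      case True
      then have x0V: "x0 \<in> V" using K(2) by blast
      show ?thesis
      proof (cases "\<phi> x0 = x0")
        case False
        then obtain U1 U2 where U: "openin X U1" "openin X U2" "x0 \<in> U1" "\<phi> x0 \<in> U2" "disjnt U1 U2"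
          using Hausdorff x0 Ds(6)[OF x0V] unfolding Hausdorff_space_def by metis
        show ?thesis
        proof (rule triv[OF _ _ _ \<epsilon>])
          show "openin X (U1 \<inter> {x \<in> V. \<phi> x \<in> U2})" by (intro openin_Int U sect_preimage[OF s])
          show "x0 \<in> U1 \<inter> {x \<in> V. \<phi> x \<in> U2}" using U x0V by simp
          show "e (x, n, x) = 0" if "x \<in> U1 \<inter> {x \<in> V. \<phi> x \<in> U2}" for x n
            using that U(5) by (auto simp: e0 disjnt_iff)
        qed
      next
        case True
        have eq: "T p x0 = T q x0" using Ds(4)[OF x0V] True by simp
        then have ar: "(x0, ?m, x0) \<in> arrows G" unfolding arrows_iff using x0 by blast
        note PQm = germs[rule_format, OF ar]
        obtain U1 V1 where UV: "openin X U1" "openin X V1" "x0 \<in> U1" "x0 \<in> V1"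
          "\<forall>x\<in>U1. \<forall>y\<in>V1. T (P ?m) x = T (Q ?m) y \<longleftrightarrow> T p x = T q y"
          using local_equivalence[OF x0 x0 conjunct1[OF PQm] eq conjunct2[OF PQm]] by (elim exE conjE)
        obtain U2 where U2: "openin X U2" "x0 \<in> U2" "inj_on (T p) U2" by (rule T_locally_injective[OF x0])
        have ho: "openin X {x \<in> M. h x \<in> ball (h x0) \<epsilon>}"
          by (rule openin_continuous_map_preimage[OF hc]) simp
        define U where "U = {x \<in> V. \<phi> x \<in> U2} \<inter> U1 \<inter> V1 \<inter> U2 \<inter> {x \<in> M. h x \<in> ball (h x0) \<epsilon>}"
        have Uo: "openin X U" unfolding U_def by (intro openin_Int UV U2 ho sect_preimage[OF s])
        have Ux0: "x0 \<in> U" using True x0 x0V UV U2 \<epsilon> by (simp add: U_def)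
        have iff: "?m \<in> near_iso x \<longleftrightarrow> x = \<phi> x" if x: "x \<in> U" for x
        proof -
          have xx: "x \<in> V" "\<phi> x \<in> U2" "x \<in> U1" "x \<in> V1" "x \<in> U2" using x by (simp_all add: U_def)
          have "?m \<in> near_iso x \<longleftrightarrow> T (P ?m) x = T (Q ?m) x" using ar by (simp add: near_iso_def)
          also have "\<dots> \<longleftrightarrow> T p x = T q x" using UV(5) xx by blast
          also have "\<dots> \<longleftrightarrow> T p x = T p (\<phi> x)" using Ds(4)[OF xx(1)] by simp
          also have "\<dots> \<longleftrightarrow> x = \<phi> x" using inj_on_eq_iff[OF U2(3) xx(5) xx(2)] by simp
          finally show ?thesis .
        qed
        have "(n \<notin> {?m} \<longrightarrow> e (x, n, x) = 0) \<and> cmod (e (x, n, x) - (if n \<in> near_iso x then e (x0, n, x0) else 0)) \<le> \<epsilon>"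
          if x: "x \<in> U" for x n
        proof (cases "n = ?m")
          case n: True
          have "x \<in> V" "cmod (h x - h x0) \<le> \<epsilon>"
            using x by (auto simp: U_def dist_norm norm_minus_commute)
          then show ?thesis using iff[OF x] \<epsilon> x0V True by (simp add: e0 n)
        qed (use \<epsilon> in \<open>simp add: e0\<close>)
        then show ?thesis using Uo Ux0 by (intro exI[of _ U] conjI ballI allI) blast+
      qed
    qed
  qed simp
qed

end

text \<open>
  With \<open>b = u\<^sup>*u\<close> for \<open>u\<close> close to \<open>a\<close>, the diagonal entry of \<open>\<pi>\<^sub>x\<^sub>,\<^sub>z(b)\<close> at \<open>e\<^sub>x\<close> is
  \<open>\<parallel>\<pi>\<^sub>x\<^sub>,\<^sub>z(u) e\<^sub>x\<parallel>\<^sup>2\<close>. The same \<open>b\<close> serves all \<open>x\<close> and \<open>z\<close>.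
\<close>

lemma rep_norm_approx:
  assumes a: "a \<in> elems E" and \<epsilon>: "0 < \<epsilon>"
  shows "\<exists>b\<in>Cc G. \<forall>x\<in>M. \<forall>z\<in>torus.
    \<bar>(ell2_norm (orbit G x) (DR_rep X T x z a (basis_vec x)))\<^sup>2 - Re (matrix_coef z b x x)\<bar> \<le> \<epsilon>"
proof -
  obtain u1 where u1: "u1 \<in> elems A" and u1b: "\<forall>(S :: 'x set) \<rho> \<xi>. star_rep E S \<rho> \<longrightarrow> \<xi> \<in> ell2 S \<longrightarrow>
    ell2_norm S (\<lambda>i. \<rho> a \<xi> i - \<rho> (emb u1) \<xi> i) \<le> 1 * ell2_norm S \<xi>"
    using cstar.rep_approx[OF a, of 1] by auto
  define B where "B = 1 + cstar.N u1"
  have B: "B \<ge> 1" using cstar.N_nonneg[OF u1] by (simp add: B_def)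
  define \<epsilon>' where "\<epsilon>' = min 1 (\<epsilon> / (2 * B + 1))"
  have e': "\<epsilon>' > 0" "\<epsilon>' \<le> 1" "\<epsilon>' * (2 * B + 1) \<le> \<epsilon>"
  proof -
    have pos: "0 < 2 * B + 1" using B by simp
    then show "\<epsilon>' > 0" using \<epsilon> by (simp add: \<epsilon>'_def)
    show "\<epsilon>' \<le> 1" by (simp add: \<epsilon>'_def)
    have "\<epsilon>' \<le> \<epsilon> / (2 * B + 1)" unfolding \<epsilon>'_def by (rule min.cobounded2)
    then show "\<epsilon>' * (2 * B + 1) \<le> \<epsilon>" by (simp only: pos_le_divide_eq[OF pos])
  qed
  obtain u where u: "u \<in> elems A" and ub: "\<forall>(S :: 'x set) \<rho> \<xi>. star_rep E S \<rho> \<longrightarrow> \<xi> \<in> ell2 S \<longrightarrow>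
    ell2_norm S (\<lambda>i. \<rho> a \<xi> i - \<rho> (emb u) \<xi> i) \<le> \<epsilon>' * ell2_norm S \<xi>"
    using cstar.rep_approx[OF a e'(1)] by auto
  define b where "b = convolution G (star A u) u"
  have uC: "u \<in> Cc G" "star A u \<in> Cc G" using u Cc_star by simp_all
  have bC: "b \<in> Cc G" unfolding b_def by (rule Cc_convolution[OF uC(2,1)])
  have "\<bar>(ell2_norm (orbit G x) (DR_rep X T x z a (basis_vec x)))\<^sup>2 - Re (matrix_coef z b x x)\<bar> \<le> \<epsilon>"
    if x: "x \<in> M" and z: "z \<in> torus" for x z
  proof -
    let ?S = "orbit G x" and ?\<rho> = "DR_rep X T x z" and ?e = "basis_vec x :: 'x \<Rightarrow> complex"
    note r = DR_rep_spec(1)[OF z, of x]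
    have xS: "x \<in> ?S" by (rule orbit_self[OF x])
    have eS: "?e \<in> ell2 ?S" "ell2_norm ?S ?e = 1" using xS by simp_all
    have uE: "emb u \<in> elems E" "emb u1 \<in> elems E" using u u1 cstar.embed_elem by auto
    let ?s = "ell2_norm ?S (?\<rho> a ?e)" and ?t = "ell2_norm ?S (?\<rho> (emb u) ?e)"
    have m: "?\<rho> a ?e \<in> ell2 ?S" "?\<rho> (emb u) ?e \<in> ell2 ?S" "?\<rho> (emb u1) ?e \<in> ell2 ?S"
      by (intro star_repD(2)[OF r] a uE eS)+
    have st: "\<bar>?s - ?t\<bar> \<le> \<epsilon>'"
      using ell2_norm_abs_diff[OF m(1,2)] ub r eS by fastforce
    have sB: "?s \<le> B"
    proof -
      have "\<bar>?s - ell2_norm ?S (?\<rho> (emb u1) ?e)\<bar> \<le> 1"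
        using ell2_norm_abs_diff[OF m(1,3)] u1b r eS by fastforce
      moreover have "ell2_norm ?S (?\<rho> (emb u1) ?e) \<le> cstar.N u1"
        using cstar.rep_contractive[OF r cstar.const_cauchy[OF u1] order_refl cstar.N_nonneg[OF u1] eS(1)] eS(2)
        by (simp add: cstar.embed_cls)
      ultimately show ?thesis by (simp add: B_def)
    qed
    have "?t\<^sup>2 = Re (matrix_coef z b x x)"
    proof -
      have "emb b = mul E (star E (emb u)) (emb u)"
        using cstar.embed_hom(3)[of "star A u" u] cstar.embed_hom(4)[of u u] uC by (simp add: b_def)
      then have "?\<rho> (emb b) ?e = ?\<rho> (star E (emb u)) (?\<rho> (emb u) ?e)"
        using star_repD(5)[OF r cstar.E_closed(4)[OF uE(1) uE(1)] uE(1) eS(1)] by simp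
      then have "?\<rho> (emb b) ?e x = ell2_inner ?S (?\<rho> (star E (emb u)) (?\<rho> (emb u) ?e)) ?e"
        using ell2_inner_basis[OF xS] by simp
      also have "\<dots> = ell2_inner ?S (?\<rho> (emb u) ?e) (?\<rho> (emb u) ?e)"
        by (rule star_repD(6)[OF r uE(1) m(2) eS(1)])
      also have "\<dots> = complex_of_real (?t\<^sup>2)" by (rule ell2_inner_self[OF m(2)])
      finally have "matrix_coef z b x x = complex_of_real (?t\<^sup>2)"
        using DR_rep_spec(2)[OF z bC xS] by simp
      then show ?thesis by simp
    qed
    moreover have "\<bar>?s\<^sup>2 - ?t\<^sup>2\<bar> \<le> \<epsilon>"
    proof -
      have "\<bar>?s\<^sup>2 - ?t\<^sup>2\<bar> = \<bar>?s - ?t\<bar> * (?s + ?t)"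
        by (simp add: power2_eq_square square_diff_square_factored abs_mult)
      also have "\<dots> \<le> \<epsilon>' * (2 * B + 1)"
        using st sB e' B by (intro mult_mono) (auto simp: abs_le_iff)
      finally show ?thesis using e'(3) by simp
    qed
    ultimately show ?thesis by simp
  qed
  then show ?thesis using bC by blast
qed

lemma torus_power_tendsto:
  assumes "z0 \<in> torus"
  shows "((\<lambda>w. torus_power w n) \<longlongrightarrow> torus_power z0 n) (at z0 within torus)"
  unfolding torus_power_def
  by (intro tendsto_prod tendsto_power_int tendsto_vec_nth tendsto_ident_at) (rule torus_nonzero[OF assms])

lemma coef_continuous:
  assumes b: "b \<in> Cc G" and z0: "z0 \<in> torus" and \<epsilon>: "0 < \<epsilon>"
  shows "\<exists>\<delta>>0. \<forall>w\<in>torus. (\<forall>i. cmod (w $ i - z0 $ i) < \<delta>) \<longrightarrow> \<bar>Re (matrix_coef w b x y) - Re (matrix_coef z0 b x y)\<bar> < \<epsilon>"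
proof -
  have "((\<lambda>w. Re (matrix_coef w b x y)) \<longlongrightarrow> Re (matrix_coef z0 b x y)) (at z0 within torus)"
    unfolding matrix_coef_def by (intro tendsto_Re tendsto_sum tendsto_mult tendsto_const torus_power_tendsto z0)
  from tendstoD[OF this \<epsilon>] obtain d where d: "d > 0"
    "\<forall>w\<in>torus. w \<noteq> z0 \<and> dist w z0 < d \<longrightarrow> dist (Re (matrix_coef w b x y)) (Re (matrix_coef z0 b x y)) < \<epsilon>"
    by (auto simp: eventually_at)
  define \<delta> where "\<delta> = d / (real CARD('k) + 1)"
  have \<delta>: "\<delta> > 0" using d(1) by (simp add: \<delta>_def)
  have "\<bar>Re (matrix_coef w b x y) - Re (matrix_coef z0 b x y)\<bar> < \<epsilon>"
    if w: "w \<in> torus" and near: "\<forall>i. cmod (w $ i - z0 $ i) < \<delta>" for w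
  proof (cases "w = z0")
    case False
    have "dist w z0 \<le> (\<Sum>i\<in>UNIV. dist (w $ i) (z0 $ i))"
      unfolding dist_vec_def by (rule L2_set_le_sum) simp
    also have "\<dots> \<le> (\<Sum>i\<in>(UNIV :: 'k set). \<delta>)"
      using near by (intro sum_mono) (simp add: dist_norm less_imp_le)
    also have "\<dots> = real CARD('k) * \<delta>" by simp
    also have "\<dots> < (real CARD('k) + 1) * \<delta>" using \<delta> by simp
    also have "\<dots> = d"
    proof -
      have "real CARD('k) + 1 \<noteq> 0" by linarith
      then show ?thesis unfolding \<delta>_def by simp
    qed
    finally show ?thesis using d(2) w False by (simp add: dist_real_def)
  qed (use \<epsilon> in simp)
  then show ?thesis using \<delta> by blast
qed

lemma torus_mult: "z \<in> torus \<Longrightarrow> w \<in> torus \<Longrightarrow> z * w \<in> torus"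
  by (simp add: torus_def norm_mult)

lemma torus_power_mult: "torus_power (z * w) n = torus_power z n * torus_power w n"
  by (simp add: torus_power_def power_int_mult_distrib prod.distrib)

text \<open>
  With \<open>F(x, z) = \<parallel>\<pi>\<^sub>x\<^sub>,\<^sub>z(a) e\<^sub>x\<parallel>\<^sup>2\<close>, the function \<open>w \<mapsto> F(x\<^sub>0, zw)\<close> lies above
  \<open>c \<bar>q\<bar>\<^sup>2 - \<epsilon>\<close> on the whole torus, for \<open>z\<close> near \<open>z\<^sub>0\<close>. Restricting coefficients to \<open>H\<^sub>x\<close> turns
  it approximately into \<open>F(x, z)\<close>, while the lower bound stays positive.
\<close>

lemma unit_vector_nonzero_nearby:
  assumes a: "a \<in> elems E" and x0: "x0 \<in> M" and z0: "z0 \<in> torus"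
    and nz: "DR_rep X T x0 z0 a (basis_vec x0) \<noteq> (\<lambda>_. 0)"
  shows "\<exists>U \<delta>. openin X U \<and> x0 \<in> U \<and> 0 < \<delta> \<and> (\<forall>x\<in>U. \<forall>z\<in>torus. (\<forall>i. cmod (z $ i - z0 $ i) < \<delta>) \<longrightarrow>
    DR_rep X T x z a (basis_vec x) \<noteq> (\<lambda>_. 0))"
proof -
  define F where "F x z = (ell2_norm (orbit G x) (DR_rep X T x z a (basis_vec x)))\<^sup>2" for x z
  have F0: "0 \<le> F x z" for x z by (simp add: F_def)
  \<comment> \<open>three errors of size \<open>c\<close> have to be absorbed by \<open>F x\<^sub>0 z\<^sub>0\<close>\<close>
  define c where "c = F x0 z0 / 4"
  have x0S: "x0 \<in> orbit G x0" by (rule orbit_self[OF x0])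
  have c: "c > 0"
  proof -
    have "ell2_norm (orbit G x0) (DR_rep X T x0 z0 a (basis_vec x0)) \<noteq> 0"
      using nz ell2_norm_eq_0[OF star_repD(2)[OF DR_rep_spec(1)[OF z0] a basis_vec_ell2[OF x0S]]] by blast
    then show ?thesis by (simp add: c_def F_def)
  qed
  \<comment> \<open>\<open>F x\<^sub>0\<close> stays above \<open>c\<close> near \<open>z\<^sub>0\<close>\<close>
  obtain b1 where b1: "b1 \<in> Cc G" "\<forall>x\<in>M. \<forall>z\<in>torus. \<bar>F x z - Re (matrix_coef z b1 x x)\<bar> \<le> c"
    using rep_norm_approx[OF a c] unfolding F_def by blast
  obtain \<delta>2 where \<delta>2: "\<delta>2 > 0"
    "\<forall>w\<in>torus. (\<forall>i. cmod (w $ i - z0 $ i) < \<delta>2) \<longrightarrow> \<bar>Re (matrix_coef w b1 x0 x0) - Re (matrix_coef z0 b1 x0 x0)\<bar> < c"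
    using coef_continuous[OF b1(1) z0 c] by blast
  define \<delta> where "\<delta> = \<delta>2 / 2"
  have \<delta>: "\<delta> > 0" using \<delta>2(1) by (simp add: \<delta>_def)
  have Fc: "c \<le> F x0 w" if "w \<in> torus" "\<forall>i. cmod (w $ i - z0 $ i) < \<delta>2" for w
  proof -
    have 1: "\<bar>Re (matrix_coef w b1 x0 x0) - Re (matrix_coef z0 b1 x0 x0)\<bar> < c" using \<delta>2(2) that by blast
    have 2: "\<bar>F x0 z0 - Re (matrix_coef z0 b1 x0 x0)\<bar> \<le> c" using b1(2) x0 z0 by blast
    have 3: "\<bar>F x0 w - Re (matrix_coef w b1 x0 x0)\<bar> \<le> c" using b1(2) x0 that(1) by blast
    have 4: "F x0 z0 = 4 * c" by (simp add: c_def)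
    show ?thesis using 1 2 3 4 by (simp add: abs_le_iff abs_less_iff)
  qed
  have eighth: "(0 :: real) < 1/8" by simp
  obtain Q :: "('k \<Rightarrow> nat) set" and \<beta> and e :: "('k \<Rightarrow> nat) \<Rightarrow> int ^ 'k" where Q: "finite Q" "\<forall>b\<in>Q. 0 \<le> \<beta> b" "0 < (\<Sum>b\<in>Q. (\<beta> b)\<^sup>2)"
    "\<forall>w\<in>torus. (cmod (\<Sum>b\<in>Q. complex_of_real (\<beta> b) * torus_power w (e b)))\<^sup>2 \<le> 1 \<and>
      ((\<exists>i. \<delta> \<le> cmod (w $ i - 1)) \<longrightarrow>
        (cmod (\<Sum>b\<in>Q. complex_of_real (\<beta> b) * torus_power w (e b)))\<^sup>2 \<le> 1/8 * (\<Sum>b\<in>Q. (\<beta> b)\<^sup>2))"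
    using concentrating_polynomial[OF \<delta> eighth] by (elim exE conjE)
  define q where "q w = (cmod (\<Sum>b\<in>Q. complex_of_real (\<beta> b) * torus_power w (e b)))\<^sup>2" for w
  define \<kappa> where "\<kappa> = (\<Sum>b\<in>Q. (\<beta> b)\<^sup>2)"
  \<comment> \<open>five errors of size \<open>\<epsilon>\<close> have to be absorbed by \<open>c \<kappa>\<close>\<close>
  define \<epsilon> where "\<epsilon> = c * \<kappa> / 8"
  have \<epsilon>: "\<epsilon> > 0" using c Q(3) by (simp add: \<epsilon>_def \<kappa>_def)
  \<comment> \<open>near \<open>w = 1\<close> because \<open>q \<le> 1\<close>, elsewhere because \<open>q \<le> \<kappa>/8\<close> and \<open>F \<ge> 0\<close>\<close>
  have Fq: "c * q w - \<epsilon> \<le> F x0 (z * w)"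
    if z: "z \<in> torus" "\<forall>i. cmod (z $ i - z0 $ i) < \<delta>" and w: "w \<in> torus" for z w
  proof (cases "\<exists>i. \<delta> \<le> cmod (w $ i - 1)")
    case True
    then have "q w \<le> 1/8 * \<kappa>" using Q(4) w by (simp add: q_def \<kappa>_def)
    then have "c * q w \<le> c * (1/8 * \<kappa>)" using c by (intro mult_left_mono) auto
    then show ?thesis using F0[of x0 "z * w"] by (simp add: \<epsilon>_def)
  next
    case False
    have "q w \<le> 1" using Q(4) w by (simp add: q_def)
    then have "c * q w \<le> c" using c by (simp add: mult_left_le)
    moreover have "cmod ((z * w) $ i - z0 $ i) < \<delta>2" for i
    proof -
      have "(z * w) $ i - z0 $ i = z $ i * (w $ i - 1) + (z $ i - z0 $ i)" by (simp add: algebra_simps)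
      also have "cmod \<dots> \<le> cmod (z $ i * (w $ i - 1)) + cmod (z $ i - z0 $ i)" by (rule norm_triangle_ineq)
      also have "\<dots> < \<delta> + \<delta>"
      proof (rule add_strict_mono)
        have "cmod (z $ i) = 1" using z(1) by (simp add: torus_def)
        then show "cmod (z $ i * (w $ i - 1)) < \<delta>" using False by (simp add: norm_mult not_le)
      qed (use z in blast)
      finally show ?thesis by (simp add: \<delta>_def)
    qed
    then have "c \<le> F x0 (z * w)" using Fc[OF torus_mult[OF z(1) w]] by blast
    ultimately show ?thesis using \<epsilon> by linarith
  qed
  obtain b where b: "b \<in> Cc G" "\<forall>x\<in>M. \<forall>z\<in>torus. \<bar>F x z - Re (matrix_coef z b x x)\<bar> \<le> \<epsilon>"
    using rep_norm_approx[OF a \<epsilon>] unfolding F_def by blast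
  have "\<forall>n. \<exists>p q. (x0, n, x0) \<in> arrows G \<longrightarrow> n = int_diff p q \<and> T p x0 = T q x0"
    by (meson arrowE)
  then obtain P P' where PQ: "\<forall>n. (x0, n, x0) \<in> arrows G \<longrightarrow> n = int_diff (P n) (P' n) \<and> T (P n) x0 = T (P' n) x0"
    by metis
  let ?I = "near_iso x0 P P'"
  obtain D where D: "finite D" and Dnear: "\<forall>\<epsilon>>0. \<exists>U. openin X U \<and> x0 \<in> U \<and> (\<forall>x\<in>U. \<forall>n. (n \<notin> D \<longrightarrow> b (x, n, x) = 0) \<and>
    cmod (b (x, n, x) - (if n \<in> ?I x then b (x0, n, x0) else 0)) \<le> \<epsilon>)"
    using Cc_near_iso[OF x0 PQ b(1)] by (elim exE conjE)
  obtain d where d: "D \<subseteq> ibox d" using finite_in_ibox[OF D] by blast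
  define B where "B = (\<Sum>n\<in>D. cmod (b (x0, n, x0)))"
  have B: "0 \<le> B" by (simp add: B_def sum_nonneg)
  obtain R where dR: "d \<le> R" and R: "\<forall>H p Q c e \<beta> \<eta>. 0 \<in> H \<longrightarrow> H \<subseteq> ibox R \<longrightarrow> (\<forall>a\<in>H. \<forall>b\<in>H. a - b \<in> ibox R \<longrightarrow> a - b \<in> H) \<longrightarrow>
    (\<Sum>n\<in>D. cmod (p n)) \<le> B \<longrightarrow> finite (Q :: ('k \<Rightarrow> nat) set) \<longrightarrow> (\<forall>b\<in>Q. 0 \<le> \<beta> b) \<longrightarrow> 0 \<le> c \<longrightarrow>
    (\<forall>w\<in>torus. c * (cmod (\<Sum>b\<in>Q. complex_of_real (\<beta> b) * torus_power w (e b)))\<^sup>2 - \<eta>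
        \<le> Re (\<Sum>n\<in>D. p n * torus_power w n)) \<longrightarrow>
    c * (\<Sum>b\<in>Q. (\<beta> b)\<^sup>2) - \<eta> - \<epsilon> \<le> Re (\<Sum>n\<in>D \<inter> H. p n)"
    using local_subgroup_positivity[OF D d \<epsilon> B] by (elim exE conjE)
  define \<epsilon>' where "\<epsilon>' = \<epsilon> / (real (card D) + 1)"
  have e': "\<epsilon>' > 0" "real (card D) * \<epsilon>' \<le> \<epsilon>" using \<epsilon> by (auto simp: \<epsilon>'_def field_simps)
  obtain U1 where U1: "openin X U1" "x0 \<in> U1" "\<forall>x\<in>U1. \<forall>n. (n \<notin> D \<longrightarrow> b (x, n, x) = 0) \<and>
    cmod (b (x, n, x) - (if n \<in> ?I x then b (x0, n, x0) else 0)) \<le> \<epsilon>'"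
    using Dnear[rule_format, OF e'(1)] by (elim exE conjE)
  \<comment> \<open>inside the box of size \<open>R\<close>, \<open>?I x\<close> is now closed under differences\<close>
  obtain U2 where U2: "openin X U2" "x0 \<in> U2"
    "\<forall>x\<in>U2. \<forall>a\<in>?I x \<inter> ibox R. \<forall>b\<in>?I x \<inter> ibox R. a - b \<in> ?I x"
    using near_iso_diff[OF x0 PQ ibox_finite[of R]] by (elim exE conjE)
  have "DR_rep X T x z a (basis_vec x) \<noteq> (\<lambda>_. 0)"
    if x: "x \<in> U1 \<inter> U2" and z: "z \<in> torus" "\<forall>i. cmod (z $ i - z0 $ i) < \<delta>" for x z
  proof -
    have xM: "x \<in> M" using x openin_subset[OF U1(1)] by blast
    have Dx: "matrix_coef w b y y = (\<Sum>n\<in>D. torus_power w n * b (y, n, y))" if "y \<in> U1" for w y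
      by (rule coef_eq[OF D]) (use U1(3) that in blast)
    define p where "p n = torus_power z n * b (x0, n, x0)" for n
    have cp: "cmod (p n) = cmod (b (x0, n, x0))" for n by (simp add: p_def norm_mult z(1))
    have low: "c * q w - 2 * \<epsilon> \<le> Re (\<Sum>n\<in>D. p n * torus_power w n)" if w: "w \<in> torus" for w
    proof -
      have "Re (\<Sum>n\<in>D. p n * torus_power w n) = Re (matrix_coef (z * w) b x0 x0)"
        unfolding Dx[OF U1(2)] by (simp add: p_def torus_power_mult mult_ac)
      moreover have "\<bar>F x0 (z * w) - Re (matrix_coef (z * w) b x0 x0)\<bar> \<le> \<epsilon>"
        using b(2) x0 torus_mult[OF z(1) w] by blast
      ultimately show ?thesis using Fq[OF z w] by linarith
    qed
    have "c * \<kappa> - 2 * \<epsilon> - \<epsilon> \<le> Re (\<Sum>n\<in>D \<inter> (?I x \<inter> ibox R). p n)"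
      unfolding \<kappa>_def
    proof (rule R[rule_format])
      show "0 \<in> ?I x \<inter> ibox R" using near_iso_zero[OF x0 PQ xM] ibox_0 by simp
      show "a - b \<in> ?I x \<inter> ibox R" if "a \<in> ?I x \<inter> ibox R" "b \<in> ?I x \<inter> ibox R" "a - b \<in> ibox R" for a b
        using U2(3) x that by blast
      show "(\<Sum>n\<in>D. cmod (p n)) \<le> B" by (simp add: cp B_def)
      show "c * (cmod (\<Sum>b\<in>Q. complex_of_real (\<beta> b) * torus_power w (e b)))\<^sup>2 - 2 * \<epsilon>
          \<le> Re (\<Sum>n\<in>D. p n * torus_power w n)" if "w \<in> torus" for w
        using low[OF that] by (simp add: q_def)
    qed (use Q c in auto)
    moreover have "D \<inter> (?I x \<inter> ibox R) = D \<inter> ?I x" using d ibox_mono[OF dR] by blast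
    ultimately have Hlow: "c * \<kappa> - 3 * \<epsilon> \<le> Re (\<Sum>n\<in>D \<inter> ?I x. p n)" by simp
    let ?g = "\<lambda>n. b (x, n, x) - (if n \<in> ?I x then b (x0, n, x0) else 0)"
    have "matrix_coef z b x x - (\<Sum>n\<in>D \<inter> ?I x. p n) = (\<Sum>n\<in>D. torus_power z n * ?g n)"
    proof -
      have "(\<Sum>n\<in>D \<inter> ?I x. p n) = (\<Sum>n\<in>D. if n \<in> ?I x then p n else 0)"
        by (rule sum.inter_restrict[OF D])
      then show ?thesis using x
        by (simp add: Dx sum_subtractf[symmetric] p_def if_distrib right_diff_distrib cong: if_cong)
    qed
    also have "cmod \<dots> \<le> (\<Sum>n\<in>D. cmod (torus_power z n * ?g n))" by (rule norm_sum)
    also have "\<dots> \<le> (\<Sum>n\<in>D. \<epsilon>')"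
      using U1(3) x by (intro sum_mono) (simp add: norm_mult z(1))
    also have "\<dots> \<le> \<epsilon>" using e'(2) by simp
    finally have "cmod (matrix_coef z b x x - (\<Sum>n\<in>D \<inter> ?I x. p n)) \<le> \<epsilon>" .
    then have "\<bar>Re (matrix_coef z b x x) - Re (\<Sum>n\<in>D \<inter> ?I x. p n)\<bar> \<le> \<epsilon>"
      using order_trans[OF abs_Re_le_cmod] by fastforce
    moreover have "\<bar>F x z - Re (matrix_coef z b x x)\<bar> \<le> \<epsilon>" using b(2) xM z(1) by blast
    moreover have "c * \<kappa> = 8 * \<epsilon>" by (simp add: \<epsilon>_def)
    ultimately have "0 < F x z" using Hlow \<epsilon> unfolding abs_le_iff by linarith
    then show ?thesis by (auto simp: F_def ell2_norm_zero)
  qed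
  then show ?thesis using U1 U2 \<delta> by (intro exI[of _ "U1 \<inter> U2"] exI[of _ \<delta>]) auto
qed

end

section \<open>Continuity of the map to the primitive ideal space\<close>

text \<open>
  An operator that annihilates all basis vectors has adjoint zero, hence is zero; in this form the
  argument avoids the density of finite linear combinations.
\<close>

lemma star_rep_nonzero_basis:
  assumes \<rho>: "star_rep B S \<rho>" and a: "a \<in> elems B" "star B a \<in> elems B" and nz: "a \<notin> rep_ker B S \<rho>"
  shows "\<exists>y\<in>S. \<rho> a (basis_vec y) \<noteq> (\<lambda>_. 0)"
proof (rule ccontr)
  assume "\<not> (\<exists>y\<in>S. \<rho> a (basis_vec y) \<noteq> (\<lambda>_. 0))"
  then have 0: "\<rho> a (basis_vec y) = (\<lambda>_. 0)" if "y \<in> S" for y using that by blast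
  have star0: "\<rho> (star B a) \<xi> = (\<lambda>_. 0)" if x: "\<xi> \<in> ell2 S" for \<xi>
  proof
    fix w
    show "\<rho> (star B a) \<xi> w = 0"
    proof (cases "w \<in> S")
      case True
      then have "\<rho> (star B a) \<xi> w = ell2_inner S \<xi> (\<rho> a (basis_vec w))"
        using star_repD(6)[OF \<rho> a(1) x basis_vec_ell2[OF True]] ell2_inner_basis[OF True, of "\<rho> (star B a) \<xi>"] by simp
      then show ?thesis using 0[OF True] by (simp add: ell2_inner_def)
    qed (rule ell2_support[OF star_repD(2)[OF \<rho> a(2) x]])
  qed
  have "\<rho> a \<xi> = (\<lambda>_. 0)" if x: "\<xi> \<in> ell2 S" for \<xi>
  proof
    fix w
    show "\<rho> a \<xi> w = 0"
    proof (cases "w \<in> S")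
      case True
      have "ell2_inner S (basis_vec w) (\<rho> a \<xi>) = 0"
        using star_repD(6)[OF \<rho> a(1) basis_vec_ell2[OF True] x] star0[OF basis_vec_ell2[OF True]]
        by (simp add: ell2_inner_def)
      then have "ell2_inner S (\<rho> a \<xi>) (basis_vec w) = 0"
        using ell2_inner_cnj[of S "basis_vec w" "\<rho> a \<xi>"] by simp
      then show ?thesis using ell2_inner_basis[OF True, of "\<rho> a \<xi>"] by simp
    qed (rule ell2_support[OF star_repD(2)[OF \<rho> a(1) x]])
  qed
  then show False using nz a(1) by (simp add: rep_ker_def)
qed

context deaconu_renault
begin

lemma DR_prim_iff: "a \<in> DR_prim X T (x, z) \<longleftrightarrow> a \<in> rep_ker E (orbit G x) (DR_rep X T x z)"
  by (simp add: DR_prim_def E_groupoid_cstar)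

text \<open>
  If \<open>f\<close> moves \<open>e\<^sub>x\<^sub>0\<close> to a basis vector that \<open>\<pi>\<^sub>x\<^sub>0\<^sub>,\<^sub>z\<^sub>0(a)\<close> does not annihilate, then
  \<open>a f\<close> has a nonzero value on \<open>e\<^sub>x\<^sub>0\<close>. This persists nearby, and \<open>\<pi>\<^sub>x\<^sub>,\<^sub>z(a f) \<noteq> 0\<close> implies
  \<open>\<pi>\<^sub>x\<^sub>,\<^sub>z(a) \<noteq> 0\<close>.
\<close>

lemma not_in_DR_prim_nearby:
  assumes a: "a \<in> elems E" and x0: "x0 \<in> M" and z0: "z0 \<in> torus" and n: "a \<notin> DR_prim X T (x0, z0)"
  shows "\<exists>U \<delta>. openin X U \<and> x0 \<in> U \<and> 0 < \<delta> \<and> (\<forall>x\<in>U. \<forall>z\<in>torus. (\<forall>i. cmod (z $ i - z0 $ i) < \<delta>) \<longrightarrow>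
    a \<notin> DR_prim X T (x, z))"
proof -
  let ?S = "orbit G x0" and ?\<rho> = "DR_rep X T x0 z0"
  note r = DR_rep_spec(1)[OF z0, of x0]
  have x0S: "x0 \<in> ?S" by (rule orbit_self[OF x0])
  have "\<exists>y\<in>?S. ?\<rho> a (basis_vec y) \<noteq> (\<lambda>_. 0)"
    using n by (intro star_rep_nonzero_basis[OF r a cstar.E_closed(4)[OF a a]]) (simp add: DR_prim_iff)
  then obtain y where y: "y \<in> ?S" "?\<rho> a (basis_vec y) \<noteq> (\<lambda>_. 0)" by (elim bexE)
  obtain f c where f: "f \<in> Cc G" "cmod c = 1" "?\<rho> (emb f) (basis_vec x0) = (\<lambda>i. c * basis_vec y i)"
    using rho_move[OF x0 z0 refl refl x0S y(1)] by (elim exE conjE)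
  define a' where "a' = mul E a (emb f)"
  have fE: "emb f \<in> elems E" by (rule emb_E[OF f(1)])
  have a': "a' \<in> elems E" unfolding a'_def by (rule cstar.E_closed(3)[OF a fE])
  have mult: "DR_rep X T x z a' (basis_vec x) = DR_rep X T x z a (DR_rep X T x z (emb f) (basis_vec x))"
    if "x \<in> M" "z \<in> torus" for x z
    unfolding a'_def using DR_rep_spec(1)[OF that(2)] a fE basis_vec_ell2[OF orbit_self[OF that(1)]]
    by (rule star_repD(5))
  have "?\<rho> a' (basis_vec x0) = (\<lambda>i. c * ?\<rho> a (basis_vec y) i)"
    unfolding mult[OF x0 z0] f(3)
    using bounded_operatorD(3)[OF star_repD(1)[OF r a] basis_vec_ell2[OF y(1)]] .
  moreover have "c \<noteq> 0" using f(2) by auto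
  ultimately have "?\<rho> a' (basis_vec x0) \<noteq> (\<lambda>_. 0)" using y(2) by (auto simp: fun_eq_iff)
  from unit_vector_nonzero_nearby[OF a' x0 z0 this] obtain U \<delta> where U: "openin X U" "x0 \<in> U" "0 < \<delta>"
    "\<forall>x\<in>U. \<forall>z\<in>torus. (\<forall>i. cmod (z $ i - z0 $ i) < \<delta>) \<longrightarrow> DR_rep X T x z a' (basis_vec x) \<noteq> (\<lambda>_. 0)"
    by (elim exE conjE)
  have "a \<notin> DR_prim X T (x, z)" if x: "x \<in> U" and z: "z \<in> torus" "\<forall>i. cmod (z $ i - z0 $ i) < \<delta>" for x z
  proof
    assume "a \<in> DR_prim X T (x, z)"
    then have 0: "\<And>\<xi>. \<xi> \<in> ell2 (orbit G x) \<Longrightarrow> DR_rep X T x z a \<xi> = (\<lambda>_. 0)"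
      by (simp add: DR_prim_iff rep_ker_def)
    have xM: "x \<in> M" using x openin_subset[OF U(1)] by blast
    have "DR_rep X T x z (emb f) (basis_vec x) \<in> ell2 (orbit G x)"
      by (rule star_repD(2)[OF DR_rep_spec(1)[OF z(1)] fE basis_vec_ell2[OF orbit_self[OF xM]]])
    then have "DR_rep X T x z a' (basis_vec x) = (\<lambda>_. 0)" unfolding mult[OF xM z(1)] by (rule 0)
    then show False using U(4) x z by blast
  qed
  then show ?thesis using U by (intro exI[of _ U] exI[of _ \<delta>]) blast
qed

lemma DR_prim_continuous:
  "continuous_map (prod_topology X (top_of_set torus)) (hull_kernel_topology E) (DR_prim X T)"
  unfolding hull_kernel_topology_def
proof (rule continuous_on_generated_topo)
  let ?Z = "prod_topology X (top_of_set (torus :: (complex ^ 'k) set))"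
  let ?S = "{prim E - hull_of E (kernel_of E F) | F. F \<subseteq> prim E}"
  have top: "topspace ?Z = M \<times> torus" by simp
  have "P \<noteq> elems E" if "P \<in> prim E" for P
    using that unfolding prim_def irreducible_rep_def by auto
  \<comment> \<open>the kernel of the empty family is the whole algebra, which no primitive ideal contains\<close>
  then have "hull_of E (kernel_of E {}) = {}"
    unfolding hull_of_def kernel_of_def prim_def by (auto simp: rep_ker_def)
  then have "prim E - {} \<in> ?S" by (metis (mono_tags, lifting) empty_subsetI mem_Collect_eq)
  moreover have "DR_prim X T ` topspace ?Z \<subseteq> prim E"
    unfolding top using DR_prim_in_prim by auto
  ultimately show "DR_prim X T ` topspace ?Z \<subseteq> \<Union> ?S" by blast
  fix W assume "W \<in> ?S"
  then obtain F where W: "W = prim E - hull_of E (kernel_of E F)" by blast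
  show "openin ?Z (DR_prim X T -` W \<inter> topspace ?Z)"
  proof (subst openin_subopen, intro ballI)
    fix v assume v: "v \<in> DR_prim X T -` W \<inter> topspace ?Z"
    obtain x0 z0 where v0: "v = (x0, z0)" by (cases v)
    have x0: "x0 \<in> M" and z0: "z0 \<in> torus" using v unfolding v0 top by simp_all
    obtain a where a: "a \<in> kernel_of E F" "a \<notin> DR_prim X T (x0, z0)"
      using v unfolding v0 W hull_of_def by auto
    have aE: "a \<in> elems E" using a(1) by (simp add: kernel_of_def)
    obtain U \<delta> where U: "openin X U" "x0 \<in> U" "0 < \<delta>"
      "\<forall>x\<in>U. \<forall>z\<in>torus. (\<forall>i. cmod (z $ i - z0 $ i) < \<delta>) \<longrightarrow> a \<notin> DR_prim X T (x, z)"
      using not_in_DR_prim_nearby[OF aE x0 z0 a(2)] by (elim exE conjE)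
    define V where "V = torus \<inter> ball z0 \<delta>"
    have V: "openin (top_of_set torus) V" unfolding V_def by (rule openin_open_Int) simp
    have "DR_prim X T (x, z) \<in> W" if x: "x \<in> U" and z: "z \<in> V" for x z
    proof -
      have zt: "z \<in> torus" "dist z z0 < \<delta>" using z by (simp_all add: V_def dist_commute)
      have "cmod (z $ i - z0 $ i) < \<delta>" for i
        using dist_vec_nth_le[of z i z0] zt(2) by (simp add: dist_norm)
      then have "a \<notin> DR_prim X T (x, z)" using U(4) x zt(1) by blast
      moreover have "DR_prim X T (x, z) \<in> prim E"
        using DR_prim_in_prim zt(1) x openin_subset[OF U(1)] by blast
      ultimately show ?thesis using a(1) unfolding W hull_of_def by blast
    qed
    then have "U \<times> V \<subseteq> DR_prim X T -` W \<inter> topspace ?Z"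
      unfolding top using openin_subset[OF U(1)] by (auto simp: V_def)
    moreover have "openin ?Z (U \<times> V)" using U(1) V by (simp add: openin_prod_Times_iff)
    moreover have "v \<in> U \<times> V" using U z0 by (simp add: v0 V_def)
    ultimately show "\<exists>V. openin ?Z V \<and> v \<in> V \<and> V \<subseteq> DR_prim X T -` W \<inter> topspace ?Z" by blast
  qed
qed

end

theorem corollary4p4:
  fixes X :: "'x topology" and T :: "nat ^ 'k \<Rightarrow> 'x \<Rightarrow> 'x"
  assumes "second_countable X" and "locally_compact_space X" and "Hausdorff_space X"
    and "local_homeo_action X T"
  shows "continuous_map (prod_topology X (top_of_set torus))
           (hull_kernel_topology (groupoid_cstar (DR_groupoid X T))) (DR_prim X T)"
proof -
  interpret deaconu_renault X T using assms by unfold_locales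
  show ?thesis unfolding E_groupoid_cstar by (rule DR_prim_continuous)
qed

end
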